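(* Let $\mathcal C$ be a small rigid C$^*$-tensor category with simple unit $\mathbf 1$, finite direct sums and subobjects, let $\mathcal S$ be a representative set of its simple objects with $\mathbf 1\in\mathcal S$, and choose arbitrary real numbers $\lambda_\alpha>0$ ($\alpha\in\mathcal S$), with $\lambda_{\overline\alpha}=1/\lambda_\alpha$. Let $H(\mathbf 1)$ be the associated Tomita $\mathfrak A(\mathbf 1)$-$\mathfrak A(\mathbf 1)$ bimodule and $\Phi(H(\mathbf 1))''$ the associated von Neumann algebra on (the completed) Fock space. Then $\Phi(H(\mathbf 1))''$ is a factor.
   Context: Category data. $\mathcal C$ is assumed strict. $XY$ denotes the tensor product of objects, $\circ$ composition, $\otimes$ tensor product of arrows (evaluated before $\circ$), $I_X$ the identity of $X$. Each object $X$ has a conjugate $\overline X$ with $\eta_X\in Hom(\mathbf 1,\overline XX)$, $\varepsilon_X\in Hom(X\overline X,\mathbf 1)$ satisfying $\varepsilon_X\otimes I_X\circ I_X\otimes\eta_X=I_X$, $I_{\overline X}\otimes\varepsilon_X\circ\eta_X\otimes I_{\overline X}=I_{\overline X}$, where $(\eta_X,\varepsilon_X^* )$ is a standard solution of the conjugate equations (in the sense of Longo--Roberts); $d_X=\eta_X^*\circ\eta_X=\varepsilon_X\circ\varepsilon_X^*$ is the dimension. $\mathcal S$ contains exactly one simple object from each isomorphism class. $\Lambda=\mathcal S\sqcup\overline{\mathcal S}$ is a disjoint union, $\overline{\mathcal S}=\{\overline\alpha:\alpha\in\mathcal S\}$; $\alpha$ and $\overline\alpha$ are always distinct elements of $\Lambda$,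 even if they coincide as objects of $\mathcal C$; $\overline{\overline\alpha}=\alpha$. Elements of $\Lambda$ are also read as objects of $\mathcal C$. For $\alpha\in\mathcal S$ put $r_\alpha=\eta_\alpha\in Hom(\mathbf 1,\overline\alpha\alpha)$ and $r_{\overline\alpha}=\varepsilon_\alpha^*\in Hom(\mathbf 1,\alpha\overline\alpha)$. For $\beta_1,\beta_2\in\mathcal S$, $\alpha\in\Lambda$, let $\left[{\beta_2*\alpha\atop\beta_1}\right]=Hom(\beta_1,\beta_2\alpha)$ (labelled by the triple). $\mathfrak A(\mathbf 1)=\bigoplus_{\beta\in\mathcal S}\mathbb CI_\beta$ (von Neumann algebra direct sum), with normal semifinite faithful trace $\tau(I_\beta)=d_\beta$. $H(\mathbf 1)=\bigoplus_{\alpha\in\Lambda,\beta_1,\beta_2\in\mathcal S}\left[{\beta_2*\alpha\atop\beta_1}\right]$ (algebraic direct sum), with actions $I_{\gamma_2}\cdot\xi\cdot I_{\gamma_1}=\delta_{\gamma_2,\beta_2}\delta_{\gamma_1,\beta_1}\xi$ for $\xi\in\left[{\beta_2*\alpha\atop\beta_1}\right]$, and $\langle\xi_2|\xi_1\rangle_{\mathfrak A(\mathbf 1)}=\delta_{\alpha_1,\alpha_2}\delta_{\omega_1,\omega_2}\,\xi_2^*\circ\xi_1$ for $\xi_i\in\left[{\omega_i*\alpha_i\atop\beta_i}\right]$ (which is $0$ unless $\beta_1=\beta_2$, and otherwise lies in $\mathbb CI_{\beta_1}$). For $\xi\in\left[{\beta_2*\alpha\atop\beta_1}\right]$ let $\overline\xi=\xi^*\otimes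 I_{\overline\alpha}\circ I_{\beta_2}\otimes r_{\overline\alpha}\in\left[{\beta_1*\overline\alpha\atop\beta_2}\right]$. The Tomita structure is given by the conjugate-linear $S$ and linear $U(z)$ with $S\xi=\sqrt{\lambda_\alpha}\,\overline\xi$, $U(z)\xi=\lambda_\alpha^{iz}\xi$ for $\xi\in\left[{\beta_2*\alpha\atop\beta_1}\right]$, $z\in\mathbb C$. Fock space construction. Write $\mathfrak A=\mathfrak A(\mathbf 1)$, $H=H(\mathbf 1)$. $\mathcal F(H)=\bigoplus_{n\ge0}H^{\otimes_{\mathfrak A}^n}$ (algebraic), $H^{\otimes_{\mathfrak A}^0}=\mathfrak A$ with $\langle A_1|A_2\rangle_{\mathfrak A}=A_1^*A_2$, and $\langle\xi_1\otimes\cdots\otimes\xi_n|\beta_1\otimes\cdots\otimes\beta_n\rangle_{\mathfrak A}=\langle\xi_n|\langle\cdots\langle\xi_2|\langle\xi_1|\beta_1\rangle_{\mathfrak A}\beta_2\rangle_{\mathfrak A}\cdots\rangle_{\mathfrak A}\beta_n\rangle_{\mathfrak A}$. For $\xi\in H$: $L(\xi)A=\xi\cdot A$, $L(\xi)(\beta_1\otimes\cdots\otimes\beta_n)=\xi\otimes\beta_1\otimes\cdots\otimes\beta_n$, $L^*(\xi)A=0$, $L^*(\xi)(\beta_1\otimes\cdots\otimes\beta_n)=\langle\xi|\beta_1\rangle_{\mathfrak A}\cdot\beta_2\otimes\cdots\otimes\beta_n$; $\Gamma(\xi)=L(\xi)+L^*(S(\xi))$. $\mathcal F(H)_\tau$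 is the Hilbert space completion of $\{\zeta\in\mathcal F(H):\tau(\langle\zeta|\zeta\rangle_{\mathfrak A})<\infty\}$ for $\langle\zeta_1|\zeta_2\rangle=\tau(\langle\zeta_1|\zeta_2\rangle_{\mathfrak A})$; bounded adjointable maps on $\mathcal F(H)$ extend to bounded operators on $\mathcal F(H)_\tau$. $\Phi(H)''$ is the von Neumann algebra on $\mathcal F(H)_\tau$ generated by the left action of $\mathfrak A$ and by all $\Gamma(\xi)$, $\xi\in H$. *)

theory Defs
  imports "HOL-Analysis.Analysis" "HOL-Library.Poly_Mapping"
begin

section \<open>Hilbert spaces on explicit carriers\<close>

text \<open>Inner products are conjugate-linear in the first argument throughout.\<close>

record 'v inner_space =
  car :: "'v set"
  vadd :: "'v \<Rightarrow> 'v \<Rightarrow> 'v"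
  vscale :: "complex \<Rightarrow> 'v \<Rightarrow> 'v"
  vzero :: "'v"
  vip :: "'v \<Rightarrow> 'v \<Rightarrow> complex"

definition vnorm :: "'v inner_space \<Rightarrow> 'v \<Rightarrow> real" where
  "vnorm K x = sqrt (Re (vip K x x))"

definition vdist :: "'v inner_space \<Rightarrow> 'v \<Rightarrow> 'v \<Rightarrow> real" where
  "vdist K x y = vnorm K (vadd K x (vscale K (-1) y))"

text \<open>The Hilbert space completion of a space with a positive semidefinite form, as the set of
  Cauchy sequences modulo sequences tending to 0 (null vectors are therefore divided out).
  The representatives chosen by \<open>SOME\<close> are immaterial.\<close>

definition cauchy_seqs :: "'v inner_space \<Rightarrow> (nat \<Rightarrow> 'v) set" where
  "cauchy_seqs K = {s. (\<forall>n. s n \<in> car K) \<and>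
     (\<forall>e>0. \<exists>N. \<forall>m\<ge>N. \<forall>n\<ge>N. vdist K (s m) (s n) < e)}"

definition limit_class :: "'v inner_space \<Rightarrow> (nat \<Rightarrow> 'v) \<Rightarrow> (nat \<Rightarrow> 'v) set" where
  "limit_class K s = {t \<in> cauchy_seqs K. (\<lambda>n. vdist K (s n) (t n)) \<longlonglongrightarrow> 0}"

definition rep :: "'x set \<Rightarrow> 'x" where
  "rep X = (SOME x. x \<in> X)"

definition hilbert_completion :: "'v inner_space \<Rightarrow> (nat \<Rightarrow> 'v) set inner_space" where
  "hilbert_completion K = \<lparr>
     car = limit_class K ` cauchy_seqs K,
     vadd = (\<lambda>X Y. limit_class K (\<lambda>n. vadd K (rep X n) (rep Y n))),
     vscale = (\<lambda>c X. limit_class K (\<lambda>n. vscale K c (rep X n))),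
     vzero = limit_class K (\<lambda>n. vzero K),
     vip = (\<lambda>X Y. lim (\<lambda>n. vip K (rep X n) (rep Y n))) \<rparr>"

text \<open>The extension to the completion of a linear map on \<open>K\<close> that is bounded for the seminorm.\<close>

definition extend_op ::
  "'v inner_space \<Rightarrow> ('v \<Rightarrow> 'v) \<Rightarrow> (nat \<Rightarrow> 'v) set \<Rightarrow> (nat \<Rightarrow> 'v) set" where
  "extend_op K T = (\<lambda>X\<in>car (hilbert_completion K). limit_class K (\<lambda>n. T (rep X n)))"

text \<open>Operators are extensional functions on the carrier, so that equality of operators is
  equality in HOL.\<close>

definition bounded_ops :: "'v inner_space \<Rightarrow> ('v \<Rightarrow> 'v) set" where
  "bounded_ops K = {T \<in> car K \<rightarrow>\<^sub>E car K.
     (\<forall>x\<in>car K. \<forall>y\<in>car K. T (vadd K x y) = vadd K (T x) (T y)) \<and>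
     (\<forall>c. \<forall>x\<in>car K. T (vscale K c x) = vscale K c (T x)) \<and>
     (\<exists>B. \<forall>x\<in>car K. vnorm K (T x) \<le> B * vnorm K x)}"

definition adjoint_op :: "'v inner_space \<Rightarrow> ('v \<Rightarrow> 'v) \<Rightarrow> 'v \<Rightarrow> 'v" where
  "adjoint_op K T = (THE T'. T' \<in> bounded_ops K \<and>
     (\<forall>x\<in>car K. \<forall>y\<in>car K. vip K (T x) y = vip K x (T' y)))"

definition commutant :: "'v inner_space \<Rightarrow> ('v \<Rightarrow> 'v) set \<Rightarrow> ('v \<Rightarrow> 'v) set" where
  "commutant K M =
     {T \<in> bounded_ops K. \<forall>A\<in>M. compose (car K) T A = compose (car K) A T}"

definition von_neumann_algebra :: "'v inner_space \<Rightarrow> ('v \<Rightarrow> 'v) set \<Rightarrow> bool" where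
  "von_neumann_algebra K M \<longleftrightarrow> M \<subseteq> bounded_ops K \<and> (\<forall>T\<in>M. adjoint_op K T \<in> M) \<and>
     commutant K (commutant K M) = M"

definition vN_generated :: "'v inner_space \<Rightarrow> ('v \<Rightarrow> 'v) set \<Rightarrow> ('v \<Rightarrow> 'v) set" where
  "vN_generated K G = \<Inter>{M. von_neumann_algebra K M \<and> G \<subseteq> M}"

definition factor :: "'v inner_space \<Rightarrow> ('v \<Rightarrow> 'v) set \<Rightarrow> bool" where
  "factor K M \<longleftrightarrow> von_neumann_algebra K M \<and> (\<exists>x\<in>car K. x \<noteq> vzero K) \<and>
     M \<inter> commutant K M = {\<lambda>x\<in>car K. vscale K c x | c. True}"


section \<open>Strict C*-tensor categories\<close>

record ('o, 'm) tensor_cat =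
  obj :: "'o set"
  hom :: "'o \<Rightarrow> 'o \<Rightarrow> 'm set"
  idt :: "'o \<Rightarrow> 'm" ("I\<index>")
  cmp :: "'m \<Rightarrow> 'm \<Rightarrow> 'm" (infixr "\<cdot>\<index>" 70)
  zer :: "'o \<Rightarrow> 'o \<Rightarrow> 'm"
  pls :: "'m \<Rightarrow> 'm \<Rightarrow> 'm" (infixl "\<oplus>\<index>" 65)
  scl :: "complex \<Rightarrow> 'm \<Rightarrow> 'm" (infixr "\<odot>\<index>" 68)
  adj :: "'m \<Rightarrow> 'm" ("_\<^sup>\<dagger>\<index>" [1000] 999)
  nrm :: "'m \<Rightarrow> real"
  unt :: "'o"
  ten :: "'o \<Rightarrow> 'o \<Rightarrow> 'o" (infixr "\<box>\<index>" 75)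
  tnm :: "'m \<Rightarrow> 'm \<Rightarrow> 'm" (infixr "\<otimes>\<index>" 75)

text \<open>Notation: \<open>g \<cdot> f\<close> is composition of arrows, \<open>c \<odot> f\<close> multiplication by a complex scalar,
  \<open>f\<^sup>\<dagger>\<close> the adjoint, \<open>X \<box> Y\<close> the tensor product of objects and \<open>f \<otimes> g\<close> that of arrows.\<close>

locale tcat =
  fixes C :: "('o, 'm) tensor_cat" (structure)
begin

primrec fsum :: "'o \<Rightarrow> 'o \<Rightarrow> (nat \<Rightarrow> 'm) \<Rightarrow> nat \<Rightarrow> 'm" where
  "fsum X Y f 0 = zer C X Y"
| "fsum X Y f (Suc n) = fsum X Y f n \<oplus> f n"

definition simple :: "'o \<Rightarrow> bool" where
  "simple X \<longleftrightarrow> X \<in> obj C \<and> I X \<noteq> zer C X X \<and> hom C X X = {c \<odot> I X | c. True}"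

definition isomorphic :: "'o \<Rightarrow> 'o \<Rightarrow> bool" where
  "isomorphic X Y \<longleftrightarrow> (\<exists>f\<in>hom C X Y. \<exists>g\<in>hom C Y X. g \<cdot> f = I X \<and> f \<cdot> g = I Y)"

definition has_direct_sums :: bool where
  "has_direct_sums \<longleftrightarrow> (\<forall>X\<in>obj C. \<forall>Y\<in>obj C. \<exists>Z\<in>obj C. \<exists>u\<in>hom C X Z. \<exists>v\<in>hom C Y Z.
     u\<^sup>\<dagger> \<cdot> u = I X \<and> v\<^sup>\<dagger> \<cdot> v = I Y \<and> u \<cdot> u\<^sup>\<dagger> \<oplus> v \<cdot> v\<^sup>\<dagger> = I Z)"

text \<open>Only nonzero projections are required to split, so a zero object is allowed but not
  required.\<close>

definition has_subobjects :: bool where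
  "has_subobjects \<longleftrightarrow> (\<forall>X\<in>obj C. \<forall>p\<in>hom C X X. p\<^sup>\<dagger> = p \<and> p \<cdot> p = p \<and> p \<noteq> zer C X X \<longrightarrow>
     (\<exists>Y\<in>obj C. \<exists>v\<in>hom C Y X. v\<^sup>\<dagger> \<cdot> v = I Y \<and> v \<cdot> v\<^sup>\<dagger> = p))"

definition simple_representatives :: "'o set \<Rightarrow> bool" where
  "simple_representatives S \<longleftrightarrow> (\<forall>X\<in>S. simple X) \<and>
     (\<forall>X. simple X \<longrightarrow> (\<exists>!Y. Y \<in> S \<and> isomorphic X Y))"

text \<open>\<open>(r, rb)\<close> with \<open>r \<in> Hom(1, Xb X)\<close>, \<open>rb \<in> Hom(1, X Xb)\<close> solves the conjugate equations;
  in terms of evaluation and coevaluation, \<open>\<eta> = r\<close> and \<open>\<epsilon> = rb\<^sup>\<dagger>\<close>.\<close>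

definition conjugate_solution :: "'o \<Rightarrow> 'o \<Rightarrow> 'm \<Rightarrow> 'm \<Rightarrow> bool" where
  "conjugate_solution X Xb r rb \<longleftrightarrow>
     r \<in> hom C (unt C) (Xb \<box> X) \<and> rb \<in> hom C (unt C) (X \<box> Xb) \<and>
     (rb\<^sup>\<dagger> \<otimes> I X) \<cdot> (I X \<otimes> r) = I X \<and>
     (I Xb \<otimes> rb\<^sup>\<dagger>) \<cdot> (r \<otimes> I Xb) = I Xb"

text \<open>Standard solutions in the sense of Longo and Roberts: direct sums of solutions
  \<open>(r\<^sub>i, rb\<^sub>i)\<close> for simple objects, normalized by equality of the norms of \<open>r\<^sub>i\<close> and \<open>rb\<^sub>i\<close>.\<close>

definition standard_solution :: "'o \<Rightarrow> 'o \<Rightarrow> 'm \<Rightarrow> 'm \<Rightarrow> bool" where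
  "standard_solution X Xb r rb \<longleftrightarrow> conjugate_solution X Xb r rb \<and>
     (\<exists>n Y Yb w wb q qb.
        (\<forall>i<n. simple (Y i) \<and> Yb i \<in> obj C \<and>
           w i \<in> hom C (Y i) X \<and> (w i)\<^sup>\<dagger> \<cdot> w i = I (Y i) \<and>
           wb i \<in> hom C (Yb i) Xb \<and> (wb i)\<^sup>\<dagger> \<cdot> wb i = I (Yb i) \<and>
           conjugate_solution (Y i) (Yb i) (q i) (qb i) \<and> nrm C (q i) = nrm C (qb i)) \<and>
        fsum X X (\<lambda>i. w i \<cdot> (w i)\<^sup>\<dagger>) n = I X \<and>
        fsum Xb Xb (\<lambda>i. wb i \<cdot> (wb i)\<^sup>\<dagger>) n = I Xb \<and>
        r = fsum (unt C) (Xb \<box> X) (\<lambda>i. (wb i \<otimes> w i) \<cdot> q i) n \<and>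
        rb = fsum (unt C) (X \<box> Xb) (\<lambda>i. (w i \<otimes> wb i) \<cdot> qb i) n)"

definition standard_conjugates :: "('o \<Rightarrow> 'o) \<Rightarrow> ('o \<Rightarrow> 'm) \<Rightarrow> ('o \<Rightarrow> 'm) \<Rightarrow> bool" where
  "standard_conjugates cj \<eta> \<epsilon> \<longleftrightarrow> (\<forall>X\<in>obj C. cj X \<in> obj C \<and>
     \<epsilon> X \<in> hom C (X \<box> cj X) (unt C) \<and> standard_solution X (cj X) (\<eta> X) ((\<epsilon> X)\<^sup>\<dagger>))"

text \<open>The scalar \<open>c\<close> with \<open>f = c \<odot> I X\<close>, for \<open>X\<close> simple and \<open>f \<in> End(X)\<close>.\<close>

definition coef :: "'o \<Rightarrow> 'm \<Rightarrow> complex" where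
  "coef X f = (THE c. f = c \<odot> I X)"

end

text \<open>Morphism sets of distinct pairs of objects are disjoint, which is why composition, adjoint
  and so on need no object arguments. The norm makes each \<open>Hom(X, Y)\<close> a Banach space.\<close>

locale cstar_category = tcat +
  assumes hom_disjoint: "\<lbrakk>X \<in> obj C; Y \<in> obj C; X' \<in> obj C; Y' \<in> obj C;
      f \<in> hom C X Y; f \<in> hom C X' Y'\<rbrakk> \<Longrightarrow> X = X' \<and> Y = Y'"
    and idt_in: "X \<in> obj C \<Longrightarrow> I X \<in> hom C X X"
    and cmp_in: "\<lbrakk>X \<in> obj C; Y \<in> obj C; Z \<in> obj C; f \<in> hom C X Y; g \<in> hom C Y Z\<rbrakk>
      \<Longrightarrow> g \<cdot> f \<in> hom C X Z"
    and cmp_assoc: "\<lbrakk>W \<in> obj C; X \<in> obj C; Y \<in> obj C; Z \<in> obj C;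
      f \<in> hom C W X; g \<in> hom C X Y; h \<in> hom C Y Z\<rbrakk> \<Longrightarrow> (h \<cdot> g) \<cdot> f = h \<cdot> (g \<cdot> f)"
    and cmp_idt: "\<lbrakk>X \<in> obj C; Y \<in> obj C; f \<in> hom C X Y\<rbrakk> \<Longrightarrow> f \<cdot> I X = f \<and> I Y \<cdot> f = f"
    and zer_in: "\<lbrakk>X \<in> obj C; Y \<in> obj C\<rbrakk> \<Longrightarrow> zer C X Y \<in> hom C X Y"
    and pls_in: "\<lbrakk>X \<in> obj C; Y \<in> obj C; f \<in> hom C X Y; g \<in> hom C X Y\<rbrakk> \<Longrightarrow> f \<oplus> g \<in> hom C X Y"
    and scl_in: "\<lbrakk>X \<in> obj C; Y \<in> obj C; f \<in> hom C X Y\<rbrakk> \<Longrightarrow> c \<odot> f \<in> hom C X Y"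
    and pls_assoc: "\<lbrakk>X \<in> obj C; Y \<in> obj C; f \<in> hom C X Y; g \<in> hom C X Y; h \<in> hom C X Y\<rbrakk>
      \<Longrightarrow> (f \<oplus> g) \<oplus> h = f \<oplus> (g \<oplus> h)"
    and pls_commute: "\<lbrakk>X \<in> obj C; Y \<in> obj C; f \<in> hom C X Y; g \<in> hom C X Y\<rbrakk> \<Longrightarrow> f \<oplus> g = g \<oplus> f"
    and pls_zer: "\<lbrakk>X \<in> obj C; Y \<in> obj C; f \<in> hom C X Y\<rbrakk> \<Longrightarrow> f \<oplus> zer C X Y = f"
    and pls_neg: "\<lbrakk>X \<in> obj C; Y \<in> obj C; f \<in> hom C X Y\<rbrakk> \<Longrightarrow> f \<oplus> (-1) \<odot> f = zer C X Y"
    and scl_one: "\<lbrakk>X \<in> obj C; Y \<in> obj C; f \<in> hom C X Y\<rbrakk> \<Longrightarrow> 1 \<odot> f = f"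
    and scl_mult: "\<lbrakk>X \<in> obj C; Y \<in> obj C; f \<in> hom C X Y\<rbrakk> \<Longrightarrow> (c * d) \<odot> f = c \<odot> (d \<odot> f)"
    and scl_pls_left: "\<lbrakk>X \<in> obj C; Y \<in> obj C; f \<in> hom C X Y\<rbrakk>
      \<Longrightarrow> (c + d) \<odot> f = (c \<odot> f) \<oplus> (d \<odot> f)"
    and scl_pls_right: "\<lbrakk>X \<in> obj C; Y \<in> obj C; f \<in> hom C X Y; g \<in> hom C X Y\<rbrakk>
      \<Longrightarrow> c \<odot> (f \<oplus> g) = (c \<odot> f) \<oplus> (c \<odot> g)"
    and cmp_pls_left: "\<lbrakk>X \<in> obj C; Y \<in> obj C; Z \<in> obj C;
      f \<in> hom C X Y; g \<in> hom C Y Z; g' \<in> hom C Y Z\<rbrakk> \<Longrightarrow> (g \<oplus> g') \<cdot> f = (g \<cdot> f) \<oplus> (g' \<cdot> f)"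
    and cmp_pls_right: "\<lbrakk>X \<in> obj C; Y \<in> obj C; Z \<in> obj C;
      f \<in> hom C X Y; f' \<in> hom C X Y; g \<in> hom C Y Z\<rbrakk> \<Longrightarrow> g \<cdot> (f \<oplus> f') = (g \<cdot> f) \<oplus> (g \<cdot> f')"
    and cmp_scl: "\<lbrakk>X \<in> obj C; Y \<in> obj C; Z \<in> obj C; f \<in> hom C X Y; g \<in> hom C Y Z\<rbrakk>
      \<Longrightarrow> (c \<odot> g) \<cdot> f = c \<odot> (g \<cdot> f) \<and> g \<cdot> (c \<odot> f) = c \<odot> (g \<cdot> f)"
    and adj_in: "\<lbrakk>X \<in> obj C; Y \<in> obj C; f \<in> hom C X Y\<rbrakk> \<Longrightarrow> f\<^sup>\<dagger> \<in> hom C Y X"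
    and adj_adj: "\<lbrakk>X \<in> obj C; Y \<in> obj C; f \<in> hom C X Y\<rbrakk> \<Longrightarrow> (f\<^sup>\<dagger>)\<^sup>\<dagger> = f"
    and adj_pls: "\<lbrakk>X \<in> obj C; Y \<in> obj C; f \<in> hom C X Y; g \<in> hom C X Y\<rbrakk>
      \<Longrightarrow> (f \<oplus> g)\<^sup>\<dagger> = f\<^sup>\<dagger> \<oplus> g\<^sup>\<dagger>"
    and adj_scl: "\<lbrakk>X \<in> obj C; Y \<in> obj C; f \<in> hom C X Y\<rbrakk> \<Longrightarrow> (c \<odot> f)\<^sup>\<dagger> = cnj c \<odot> f\<^sup>\<dagger>"
    and adj_cmp: "\<lbrakk>X \<in> obj C; Y \<in> obj C; Z \<in> obj C; f \<in> hom C X Y; g \<in> hom C Y Z\<rbrakk>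
      \<Longrightarrow> (g \<cdot> f)\<^sup>\<dagger> = f\<^sup>\<dagger> \<cdot> g\<^sup>\<dagger>"
    and nrm_eq_0: "\<lbrakk>X \<in> obj C; Y \<in> obj C; f \<in> hom C X Y\<rbrakk>
      \<Longrightarrow> 0 \<le> nrm C f \<and> (nrm C f = 0 \<longleftrightarrow> f = zer C X Y)"
    and nrm_pls: "\<lbrakk>X \<in> obj C; Y \<in> obj C; f \<in> hom C X Y; g \<in> hom C X Y\<rbrakk>
      \<Longrightarrow> nrm C (f \<oplus> g) \<le> nrm C f + nrm C g"
    and nrm_scl: "\<lbrakk>X \<in> obj C; Y \<in> obj C; f \<in> hom C X Y\<rbrakk> \<Longrightarrow> nrm C (c \<odot> f) = cmod c * nrm C f"
    and nrm_complete: "\<lbrakk>X \<in> obj C; Y \<in> obj C; \<And>n. s n \<in> hom C X Y;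
      \<forall>e>0. \<exists>N::nat. \<forall>m\<ge>N. \<forall>n\<ge>N. nrm C (s m \<oplus> (-1) \<odot> s n) < e\<rbrakk>
      \<Longrightarrow> \<exists>f\<in>hom C X Y. (\<lambda>n. nrm C (s n \<oplus> (-1) \<odot> f)) \<longlonglongrightarrow> 0"
    and nrm_cmp: "\<lbrakk>X \<in> obj C; Y \<in> obj C; Z \<in> obj C; f \<in> hom C X Y; g \<in> hom C Y Z\<rbrakk>
      \<Longrightarrow> nrm C (g \<cdot> f) \<le> nrm C g * nrm C f"
    and cstar_identity: "\<lbrakk>X \<in> obj C; Y \<in> obj C; f \<in> hom C X Y\<rbrakk>
      \<Longrightarrow> nrm C (f\<^sup>\<dagger> \<cdot> f) = (nrm C f)\<^sup>2"
    and adj_cmp_positive: "\<lbrakk>X \<in> obj C; Y \<in> obj C; f \<in> hom C X Y\<rbrakk>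
      \<Longrightarrow> \<exists>g\<in>hom C X X. f\<^sup>\<dagger> \<cdot> f = g\<^sup>\<dagger> \<cdot> g"

locale cstar_tensor_category = cstar_category +
  assumes unt_obj: "unt C \<in> obj C"
    and ten_obj: "\<lbrakk>X \<in> obj C; Y \<in> obj C\<rbrakk> \<Longrightarrow> X \<box> Y \<in> obj C"
    and ten_assoc: "\<lbrakk>X \<in> obj C; Y \<in> obj C; Z \<in> obj C\<rbrakk> \<Longrightarrow> (X \<box> Y) \<box> Z = X \<box> (Y \<box> Z)"
    and ten_unt: "X \<in> obj C \<Longrightarrow> unt C \<box> X = X \<and> X \<box> unt C = X"
    and tnm_in: "\<lbrakk>X \<in> obj C; Y \<in> obj C; X' \<in> obj C; Y' \<in> obj C; f \<in> hom C X Y; f' \<in> hom C X' Y'\<rbrakk>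
      \<Longrightarrow> f \<otimes> f' \<in> hom C (X \<box> X') (Y \<box> Y')"
    and tnm_assoc: "\<lbrakk>X \<in> obj C; Y \<in> obj C; X' \<in> obj C; Y' \<in> obj C; X'' \<in> obj C; Y'' \<in> obj C;
      f \<in> hom C X Y; f' \<in> hom C X' Y'; f'' \<in> hom C X'' Y''\<rbrakk>
      \<Longrightarrow> (f \<otimes> f') \<otimes> f'' = f \<otimes> (f' \<otimes> f'')"
    and tnm_unt: "\<lbrakk>X \<in> obj C; Y \<in> obj C; f \<in> hom C X Y\<rbrakk>
      \<Longrightarrow> I (unt C) \<otimes> f = f \<and> f \<otimes> I (unt C) = f"
    and tnm_idt: "\<lbrakk>X \<in> obj C; Y \<in> obj C\<rbrakk> \<Longrightarrow> I X \<otimes> I Y = I (X \<box> Y)"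
    and tnm_cmp: "\<lbrakk>X \<in> obj C; Y \<in> obj C; Z \<in> obj C; X' \<in> obj C; Y' \<in> obj C; Z' \<in> obj C;
      f \<in> hom C X Y; g \<in> hom C Y Z; f' \<in> hom C X' Y'; g' \<in> hom C Y' Z'\<rbrakk>
      \<Longrightarrow> (g \<cdot> f) \<otimes> (g' \<cdot> f') = (g \<otimes> g') \<cdot> (f \<otimes> f')"
    and tnm_pls_left: "\<lbrakk>X \<in> obj C; Y \<in> obj C; X' \<in> obj C; Y' \<in> obj C;
      f \<in> hom C X Y; g \<in> hom C X Y; f' \<in> hom C X' Y'\<rbrakk>
      \<Longrightarrow> (f \<oplus> g) \<otimes> f' = (f \<otimes> f') \<oplus> (g \<otimes> f')"
    and tnm_pls_right: "\<lbrakk>X \<in> obj C; Y \<in> obj C; X' \<in> obj C; Y' \<in> obj C;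
      f \<in> hom C X Y; f' \<in> hom C X' Y'; g' \<in> hom C X' Y'\<rbrakk>
      \<Longrightarrow> f \<otimes> (f' \<oplus> g') = (f \<otimes> f') \<oplus> (f \<otimes> g')"
    and tnm_scl: "\<lbrakk>X \<in> obj C; Y \<in> obj C; X' \<in> obj C; Y' \<in> obj C;
      f \<in> hom C X Y; f' \<in> hom C X' Y'\<rbrakk>
      \<Longrightarrow> (c \<odot> f) \<otimes> f' = c \<odot> (f \<otimes> f') \<and> f \<otimes> (c \<odot> f') = c \<odot> (f \<otimes> f')"
    and tnm_adj: "\<lbrakk>X \<in> obj C; Y \<in> obj C; X' \<in> obj C; Y' \<in> obj C;
      f \<in> hom C X Y; f' \<in> hom C X' Y'\<rbrakk> \<Longrightarrow> (f \<otimes> f')\<^sup>\<dagger> = f\<^sup>\<dagger> \<otimes> f'\<^sup>\<dagger>"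


section \<open>The bimodule and its Fock space\<close>

text \<open>Labels: the disjoint union of \<open>S\<close> and its formal conjugate; \<open>Bar \<alpha>\<close> is never equal to
  \<open>Plain \<alpha>\<close>, even if the objects they denote coincide.\<close>

datatype 'o label = Plain 'o | Bar 'o

fun bar_label :: "'o label \<Rightarrow> 'o label" where
  "bar_label (Plain a) = Bar a"
| "bar_label (Bar a) = Plain a"

text \<open>A vector of the bimodule is a function on triples \<open>(\<beta>\<^sub>2, \<alpha>, \<beta>\<^sub>1)\<close>, whose value lies in
  \<open>Hom(\<beta>\<^sub>1, \<beta>\<^sub>2 \<alpha>)\<close>.\<close>

type_synonym ('o, 'm) hvec = "'o \<times> 'o label \<times> 'o \<Rightarrow> 'm"

text \<open>Formal finite linear combinations of words in vectors of the bimodule.\<close>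

type_synonym ('o, 'm) words = "('o, 'm) hvec list \<Rightarrow>\<^sub>0 complex"

text \<open>A Fock space vector: its component in degree 0, and the coset representing its components
  in all positive degrees.\<close>

type_synonym ('o, 'm) fvec = "('o \<Rightarrow> complex) \<times> ('o, 'm) words set"

definition pm_scale :: "complex \<Rightarrow> ('k \<Rightarrow>\<^sub>0 complex) \<Rightarrow> ('k \<Rightarrow>\<^sub>0 complex)" where
  "pm_scale c x = Poly_Mapping.map (\<lambda>z. c * z) x"

definition pm_linear :: "('k \<Rightarrow> ('l \<Rightarrow>\<^sub>0 complex)) \<Rightarrow> ('k \<Rightarrow>\<^sub>0 complex) \<Rightarrow> ('l \<Rightarrow>\<^sub>0 complex)" where
  "pm_linear f x = (\<Sum>u\<in>Poly_Mapping.keys x. pm_scale (Poly_Mapping.lookup x u) (f u))"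

abbreviation word :: "'h list \<Rightarrow> ('h list \<Rightarrow>\<^sub>0 complex)" where
  "word u \<equiv> Poly_Mapping.single u 1"

locale fock = tcat C
  for C :: "('o, 'm) tensor_cat" (structure) +
  fixes cj :: "'o \<Rightarrow> 'o" and \<eta> \<epsilon> :: "'o \<Rightarrow> 'm" and S :: "'o set" and lam :: "'o \<Rightarrow> real"
begin

definition dim :: "'o \<Rightarrow> real" where
  "dim X = (THE d. (\<eta> X)\<^sup>\<dagger> \<cdot> \<eta> X = complex_of_real d \<odot> I (unt C))"

definition \<Lambda> :: "'o label set" where
  "\<Lambda> = Plain ` S \<union> Bar ` S"

fun label_obj :: "'o label \<Rightarrow> 'o" where
  "label_obj (Plain a) = a"
| "label_obj (Bar a) = cj a"

fun label_lam :: "'o label \<Rightarrow> real" where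
  "label_lam (Plain a) = lam a"
| "label_lam (Bar a) = 1 / lam a"

fun r :: "'o label \<Rightarrow> 'm" where
  "r (Plain a) = \<eta> a"
| "r (Bar a) = (\<epsilon> a)\<^sup>\<dagger>"

text \<open>The element \<open>\<Sum>\<^sub>\<beta> a(\<beta>) I\<^sub>\<beta>\<close> of the von Neumann algebra direct sum is represented by its
  bounded coefficient function \<open>a\<close>.\<close>

definition \<AA> :: "('o \<Rightarrow> complex) set" where
  "\<AA> = {a. bounded (range a) \<and> (\<forall>\<beta>. \<beta> \<notin> S \<longrightarrow> a \<beta> = 0)}"

definition unitA :: "'o \<Rightarrow> complex" where
  "unitA \<beta> = (if \<beta> \<in> S then 1 else 0)"

definition \<tau> :: "('o \<Rightarrow> complex) \<Rightarrow> complex" where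
  "\<tau> a = (\<Sum>\<^sub>\<infinity>\<beta>\<in>S. complex_of_real (dim \<beta>) * a \<beta>)"

text \<open>For \<open>a \<ge> 0\<close>, this says that the trace of \<open>a\<close> is finite.\<close>

definition \<tau>_finite :: "('o \<Rightarrow> complex) \<Rightarrow> bool" where
  "\<tau>_finite a \<longleftrightarrow> (\<lambda>\<beta>. complex_of_real (dim \<beta>) * a \<beta>) summable_on S"

definition triples :: "('o \<times> 'o label \<times> 'o) set" where
  "triples = S \<times> \<Lambda> \<times> S"

definition H :: "('o, 'm) hvec set" where
  "H = {\<xi> \<in> (\<Pi>\<^sub>E (\<beta>\<^sub>2, \<alpha>, \<beta>\<^sub>1) \<in> triples. hom C \<beta>\<^sub>1 (\<beta>\<^sub>2 \<box> label_obj \<alpha>)).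
     finite {(\<beta>\<^sub>2, \<alpha>, \<beta>\<^sub>1) \<in> triples. \<xi> (\<beta>\<^sub>2, \<alpha>, \<beta>\<^sub>1) \<noteq> zer C \<beta>\<^sub>1 (\<beta>\<^sub>2 \<box> label_obj \<alpha>)}}"

definition hadd :: "('o, 'm) hvec \<Rightarrow> ('o, 'm) hvec \<Rightarrow> ('o, 'm) hvec" where
  "hadd \<xi> \<zeta> = (\<lambda>t\<in>triples. \<xi> t \<oplus> \<zeta> t)"

definition hscale :: "complex \<Rightarrow> ('o, 'm) hvec \<Rightarrow> ('o, 'm) hvec" where
  "hscale c \<xi> = (\<lambda>t\<in>triples. c \<odot> \<xi> t)"

definition lact :: "('o \<Rightarrow> complex) \<Rightarrow> ('o, 'm) hvec \<Rightarrow> ('o, 'm) hvec" where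
  "lact a \<xi> = (\<lambda>(\<beta>\<^sub>2, \<alpha>, \<beta>\<^sub>1)\<in>triples. a \<beta>\<^sub>2 \<odot> \<xi> (\<beta>\<^sub>2, \<alpha>, \<beta>\<^sub>1))"

definition ract :: "('o, 'm) hvec \<Rightarrow> ('o \<Rightarrow> complex) \<Rightarrow> ('o, 'm) hvec" where
  "ract \<xi> a = (\<lambda>(\<beta>\<^sub>2, \<alpha>, \<beta>\<^sub>1)\<in>triples. a \<beta>\<^sub>1 \<odot> \<xi> (\<beta>\<^sub>2, \<alpha>, \<beta>\<^sub>1))"

text \<open>The \<open>\<AA>\<close>-valued inner product; the sum ranges over the (finite) set of pairs \<open>(\<beta>\<^sub>2, \<alpha>)\<close> at
  which both arguments can contribute to the coefficient of \<open>I\<^sub>\<beta>\<close>.\<close>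

definition hip :: "('o, 'm) hvec \<Rightarrow> ('o, 'm) hvec \<Rightarrow> 'o \<Rightarrow> complex" where
  "hip \<xi> \<zeta> \<beta> = (if \<beta> \<in> S then
     \<Sum>(\<omega>, \<alpha>) \<in> {(\<omega>, \<alpha>) \<in> S \<times> \<Lambda>. \<xi> (\<omega>, \<alpha>, \<beta>) \<noteq> zer C \<beta> (\<omega> \<box> label_obj \<alpha>) \<and>
                                 \<zeta> (\<omega>, \<alpha>, \<beta>) \<noteq> zer C \<beta> (\<omega> \<box> label_obj \<alpha>)}.
       coef \<beta> ((\<xi> (\<omega>, \<alpha>, \<beta>))\<^sup>\<dagger> \<cdot> \<zeta> (\<omega>, \<alpha>, \<beta>))
     else 0)"

text \<open>\<open>bar \<beta>\<^sub>2 \<alpha> x\<close> is the conjugate in \<open>Hom(\<beta>\<^sub>2, \<beta>\<^sub>1 \<alpha>\<^sup>-)\<close> of \<open>x\<close> in \<open>Hom(\<beta>\<^sub>1, \<beta>\<^sub>2 \<alpha>)\<close>.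
  Accordingly, the \<open>(\<beta>\<^sub>1, \<alpha>\<^sup>-, \<beta>\<^sub>2)\<close>-component of \<open>tomita_S \<xi>\<close> comes from the
  \<open>(\<beta>\<^sub>2, \<alpha>, \<beta>\<^sub>1)\<close>-component of \<open>\<xi>\<close>.\<close>

definition bar :: "'o \<Rightarrow> 'o label \<Rightarrow> 'm \<Rightarrow> 'm" where
  "bar \<beta>\<^sub>2 \<alpha> x = (x\<^sup>\<dagger> \<otimes> I (label_obj (bar_label \<alpha>))) \<cdot> (I \<beta>\<^sub>2 \<otimes> r (bar_label \<alpha>))"

definition tomita_S :: "('o, 'm) hvec \<Rightarrow> ('o, 'm) hvec" where
  "tomita_S \<xi> = (\<lambda>(\<beta>\<^sub>1, \<alpha>', \<beta>\<^sub>2)\<in>triples. let \<alpha> = bar_label \<alpha>' in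
     complex_of_real (sqrt (label_lam \<alpha>)) \<odot> bar \<beta>\<^sub>2 \<alpha> (\<xi> (\<beta>\<^sub>2, \<alpha>, \<beta>\<^sub>1)))"

text \<open>The direct sum over \<open>n \<ge> 1\<close> of the \<open>n\<close>-fold algebraic tensor products of \<open>H\<close> over \<open>\<AA>\<close> is the
  free vector space on nonempty words in \<open>H\<close> modulo the span of the relations of multilinearity
  and \<open>\<AA>\<close>-balancing, which preserve the length of words.\<close>

definition free_words :: "('o, 'm) words set" where
  "free_words = {x. \<forall>u\<in>Poly_Mapping.keys x. u \<noteq> [] \<and> set u \<subseteq> H}"

definition relators :: "('o, 'm) words set" where
  "relators =
     {word (u @ hadd \<xi> \<zeta> # w) - word (u @ \<xi> # w) - word (u @ \<zeta> # w) | u w \<xi> \<zeta>.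
        set u \<subseteq> H \<and> set w \<subseteq> H \<and> \<xi> \<in> H \<and> \<zeta> \<in> H} \<union>
     {word (u @ hscale c \<xi> # w) - pm_scale c (word (u @ \<xi> # w)) | u w c \<xi>.
        set u \<subseteq> H \<and> set w \<subseteq> H \<and> \<xi> \<in> H} \<union>
     {word (u @ ract \<xi> a # \<zeta> # w) - word (u @ \<xi> # lact a \<zeta> # w) | u w a \<xi> \<zeta>.
        set u \<subseteq> H \<and> set w \<subseteq> H \<and> \<xi> \<in> H \<and> \<zeta> \<in> H \<and> a \<in> \<AA>}"

definition tensor_class :: "('o, 'm) words \<Rightarrow> ('o, 'm) words set" where
  "tensor_class x = {y \<in> free_words. y - x \<in> module.span pm_scale relators}"

definition fock_car :: "('o, 'm) fvec set" where
  "fock_car = \<AA> \<times> tensor_class ` free_words"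

definition fadd :: "('o, 'm) fvec \<Rightarrow> ('o, 'm) fvec \<Rightarrow> ('o, 'm) fvec" where
  "fadd = (\<lambda>(a, X) (b, Y). (\<lambda>\<beta>. a \<beta> + b \<beta>, tensor_class (rep X + rep Y)))"

definition fscale :: "complex \<Rightarrow> ('o, 'm) fvec \<Rightarrow> ('o, 'm) fvec" where
  "fscale c = (\<lambda>(a, X). (\<lambda>\<beta>. c * a \<beta>, tensor_class (pm_scale c (rep X))))"

definition fzero :: "('o, 'm) fvec" where
  "fzero = (\<lambda>\<beta>. 0, tensor_class 0)"

text \<open>\<open>word_ip a [\<xi>\<^sub>1, \<dots>, \<xi>\<^sub>n] [\<beta>\<^sub>1, \<dots>, \<beta>\<^sub>n]\<close> is
  \<open>\<langle>\<xi>\<^sub>n | \<langle>\<dots> \<langle>\<xi>\<^sub>2 | \<langle>\<xi>\<^sub>1 | a \<beta>\<^sub>1\<rangle> \<beta>\<^sub>2\<rangle> \<dots>\<rangle> \<beta>\<^sub>n\<rangle>\<close>; it is used with \<open>a = 1\<close>.\<close>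

fun word_ip :: "('o \<Rightarrow> complex) \<Rightarrow> ('o, 'm) hvec list \<Rightarrow> ('o, 'm) hvec list \<Rightarrow> 'o \<Rightarrow> complex" where
  "word_ip a [] [] = a"
| "word_ip a (\<xi> # u) (\<zeta> # w) = word_ip (hip \<xi> (lact a \<zeta>)) u w"
| "word_ip a _ _ = (\<lambda>_. 0)"

definition fip :: "('o, 'm) fvec \<Rightarrow> ('o, 'm) fvec \<Rightarrow> 'o \<Rightarrow> complex" where
  "fip = (\<lambda>(a, X) (b, Y) \<beta>. cnj (a \<beta>) * b \<beta> +
     (\<Sum>u\<in>Poly_Mapping.keys (rep X). \<Sum>w\<in>Poly_Mapping.keys (rep Y).
        cnj (Poly_Mapping.lookup (rep X) u) * Poly_Mapping.lookup (rep Y) w *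
        word_ip unitA u w \<beta>))"

definition left_action :: "('o \<Rightarrow> complex) \<Rightarrow> ('o, 'm) fvec \<Rightarrow> ('o, 'm) fvec" where
  "left_action a = (\<lambda>(b, X). (\<lambda>\<beta>. a \<beta> * b \<beta>,
     tensor_class (pm_linear (\<lambda>u. word (lact a (hd u) # tl u)) (rep X))))"

definition creation :: "('o, 'm) hvec \<Rightarrow> ('o, 'm) fvec \<Rightarrow> ('o, 'm) fvec" where
  "creation \<xi> = (\<lambda>(a, X). (\<lambda>\<beta>. 0,
     tensor_class (word [ract \<xi> a] + pm_linear (\<lambda>u. word (\<xi> # u)) (rep X))))"

text \<open>On words of length 1 the result lies in \<open>\<AA>\<close>: \<open>L\<^sup>*(\<xi>) \<zeta> = \<langle>\<xi> | \<zeta>\<rangle>\<close>.\<close>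

definition annihilation :: "('o, 'm) hvec \<Rightarrow> ('o, 'm) fvec \<Rightarrow> ('o, 'm) fvec" where
  "annihilation \<xi> = (\<lambda>(a, X).
     (\<lambda>\<beta>. \<Sum>u\<in>{u \<in> Poly_Mapping.keys (rep X). length u = 1}.
            Poly_Mapping.lookup (rep X) u * hip \<xi> (hd u) \<beta>,
      tensor_class (pm_linear
        (\<lambda>u. case u of \<zeta>\<^sub>1 # \<zeta>\<^sub>2 # w \<Rightarrow> word (lact (hip \<xi> \<zeta>\<^sub>1) \<zeta>\<^sub>2 # w) | _ \<Rightarrow> 0) (rep X))))"

definition \<Gamma> :: "('o, 'm) hvec \<Rightarrow> ('o, 'm) fvec \<Rightarrow> ('o, 'm) fvec" where
  "\<Gamma> \<xi> \<zeta> = fadd (creation \<xi> \<zeta>) (annihilation (tomita_S \<xi>) \<zeta>)"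

definition fock_pre :: "('o, 'm) fvec inner_space" where
  "fock_pre = \<lparr> car = {\<zeta> \<in> fock_car. \<tau>_finite (fip \<zeta> \<zeta>)},
     vadd = fadd, vscale = fscale, vzero = fzero, vip = (\<lambda>\<zeta>\<^sub>1 \<zeta>\<^sub>2. \<tau> (fip \<zeta>\<^sub>1 \<zeta>\<^sub>2)) \<rparr>"

definition fock_space :: "(nat \<Rightarrow> ('o, 'm) fvec) set inner_space" where
  "fock_space = hilbert_completion fock_pre"

definition Phi ::
  "((nat \<Rightarrow> ('o, 'm) fvec) set \<Rightarrow> (nat \<Rightarrow> ('o, 'm) fvec) set) set" where
  "Phi = vN_generated fock_space
     ({extend_op fock_pre (left_action a) | a. a \<in> \<AA>} \<union> {extend_op fock_pre (\<Gamma> \<xi>) | \<xi>. \<xi> \<in> H})"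

end

end

theory Submission
  imports Defs
begin

text \<open>Let \<open>z\<close> be central, that is, in the commutant and the bicommutant of the generators. It commutes
  with the operators \<open>\<Gamma> \<xi>\<close>, which create or annihilate on the left of a word, and with their mirror
  images acting on the right. Consider the vector \<open>z \<Omega>\<close>, where \<open>\<Omega>\<close> is the vacuum vector
  \<open>I\<^sub>v\<close> of a simple object \<open>v\<close>. The unit object gives two conjugate loops \<open>a\<close>, \<open>b\<close> at \<open>v\<close>, and
  \<open>\<Gamma> b (\<Gamma> a \<Omega>)\<close> is also obtained by acting on the right. Thus \<open>z \<Omega>\<close> satisfies the same identity,
  which is a discrete wave equation for its coefficients at the words
  \<open>(ba)\<^sup>m u (ba)\<^sup>n\<close>. Since coefficients of a vector tend to 0 along orthogonal words of constant
  norm, the equation forces all of them to vanish in positive degree. Hence \<open>\<Omega>\<close> is an eigenvector of \<open>z\<close>.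
  All the vacuum vectors have the same eigenvalue because edges of the fusion graph connect them to
  that of the unit object, and they generate the Fock space.

  That the forms involved are positive semidefinite follows from the Schur product theorem.\<close>

section \<open>Spaces with a positive semidefinite form\<close>

text \<open>The loop parameter \<open>s\<close> combines \<open>lam (unt C)\<close> with the norm of
  the conjugate of an identity morphism; nothing bounds it, and swapping the two loops replaces it
  by \<open>1 / s\<close>. At the boundary of the quarter plane the wave equation only yields a
  recurrence of the form \<open>y n = - s * y (n + 1)\<close>. For \<open>s \<le> 1\<close> it
  forces growth and so contradicts decay unless \<open>y\<close> vanishes; for \<open>s > 1\<close>
  it is compatible with decay. Loops are therefore oriented so that \<open>s \<le> 1\<close>. Only
  the words \<open>(ba)^k\<close>, whose core is empty, then escape; they are taken as cores for the
  swapped pair, where the value at the next point is already known to be 0. The loops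
  \<open>a\<close> and \<open>b\<close> are orthogonal because the labels
  \<open>Plain (unt C)\<close> and \<open>Bar (unt C)\<close> differ even where their objects agree.
  A Fock vector of the completion is a class of Cauchy sequences of pairs containing cosets, all
  with chosen representatives. Computations are therefore carried out on explicit representatives,
  and equality is tested by inner products in the completion, where null vectors have been divided
  out.\<close>

text \<open>No vector space axioms are needed: addition and scaling only enter through the form.\<close>

locale pre_inner =
  fixes K :: "'v inner_space"
  assumes add_closed: "x \<in> car K \<Longrightarrow> y \<in> car K \<Longrightarrow> vadd K x y \<in> car K"
    and scale_closed: "x \<in> car K \<Longrightarrow> vscale K c x \<in> car K"
    and zero_closed: "vzero K \<in> car K"
    and ip_add: "z \<in> car K \<Longrightarrow> x \<in> car K \<Longrightarrow> y \<in> car K \<Longrightarrow>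
      vip K z (vadd K x y) = vip K z x + vip K z y"
    and ip_scale: "z \<in> car K \<Longrightarrow> x \<in> car K \<Longrightarrow> vip K z (vscale K c x) = c * vip K z x"
    and ip_zero: "z \<in> car K \<Longrightarrow> vip K z (vzero K) = 0"
    and ip_cnj: "x \<in> car K \<Longrightarrow> y \<in> car K \<Longrightarrow> vip K x y = cnj (vip K y x)"
    and ip_nonneg: "x \<in> car K \<Longrightarrow> 0 \<le> Re (vip K x x)"
begin

lemma ip_add_left: "z \<in> car K \<Longrightarrow> x \<in> car K \<Longrightarrow> y \<in> car K \<Longrightarrow>
    vip K (vadd K x y) z = vip K x z + vip K y z"
  by (metis add_closed complex_cnj_add ip_add ip_cnj)

lemma ip_scale_left: "z \<in> car K \<Longrightarrow> x \<in> car K \<Longrightarrow> vip K (vscale K c x) z = cnj c * vip K x z"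
  by (metis scale_closed complex_cnj_mult ip_scale ip_cnj)

lemma ip_zero_left: "z \<in> car K \<Longrightarrow> vip K (vzero K) z = 0"
  by (metis zero_closed complex_cnj_zero ip_zero ip_cnj)

lemmas ip_simps = add_closed scale_closed zero_closed ip_add ip_scale ip_zero
  ip_add_left ip_scale_left ip_zero_left

definition vdiff :: "'v \<Rightarrow> 'v \<Rightarrow> 'v" where
  "vdiff x y = vadd K x (vscale K (-1) y)"

lemma vdiff_closed [simp]: "x \<in> car K \<Longrightarrow> y \<in> car K \<Longrightarrow> vdiff x y \<in> car K"
  by (simp add: vdiff_def ip_simps)

lemma ip_vdiff: "z \<in> car K \<Longrightarrow> x \<in> car K \<Longrightarrow> y \<in> car K \<Longrightarrow>
    vip K z (vdiff x y) = vip K z x - vip K z y"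
  "z \<in> car K \<Longrightarrow> x \<in> car K \<Longrightarrow> y \<in> car K \<Longrightarrow> vip K (vdiff x y) z = vip K x z - vip K y z"
  by (simp_all add: vdiff_def ip_simps)

lemma vdist_vdiff: "vdist K x y = vnorm K (vdiff x y)"
  by (simp add: vdist_def vdiff_def)

lemma vnorm_sq: "x \<in> car K \<Longrightarrow> (vnorm K x)\<^sup>2 = Re (vip K x x)"
  by (simp add: vnorm_def ip_nonneg)

lemma ip_self: "x \<in> car K \<Longrightarrow> vip K x x = complex_of_real ((vnorm K x)\<^sup>2)"
  using ip_cnj[of x x] by (simp add: vnorm_sq complex_eq_iff)

lemma vnorm_nonneg [simp]: "x \<in> car K \<Longrightarrow> 0 \<le> vnorm K x"
  by (simp add: vnorm_def ip_nonneg)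

lemma vdist_nonneg [simp]: "x \<in> car K \<Longrightarrow> y \<in> car K \<Longrightarrow> 0 \<le> vdist K x y"
  by (simp add: vdist_vdiff)

text \<open>Positivity of the form at \<open>x + t * cnj w * y\<close>, with \<open>w\<close> the
  inner product, is a quadratic condition on the real number \<open>t\<close>. As the form is only
  semidefinite, \<open>vnorm K y = 0\<close> is treated apart: the condition is then linear in
  \<open>t\<close> and forces \<open>w = 0\<close>.\<close>

lemma cauchy_schwarz:
  assumes x: "x \<in> car K" and y: "y \<in> car K"
  shows "cmod (vip K x y) \<le> vnorm K x * vnorm K y"
proof -
  define w where "w = vip K x y"
  have *: "0 \<le> (vnorm K x)\<^sup>2 + 2 * t * (cmod w)\<^sup>2 + t\<^sup>2 * (cmod w)\<^sup>2 * (vnorm K y)\<^sup>2" for t :: real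
  proof -
    let ?c = "complex_of_real t * cnj w"
    let ?z = "vadd K x (vscale K ?c y)"
    have yx: "vip K y x = cnj w" using ip_cnj[OF y x] by (simp add: w_def)
    have "vip K ?z ?z = vip K x x + ?c * w + cnj ?c * cnj w + cnj ?c * ?c * vip K y y"
      using x y by (simp add: ip_simps yx w_def[symmetric] algebra_simps)
    also have "\<dots> = complex_of_real ((vnorm K x)\<^sup>2 + 2 * t * (cmod w)\<^sup>2 + t\<^sup>2 * (cmod w)\<^sup>2 * (vnorm K y)\<^sup>2)"
      unfolding ip_self[OF x] ip_self[OF y]
      by (simp add: complex_eq_iff cmod_power2 algebra_simps) (simp add: power2_eq_square algebra_simps)
    finally show ?thesis
      using ip_nonneg[of ?z] x y by (simp add: ip_simps)
  qed
  show ?thesis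
  proof (cases "w = 0")
    case True
    then show ?thesis using x y by (simp add: w_def[symmetric])
  next
    case False
    have "(cmod w)\<^sup>2 \<le> (vnorm K x)\<^sup>2 * (vnorm K y)\<^sup>2"
    proof (cases "vnorm K y = 0")
      case True
      have "0 \<le> (vnorm K x)\<^sup>2 + 2 * (- ((vnorm K x)\<^sup>2 + 1) / (cmod w)\<^sup>2) * (cmod w)\<^sup>2"
        using *[of "- ((vnorm K x)\<^sup>2 + 1) / (cmod w)\<^sup>2"] True by simp
      also have "\<dots> = - (vnorm K x)\<^sup>2 - 2" using False by (simp add: field_simps)
      finally show ?thesis by (smt (verit) zero_le_power2)
    next
      case F: False
      \<comment> \<open>The value \<open>t = - 1 / (vnorm K y)^2\<close> minimizes the
        quadratic.\<close>
      have "0 \<le> (vnorm K x)\<^sup>2 + 2 * (- 1 / (vnorm K y)\<^sup>2) * (cmod w)\<^sup>2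
          + (- 1 / (vnorm K y)\<^sup>2)\<^sup>2 * (cmod w)\<^sup>2 * (vnorm K y)\<^sup>2"
        by (rule *)
      also have "\<dots> = (vnorm K x)\<^sup>2 - (cmod w)\<^sup>2 / (vnorm K y)\<^sup>2"
        using F by (simp add: field_simps power2_eq_square)
      finally show ?thesis using F by (simp add: field_simps)
    qed
    then have "cmod w \<le> \<bar>vnorm K x * vnorm K y\<bar>"
      by (metis abs_le_square_iff abs_norm_cancel power_mult_distrib)
    then show ?thesis using x y by (simp add: w_def)
  qed
qed

text \<open>In the absence of vector space axioms, rearrangements such as
  \<open>x - z = (x - y) + (y - z)\<close> hold only up to null vectors. Norms do not see the
  difference.\<close>

lemma vnorm_eqI: "x \<in> car K \<Longrightarrow> y \<in> car K \<Longrightarrow> (\<And>z. z \<in> car K \<Longrightarrow> vip K z x = vip K z y) \<Longrightarrow>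
    vnorm K x = vnorm K y"
  by (metis ip_cnj vnorm_def)

lemma vnorm_add:
  assumes x: "x \<in> car K" and y: "y \<in> car K"
  shows "vnorm K (vadd K x y) \<le> vnorm K x + vnorm K y"
proof (rule power2_le_imp_le)
  have "(vnorm K (vadd K x y))\<^sup>2 = (vnorm K x)\<^sup>2 + 2 * Re (vip K x y) + (vnorm K y)\<^sup>2"
    using x y ip_cnj[OF y x] by (simp add: vnorm_sq ip_simps)
  also have "\<dots> \<le> (vnorm K x)\<^sup>2 + 2 * (vnorm K x * vnorm K y) + (vnorm K y)\<^sup>2"
    using cauchy_schwarz[OF x y] complex_Re_le_cmod[of "vip K x y"] by simp
  finally show "(vnorm K (vadd K x y))\<^sup>2 \<le> (vnorm K x + vnorm K y)\<^sup>2"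
    by (simp add: power2_eq_square algebra_simps)
qed (use x y in simp)

lemma vnorm_scale: "x \<in> car K \<Longrightarrow> vnorm K (vscale K c x) = cmod c * vnorm K x"
proof -
  assume x: "x \<in> car K"
  have "vip K (vscale K c x) (vscale K c x) = complex_of_real ((cmod c * vnorm K x)\<^sup>2)"
    using x ip_self[OF x] complex_norm_square[of c] by (simp add: ip_simps power_mult_distrib mult_ac)
  then show ?thesis
    using x by (simp add: vnorm_def[of K "vscale K c x"])
qed

lemma vdist_sym: "x \<in> car K \<Longrightarrow> y \<in> car K \<Longrightarrow> vdist K x y = vdist K y x"
  unfolding vdist_vdiff vnorm_def
  by (simp add: ip_vdiff algebra_simps)

lemma vdist_self [simp]: "x \<in> car K \<Longrightarrow> vdist K x x = 0"
  by (simp add: vdist_vdiff vnorm_def ip_vdiff)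

lemma vdist_triangle:
  assumes "x \<in> car K" "y \<in> car K" "z \<in> car K"
  shows "vdist K x z \<le> vdist K x y + vdist K y z"
proof -
  have "vdist K x z = vnorm K (vadd K (vdiff x y) (vdiff y z))"
    unfolding vdist_vdiff by (rule vnorm_eqI) (use assms in \<open>simp_all add: ip_simps ip_vdiff\<close>)
  also have "\<dots> \<le> vdist K x y + vdist K y z"
    unfolding vdist_vdiff by (rule vnorm_add) (use assms in simp_all)
  finally show ?thesis .
qed

lemma vdist_le_triangle:
  assumes "x \<in> car K" "y \<in> car K" "z \<in> car K"
  shows "vdist K x z \<le> vdist K y x + vdist K y z"
  using vdist_triangle[OF assms] vdist_sym[OF assms(1,2)] by simp

lemma ip_diff_le: "z \<in> car K \<Longrightarrow> x \<in> car K \<Longrightarrow> y \<in> car K \<Longrightarrow>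
    cmod (vip K z x - vip K z y) \<le> vnorm K z * vdist K x y"
  using cauchy_schwarz[of z "vdiff x y"] by (simp add: ip_vdiff vdist_vdiff)

lemma ip_diff_le_left: "z \<in> car K \<Longrightarrow> x \<in> car K \<Longrightarrow> y \<in> car K \<Longrightarrow>
    cmod (vip K x z - vip K y z) \<le> vdist K x y * vnorm K z"
  using cauchy_schwarz[of "vdiff x y" z] by (simp add: ip_vdiff vdist_vdiff)

lemma vnorm_le_vdist:
  assumes x: "x \<in> car K" and y: "y \<in> car K"
  shows "vnorm K x \<le> vnorm K y + vdist K x y"
proof -
  have "vnorm K x = vnorm K (vadd K y (vdiff x y))"
    by (rule vnorm_eqI) (use x y in \<open>simp_all add: ip_simps ip_vdiff\<close>)
  also have "\<dots> \<le> vnorm K y + vdist K x y"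
    unfolding vdist_vdiff by (rule vnorm_add) (use x y in simp_all)
  finally show ?thesis .
qed

lemma vnorm_diff_le:
  assumes x: "x \<in> car K" and y: "y \<in> car K"
  shows "\<bar>vnorm K x - vnorm K y\<bar> \<le> vdist K x y"
  using vnorm_le_vdist[OF x y] vnorm_le_vdist[OF y x] vdist_sym[OF x y] by linarith

lemma vdist_add:
  assumes "x \<in> car K" "y \<in> car K" "x' \<in> car K" "y' \<in> car K"
  shows "vdist K (vadd K x y) (vadd K x' y') \<le> vdist K x x' + vdist K y y'"
proof -
  have "vdist K (vadd K x y) (vadd K x' y') = vnorm K (vadd K (vdiff x x') (vdiff y y'))"
    unfolding vdist_vdiff by (rule vnorm_eqI) (use assms in \<open>simp_all add: ip_simps ip_vdiff\<close>)
  also have "\<dots> \<le> vdist K x x' + vdist K y y'"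
    unfolding vdist_vdiff by (rule vnorm_add) (use assms in simp_all)
  finally show ?thesis .
qed

lemma vdist_scale:
  assumes "x \<in> car K" "y \<in> car K"
  shows "vdist K (vscale K c x) (vscale K c y) = cmod c * vdist K x y"
proof -
  have "vdist K (vscale K c x) (vscale K c y) = vnorm K (vscale K c (vdiff x y))"
    unfolding vdist_vdiff
    by (rule vnorm_eqI) (use assms in \<open>simp_all add: ip_simps ip_vdiff algebra_simps\<close>)
  then show ?thesis using assms by (simp add: vnorm_scale vdist_vdiff)
qed

end

section \<open>Hilbert spaces and bounded operators\<close>

text \<open>The axiom \<open>ip_ext\<close> excludes null vectors and stands in for the vector space
  axioms: an identity of vectors is proved by pairing both sides with an arbitrary
  \<open>z\<close>.\<close>

locale hilbert = pre_inner +
  assumes ip_ext: "x \<in> car K \<Longrightarrow> y \<in> car K \<Longrightarrow> (\<And>z. z \<in> car K \<Longrightarrow> vip K z x = vip K z y) \<Longrightarrow> x = y"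
    and complete: "s \<in> cauchy_seqs K \<Longrightarrow> \<exists>x\<in>car K. (\<lambda>n. vdist K (s n) x) \<longlonglongrightarrow> 0"
begin

lemma vnorm_LIMSEQ:
  assumes "\<And>n. s n \<in> car K" "x \<in> car K" "(\<lambda>n. vdist K (s n) x) \<longlonglongrightarrow> 0"
  shows "(\<lambda>n. vnorm K (s n)) \<longlonglongrightarrow> vnorm K x"
proof -
  have "(\<lambda>n. vnorm K (s n) - vnorm K x) \<longlonglongrightarrow> 0"
  proof (rule Lim_null_comparison)
    show "\<forall>\<^sub>F n in sequentially. norm (vnorm K (s n) - vnorm K x) \<le> vdist K (s n) x"
      using assms vnorm_diff_le by auto
  qed (rule assms)
  then show ?thesis by (simp add: LIM_zero_iff)
qed

text \<open>The representing vector is the maximizer of \<open>\<lambda>x. 2 Re (f x) - \<parallel>x\<parallel>\<^sup>2\<close>; maximizing sequences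
  are Cauchy by the parallelogram law.\<close>

lemma riesz:
  assumes add: "\<And>x y. x \<in> car K \<Longrightarrow> y \<in> car K \<Longrightarrow> f (vadd K x y) = f x + f y"
    and scale: "\<And>c x. x \<in> car K \<Longrightarrow> f (vscale K c x) = c * f x"
    and bound: "\<And>x. x \<in> car K \<Longrightarrow> cmod (f x) \<le> B * vnorm K x"
  shows "\<exists>p\<in>car K. \<forall>x\<in>car K. f x = vip K p x"
proof -
  define \<phi> where "\<phi> x = 2 * Re (f x) - (vnorm K x)\<^sup>2" for x
  have \<phi>_le: "\<phi> x \<le> B\<^sup>2" if "x \<in> car K" for x
  proof -
    have "Re (f x) \<le> B * vnorm K x"
      using bound[OF that] complex_Re_le_cmod[of "f x"] by linarith
    moreover have "0 \<le> (B - vnorm K x)\<^sup>2" by simp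
    ultimately show ?thesis by (simp add: \<phi>_def power2_eq_square algebra_simps)
  qed
  then have bdd: "bdd_above (\<phi> ` car K)" by (intro bdd_aboveI2)
  define M where "M = Sup (\<phi> ` car K)"
  have le_M: "\<phi> x \<le> M" if "x \<in> car K" for x
    unfolding M_def by (rule cSup_upper) (use that bdd in auto)
  have "\<exists>x\<in>car K. M - 1 / real (Suc n) < \<phi> x" for n
  proof -
    have "M - 1 / real (Suc n) < Sup (\<phi> ` car K)" by (simp add: M_def)
    then show ?thesis
      using less_cSup_iff[OF _ bdd] zero_closed by blast
  qed
  then obtain s where s: "\<And>n. s n \<in> car K" "\<And>n. M - 1 / real (Suc n) < \<phi> (s n)" by metis
  have para: "(vdist K x y)\<^sup>2 \<le> 2 * ((M - \<phi> x) + (M - \<phi> y))" if x: "x \<in> car K" and y: "y \<in> car K" for x y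
  proof -
    let ?m = "vscale K (1/2) (vadd K x y)"
    have "\<phi> ?m = Re (f x) + Re (f y) - (1/4) * ((vnorm K x)\<^sup>2 + 2 * Re (vip K x y) + (vnorm K y)\<^sup>2)"
      using x y ip_cnj[OF y x]
      by (simp add: \<phi>_def add scale vnorm_sq ip_simps algebra_simps)
    moreover have "(vdist K x y)\<^sup>2 = (vnorm K x)\<^sup>2 - 2 * Re (vip K x y) + (vnorm K y)\<^sup>2"
      using x y ip_cnj[OF y x] by (simp add: vdist_vdiff vnorm_sq ip_vdiff)
    moreover have "\<phi> ?m \<le> M" by (rule le_M) (use x y in \<open>simp add: ip_simps\<close>)
    ultimately show ?thesis unfolding \<phi>_def[of x] \<phi>_def[of y] by argo
  qed
  have "s \<in> cauchy_seqs K"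
    unfolding cauchy_seqs_def
  proof (intro CollectI conjI allI impI s)
    fix e :: real assume e: "0 < e"
    obtain N where N: "4 / e\<^sup>2 < real (Suc N)" using reals_Archimedean2
      by (metis less_trans lessI of_nat_less_iff)
    show "\<exists>N. \<forall>m\<ge>N. \<forall>n\<ge>N. vdist K (s m) (s n) < e"
    proof (intro exI allI impI)
      fix m n assume mn: "N \<le> m" "N \<le> n"
      have b: "M - \<phi> (s k) < 1 / real (Suc N)" if "N \<le> k" for k
      proof -
        have "1 / real (Suc k) \<le> 1 / real (Suc N)" using that by (simp add: field_simps)
        then show ?thesis using s(2)[of k] by linarith
      qed
      have "(vdist K (s m) (s n))\<^sup>2 \<le> 2 * ((M - \<phi> (s m)) + (M - \<phi> (s n)))"
        by (rule para[OF s(1) s(1)])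
      also have "\<dots> < 4 / real (Suc N)" using b[OF mn(1)] b[OF mn(2)] by simp
      also have "\<dots> < e\<^sup>2" using N e by (simp add: field_simps)
      finally show "vdist K (s m) (s n) < e" using e by (simp add: power_less_imp_less_base)
    qed
  qed
  then obtain p where p: "p \<in> car K" "(\<lambda>n. vdist K (s n) p) \<longlonglongrightarrow> 0" using complete by blast
  have f_diff: "f (vdiff x y) = f x - f y" if "x \<in> car K" "y \<in> car K" for x y
    using that by (simp add: vdiff_def add scale scale_closed)
  have "(\<lambda>n. f (s n) - f p) \<longlonglongrightarrow> 0"
  proof (rule Lim_null_comparison)
    show "\<forall>\<^sub>F n in sequentially. norm (f (s n) - f p) \<le> B * vdist K (s n) p"
      using bound[OF vdiff_closed[OF s(1) p(1)]] f_diff[OF s(1) p(1)] by (auto simp: vdist_vdiff)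
    show "(\<lambda>n. B * vdist K (s n) p) \<longlonglongrightarrow> 0" using tendsto_mult_right_zero[OF p(2)] by simp
  qed
  then have "(\<lambda>n. f (s n)) \<longlonglongrightarrow> f p" by (simp add: LIM_zero_iff)
  then have lim1: "(\<lambda>n. \<phi> (s n)) \<longlonglongrightarrow> \<phi> p"
    unfolding \<phi>_def by (intro tendsto_intros vnorm_LIMSEQ s p)
  have lim2: "(\<lambda>n. M - 1 / real (Suc n)) \<longlonglongrightarrow> M - 0"
    by (intro tendsto_intros LIMSEQ_Suc lim_1_over_n)
  have "M - 0 \<le> \<phi> p"
    by (rule LIMSEQ_le[OF lim2 lim1]) (use s(2) less_imp_le in blast)
  then have max: "\<phi> x \<le> \<phi> p" if "x \<in> car K" for x using le_M[OF that] by simp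
  have Re_eq: "Re (f k) = Re (vip K p k)" if k: "k \<in> car K" for k
  proof (rule ccontr)
    assume ne: "Re (f k) \<noteq> Re (vip K p k)"
    define g where "g = Re (f k) - Re (vip K p k)"
    \<comment> \<open>First variation: \<open>p\<close> maximizes the functional, so moving from
      \<open>p\<close> to \<open>p + t k\<close> cannot increase it.\<close>
    have *: "2 * t * g \<le> t\<^sup>2 * (vnorm K k)\<^sup>2" for t
    proof -
      have "\<phi> (vadd K p (vscale K (complex_of_real t) k)) \<le> \<phi> p"
        by (rule max) (use p k in \<open>simp add: ip_simps\<close>)
      moreover have "(vnorm K (vadd K p (vscale K (complex_of_real t) k)))\<^sup>2 =
          (vnorm K p)\<^sup>2 + 2 * t * Re (vip K p k) + t\<^sup>2 * (vnorm K k)\<^sup>2"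
      proof -
        have "vip K (vadd K p (vscale K (complex_of_real t) k)) (vadd K p (vscale K (complex_of_real t) k)) =
            vip K p p + t * vip K p k + t * cnj (vip K p k) + t\<^sup>2 * vip K k k"
          using p(1) k ip_cnj[OF k p(1)] by (simp add: ip_simps algebra_simps power2_eq_square)
        then show ?thesis using p(1) k
          by (simp add: vnorm_sq add_closed scale_closed flip: of_real_power)
      qed
      ultimately show ?thesis using p(1) k
        by (simp add: \<phi>_def g_def add scale scale_closed algebra_simps)
    qed
    \<comment> \<open>With this \<open>t\<close>, \<open>t * g\<close> equals
      \<open>t^2 * (vnorm K k)^2 + t^2\<close>, too large for the first variation unless
      \<open>g = 0\<close>.\<close>
    define t where "t = g / ((vnorm K k)\<^sup>2 + 1)"
    have pos: "(vnorm K k)\<^sup>2 + 1 > 0" by (smt (verit) zero_le_power2)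
    have g: "g = t * ((vnorm K k)\<^sup>2 + 1)" unfolding t_def using pos by simp
    have "t\<^sup>2 * (vnorm K k)\<^sup>2 = t * g - t\<^sup>2" unfolding g by (simp add: power2_eq_square algebra_simps)
    with *[of t] have "t * g + t\<^sup>2 \<le> 0" by (simp add: mult.commute)
    moreover have "0 < t * g" using ne pos unfolding t_def g_def[symmetric]
      by (simp add: g_def divide_simps) (metis ne diff_eq_diff_eq eq_iff_diff_eq_0 not_real_square_gt_zero)
    ultimately show False by (smt (verit) zero_le_power2)
  qed
  \<comment> \<open>The imaginary part is recovered from the real part at \<open>\<i>\<close> times
    \<open>k\<close>.\<close>
  have "f k = vip K p k" if k: "k \<in> car K" for k
    using Re_eq[OF k] Re_eq[OF scale_closed[OF k, of \<i>]] k p(1)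
    by (simp add: complex_eq_iff scale ip_scale)
  then show ?thesis using p(1) by blast
qed

section \<open>Bounded operators and their adjoints\<close>

lemma bounded_opsD:
  assumes "T \<in> bounded_ops K"
  shows "x \<in> car K \<Longrightarrow> T x \<in> car K"
    and "x \<in> car K \<Longrightarrow> y \<in> car K \<Longrightarrow> T (vadd K x y) = vadd K (T x) (T y)"
    and "x \<in> car K \<Longrightarrow> T (vscale K c x) = vscale K c (T x)"
    and "\<exists>B\<ge>0. \<forall>x\<in>car K. vnorm K (T x) \<le> B * vnorm K x"
proof -
  show "\<exists>B\<ge>0. \<forall>x\<in>car K. vnorm K (T x) \<le> B * vnorm K x"
  proof -
    obtain B where B: "\<forall>x\<in>car K. vnorm K (T x) \<le> B * vnorm K x"
      using assms by (auto simp: bounded_ops_def)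
    have "vnorm K (T x) \<le> \<bar>B\<bar> * vnorm K x" if "x \<in> car K" for x
    proof -
      have "B * vnorm K x \<le> \<bar>B\<bar> * vnorm K x" using that by (intro mult_right_mono) auto
      then show ?thesis using B that by fastforce
    qed
    then show ?thesis by (intro exI[of _ "\<bar>B\<bar>"]) auto
  qed
qed (use assms in \<open>auto simp: bounded_ops_def\<close>)

lemma bounded_ops_ext: "T \<in> bounded_ops K \<Longrightarrow> T' \<in> bounded_ops K \<Longrightarrow>
    (\<And>x. x \<in> car K \<Longrightarrow> T x = T' x) \<Longrightarrow> T = T'"
  by (rule extensionalityI[of _ "car K"]) (auto simp: bounded_ops_def PiE_def)

text \<open>Linearity comes for free from the existence of a formal adjoint.\<close>

lemma bounded_opsI:
  assumes "T \<in> car K \<rightarrow>\<^sub>E car K" "\<And>x. x \<in> car K \<Longrightarrow> T' x \<in> car K"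
    and "\<And>x y. x \<in> car K \<Longrightarrow> y \<in> car K \<Longrightarrow> vip K x (T y) = vip K (T' x) y"
    and "\<And>x. x \<in> car K \<Longrightarrow> vnorm K (T x) \<le> B * vnorm K x"
  shows "T \<in> bounded_ops K"
  unfolding bounded_ops_def
proof (intro CollectI conjI ballI allI)
  have T: "x \<in> car K \<Longrightarrow> T x \<in> car K" for x using assms(1) by auto
  show "T (vadd K x y) = vadd K (T x) (T y)" if "x \<in> car K" "y \<in> car K" for x y
    by (rule ip_ext) (use that T assms(2) in \<open>simp_all add: assms(3) ip_simps\<close>)
  show "T (vscale K c x) = vscale K c (T x)" if "x \<in> car K" for x c
    by (rule ip_ext) (use that T assms(2) in \<open>simp_all add: assms(3) ip_simps\<close>)
  show "\<exists>B. \<forall>x\<in>car K. vnorm K (T x) \<le> B * vnorm K x" using assms(4) by blast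
qed (rule assms)

text \<open>The value at \<open>y\<close> represents, by Riesz, the functional sending
  \<open>x\<close> to the inner product of \<open>y\<close> with \<open>T x\<close>. The bound
  passes to the adjoint because the square norm of \<open>T' y\<close> is the inner product of
  \<open>T (T' y)\<close> with \<open>y\<close>.\<close>

lemma ex_adjoint:
  assumes T: "T \<in> bounded_ops K"
  shows "\<exists>T'. T' \<in> bounded_ops K \<and> (\<forall>x\<in>car K. \<forall>y\<in>car K. vip K (T x) y = vip K x (T' y))"
proof -
  note D = bounded_opsD[OF T]
  obtain B where B: "B \<ge> 0" "\<And>x. x \<in> car K \<Longrightarrow> vnorm K (T x) \<le> B * vnorm K x" using D(4) by blast
  have "\<exists>p\<in>car K. \<forall>x\<in>car K. vip K y (T x) = vip K p x" if y: "y \<in> car K" for y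
  proof (rule riesz)
    show "cmod (vip K y (T x)) \<le> (vnorm K y * B) * vnorm K x" if x: "x \<in> car K" for x
    proof -
      have "cmod (vip K y (T x)) \<le> vnorm K y * vnorm K (T x)"
        by (rule cauchy_schwarz) (use x y D(1) in auto)
      also have "\<dots> \<le> vnorm K y * (B * vnorm K x)" using B(2)[OF x] y by (intro mult_left_mono) auto
      finally show ?thesis by (simp add: mult.assoc)
    qed
  qed (use y D in \<open>simp_all add: ip_simps\<close>)
  then obtain T0 where T0: "\<And>y. y \<in> car K \<Longrightarrow> T0 y \<in> car K"
    "\<And>x y. x \<in> car K \<Longrightarrow> y \<in> car K \<Longrightarrow> vip K y (T x) = vip K (T0 y) x" by metis
  define T' where "T' = restrict T0 (car K)"
  have eq: "vip K (T x) y = vip K x (T' y)" if "x \<in> car K" "y \<in> car K" for x y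
    using T0 that D(1) ip_cnj by (metis T'_def restrict_apply')
  have "vnorm K (T' y) \<le> B * vnorm K y" if y: "y \<in> car K" for y
  proof -
    have c: "T' y \<in> car K" using y T0 by (simp add: T'_def)
    have "(vnorm K (T' y))\<^sup>2 = Re (vip K (T (T' y)) y)"
      using eq[OF c y] by (simp add: vnorm_sq[OF c])
    also have "\<dots> \<le> vnorm K (T (T' y)) * vnorm K y"
      using cauchy_schwarz[OF D(1)[OF c] y] complex_Re_le_cmod order_trans by blast
    also have "\<dots> \<le> (B * vnorm K (T' y)) * vnorm K y"
      using B(2)[OF c] y by (intro mult_right_mono) auto
    finally have "vnorm K (T' y) * vnorm K (T' y) \<le> vnorm K (T' y) * (B * vnorm K y)"
      by (simp add: power2_eq_square mult_ac)
    then show ?thesis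
      using c y B(1) by (cases "vnorm K (T' y) = 0") (auto simp: order_less_le)
  qed
  then have "T' \<in> bounded_ops K"
    by (intro bounded_opsI[of _ T]) (use T0 D(1) eq in \<open>auto simp: T'_def\<close>)
  then show ?thesis using eq by blast
qed

lemma adjoint_unique:
  assumes T: "T \<in> bounded_ops K" and T': "T' \<in> bounded_ops K"
    and eq: "\<And>x y. x \<in> car K \<Longrightarrow> y \<in> car K \<Longrightarrow> vip K (T x) y = vip K x (T' y)"
  shows "adjoint_op K T = T'"
  unfolding adjoint_op_def
proof (rule the_equality)
  show "T' \<in> bounded_ops K \<and> (\<forall>x\<in>car K. \<forall>y\<in>car K. vip K (T x) y = vip K x (T' y))"
    using T' eq by blast
  show "S = T'" if "S \<in> bounded_ops K \<and> (\<forall>x\<in>car K. \<forall>y\<in>car K. vip K (T x) y = vip K x (S y))" for S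
    by (rule bounded_ops_ext, use that T' in blast, use T' in blast, rule ip_ext)
       (use that T' eq bounded_opsD(1) in \<open>force+\<close>)
qed

lemma adjoint_op:
  assumes T: "T \<in> bounded_ops K"
  shows "adjoint_op K T \<in> bounded_ops K"
    and "x \<in> car K \<Longrightarrow> y \<in> car K \<Longrightarrow> vip K (T x) y = vip K x (adjoint_op K T y)"
    and "x \<in> car K \<Longrightarrow> y \<in> car K \<Longrightarrow> vip K x (T y) = vip K (adjoint_op K T x) y"
proof -
  obtain T' where T': "T' \<in> bounded_ops K" "\<And>x y. x \<in> car K \<Longrightarrow> y \<in> car K \<Longrightarrow> vip K (T x) y = vip K x (T' y)"
    using ex_adjoint[OF T] by blast
  have e: "adjoint_op K T = T'" by (rule adjoint_unique[OF T T'])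
  show "adjoint_op K T \<in> bounded_ops K"
    "x \<in> car K \<Longrightarrow> y \<in> car K \<Longrightarrow> vip K (T x) y = vip K x (adjoint_op K T y)" using T' e by auto
  show "vip K x (T y) = vip K (adjoint_op K T x) y" if "x \<in> car K" "y \<in> car K"
    using that T' bounded_opsD(1)[OF T] bounded_opsD(1)[OF T'(1)] ip_cnj[of x "T y"]
      ip_cnj[of "T' x" y] by (simp add: e)
qed

section \<open>Commutants, generated von Neumann algebras and a criterion for factors\<close>

lemma commutantD:
  assumes "T \<in> commutant K M"
  shows "T \<in> bounded_ops K" "A \<in> M \<Longrightarrow> x \<in> car K \<Longrightarrow> T (A x) = A (T x)"
proof -
  show "T \<in> bounded_ops K" using assms by (simp add: commutant_def)
  assume "A \<in> M" "x \<in> car K"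
  with assms have "compose (car K) T A x = compose (car K) A T x" by (auto simp: commutant_def)
  with \<open>x \<in> car K\<close> show "T (A x) = A (T x)" by (simp add: compose_def)
qed

lemma commutantI: "T \<in> bounded_ops K \<Longrightarrow> (\<And>A x. A \<in> M \<Longrightarrow> x \<in> car K \<Longrightarrow> T (A x) = A (T x)) \<Longrightarrow>
    T \<in> commutant K M"
  by (auto simp: commutant_def compose_def restrict_def)

lemma commutant_mono: "M \<subseteq> N \<Longrightarrow> commutant K N \<subseteq> commutant K M"
  by (auto simp: commutant_def)

lemma commutant_commutant: "M \<subseteq> bounded_ops K \<Longrightarrow> M \<subseteq> commutant K (commutant K M)"
  using commutantD by (intro subsetI commutantI) (auto 4 3)

lemma commutant_triple: "M \<subseteq> bounded_ops K \<Longrightarrow> commutant K (commutant K (commutant K M)) = commutant K M"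
  by (intro equalityI commutant_mono commutant_commutant) (auto dest: commutantD)

lemma commutant_adjoint:
  assumes M: "M \<subseteq> bounded_ops K" and adj: "\<And>A. A \<in> M \<Longrightarrow> adjoint_op K A \<in> M"
    and T: "T \<in> commutant K M"
  shows "adjoint_op K T \<in> commutant K M"
proof (rule commutantI)
  have T': "T \<in> bounded_ops K" by (rule commutantD[OF T])
  note A' = adjoint_op[OF T']
  then show "adjoint_op K T \<in> bounded_ops K" by blast
  fix A x assume A: "A \<in> M" and x: "x \<in> car K"
  note Ab = subsetD[OF M A] and Aa = adj[OF A]
  note Ao = adjoint_op[OF Ab]
  have c: "y \<in> car K \<Longrightarrow> A y \<in> car K" "y \<in> car K \<Longrightarrow> T y \<in> car K"
    "y \<in> car K \<Longrightarrow> adjoint_op K A y \<in> car K" "y \<in> car K \<Longrightarrow> adjoint_op K T y \<in> car K" for y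
    using bounded_opsD(1) Ab T' A'(1) Ao(1) by auto
  show "adjoint_op K T (A x) = A (adjoint_op K T x)"
  proof (rule ip_ext)
    fix z assume z: "z \<in> car K"
    have "vip K z (adjoint_op K T (A x)) = vip K (adjoint_op K A (T z)) x"
      using x z c by (simp add: A'(2)[symmetric] Ao(3))
    also have "\<dots> = vip K (T (adjoint_op K A z)) x" using commutantD(2)[OF T Aa z] by simp
    also have "\<dots> = vip K z (A (adjoint_op K T x))"
      using x z c by (simp add: A'(2) Ao(3))
    finally show "vip K z (adjoint_op K T (A x)) = vip K z (A (adjoint_op K T x))" .
  qed (use x c in auto)
qed

lemma von_neumann_bicommutant:
  assumes M: "M \<subseteq> bounded_ops K" and adj: "\<And>A. A \<in> M \<Longrightarrow> adjoint_op K A \<in> M"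
  shows "von_neumann_algebra K (commutant K (commutant K M))"
proof -
  have "adjoint_op K T \<in> commutant K (commutant K M)" if "T \<in> commutant K (commutant K M)" for T
    by (rule commutant_adjoint[OF _ _ that]) (use commutant_adjoint[OF M adj] commutantD in auto)
  then show ?thesis unfolding von_neumann_algebra_def
    using commutant_triple[OF M] by (auto dest: commutantD)
qed

text \<open>Taking commutants twice is monotone, so the bicommutant of the intersection stays inside
  each member. This makes \<open>vN_generated\<close> itself a von Neumann algebra.\<close>

lemma von_neumann_Inter:
  assumes "\<M> \<noteq> {}" "\<And>M. M \<in> \<M> \<Longrightarrow> von_neumann_algebra K M"
  shows "von_neumann_algebra K (\<Inter>\<M>)"
  unfolding von_neumann_algebra_def
proof (intro conjI)
  show sub: "\<Inter>\<M> \<subseteq> bounded_ops K" "\<forall>T\<in>\<Inter>\<M>. adjoint_op K T \<in> \<Inter>\<M>"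
    using assms unfolding von_neumann_algebra_def by blast+
  have "commutant K (commutant K (\<Inter>\<M>)) \<subseteq> M" if "M \<in> \<M>" for M
  proof -
    have "commutant K (commutant K (\<Inter>\<M>)) \<subseteq> commutant K (commutant K M)"
      using that by (intro commutant_mono) auto
    then show ?thesis using assms(2)[OF that] by (simp add: von_neumann_algebra_def)
  qed
  then show "commutant K (commutant K (\<Inter>\<M>)) = \<Inter>\<M>" using commutant_commutant[OF sub(1)] by blast
qed

lemma scalar_bounded_op: "(\<lambda>x\<in>car K. vscale K c x) \<in> bounded_ops K"
  by (rule bounded_opsI[where T' = "vscale K (cnj c)" and B = "cmod c"])
     (auto simp: ip_simps vnorm_scale)

lemma scalar_commutes: "M \<subseteq> bounded_ops K \<Longrightarrow> (\<lambda>x\<in>car K. vscale K c x) \<in> commutant K M"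
  by (rule commutantI[OF scalar_bounded_op]) (auto simp: bounded_opsD)

text \<open>The generated algebra contains \<open>G\<close>, so its commutant lies in the commutant
  of \<open>G\<close>; being an intersection, it lies inside the bicommutant of \<open>G\<close>,
  which is one of the intersected algebras. A central element thus belongs to both sets named in the
  hypothesis \<open>scalar\<close>.\<close>

lemma factor_generatedI:
  assumes G: "G \<subseteq> bounded_ops K" and adj: "\<And>A. A \<in> G \<Longrightarrow> adjoint_op K A \<in> G"
    and nz: "\<exists>x\<in>car K. x \<noteq> vzero K"
    and scalar: "\<And>z. z \<in> commutant K G \<Longrightarrow> z \<in> commutant K (commutant K G) \<Longrightarrow>
      \<exists>c. \<forall>x\<in>car K. z x = vscale K c x"
  shows "factor K (vN_generated K G)"
proof -
  let ?M = "vN_generated K G"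
  have bi: "commutant K (commutant K G) \<in> {M. von_neumann_algebra K M \<and> G \<subseteq> M}"
    using von_neumann_bicommutant[OF G adj] commutant_commutant[OF G] by blast
  have vN: "von_neumann_algebra K ?M"
    unfolding vN_generated_def by (rule von_neumann_Inter) (use bi in auto)
  then have Mb: "?M \<subseteq> bounded_ops K" by (simp add: von_neumann_algebra_def)
  have GM: "G \<subseteq> ?M" and MG: "?M \<subseteq> commutant K (commutant K G)"
    using bi by (auto simp: vN_generated_def)
  have "?M \<inter> commutant K ?M = {\<lambda>x\<in>car K. vscale K c x | c. True}"
  proof (intro equalityI subsetI)
    fix z assume z: "z \<in> ?M \<inter> commutant K ?M"
    then obtain c where c: "\<And>x. x \<in> car K \<Longrightarrow> z x = vscale K c x"
      using scalar MG commutant_mono[OF GM] by blast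
    have "z = (\<lambda>x\<in>car K. vscale K c x)"
      by (rule bounded_ops_ext) (use z Mb scalar_bounded_op c in auto)
    then show "z \<in> {\<lambda>x\<in>car K. vscale K c x | c. True}" by blast
  next
    fix z assume "z \<in> {\<lambda>x\<in>car K. vscale K c x | c. True}"
    then obtain c where z: "z = (\<lambda>x\<in>car K. vscale K c x)" by blast
    have "commutant K ?M \<subseteq> bounded_ops K" by (auto dest: commutantD)
    then have "z \<in> commutant K (commutant K ?M)" unfolding z by (rule scalar_commutes)
    then show "z \<in> ?M \<inter> commutant K ?M"
      using scalar_commutes[OF Mb] vN z by (auto simp: von_neumann_algebra_def)
  qed
  then show ?thesis using vN nz by (simp add: factor_def)
qed

text \<open>Totality of \<open>W\<close> is stated as triviality of its orthogonal complement. The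
  adjoints of \<open>P\<close> and \<open>Q\<close> at any \<open>z\<close> differ by a vector
  orthogonal to \<open>W\<close>, hence agree; pairing them with \<open>x\<close> gives the
  claim.\<close>

lemma eq_on_total:
  assumes W: "\<And>w. w \<in> W \<Longrightarrow> w \<in> car K"
    and total: "\<And>x. x \<in> car K \<Longrightarrow> (\<And>w. w \<in> W \<Longrightarrow> vip K w x = 0) \<Longrightarrow> x = vzero K"
    and P: "P \<in> bounded_ops K" and Q: "Q \<in> bounded_ops K"
    and eq: "\<And>w. w \<in> W \<Longrightarrow> P w = Q w"
    and x: "x \<in> car K"
  shows "P x = Q x"
proof (rule ip_ext)
  note P' = adjoint_op[OF P] and Q' = adjoint_op[OF Q]
  fix z assume z: "z \<in> car K"
  have c: "adjoint_op K P z \<in> car K" "adjoint_op K Q z \<in> car K"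
    using z bounded_opsD(1) P'(1) Q'(1) by auto
  have "vdiff (adjoint_op K P z) (adjoint_op K Q z) = vzero K"
  proof (rule total)
    fix w assume w: "w \<in> W"
    show "vip K w (vdiff (adjoint_op K P z) (adjoint_op K Q z)) = 0"
      using w z W c eq[OF w] by (simp add: ip_vdiff P'(2)[symmetric] Q'(2)[symmetric])
  qed (use c in simp)
  then have "vip K (adjoint_op K P z) x - vip K (adjoint_op K Q z) x = 0"
    using ip_vdiff(2)[OF x c] ip_zero_left[OF x] by simp
  then show "vip K z (P x) = vip K z (Q x)" using z x by (simp add: P'(3) Q'(3))
qed (use x P Q bounded_opsD(1) in auto)

lemma bounded_ops_compose:
  assumes P: "P \<in> bounded_ops K" and Q: "Q \<in> bounded_ops K"
  shows "compose (car K) P Q \<in> bounded_ops K"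
proof -
  note P' = adjoint_op[OF P] and Q' = adjoint_op[OF Q]
  obtain B where B: "B \<ge> 0" "\<And>x. x \<in> car K \<Longrightarrow> vnorm K (P x) \<le> B * vnorm K x"
    using bounded_opsD(4)[OF P] by blast
  obtain D where D: "D \<ge> 0" "\<And>x. x \<in> car K \<Longrightarrow> vnorm K (Q x) \<le> D * vnorm K x"
    using bounded_opsD(4)[OF Q] by blast
  have c: "x \<in> car K \<Longrightarrow> P x \<in> car K" "x \<in> car K \<Longrightarrow> Q x \<in> car K"
    "x \<in> car K \<Longrightarrow> adjoint_op K P x \<in> car K" "x \<in> car K \<Longrightarrow> adjoint_op K Q x \<in> car K" for x
    using P Q P'(1) Q'(1) bounded_opsD(1) by auto
  show ?thesis
  proof (rule bounded_opsI[where T' = "\<lambda>x. adjoint_op K Q (adjoint_op K P x)" and B = "B * D"])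
    show "vnorm K (compose (car K) P Q x) \<le> B * D * vnorm K x" if "x \<in> car K" for x
    proof -
      have "vnorm K (P (Q x)) \<le> B * vnorm K (Q x)" using that c B by auto
      also have "\<dots> \<le> B * (D * vnorm K x)" using D that B by (intro mult_left_mono) auto
      finally show ?thesis using that by (simp add: compose_def mult_ac)
    qed
  qed (use c in \<open>auto simp: compose_def P'(3) Q'(3)\<close>)
qed

end

section \<open>The Hilbert space completion\<close>

context pre_inner
begin

lemma cauchy_seqsD:
  assumes "s \<in> cauchy_seqs K"
  shows "s n \<in> car K" "e > 0 \<Longrightarrow> \<exists>N. \<forall>m\<ge>N. \<forall>n\<ge>N. vdist K (s m) (s n) < e"
  using assms by (auto simp: cauchy_seqs_def)

lemma cauchy_seqs_bounded:
  assumes s: "s \<in> cauchy_seqs K"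
  shows "\<exists>B>0. \<forall>n. vnorm K (s n) \<le> B"
proof -
  have "Cauchy (\<lambda>n. vnorm K (s n))"
  proof (rule CauchyI)
    fix e :: real assume "e > 0"
    then obtain N where "\<forall>m\<ge>N. \<forall>n\<ge>N. vdist K (s m) (s n) < e" using cauchy_seqsD(2)[OF s] by blast
    then show "\<exists>M. \<forall>m\<ge>M. \<forall>n\<ge>M. norm (vnorm K (s m) - vnorm K (s n)) < e"
      using vnorm_diff_le cauchy_seqsD(1)[OF s] by (metis order_le_less_trans real_norm_def)
  qed
  then have "Bseq (\<lambda>n. vnorm K (s n))" by (rule Cauchy_Bseq)
  then show ?thesis unfolding Bseq_def using cauchy_seqsD(1)[OF s] by auto
qed

lemma ip_seq_diff_le:
  assumes "x \<in> car K" "y \<in> car K" "x' \<in> car K" "y' \<in> car K"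
  shows "cmod (vip K x y - vip K x' y') \<le> vnorm K x * vdist K y y' + vdist K x x' * vnorm K y'"
proof -
  have "cmod (vip K x y - vip K x' y') \<le> cmod (vip K x y - vip K x y') + cmod (vip K x y' - vip K x' y')"
    by norm
  then show ?thesis
    using ip_diff_le[of x y y'] ip_diff_le_left[of y' x x'] assms by linarith
qed

lemma ip_seq_convergent:
  assumes s: "s \<in> cauchy_seqs K" and t: "t \<in> cauchy_seqs K"
  shows "convergent (\<lambda>n. vip K (s n) (t n))"
proof (rule Cauchy_convergent, rule CauchyI)
  fix e :: real assume e: "e > 0"
  obtain B where B: "B > 0" "\<And>n. vnorm K (s n) \<le> B" using cauchy_seqs_bounded[OF s] by blast
  obtain D where D: "D > 0" "\<And>n. vnorm K (t n) \<le> D" using cauchy_seqs_bounded[OF t] by blast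
  note sc = cauchy_seqsD(1)[OF s] and tc = cauchy_seqsD(1)[OF t]
  obtain N where N: "\<forall>m\<ge>N. \<forall>n\<ge>N. vdist K (s m) (s n) < e / (2 * D)"
    using cauchy_seqsD(2)[OF s, of "e / (2 * D)"] e D(1) by auto
  obtain N' where N': "\<forall>m\<ge>N'. \<forall>n\<ge>N'. vdist K (t m) (t n) < e / (2 * B)"
    using cauchy_seqsD(2)[OF t, of "e / (2 * B)"] e B(1) by auto
  show "\<exists>M. \<forall>m\<ge>M. \<forall>n\<ge>M. norm (vip K (s m) (t m) - vip K (s n) (t n)) < e"
  proof (intro exI allI impI)
    fix m n assume mn: "max N N' \<le> m" "max N N' \<le> n"
    have "cmod (vip K (s m) (t m) - vip K (s n) (t n)) \<le>
        vnorm K (s m) * vdist K (t m) (t n) + vdist K (s m) (s n) * vnorm K (t n)"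
      by (rule ip_seq_diff_le) (use sc tc in auto)
    also have "\<dots> \<le> B * vdist K (t m) (t n) + vdist K (s m) (s n) * D"
      by (intro add_mono mult_right_mono mult_left_mono B D) (use sc tc in auto)
    also have "\<dots> < B * (e / (2 * B)) + (e / (2 * D)) * D"
      by (intro add_strict_mono mult_strict_left_mono mult_strict_right_mono)
         (use N N' mn B D in auto)
    finally show "norm (vip K (s m) (t m) - vip K (s n) (t n)) < e" using B D by simp
  qed
qed

definition null_diff :: "(nat \<Rightarrow> 'v) \<Rightarrow> (nat \<Rightarrow> 'v) \<Rightarrow> bool" where
  "null_diff s t \<longleftrightarrow> (\<lambda>n. vdist K (s n) (t n)) \<longlonglongrightarrow> 0"

lemma null_diff_le:
  assumes "\<And>n. 0 \<le> vdist K (s n) (t n)" "\<And>n. vdist K (s n) (t n) \<le> f n" "f \<longlonglongrightarrow> 0"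
  shows "null_diff s t"
  unfolding null_diff_def by (rule Lim_null_comparison[OF _ assms(3)]) (use assms in auto)

lemma null_diff_refl: "s \<in> cauchy_seqs K \<Longrightarrow> null_diff s s"
  by (simp add: null_diff_def cauchy_seqsD(1))

lemma null_diff_sym: "s \<in> cauchy_seqs K \<Longrightarrow> t \<in> cauchy_seqs K \<Longrightarrow> null_diff s t \<Longrightarrow> null_diff t s"
  by (simp add: null_diff_def cauchy_seqsD(1) vdist_sym[of "t _" "s _"])

lemma null_diff_trans:
  assumes "s \<in> cauchy_seqs K" "t \<in> cauchy_seqs K" "u \<in> cauchy_seqs K" "null_diff s t" "null_diff t u"
  shows "null_diff s u"
proof (rule null_diff_le)
  show "(\<lambda>n. vdist K (s n) (t n) + vdist K (t n) (u n)) \<longlonglongrightarrow> 0"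
    using tendsto_add[OF assms(4,5)[unfolded null_diff_def]] by simp
qed (use assms(1-3) cauchy_seqsD(1) vdist_triangle in auto)

lemma limit_class_eq_iff:
  assumes s: "s \<in> cauchy_seqs K" and t: "t \<in> cauchy_seqs K"
  shows "limit_class K s = limit_class K t \<longleftrightarrow> null_diff s t"
proof -
  have 1: "limit_class K s = {u \<in> cauchy_seqs K. null_diff s u}" for s
    by (simp add: limit_class_def null_diff_def)
  show ?thesis unfolding 1 using s t null_diff_refl null_diff_sym null_diff_trans by blast
qed

lemma rep_limit_class:
  assumes s: "s \<in> cauchy_seqs K"
  shows "rep (limit_class K s) \<in> cauchy_seqs K" "null_diff s (rep (limit_class K s))"
    "limit_class K (rep (limit_class K s)) = limit_class K s"
proof -
  have "s \<in> limit_class K s" using null_diff_refl[OF s] s by (simp add: limit_class_def null_diff_def)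
  then have "rep (limit_class K s) \<in> limit_class K s" unfolding rep_def by (metis some_in_eq empty_iff)
  then show *: "rep (limit_class K s) \<in> cauchy_seqs K" "null_diff s (rep (limit_class K s))"
    by (simp_all add: limit_class_def null_diff_def)
  show "limit_class K (rep (limit_class K s)) = limit_class K s"
    using limit_class_eq_iff[OF s *(1)] *(2) by simp
qed

abbreviation Hc :: "(nat \<Rightarrow> 'v) set inner_space" where
  "Hc \<equiv> hilbert_completion K"

lemma Hc_car: "X \<in> car Hc \<longleftrightarrow> (\<exists>s\<in>cauchy_seqs K. X = limit_class K s)"
  by (auto simp: hilbert_completion_def)

lemma limit_class_in [simp]: "s \<in> cauchy_seqs K \<Longrightarrow> limit_class K s \<in> car Hc"
  by (auto simp: Hc_car)

lemma Hc_cases: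
  assumes "X \<in> car Hc"
  obtains s where "s \<in> cauchy_seqs K" "X = limit_class K s"
  using assms by (auto simp: Hc_car)

text \<open>The completion computes inner products on representatives picked by \<open>SOME\<close>.
  Any other representative differs by a null sequence, and Cauchy sequences are bounded, so the
  limit is the same.\<close>

lemma Hc_vip:
  assumes s: "s \<in> cauchy_seqs K" and t: "t \<in> cauchy_seqs K"
  shows "(\<lambda>n. vip K (s n) (t n)) \<longlonglongrightarrow> vip Hc (limit_class K s) (limit_class K t)"
proof -
  let ?s = "rep (limit_class K s)" and ?t = "rep (limit_class K t)"
  note rs = rep_limit_class[OF s] and rt = rep_limit_class[OF t]
  note c = cauchy_seqsD(1)[OF s] cauchy_seqsD(1)[OF t] cauchy_seqsD(1)[OF rs(1)] cauchy_seqsD(1)[OF rt(1)]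
  have v: "vip Hc (limit_class K s) (limit_class K t) = lim (\<lambda>n. vip K (?s n) (?t n))"
    by (simp add: hilbert_completion_def)
  have 1: "(\<lambda>n. vip K (?s n) (?t n)) \<longlonglongrightarrow> lim (\<lambda>n. vip K (?s n) (?t n))"
    using ip_seq_convergent[OF rs(1) rt(1)] convergent_LIMSEQ_iff by blast
  obtain B where B: "B > 0" "\<And>n. vnorm K (s n) \<le> B" using cauchy_seqs_bounded[OF s] by blast
  obtain D where D: "D > 0" "\<And>n. vnorm K (?t n) \<le> D" using cauchy_seqs_bounded[OF rt(1)] by blast
  have "(\<lambda>n. vip K (s n) (t n) - vip K (?s n) (?t n)) \<longlonglongrightarrow> 0"
  proof (rule Lim_null_comparison)
    show "\<forall>\<^sub>F n in sequentially. norm (vip K (s n) (t n) - vip K (?s n) (?t n)) \<le>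
        B * vdist K (t n) (?t n) + vdist K (s n) (?s n) * D"
    proof (rule always_eventually, rule allI)
      fix n
      have "norm (vip K (s n) (t n) - vip K (?s n) (?t n)) \<le>
        vnorm K (s n) * vdist K (t n) (?t n) + vdist K (s n) (?s n) * vnorm K (?t n)"
        by (rule ip_seq_diff_le) (use c in auto)
      also have "\<dots> \<le> B * vdist K (t n) (?t n) + vdist K (s n) (?s n) * D"
        by (intro add_mono mult_right_mono mult_left_mono B D) (use c in auto)
      finally show "norm (vip K (s n) (t n) - vip K (?s n) (?t n)) \<le>
        B * vdist K (t n) (?t n) + vdist K (s n) (?s n) * D" .
    qed
    show "(\<lambda>n. B * vdist K (t n) (?t n) + vdist K (s n) (?s n) * D) \<longlonglongrightarrow> 0"
      using tendsto_add[OF tendsto_mult_right_zero[OF rt(2)[unfolded null_diff_def]]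
          tendsto_mult_left_zero[OF rs(2)[unfolded null_diff_def]]] by simp
  qed
  from tendsto_add[OF this 1] show ?thesis by (simp add: v)
qed

lemma cauchy_seqs_add:
  assumes s: "s \<in> cauchy_seqs K" and t: "t \<in> cauchy_seqs K"
  shows "(\<lambda>n. vadd K (s n) (t n)) \<in> cauchy_seqs K"
  unfolding cauchy_seqs_def
proof (intro CollectI conjI allI impI)
  note sc = cauchy_seqsD(1)[OF s] and tc = cauchy_seqsD(1)[OF t]
  show "vadd K (s n) (t n) \<in> car K" for n using sc tc by (simp add: add_closed)
  fix e :: real assume e: "e > 0"
  obtain N where N: "\<forall>m\<ge>N. \<forall>n\<ge>N. vdist K (s m) (s n) < e / 2"
    using cauchy_seqsD(2)[OF s, of "e / 2"] e by auto
  obtain N' where N': "\<forall>m\<ge>N'. \<forall>n\<ge>N'. vdist K (t m) (t n) < e / 2"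
    using cauchy_seqsD(2)[OF t, of "e / 2"] e by auto
  show "\<exists>N. \<forall>m\<ge>N. \<forall>n\<ge>N. vdist K (vadd K (s m) (t m)) (vadd K (s n) (t n)) < e"
  proof (intro exI allI impI)
    fix m n assume mn: "max N N' \<le> m" "max N N' \<le> n"
    have "vdist K (vadd K (s m) (t m)) (vadd K (s n) (t n)) \<le> vdist K (s m) (s n) + vdist K (t m) (t n)"
      by (rule vdist_add) (use sc tc in auto)
    also have "\<dots> < e / 2 + e / 2"
      by (rule add_strict_mono) (use N N' mn in auto)
    finally show "vdist K (vadd K (s m) (t m)) (vadd K (s n) (t n)) < e" by simp
  qed
qed

lemma cauchy_seqs_image:
  assumes s: "s \<in> cauchy_seqs K" and B: "B \<ge> 0" and T: "\<And>x. x \<in> car K \<Longrightarrow> T x \<in> car K"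
    and le: "\<And>x y. x \<in> car K \<Longrightarrow> y \<in> car K \<Longrightarrow> vdist K (T x) (T y) \<le> B * vdist K x y"
  shows "(\<lambda>n. T (s n)) \<in> cauchy_seqs K"
  unfolding cauchy_seqs_def
proof (intro CollectI conjI allI impI)
  note sc = cauchy_seqsD(1)[OF s]
  show "T (s n) \<in> car K" for n using T sc by simp
  fix e :: real assume e: "e > 0"
  obtain N where N: "\<And>m n. m \<ge> N \<Longrightarrow> n \<ge> N \<Longrightarrow> vdist K (s m) (s n) < e / (B + 1)"
    using cauchy_seqsD(2)[OF s, of "e / (B + 1)"] e B by auto
  show "\<exists>N. \<forall>m\<ge>N. \<forall>n\<ge>N. vdist K (T (s m)) (T (s n)) < e"
  proof (intro exI allI impI)
    fix m n assume mn: "N \<le> m" "N \<le> n"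
    have "vdist K (T (s m)) (T (s n)) \<le> B * vdist K (s m) (s n)" using le sc by simp
    also have "\<dots> \<le> (B + 1) * vdist K (s m) (s n)" using sc by (intro mult_right_mono) auto
    also have "\<dots> < (B + 1) * (e / (B + 1))"
      by (rule mult_strict_left_mono) (use N[OF mn] B in auto)
    finally show "vdist K (T (s m)) (T (s n)) < e" using B by simp
  qed
qed

lemma null_diff_image:
  assumes s: "s \<in> cauchy_seqs K" and t: "t \<in> cauchy_seqs K" and st: "null_diff s t"
    and T: "\<And>x. x \<in> car K \<Longrightarrow> T x \<in> car K"
    and le: "\<And>x y. x \<in> car K \<Longrightarrow> y \<in> car K \<Longrightarrow> vdist K (T x) (T y) \<le> B * vdist K x y"
  shows "null_diff (\<lambda>n. T (s n)) (\<lambda>n. T (t n))"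
proof (rule null_diff_le)
  show "(\<lambda>n. B * vdist K (s n) (t n)) \<longlonglongrightarrow> 0"
    using tendsto_mult_right_zero[OF st[unfolded null_diff_def]] by simp
qed (use T le cauchy_seqsD(1)[OF s] cauchy_seqsD(1)[OF t] in auto)

lemma cauchy_seqs_scale: "s \<in> cauchy_seqs K \<Longrightarrow> (\<lambda>n. vscale K c (s n)) \<in> cauchy_seqs K"
  by (rule cauchy_seqs_image[where B = "cmod c"]) (auto simp: scale_closed vdist_scale)

lemma cauchy_seqs_const: "x \<in> car K \<Longrightarrow> (\<lambda>_. x) \<in> cauchy_seqs K"
  by (simp add: cauchy_seqs_def)

lemma Hc_vadd:
  assumes s: "s \<in> cauchy_seqs K" and t: "t \<in> cauchy_seqs K"
  shows "vadd Hc (limit_class K s) (limit_class K t) = limit_class K (\<lambda>n. vadd K (s n) (t n))"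
proof -
  note rs = rep_limit_class[OF s] and rt = rep_limit_class[OF t]
  note c = cauchy_seqsD(1)[OF s] cauchy_seqsD(1)[OF t] cauchy_seqsD(1)[OF rs(1)] cauchy_seqsD(1)[OF rt(1)]
  have "limit_class K (\<lambda>n. vadd K (s n) (t n)) =
      limit_class K (\<lambda>n. vadd K (rep (limit_class K s) n) (rep (limit_class K t) n))"
  proof (subst limit_class_eq_iff)
    show "null_diff (\<lambda>n. vadd K (s n) (t n)) (\<lambda>n. vadd K (rep (limit_class K s) n) (rep (limit_class K t) n))"
    proof (rule null_diff_le)
      show "(\<lambda>n. vdist K (s n) (rep (limit_class K s) n) + vdist K (t n) (rep (limit_class K t) n)) \<longlonglongrightarrow> 0"
        using tendsto_add[OF rs(2)[unfolded null_diff_def] rt(2)[unfolded null_diff_def]] by simp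
    qed (use c in \<open>auto intro: vdist_add simp: add_closed\<close>)
  qed (use s t rs rt cauchy_seqs_add in auto)
  then show ?thesis by (simp add: hilbert_completion_def)
qed

lemma Hc_vscale:
  assumes s: "s \<in> cauchy_seqs K"
  shows "vscale Hc c (limit_class K s) = limit_class K (\<lambda>n. vscale K c (s n))"
proof -
  note rs = rep_limit_class[OF s]
  have "limit_class K (\<lambda>n. vscale K c (s n)) = limit_class K (\<lambda>n. vscale K c (rep (limit_class K s) n))"
    by (subst limit_class_eq_iff, (intro cauchy_seqs_scale s rs)+,
      rule null_diff_image[OF s rs(1,2), where B = "cmod c"]) (auto simp: scale_closed vdist_scale)
  then show ?thesis by (simp add: hilbert_completion_def)
qed

lemma Hc_vzero: "vzero Hc = limit_class K (\<lambda>n. vzero K)"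
  by (simp add: hilbert_completion_def)

lemma Hc_pre_inner: "pre_inner Hc"
proof
  fix X Y Z c
  show "vzero Hc \<in> car Hc" by (simp add: Hc_vzero cauchy_seqs_const zero_closed)
  {
    assume "Z \<in> car Hc"
    then obtain s where s: "s \<in> cauchy_seqs K" "Z = limit_class K s" by (rule Hc_cases)
    note sc = cauchy_seqsD(1)[OF s(1)]
    have "(\<lambda>n. 0) \<longlonglongrightarrow> vip Hc Z (vzero Hc)"
      using Hc_vip[OF s(1) cauchy_seqs_const[OF zero_closed]] sc
      by (simp add: Hc_vzero s(2) ip_zero)
    then show "vip Hc Z (vzero Hc) = 0" by (metis LIMSEQ_unique tendsto_const)
    assume "X \<in> car Hc"
    then obtain t where t: "t \<in> cauchy_seqs K" "X = limit_class K t" by (rule Hc_cases)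
    note tc = cauchy_seqsD(1)[OF t(1)]
    note lim1 = Hc_vip[OF s(1) t(1), folded s(2) t(2)]
    have "(\<lambda>n. c * vip K (s n) (t n)) \<longlonglongrightarrow> vip Hc Z (vscale Hc c X)"
      using Hc_vip[OF s(1) cauchy_seqs_scale[OF t(1)]] sc tc
      by (simp add: s(2) t(2) Hc_vscale[OF t(1)] ip_scale)
    then show "vip Hc Z (vscale Hc c X) = c * vip Hc Z X"
      using LIMSEQ_unique tendsto_mult_left[OF lim1] by blast
    assume "Y \<in> car Hc"
    then obtain u where u: "u \<in> cauchy_seqs K" "Y = limit_class K u" by (rule Hc_cases)
    note uc = cauchy_seqsD(1)[OF u(1)]
    note lim2 = Hc_vip[OF s(1) u(1), folded s(2) u(2)]
    have "(\<lambda>n. vip K (s n) (t n) + vip K (s n) (u n)) \<longlonglongrightarrow> vip Hc Z (vadd Hc X Y)"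
      using Hc_vip[OF s(1) cauchy_seqs_add[OF t(1) u(1)]] sc tc uc
      by (simp add: s(2) t(2) u(2) Hc_vadd[OF t(1) u(1)] ip_add)
    then show "vip Hc Z (vadd Hc X Y) = vip Hc Z X + vip Hc Z Y"
      using LIMSEQ_unique tendsto_add[OF lim1 lim2] by blast
  }
  {
    assume X: "X \<in> car Hc"
    then obtain s where s: "s \<in> cauchy_seqs K" "X = limit_class K s" by (rule Hc_cases)
    note sc = cauchy_seqsD(1)[OF s(1)]
    show "vscale Hc c X \<in> car Hc" using s by (simp add: Hc_vscale cauchy_seqs_scale)
    show "0 \<le> Re (vip Hc X X)"
      by (rule LIMSEQ_le_const[OF tendsto_Re[OF Hc_vip[OF s(1) s(1), folded s(2)]]])
         (use sc ip_nonneg in auto)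
    assume "Y \<in> car Hc"
    then obtain t where t: "t \<in> cauchy_seqs K" "Y = limit_class K t" by (rule Hc_cases)
    note tc = cauchy_seqsD(1)[OF t(1)]
    show "vadd Hc X Y \<in> car Hc" using s t by (simp add: Hc_vadd cauchy_seqs_add)
    have "(\<lambda>n. cnj (vip K (t n) (s n))) = (\<lambda>n. vip K (s n) (t n))"
      by (intro ext ip_cnj[symmetric] sc tc)
    then show "vip Hc X Y = cnj (vip Hc Y X)"
      using LIMSEQ_unique Hc_vip[OF s(1) t(1), folded s(2) t(2)]
        tendsto_cnj[OF Hc_vip[OF t(1) s(1), folded s(2) t(2)]] by metis
  }
qed

section \<open>The dense image of the original space, and completeness\<close>

definition emb :: "'v \<Rightarrow> (nat \<Rightarrow> 'v) set" where
  "emb x = limit_class K (\<lambda>_. x)"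

lemma emb_in [simp]: "x \<in> car K \<Longrightarrow> emb x \<in> car Hc"
  by (simp add: emb_def cauchy_seqs_const)

lemma Hc_vdist:
  assumes s: "s \<in> cauchy_seqs K" and t: "t \<in> cauchy_seqs K"
  shows "(\<lambda>n. vdist K (s n) (t n)) \<longlonglongrightarrow> vdist Hc (limit_class K s) (limit_class K t)"
proof -
  let ?u = "\<lambda>n. vadd K (s n) (vscale K (-1) (t n))"
  have u: "?u \<in> cauchy_seqs K" using s t by (intro cauchy_seqs_add cauchy_seqs_scale)
  have "(\<lambda>n. vnorm K (?u n)) \<longlonglongrightarrow> vnorm Hc (limit_class K ?u)"
    unfolding vnorm_def by (intro tendsto_intros Hc_vip u)
  then show ?thesis by (simp add: vdist_def Hc_vadd Hc_vscale s t cauchy_seqs_scale)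
qed

lemma Hc_vdist_emb:
  assumes s: "s \<in> cauchy_seqs K"
  shows "(\<lambda>n. vdist Hc (emb (s n)) (limit_class K s)) \<longlonglongrightarrow> 0"
proof (rule LIMSEQ_I)
  fix e :: real assume e: "e > 0"
  obtain N where N: "\<And>m n. m \<ge> N \<Longrightarrow> n \<ge> N \<Longrightarrow> vdist K (s m) (s n) < e / 2"
    using cauchy_seqsD(2)[OF s, of "e / 2"] e by auto
  interpret Hc: pre_inner Hc by (rule Hc_pre_inner)
  show "\<exists>N. \<forall>n\<ge>N. norm (vdist Hc (emb (s n)) (limit_class K s) - 0) < e"
  proof (intro exI allI impI)
    fix n assume n: "N \<le> n"
    have sc: "s n \<in> car K" for n using s by (rule cauchy_seqsD)
    have "vdist Hc (emb (s n)) (limit_class K s) \<le> e / 2"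
      unfolding emb_def
      by (rule LIMSEQ_le_const2[OF Hc_vdist[OF cauchy_seqs_const[OF sc] s]])
         (use N[OF n] less_imp_le in blast)
    then show "norm (vdist Hc (emb (s n)) (limit_class K s) - 0) < e"
      using e Hc.vdist_nonneg[OF emb_in[OF sc] limit_class_in[OF s]] by simp
  qed
qed

lemma emb_vip: "x \<in> car K \<Longrightarrow> y \<in> car K \<Longrightarrow> vip Hc (emb x) (emb y) = vip K x y"
  using Hc_vip[OF cauchy_seqs_const cauchy_seqs_const, of x y]
  by (metis LIMSEQ_unique tendsto_const emb_def)

lemma emb_vdist: "x \<in> car K \<Longrightarrow> y \<in> car K \<Longrightarrow> vdist Hc (emb x) (emb y) = vdist K x y"
  using Hc_vdist[OF cauchy_seqs_const cauchy_seqs_const, of x y]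
  by (metis LIMSEQ_unique tendsto_const emb_def)

lemma emb_dense:
  assumes "X \<in> car Hc" "e > 0"
  shows "\<exists>x\<in>car K. vdist Hc (emb x) X < e"
proof -
  obtain s where s: "s \<in> cauchy_seqs K" "X = limit_class K s" using assms(1) by (rule Hc_cases)
  obtain N where "norm (vdist Hc (emb (s N)) X - 0) < e"
    using LIMSEQ_D[OF Hc_vdist_emb[OF s(1)] assms(2)] s(2) by blast
  then show ?thesis using cauchy_seqsD(1)[OF s(1)] by (intro bexI[of _ "s N"]) auto
qed

lemma Hc_eqI:
  assumes X: "X \<in> car Hc" and Y: "Y \<in> car Hc" and "vdist Hc X Y = 0"
  shows "X = Y"
proof -
  obtain s where s: "s \<in> cauchy_seqs K" "X = limit_class K s" using X by (rule Hc_cases)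
  obtain t where t: "t \<in> cauchy_seqs K" "Y = limit_class K t" using Y by (rule Hc_cases)
  show ?thesis
    using Hc_vdist[OF s(1) t(1)] assms(3) s t limit_class_eq_iff by (simp add: null_diff_def)
qed

text \<open>The difference of \<open>X\<close> and \<open>Y\<close> is a limit of embedded vectors,
  all of which are orthogonal to it; so it is orthogonal to itself.\<close>

lemma Hc_ext_emb:
  assumes X: "X \<in> car Hc" and Y: "Y \<in> car Hc"
    and eq: "\<And>x. x \<in> car K \<Longrightarrow> vip Hc (emb x) X = vip Hc (emb x) Y"
  shows "X = Y"
proof (rule Hc_eqI[OF X Y])
  interpret Hc: pre_inner Hc by (rule Hc_pre_inner)
  let ?D = "Hc.vdiff X Y"
  have D: "?D \<in> car Hc" using X Y by simp
  then obtain s where s: "s \<in> cauchy_seqs K" "?D = limit_class K s" by (rule Hc_cases)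
  have sc: "s n \<in> car K" for n using s(1) by (rule cauchy_seqsD)
  have "(\<lambda>n. vip Hc (emb (s n)) ?D - vip Hc ?D ?D) \<longlonglongrightarrow> 0"
  proof (rule Lim_null_comparison)
    show "\<forall>\<^sub>F n in sequentially. norm (vip Hc (emb (s n)) ?D - vip Hc ?D ?D) \<le>
        vdist Hc (emb (s n)) ?D * vnorm Hc ?D"
      using sc D Hc.ip_diff_le_left by auto
    show "(\<lambda>n. vdist Hc (emb (s n)) ?D * vnorm Hc ?D) \<longlonglongrightarrow> 0"
      using tendsto_mult_left_zero[OF Hc_vdist_emb[OF s(1)]] s(2) by simp
  qed
  moreover have "vip Hc (emb (s n)) ?D = 0" for n
    using eq[OF sc] sc X Y by (simp add: Hc.ip_vdiff)
  ultimately have "vip Hc ?D ?D = 0" by (simp add: LIMSEQ_const_iff)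
  then show "vdist Hc X Y = 0" by (simp add: Hc.vdist_vdiff vnorm_def)
qed

text \<open>Each term is approximated within \<open>1 / (n + 1)\<close> by an embedded vector. These
  vectors form a Cauchy sequence in the original space, and its class is the limit.\<close>

lemma Hc_complete:
  assumes S: "S \<in> cauchy_seqs Hc"
  shows "\<exists>X\<in>car Hc. (\<lambda>n. vdist Hc (S n) X) \<longlonglongrightarrow> 0"
proof -
  interpret Hc: pre_inner Hc by (rule Hc_pre_inner)
  note Sc = Hc.cauchy_seqsD(1)[OF S]
  have "\<exists>x\<in>car K. vdist Hc (emb x) (S n) < 1 / real (Suc n)" for n
    using emb_dense[OF Sc] by simp
  then obtain x where x: "\<And>n. x n \<in> car K" "\<And>n. vdist Hc (emb (x n)) (S n) < 1 / real (Suc n)"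
    by metis
  have x_CS: "x \<in> cauchy_seqs K"
    unfolding cauchy_seqs_def
  proof (intro CollectI conjI allI impI x)
    fix e :: real assume e: "e > 0"
    obtain N where N: "\<And>m n. m \<ge> N \<Longrightarrow> n \<ge> N \<Longrightarrow> vdist Hc (S m) (S n) < e / 3"
      using Hc.cauchy_seqsD(2)[OF S, of "e / 3"] e by auto
    obtain N' where N': "3 / e < real (Suc N')" by (metis reals_Archimedean2 less_trans lessI of_nat_less_iff)
    have b: "1 / real (Suc k) < e / 3" if "N' \<le> k" for k
    proof -
      have "3 / e < real (Suc k)" using N' that by simp
      then show ?thesis using e by (simp add: field_simps)
    qed
    show "\<exists>N. \<forall>m\<ge>N. \<forall>n\<ge>N. vdist K (x m) (x n) < e"
    proof (intro exI allI impI)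
      fix m n assume mn: "max N N' \<le> m" "max N N' \<le> n"
      have "vdist K (x m) (x n) = vdist Hc (emb (x m)) (emb (x n))" using x by (simp add: emb_vdist)
      also have "\<dots> \<le> vdist Hc (emb (x m)) (S m) + vdist Hc (S m) (emb (x n))"
        by (rule Hc.vdist_triangle) (use x Sc in auto)
      also have "vdist Hc (S m) (emb (x n)) \<le> vdist Hc (S m) (S n) + vdist Hc (S n) (emb (x n))"
        by (rule Hc.vdist_triangle) (use x Sc in auto)
      also have "vdist Hc (S n) (emb (x n)) = vdist Hc (emb (x n)) (S n)"
        by (rule Hc.vdist_sym) (use x Sc in auto)
      finally show "vdist K (x m) (x n) < e"
        using x(2)[of m] x(2)[of n] b[of m] b[of n] N[of m n] mn by simp
    qed
  qed
  let ?X = "limit_class K x"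
  have "(\<lambda>n. vdist Hc (S n) ?X) \<longlonglongrightarrow> 0"
  proof (rule Lim_null_comparison)
    show "\<forall>\<^sub>F n in sequentially. norm (vdist Hc (S n) ?X) \<le> 1 / real (Suc n) + vdist Hc (emb (x n)) ?X"
    proof (rule always_eventually, rule allI)
      fix n
      have "vdist Hc (S n) ?X \<le> vdist Hc (emb (x n)) (S n) + vdist Hc (emb (x n)) ?X"
        by (rule Hc.vdist_le_triangle) (use x Sc x_CS in auto)
      then show "norm (vdist Hc (S n) ?X) \<le> 1 / real (Suc n) + vdist Hc (emb (x n)) ?X"
        using x(2)[of n] Hc.vdist_nonneg[OF Sc limit_class_in[OF x_CS]] by simp
    qed
    show "(\<lambda>n. 1 / real (Suc n) + vdist Hc (emb (x n)) ?X) \<longlonglongrightarrow> 0"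
      using tendsto_add[OF LIMSEQ_Suc[OF lim_1_over_n] Hc_vdist_emb[OF x_CS]] by simp
  qed
  then show ?thesis using x_CS by auto
qed

lemma Hc_hilbert: "hilbert Hc"
proof -
  interpret Hc: pre_inner Hc by (rule Hc_pre_inner)
  show ?thesis
  proof
    show "X = Y" if "X \<in> car Hc" "Y \<in> car Hc" "\<And>Z. Z \<in> car Hc \<Longrightarrow> vip Hc Z X = vip Hc Z Y" for X Y
      by (rule Hc_ext_emb[OF that(1,2)]) (simp add: that(3))
  qed (rule Hc_complete)
qed

text \<open>\<open>T\<close> is not assumed linear. A formal adjoint makes it linear up to null
  vectors, which is enough to turn a bound on norms into a Lipschitz bound.\<close>

lemma formal_adjoint_vdist:
  assumes T: "\<And>x. x \<in> car K \<Longrightarrow> T x \<in> car K" and T': "\<And>x. x \<in> car K \<Longrightarrow> T' x \<in> car K"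
    and adj: "\<And>x y. x \<in> car K \<Longrightarrow> y \<in> car K \<Longrightarrow> vip K x (T y) = vip K (T' x) y"
    and x: "x \<in> car K" and y: "y \<in> car K"
  shows "vdist K (T x) (T y) = vnorm K (T (vdiff x y))"
  unfolding vdist_vdiff by (rule vnorm_eqI) (use T T' x y in \<open>simp_all add: ip_vdiff adj\<close>)

lemma formal_adjoint_bound:
  assumes T: "\<And>x. x \<in> car K \<Longrightarrow> T x \<in> car K" and T': "\<And>x. x \<in> car K \<Longrightarrow> T' x \<in> car K"
    and adj: "\<And>x y. x \<in> car K \<Longrightarrow> y \<in> car K \<Longrightarrow> vip K x (T y) = vip K (T' x) y"
    and B: "B \<ge> 0" "\<And>x. x \<in> car K \<Longrightarrow> vnorm K (T x) \<le> B * vnorm K x"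
    and x: "x \<in> car K"
  shows "vnorm K (T' x) \<le> B * vnorm K x"
proof -
  have "(vnorm K (T' x))\<^sup>2 = Re (vip K x (T (T' x)))" using x T' by (simp add: vnorm_sq adj)
  also have "\<dots> \<le> vnorm K x * vnorm K (T (T' x))"
    using cauchy_schwarz[OF x T[OF T'[OF x]]] complex_Re_le_cmod order_trans by blast
  also have "\<dots> \<le> vnorm K x * (B * vnorm K (T' x))"
    using B(2)[OF T'[OF x]] x by (intro mult_left_mono) auto
  finally have "vnorm K (T' x) * vnorm K (T' x) \<le> vnorm K (T' x) * (B * vnorm K x)"
    by (simp add: power2_eq_square mult_ac)
  then show ?thesis
    using T'[OF x] x B(1) by (cases "vnorm K (T' x) = 0") (auto simp: order_less_le)
qed

text \<open>The data from which an operator extends to the completion. The bound is asked of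
  \<open>T\<close> alone, since \<open>T'\<close> inherits it, and linearity follows from the
  adjoint relation.\<close>

definition adjoint_pair :: "('v \<Rightarrow> 'v) \<Rightarrow> ('v \<Rightarrow> 'v) \<Rightarrow> bool" where
  "adjoint_pair T T' \<longleftrightarrow> (\<forall>x\<in>car K. T x \<in> car K \<and> T' x \<in> car K) \<and>
     (\<forall>x\<in>car K. \<forall>y\<in>car K. vip K x (T y) = vip K (T' x) y) \<and>
     (\<exists>B\<ge>0. \<forall>x\<in>car K. vnorm K (T x) \<le> B * vnorm K x)"

lemma adjoint_pairI:
  assumes "\<And>x. x \<in> car K \<Longrightarrow> T x \<in> car K" "\<And>x. x \<in> car K \<Longrightarrow> T' x \<in> car K"
    and "\<And>x y. x \<in> car K \<Longrightarrow> y \<in> car K \<Longrightarrow> vip K x (T y) = vip K (T' x) y"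
    and "B \<ge> 0" "\<And>x. x \<in> car K \<Longrightarrow> vnorm K (T x) \<le> B * vnorm K x"
  shows "adjoint_pair T T'"
  using assms unfolding adjoint_pair_def by blast

lemma adjoint_pairD:
  assumes "adjoint_pair T T'"
  shows "x \<in> car K \<Longrightarrow> T x \<in> car K" "x \<in> car K \<Longrightarrow> T' x \<in> car K"
    "x \<in> car K \<Longrightarrow> y \<in> car K \<Longrightarrow> vip K x (T y) = vip K (T' x) y"
    "x \<in> car K \<Longrightarrow> y \<in> car K \<Longrightarrow> vip K (T x) y = vip K x (T' y)"
    "\<exists>B\<ge>0. \<forall>x\<in>car K. vnorm K (T x) \<le> B * vnorm K x"
proof -
  show *: "x \<in> car K \<Longrightarrow> T x \<in> car K" "x \<in> car K \<Longrightarrow> T' x \<in> car K"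
    "x \<in> car K \<Longrightarrow> y \<in> car K \<Longrightarrow> vip K x (T y) = vip K (T' x) y"
    "\<exists>B\<ge>0. \<forall>x\<in>car K. vnorm K (T x) \<le> B * vnorm K x" for x y
    using assms unfolding adjoint_pair_def by blast+
  show "vip K (T x) y = vip K x (T' y)" if "x \<in> car K" "y \<in> car K"
    using that *(1-2) *(3)[of y x] ip_cnj[of "T x" y] ip_cnj[of x "T' y"] by simp
qed

lemma adjoint_pair_sym:
  assumes "adjoint_pair T T'"
  shows "adjoint_pair T' T"
proof -
  note A = adjoint_pairD[OF assms]
  obtain B where B: "B \<ge> 0" "\<And>x. x \<in> car K \<Longrightarrow> vnorm K (T x) \<le> B * vnorm K x" using A(5) by blast
  show ?thesis
    by (rule adjoint_pairI[OF A(2,1) A(4)[symmetric] B(1) formal_adjoint_bound[OF A(1,2,3) B]])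
qed

lemma adjoint_pair_add:
  assumes "adjoint_pair T T'" "adjoint_pair R R'"
  shows "adjoint_pair (\<lambda>x. vadd K (T x) (R x)) (\<lambda>x. vadd K (T' x) (R' x))"
proof -
  note A = adjoint_pairD[OF assms(1)] and A2 = adjoint_pairD[OF assms(2)]
  obtain B where B: "B \<ge> 0" "\<And>x. x \<in> car K \<Longrightarrow> vnorm K (T x) \<le> B * vnorm K x" using A(5) by blast
  obtain D where D: "D \<ge> 0" "\<And>x. x \<in> car K \<Longrightarrow> vnorm K (R x) \<le> D * vnorm K x" using A2(5) by blast
  show ?thesis
  proof (rule adjoint_pairI[where B = "B + D"])
    show "vnorm K (vadd K (T x) (R x)) \<le> (B + D) * vnorm K x" if "x \<in> car K" for x
      using vnorm_add[OF A(1)[OF that] A2(1)[OF that]] B(2)[OF that] D(2)[OF that]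
      by (simp add: algebra_simps)
  qed (use A A2 B D in \<open>auto simp: ip_simps\<close>)
qed

lemma adjoint_pair_scale:
  assumes "adjoint_pair T T'"
  shows "adjoint_pair (\<lambda>x. vscale K c (T x)) (\<lambda>x. vscale K (cnj c) (T' x))"
proof -
  note A = adjoint_pairD[OF assms(1)]
  obtain B where B: "B \<ge> 0" "\<And>x. x \<in> car K \<Longrightarrow> vnorm K (T x) \<le> B * vnorm K x" using A(5) by blast
  show ?thesis
  proof (rule adjoint_pairI[where B = "cmod c * B"])
    show "vnorm K (vscale K c (T x)) \<le> (cmod c * B) * vnorm K x" if "x \<in> car K" for x
      using A(1)[OF that] B(2)[OF that] by (simp add: vnorm_scale mult.assoc mult_left_mono)
  qed (use A B in \<open>auto simp: ip_simps\<close>)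
qed

text \<open>A Lipschitz map sends equivalent Cauchy sequences to equivalent ones, so the extension
  may be computed on any representative. The adjoint relation is proved before boundedness because
  linearity of the extension is deduced from it.\<close>

lemma extend_op:
  assumes "adjoint_pair T T'"
  shows "extend_op K T \<in> bounded_ops Hc"
    and "x \<in> car K \<Longrightarrow> extend_op K T (emb x) = emb (T x)"
    and "X \<in> car Hc \<Longrightarrow> Y \<in> car Hc \<Longrightarrow> vip Hc X (extend_op K T Y) = vip Hc (extend_op K T' X) Y"
    and "adjoint_op Hc (extend_op K T) = extend_op K T'"
proof -
  interpret Hc: hilbert Hc by (rule Hc_hilbert)
  have *: "\<exists>B\<ge>0. (\<forall>s\<in>cauchy_seqs K. (\<lambda>n. T (s n)) \<in> cauchy_seqs K \<and>
        extend_op K T (limit_class K s) = limit_class K (\<lambda>n. T (s n)) \<and>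
        vnorm Hc (limit_class K (\<lambda>n. T (s n))) \<le> B * vnorm Hc (limit_class K s))"
    if "adjoint_pair T T'" for T T'
  proof -
    note A = adjoint_pairD[OF that]
    obtain B where B: "B \<ge> 0" "\<And>x. x \<in> car K \<Longrightarrow> vnorm K (T x) \<le> B * vnorm K x" using A(5) by blast
    have le: "vdist K (T x) (T y) \<le> B * vdist K x y" if "x \<in> car K" "y \<in> car K" for x y
      using formal_adjoint_vdist[of T T', OF A(1-3) that] B(2)[of "vdiff x y"] that by (simp add: vdist_vdiff)
    have "(\<lambda>n. T (s n)) \<in> cauchy_seqs K \<and> extend_op K T (limit_class K s) = limit_class K (\<lambda>n. T (s n)) \<and>
        vnorm Hc (limit_class K (\<lambda>n. T (s n))) \<le> B * vnorm Hc (limit_class K s)"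
      if s: "s \<in> cauchy_seqs K" for s
    proof (intro conjI)
      show Ts: "(\<lambda>n. T (s n)) \<in> cauchy_seqs K" by (rule cauchy_seqs_image[OF s B(1) A(1) le])
      note rs = rep_limit_class[OF s]
      have "limit_class K (\<lambda>n. T (s n)) = limit_class K (\<lambda>n. T (rep (limit_class K s) n))"
        using null_diff_image[OF s rs(1,2) A(1) le] cauchy_seqs_image[OF rs(1) B(1) A(1) le]
        by (simp add: limit_class_eq_iff Ts)
      then show "extend_op K T (limit_class K s) = limit_class K (\<lambda>n. T (s n))"
        using s by (simp add: extend_op_def)
      have l1: "(\<lambda>n. B * vnorm K (s n)) \<longlonglongrightarrow> B * vnorm Hc (limit_class K s)"
        unfolding vnorm_def by (intro tendsto_intros Hc_vip s)
      have l2: "(\<lambda>n. vnorm K (T (s n))) \<longlonglongrightarrow> vnorm Hc (limit_class K (\<lambda>n. T (s n)))"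
        unfolding vnorm_def by (intro tendsto_intros Hc_vip Ts)
      show "vnorm Hc (limit_class K (\<lambda>n. T (s n))) \<le> B * vnorm Hc (limit_class K s)"
        by (rule LIMSEQ_le[OF l2 l1]) (use B(2) cauchy_seqsD(1)[OF s] in auto)
    qed
    then show ?thesis using B(1) by blast
  qed
  have ext: "extend_op K T \<in> car Hc \<rightarrow>\<^sub>E car Hc"
    if "adjoint_pair T T'" for T T'
    using *[OF that] by (auto simp: extend_op_def[of K T] PiE_def extensional_def elim!: Hc_cases)
  show adj: "vip Hc X (extend_op K T Y) = vip Hc (extend_op K T' X) Y" if X: "X \<in> car Hc" and Y: "Y \<in> car Hc" for X Y
  proof -
    obtain s where s: "s \<in> cauchy_seqs K" "X = limit_class K s" using X by (rule Hc_cases)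
    obtain t where t: "t \<in> cauchy_seqs K" "Y = limit_class K t" using Y by (rule Hc_cases)
    have t': "(\<lambda>n. T (t n)) \<in> cauchy_seqs K" "extend_op K T Y = limit_class K (\<lambda>n. T (t n))"
      using *[OF assms] t by blast+
    have s': "(\<lambda>n. T' (s n)) \<in> cauchy_seqs K" "extend_op K T' X = limit_class K (\<lambda>n. T' (s n))"
      using *[OF adjoint_pair_sym[OF assms]] s by blast+
    have "(\<lambda>n. vip K (s n) (T (t n))) = (\<lambda>n. vip K (T' (s n)) (t n))"
      using adjoint_pairD(3)[OF assms] cauchy_seqsD(1) s t by blast
    then show ?thesis
      using LIMSEQ_unique Hc_vip[OF s(1) t'(1)] Hc_vip[OF s'(1) t(1)] s t s' t' by metis
  qed
  have bop: "extend_op K T \<in> bounded_ops Hc"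
    if TT: "adjoint_pair T T'"
      and adj: "\<And>X Y. X \<in> car Hc \<Longrightarrow> Y \<in> car Hc \<Longrightarrow> vip Hc X (extend_op K T Y) = vip Hc (extend_op K T' X) Y"
    for T T'
  proof -
    obtain B where B: "\<And>s. s \<in> cauchy_seqs K \<Longrightarrow> (\<lambda>n. T (s n)) \<in> cauchy_seqs K \<and>
        extend_op K T (limit_class K s) = limit_class K (\<lambda>n. T (s n)) \<and>
        vnorm Hc (limit_class K (\<lambda>n. T (s n))) \<le> B * vnorm Hc (limit_class K s)"
      using *[OF TT] by blast
    show ?thesis
    proof (rule Hc.bounded_opsI[OF ext[OF TT] _ adj, where B = B])
      show "extend_op K T' X \<in> car Hc" if "X \<in> car Hc" for X
        using ext[OF adjoint_pair_sym[OF TT]] that by auto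
      show "vnorm Hc (extend_op K T X) \<le> B * vnorm Hc X" if "X \<in> car Hc" for X
        using that B by (auto elim!: Hc_cases)
    qed
  qed
  show b: "extend_op K T \<in> bounded_ops Hc" by (rule bop[OF assms adj])
  have adj': "vip Hc X (extend_op K T' Y) = vip Hc (extend_op K T X) Y" if "X \<in> car Hc" "Y \<in> car Hc" for X Y
    using adj[OF that(2,1)] that ext[OF assms] ext[OF adjoint_pair_sym[OF assms]] Hc.ip_cnj
    by (metis PiE_mem)
  have b': "extend_op K T' \<in> bounded_ops Hc" by (rule bop[OF adjoint_pair_sym[OF assms] adj'])
  show "adjoint_op Hc (extend_op K T) = extend_op K T'"
    by (rule Hc.adjoint_unique[OF b b']) (simp add: adj')
  show "extend_op K T (emb x) = emb (T x)" if "x \<in> car K"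
    using *[OF assms] cauchy_seqs_const[OF that] unfolding emb_def by auto
qed

end

section \<open>Positive semidefinite matrices\<close>

definition qform :: "'i set \<Rightarrow> ('i \<Rightarrow> 'i \<Rightarrow> complex) \<Rightarrow> ('i \<Rightarrow> complex) \<Rightarrow> complex" where
  "qform J M c = (\<Sum>i\<in>J. \<Sum>j\<in>J. cnj (c i) * M i j * c j)"

definition psd :: "'i set \<Rightarrow> ('i \<Rightarrow> 'i \<Rightarrow> complex) \<Rightarrow> bool" where
  "psd J M \<longleftrightarrow> (\<forall>i\<in>J. \<forall>j\<in>J. M j i = cnj (M i j)) \<and> (\<forall>c. 0 \<le> Re (qform J M c))"

lemma psdD: "psd J M \<Longrightarrow> i \<in> J \<Longrightarrow> j \<in> J \<Longrightarrow> M j i = cnj (M i j)" "psd J M \<Longrightarrow> 0 \<le> Re (qform J M c)"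
  unfolding psd_def by blast+

lemma qform_cong: "(\<And>i j. i \<in> J \<Longrightarrow> j \<in> J \<Longrightarrow> M i j = N i j) \<Longrightarrow> (\<And>i. i \<in> J \<Longrightarrow> c i = d i) \<Longrightarrow>
    qform J M c = qform J N d"
  by (simp add: qform_def cong: sum.cong)

lemma psd_cong: "(\<And>i j. i \<in> J \<Longrightarrow> j \<in> J \<Longrightarrow> M i j = N i j) \<Longrightarrow> psd J M = psd J N"
  unfolding psd_def using qform_cong[of J M N] by metis

lemma qform_insert:
  assumes "finite J" "k \<notin> J"
  shows "qform (insert k J) M c = cnj (c k) * M k k * c k + cnj (c k) * (\<Sum>j\<in>J. M k j * c j) +
    (\<Sum>i\<in>J. cnj (c i) * M i k) * c k + qform J M c"
  using assms
  by (simp add: qform_def sum.distrib sum_distrib_left sum_distrib_right mult.assoc)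

lemma qform_add: "qform J (\<lambda>i j. M i j + N i j) c = qform J M c + qform J N c"
  by (simp add: qform_def algebra_simps sum.distrib)

lemma psd_sum:
  assumes "finite F" "\<And>p. p \<in> F \<Longrightarrow> psd J (M p)"
  shows "psd J (\<lambda>i j. \<Sum>p\<in>F. M p i j)"
  using assms
proof (induction F)
  case empty
  then show ?case by (simp add: psd_def qform_def)
next
  case (insert p F)
  have p: "psd J (M p)" and F: "psd J (\<lambda>i j. \<Sum>p\<in>F. M p i j)" using insert by auto
  show ?case
    unfolding psd_def sum.insert[OF insert.hyps]
  proof (intro conjI ballI allI)
    show "M p j i + (\<Sum>p\<in>F. M p j i) = cnj (M p i j + (\<Sum>p\<in>F. M p i j))" if "i \<in> J" "j \<in> J" for i j
      using psdD(1)[OF p that] psdD(1)[OF F that] by simp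
  qed (use psdD(2)[OF p] psdD(2)[OF F] in \<open>simp add: qform_add\<close>)
qed

lemma psd_subset:
  assumes "psd J M" "L \<subseteq> J" "finite J"
  shows "psd L M"
  unfolding psd_def
proof (intro conjI ballI allI)
  fix c
  have "qform L M c = qform J M (\<lambda>i. if i \<in> L then c i else 0)"
    unfolding qform_def using assms(2,3)
    by (intro sum.mono_neutral_cong_left ballI sum.neutral) (auto intro!: sum.mono_neutral_cong_left)
  then show "0 \<le> Re (qform L M c)" using psdD(2)[OF assms(1)] by simp
qed (rule psdD(1)[OF assms(1)]; use assms(2) in blast)

text \<open>Symmetric elimination, one index at a time. A nonzero diagonal entry at \<open>k\<close>
  is split off as a rank one matrix, and what remains, the Schur complement, is again positive
  semidefinite; a zero diagonal entry has a zero row.\<close>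

lemma psd_gram:
  assumes "finite J" "psd J M"
  shows "\<exists>v. \<forall>i\<in>J. \<forall>j\<in>J. M i j = (\<Sum>k\<in>J. cnj (v k i) * v k j)"
  using assms
proof (induction J arbitrary: M)
  case empty
  then show ?case by simp
next
  case (insert k J)
  note herm = psdD(1)[OF insert.prems]
  have sub: "psd J M" by (rule psd_subset[OF insert.prems]) (use insert in auto)
  have kk: "M k k = complex_of_real (Re (M k k))"
    using arg_cong[OF herm[of k k], of Im] by (simp add: complex_eq_iff)
  have "qform (insert k J) M (\<lambda>i. if i = k then 1 else 0) = M k k"
    using insert.hyps qform_insert[OF insert.hyps, of M "\<lambda>i. if i = k then 1 else 0"]
      sum.neutral[of J "\<lambda>j. M k j * (if j = k then 1 else 0)"]
      sum.neutral[of J "\<lambda>i. cnj (if i = k then 1 else 0) * M i k"]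
      sum.neutral[of J "\<lambda>i. \<Sum>j\<in>J. cnj (if i = k then 1 else 0) * M i j * (if j = k then 1 else 0)"]
    by (auto simp: qform_def)
  then have kk_nonneg: "0 \<le> Re (M k k)" using psdD(2)[OF insert.prems] by metis
  show ?case
  proof (cases "M k k = 0")
    case True
    have z: "M k j = 0" if j: "j \<in> J" for j
    proof (rule ccontr)
      assume ne: "M k j \<noteq> 0"
      \<comment> \<open>Chosen so that the form at \<open>c\<close> has real part
        \<open>- Re (M j j) - 2\<close>, although \<open>Re (M j j)\<close> is itself
        nonnegative.\<close>
      define t where "t = - (Re (M j j) + 1) / (cmod (M k j))\<^sup>2"
      define c where "c = (\<lambda>i. if i = k then complex_of_real t * M k j else if i = j then 1 else 0)"
      have jk: "j \<noteq> k" using j insert.hyps by auto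
      have 1: "(\<Sum>i\<in>J. M k i * c i) = M k j"
        using j jk insert.hyps by (subst sum.remove[of _ j]) (auto simp: c_def intro!: sum.neutral split: if_splits)
      have 2: "(\<Sum>i\<in>J. cnj (c i) * M i k) = cnj (M k j)"
        using j jk insert.hyps herm[of k j]
        by (subst sum.remove[of _ j]) (auto simp: c_def intro!: sum.neutral split: if_splits)
      have 3: "qform J M c = M j j"
      proof -
        have "qform J M c = (\<Sum>i\<in>J. if i = j then M j j else 0)"
          unfolding qform_def
        proof (rule sum.cong[OF refl])
          fix i assume i: "i \<in> J"
          have "(\<Sum>l\<in>J. cnj (c i) * M i l * c l) = cnj (c i) * M i j * c j + (\<Sum>l\<in>J - {j}. cnj (c i) * M i l * c l)"
            using j insert.hyps by (simp add: sum.remove)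
          also have "(\<Sum>l\<in>J - {j}. cnj (c i) * M i l * c l) = 0"
            using insert.hyps by (auto simp: c_def intro!: sum.neutral split: if_splits)
          finally show "(\<Sum>l\<in>J. cnj (c i) * M i l * c l) = (if i = j then M j j else 0)"
            using i insert.hyps jk by (auto simp: c_def)
        qed
        then show ?thesis using j insert.hyps by simp
      qed
      have "qform (insert k J) M c = cnj (complex_of_real t * M k j) * M k j + cnj (M k j) * (complex_of_real t * M k j) + M j j"
        using qform_insert[OF insert.hyps, of M c] by (simp add: 1 2 3 True) (simp add: c_def)
      also have "Re \<dots> = 2 * t * (cmod (M k j))\<^sup>2 + Re (M j j)"
        by (simp add: cmod_power2 algebra_simps) (simp add: power2_eq_square)
      also have "\<dots> = - Re (M j j) - 2" using ne by (simp add: t_def)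
      finally have "0 \<le> - Re (M j j) - 2" using psdD(2)[OF insert.prems] by metis
      moreover have "0 \<le> Re (M j j)"
      proof -
        have "qform J M (\<lambda>i. if i = j then 1 else 0) = (\<Sum>i\<in>J. if i = j then M j j else 0)"
          unfolding qform_def
          by (intro sum.cong refl) (use j insert.hyps in \<open>auto simp: sum.remove[of J j] intro!: sum.neutral\<close>)
        then show ?thesis using psdD(2)[OF sub, of "\<lambda>i. if i = j then 1 else 0"] j insert.hyps by simp
      qed
      ultimately show False by simp
    qed
    obtain v where v: "\<And>i j. i \<in> J \<Longrightarrow> j \<in> J \<Longrightarrow> M i j = (\<Sum>l\<in>J. cnj (v l i) * v l j)"
      using insert.IH[OF sub] by blast
    define v' where "v' l i = (if l = k \<or> i = k then 0 else v l i)" for l i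
    have "M i j = (\<Sum>l\<in>insert k J. cnj (v' l i) * v' l j)" if "i \<in> insert k J" "j \<in> insert k J" for i j
    proof (cases "i = k \<or> j = k")
      case T: True
      then have "M i j = 0" using that z True herm[of k i] by auto
      then show ?thesis using T by (auto simp: v'_def)
    next
      case False
      then have "(\<Sum>l\<in>insert k J. cnj (v' l i) * v' l j) = (\<Sum>l\<in>J. cnj (v l i) * v l j)"
        using insert.hyps by (auto simp: v'_def intro!: sum.cong)
      then show ?thesis using False that v by simp
    qed
    then show ?thesis by blast
  next
    case False
    define m where "m = Re (M k k)"
    have m: "m > 0" "M k k = complex_of_real m" using False kk kk_nonneg by (auto simp: m_def order_less_le)
    define M' where "M' i j = M i j - M i k * M k j / complex_of_real m" for i j
    have "psd J M'"
      unfolding psd_def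
    proof (intro conjI ballI allI)
      show "M' j i = cnj (M' i j)" if "i \<in> J" "j \<in> J" for i j
        using that herm[of i j] herm[of k i] herm[of k j] by (simp add: M'_def)
      fix c
      \<comment> \<open>The new coordinate at \<open>k\<close> minimizes the form, which makes its
        value on \<open>insert k J\<close> equal to that of the Schur complement on
        \<open>J\<close>.\<close>
      define c' where "c' i = (if i = k then - (\<Sum>j\<in>J. M k j * c j) / complex_of_real m else c i)" for i
      define s where "s = (\<Sum>j\<in>J. M k j * c j)"
      have cc: "(\<Sum>i\<in>J. f i (c' i)) = (\<Sum>i\<in>J. f i (c i))" for f :: "_ \<Rightarrow> _ \<Rightarrow> complex"
        using insert.hyps by (intro sum.cong) (auto simp: c'_def)
      have ck: "c' k = - s / complex_of_real m" by (simp add: c'_def s_def)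
      have "qform J M c' = qform J M c" using insert.hyps by (intro qform_cong) (auto simp: c'_def)
      moreover have "(\<Sum>i\<in>J. cnj (c i) * M i k) = cnj s"
        using herm[of k] by (auto simp: s_def cnj_sum mult.commute intro!: sum.cong)
      ultimately have "qform (insert k J) M c' = qform J M c - cnj s * s / complex_of_real m"
        unfolding qform_insert[OF insert.hyps] cc[of "\<lambda>i z. M k i * z"] cc[of "\<lambda>i z. cnj z * M i k"]
          s_def[symmetric] ck
        using m(1) by (simp add: m(2) divide_simps)
      also have "\<dots> = qform J M' c"
      proof -
        have "cnj s * s / complex_of_real m = (\<Sum>i\<in>J. \<Sum>j\<in>J. cnj (c i) * (M i k * M k j / complex_of_real m) * c j)"
          unfolding \<open>(\<Sum>i\<in>J. cnj (c i) * M i k) = cnj s\<close>[symmetric] unfolding s_def sum_product sum_divide_distrib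
          by (intro sum.cong refl) simp
        then show ?thesis by (simp add: qform_def M'_def algebra_simps sum_subtractf)
      qed
      finally show "0 \<le> Re (qform J M' c)" using psdD(2)[OF insert.prems, of c'] by simp
    qed
    then obtain v where v: "\<And>i j. i \<in> J \<Longrightarrow> j \<in> J \<Longrightarrow> M' i j = (\<Sum>l\<in>J. cnj (v l i) * v l j)"
      using insert.IH by blast
    \<comment> \<open>Row \<open>k\<close> carries the rank one part; the other rows vanish at
      \<open>k\<close>, so that they rebuild only the Schur complement.\<close>
    define v' where "v' l i = (if l = k then M k i / complex_of_real (sqrt m) else if i = k then 0 else v l i)" for l i
    have "M i j = (\<Sum>l\<in>insert k J. cnj (v' l i) * v' l j)" if ij: "i \<in> insert k J" "j \<in> insert k J" for i j
    proof -
      have sq: "complex_of_real (sqrt m) * complex_of_real (sqrt m) = complex_of_real m"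
        using m(1) by (simp flip: of_real_mult)
      have "(\<Sum>l\<in>insert k J. cnj (v' l i) * v' l j) = M i k * M k j / complex_of_real m + (\<Sum>l\<in>J. cnj (v' l i) * v' l j)"
        using insert.hyps ij herm[of k i] by (simp add: v'_def sq)
      moreover have "(\<Sum>l\<in>J. cnj (v' l i) * v' l j) = (if i = k \<or> j = k then 0 else M' i j)"
      proof (cases "i = k \<or> j = k")
        case True
        then show ?thesis using insert.hyps by (auto simp: v'_def intro!: sum.neutral)
      next
        case F: False
        then have "(\<Sum>l\<in>J. cnj (v' l i) * v' l j) = (\<Sum>l\<in>J. cnj (v l i) * v l j)"
          using insert.hyps by (intro sum.cong) (auto simp: v'_def)
        then show ?thesis using F ij v by simp
      qed
      ultimately show ?thesis using m by (auto simp: M'_def)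
    qed
    then show ?thesis by blast
  qed
qed

text \<open>With \<open>M\<close> written as a Gram matrix, the form of the entrywise product
  becomes a sum of forms of \<open>N\<close> at rescaled vectors. Such products arise because each
  further letter multiplies the inner products of words entry by entry.\<close>

lemma schur_product:
  assumes J: "finite J" and M: "psd J M" and N: "psd J N"
  shows "psd J (\<lambda>i j. M i j * N i j)"
  unfolding psd_def
proof (intro conjI ballI allI)
  show "M j i * N j i = cnj (M i j * N i j)" if "i \<in> J" "j \<in> J" for i j
    using psdD(1)[OF M that] psdD(1)[OF N that] by simp
  fix c
  obtain v where v: "\<And>i j. i \<in> J \<Longrightarrow> j \<in> J \<Longrightarrow> M i j = (\<Sum>k\<in>J. cnj (v k i) * v k j)"
    using psd_gram[OF J M] by blast
  have "qform J (\<lambda>i j. M i j * N i j) c = (\<Sum>i\<in>J. \<Sum>j\<in>J. \<Sum>k\<in>J. cnj (v k i * c i) * N i j * (v k j * c j))"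
    unfolding qform_def by (simp add: v sum_distrib_left sum_distrib_right algebra_simps cong: sum.cong)
  also have "\<dots> = (\<Sum>i\<in>J. \<Sum>k\<in>J. \<Sum>j\<in>J. cnj (v k i * c i) * N i j * (v k j * c j))"
    by (intro sum.cong refl sum.swap)
  also have "\<dots> = (\<Sum>k\<in>J. qform J N (\<lambda>i. v k i * c i))"
    unfolding qform_def
    by (rule sum.swap)
  finally show "0 \<le> Re (qform J (\<lambda>i j. M i j * N i j) c)"
    using psdD(2)[OF N] by (simp add: Re_sum sum_nonneg)
qed

section \<open>Consequences of the axioms\<close>

locale fock_category = fock C cj \<eta> \<epsilon> S lam + cstar_tensor_category C
  for C :: "('o, 'm) tensor_cat" (structure) and cj :: "'o \<Rightarrow> 'o" and \<eta> \<epsilon> :: "'o \<Rightarrow> 'm"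
    and S :: "'o set" and lam :: "'o \<Rightarrow> real" +
  assumes conj: "standard_conjugates cj \<eta> \<epsilon>"
    and reps: "simple_representatives S"
    and unt_S: "unt C \<in> S"
    and lam_pos: "\<alpha> \<in> S \<Longrightarrow> lam \<alpha> > 0"
begin

lemma S_simple: "\<beta> \<in> S \<Longrightarrow> simple \<beta>"
  using reps by (simp add: simple_representatives_def)

lemma S_obj [simp]: "\<beta> \<in> S \<Longrightarrow> \<beta> \<in> obj C"
  using S_simple by (simp add: simple_def)

lemma cj_obj: "X \<in> obj C \<Longrightarrow> cj X \<in> obj C"
  using conj by (simp add: standard_conjugates_def)

lemma label_obj_in [simp]: "\<alpha> \<in> \<Lambda> \<Longrightarrow> label_obj \<alpha> \<in> obj C"
  by (auto simp: \<Lambda>_def cj_obj)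

lemma bar_label_in [simp]: "bar_label \<alpha> \<in> \<Lambda> \<longleftrightarrow> \<alpha> \<in> \<Lambda>"
  by (cases \<alpha>) (auto simp: \<Lambda>_def)

lemma bar_label_bar [simp]: "bar_label (bar_label \<alpha>) = \<alpha>"
  by (cases \<alpha>) auto

lemma triples_iff [simp]: "(\<beta>\<^sub>2, \<alpha>, \<beta>\<^sub>1) \<in> triples \<longleftrightarrow> \<beta>\<^sub>2 \<in> S \<and> \<alpha> \<in> \<Lambda> \<and> \<beta>\<^sub>1 \<in> S"
  by (auto simp: triples_def)

declare unt_obj [simp] ten_obj [simp] unt_S [simp] idt_in [simp] zer_in [simp]

section \<open>Linear algebra in the morphism spaces\<close>

lemma scl_zero [simp]: "f \<in> hom C X Y \<Longrightarrow> X \<in> obj C \<Longrightarrow> Y \<in> obj C \<Longrightarrow> 0 \<odot> f = zer C X Y"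
  using scl_pls_left[of X Y f 1 "-1"] scl_one[of X Y f] pls_neg[of X Y f] by simp

lemma scl_zer [simp]: "X \<in> obj C \<Longrightarrow> Y \<in> obj C \<Longrightarrow> c \<odot> zer C X Y = zer C X Y"
  using scl_mult[of X Y "zer C X Y" c 0] scl_zero[of "zer C X Y" X Y] by simp

lemma cmp_zer_left [simp]: "f \<in> hom C X Y \<Longrightarrow> X \<in> obj C \<Longrightarrow> Y \<in> obj C \<Longrightarrow> Z \<in> obj C \<Longrightarrow>
    zer C Y Z \<cdot> f = zer C X Z"
  using cmp_scl[of X Y Z f "zer C Y Z" 0] scl_zero[OF cmp_in[of X Y Z f "zer C Y Z"]] by simp

lemma cmp_zer_right [simp]: "g \<in> hom C Y Z \<Longrightarrow> X \<in> obj C \<Longrightarrow> Y \<in> obj C \<Longrightarrow> Z \<in> obj C \<Longrightarrow>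
    g \<cdot> zer C X Y = zer C X Z"
  using cmp_scl[of X Y Z "zer C X Y" g 0] scl_zero[OF cmp_in[of X Y Z "zer C X Y" g]] by simp

lemma adj_zer [simp]: "X \<in> obj C \<Longrightarrow> Y \<in> obj C \<Longrightarrow> (zer C X Y)\<^sup>\<dagger> = zer C Y X"
  using adj_scl[of X Y "zer C X Y" 0] scl_zero[OF adj_in[of X Y "zer C X Y"]] by simp

lemma adj_idt [simp]: "X \<in> obj C \<Longrightarrow> (I X)\<^sup>\<dagger> = I X"
  using cmp_idt[of X X "(I X)\<^sup>\<dagger>"] adj_cmp[of X X X "I X" "(I X)\<^sup>\<dagger>"] adj_in[of X X "I X"] adj_adj[of X X "I X"]
  by simp

section \<open>Scalars of simple objects, and inner products on their morphism spaces\<close>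

lemma nrm_idt_pos: "\<beta> \<in> S \<Longrightarrow> nrm C (I \<beta>) > 0"
proof -
  assume \<beta>: "\<beta> \<in> S"
  have "I \<beta> \<noteq> zer C \<beta> \<beta>" using S_simple[OF \<beta>] by (simp add: simple_def)
  then show ?thesis using nrm_eq_0[of \<beta> \<beta> "I \<beta>"] \<beta> by (simp add: order_less_le)
qed

text \<open>\<open>coef\<close> is a definite description. The scalar is unique because
  \<open>I \<beta>\<close> has positive norm, so that \<open>c - d\<close> times it vanishes only
  for \<open>c = d\<close>.\<close>

lemma coef_scl_idt [simp]:
  assumes "\<beta> \<in> S"
  shows "coef \<beta> (c \<odot> I \<beta>) = c"
  unfolding coef_def
proof (rule the_equality)
  fix d assume e: "c \<odot> I \<beta> = d \<odot> I \<beta>"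
  have "(c + - d) \<odot> I \<beta> = (d + - d) \<odot> I \<beta>"
    using assms scl_pls_left[of \<beta> \<beta> "I \<beta>" _ "- d"] e by (metis S_obj idt_in)
  then have "(c - d) \<odot> I \<beta> = zer C \<beta> \<beta>" using scl_zero[OF idt_in[of \<beta>]] assms by simp
  then have "cmod (c - d) * nrm C (I \<beta>) = 0"
    using assms nrm_scl[of \<beta> \<beta> "I \<beta>" "c - d"] nrm_eq_0[of \<beta> \<beta> "zer C \<beta> \<beta>"] by simp
  then show "d = c" using nrm_idt_pos[OF assms] by simp
qed (rule refl)

lemma coef_eq: "\<beta> \<in> S \<Longrightarrow> f \<in> hom C \<beta> \<beta> \<Longrightarrow> f = coef \<beta> f \<odot> I \<beta>"
  using S_simple[of \<beta>] by (auto simp: simple_def)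

lemma coef_idt [simp]: "\<beta> \<in> S \<Longrightarrow> coef \<beta> (I \<beta>) = 1"
  using coef_scl_idt[of \<beta> 1] scl_one[of \<beta> \<beta> "I \<beta>"] by simp

lemma coef_pls: "\<beta> \<in> S \<Longrightarrow> f \<in> hom C \<beta> \<beta> \<Longrightarrow> g \<in> hom C \<beta> \<beta> \<Longrightarrow> coef \<beta> (f \<oplus> g) = coef \<beta> f + coef \<beta> g"
  using coef_eq[of \<beta> f] coef_eq[of \<beta> g] scl_pls_left[of \<beta> \<beta> "I \<beta>" "coef \<beta> f" "coef \<beta> g"]
    coef_scl_idt[of \<beta> "coef \<beta> f + coef \<beta> g"] by simp

lemma coef_scl: "\<beta> \<in> S \<Longrightarrow> f \<in> hom C \<beta> \<beta> \<Longrightarrow> coef \<beta> (c \<odot> f) = c * coef \<beta> f"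
  using coef_eq[of \<beta> f] scl_mult[of \<beta> \<beta> "I \<beta>" c "coef \<beta> f"]
    coef_scl_idt[of \<beta> "c * coef \<beta> f"] by simp

lemma coef_adj: "\<beta> \<in> S \<Longrightarrow> f \<in> hom C \<beta> \<beta> \<Longrightarrow> coef \<beta> (f\<^sup>\<dagger>) = cnj (coef \<beta> f)"
  using coef_eq[of \<beta> f] adj_scl[of \<beta> \<beta> "I \<beta>" "coef \<beta> f"]
    coef_scl_idt[of \<beta> "cnj (coef \<beta> f)"] by simp

lemma coef_zer [simp]: "\<beta> \<in> S \<Longrightarrow> coef \<beta> (zer C \<beta> \<beta>) = 0"
  using coef_scl_idt[of \<beta> 0] scl_zero[OF idt_in[of \<beta>]] by simp

text \<open>The composite is an endomorphism of a simple object, hence a scalar. This is the natural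
  inner product on the morphisms out of \<open>\<beta>\<close>, and each component of
  \<open>hip\<close> is one of its values.\<close>

definition ipm :: "'o \<Rightarrow> 'm \<Rightarrow> 'm \<Rightarrow> complex" where
  "ipm \<beta> x y = coef \<beta> (x\<^sup>\<dagger> \<cdot> y)"

context
  fixes \<beta> Y assumes \<beta>: "\<beta> \<in> S" and Y: "Y \<in> obj C"
begin

lemma ipm_pls: "x \<in> hom C \<beta> Y \<Longrightarrow> y \<in> hom C \<beta> Y \<Longrightarrow> z \<in> hom C \<beta> Y \<Longrightarrow>
    ipm \<beta> x (y \<oplus> z) = ipm \<beta> x y + ipm \<beta> x z"
  using \<beta> Y adj_in[of \<beta> Y x] cmp_pls_right[of \<beta> Y \<beta> y z "x\<^sup>\<dagger>"]
    cmp_in[of \<beta> Y \<beta> y "x\<^sup>\<dagger>"] cmp_in[of \<beta> Y \<beta> z "x\<^sup>\<dagger>"] by (simp add: ipm_def coef_pls)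

lemma ipm_scl: "x \<in> hom C \<beta> Y \<Longrightarrow> y \<in> hom C \<beta> Y \<Longrightarrow> ipm \<beta> x (c \<odot> y) = c * ipm \<beta> x y"
  using \<beta> Y adj_in[of \<beta> Y x] cmp_scl[of \<beta> Y \<beta> y "x\<^sup>\<dagger>" c] cmp_in[of \<beta> Y \<beta> y "x\<^sup>\<dagger>"]
  by (simp add: ipm_def coef_scl)

lemma ipm_cnj: "x \<in> hom C \<beta> Y \<Longrightarrow> y \<in> hom C \<beta> Y \<Longrightarrow> ipm \<beta> y x = cnj (ipm \<beta> x y)"
  using \<beta> Y adj_in[of \<beta> Y x] cmp_in[of \<beta> Y \<beta> y "x\<^sup>\<dagger>"] coef_adj[of \<beta> "x\<^sup>\<dagger> \<cdot> y"]
    adj_cmp[of \<beta> Y \<beta> y "x\<^sup>\<dagger>"] adj_adj[of \<beta> Y x]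
  by (simp add: ipm_def)

lemma ipm_zer [simp]: "x \<in> hom C \<beta> Y \<Longrightarrow> ipm \<beta> x (zer C \<beta> Y) = 0"
  using \<beta> Y cmp_zer_right[OF adj_in[of \<beta> Y x], of \<beta>] by (simp add: ipm_def)

lemma ipm_zer_left [simp]: "x \<in> hom C \<beta> Y \<Longrightarrow> ipm \<beta> (zer C \<beta> Y) x = 0"
  using \<beta> Y cmp_zer_left[of x \<beta> Y \<beta>] by (simp add: ipm_def)

lemma ipm_scl_left: "x \<in> hom C \<beta> Y \<Longrightarrow> y \<in> hom C \<beta> Y \<Longrightarrow> ipm \<beta> (c \<odot> x) y = cnj c * ipm \<beta> x y"
  using \<beta> Y ipm_cnj[of y "c \<odot> x"] ipm_cnj[of y x] ipm_scl[of y x c] scl_in[of \<beta> Y x c] by simp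

text \<open>\<open>adj_cmp_positive\<close> replaces \<open>x\<close> by an endomorphism
  \<open>g\<close> of the simple object, that is by a scalar \<open>c\<close>, so the value is
  \<open>(cmod c)^2\<close>. It is nonzero for nonzero \<open>x\<close> by the C*-identity.\<close>

lemma ipm_self:
  assumes x: "x \<in> hom C \<beta> Y"
  shows "ipm \<beta> x x = complex_of_real (Re (ipm \<beta> x x))" "0 \<le> Re (ipm \<beta> x x)"
    "x \<noteq> zer C \<beta> Y \<Longrightarrow> 0 < Re (ipm \<beta> x x)"
proof -
  obtain g where g: "g \<in> hom C \<beta> \<beta>" "x\<^sup>\<dagger> \<cdot> x = g\<^sup>\<dagger> \<cdot> g"
    using adj_cmp_positive[of \<beta> Y x] \<beta> Y x by auto
  define c where "c = coef \<beta> g"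
  have gc: "g = c \<odot> I \<beta>" using coef_eq[OF \<beta> g(1)] by (simp add: c_def)
  have gg: "g\<^sup>\<dagger> \<cdot> g = (cnj c * c) \<odot> I \<beta>"
    unfolding gc using \<beta> adj_scl[of \<beta> \<beta> "I \<beta>" c] cmp_scl[of \<beta> \<beta> \<beta> "c \<odot> I \<beta>" "I \<beta>" "cnj c"]
      scl_in[of \<beta> \<beta> "I \<beta>" c] cmp_idt[of \<beta> \<beta> "c \<odot> I \<beta>"] scl_mult[of \<beta> \<beta> "I \<beta>" "cnj c" c] by simp
  then have e: "ipm \<beta> x x = cnj c * c" using \<beta> g by (simp add: ipm_def)
  then have e': "ipm \<beta> x x = complex_of_real ((cmod c)\<^sup>2)"
    by (simp only: complex_norm_square mult.commute)
  then show "ipm \<beta> x x = complex_of_real (Re (ipm \<beta> x x))" "0 \<le> Re (ipm \<beta> x x)" by auto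
  assume "x \<noteq> zer C \<beta> Y"
  then have "nrm C (x\<^sup>\<dagger> \<cdot> x) \<noteq> 0"
    using cstar_identity[of \<beta> Y x] nrm_eq_0[of \<beta> Y x] \<beta> Y x by simp
  then have "x\<^sup>\<dagger> \<cdot> x \<noteq> zer C \<beta> \<beta>" using nrm_eq_0[of \<beta> \<beta> "zer C \<beta> \<beta>"] \<beta> by auto
  then have "c \<noteq> 0" using g(2) gg \<beta> scl_zero[OF idt_in[of \<beta>]] by auto
  then show "0 < Re (ipm \<beta> x x)" using e' by simp
qed

lemma psd_ipm:
  assumes J: "finite J" and x: "\<And>i. i \<in> J \<Longrightarrow> x i \<in> hom C \<beta> Y"
  shows "psd J (\<lambda>i j. ipm \<beta> (x i) (x j))"
  unfolding psd_def
proof (intro conjI ballI allI)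
  show "ipm \<beta> (x j) (x i) = cnj (ipm \<beta> (x i) (x j))" if "i \<in> J" "j \<in> J" for i j
    by (rule ipm_cnj) (use x that in auto)
  fix c
  \<comment> \<open>\<open>X\<close> is the combination of the \<open>x j\<close> with coefficients
    \<open>c j\<close>, characterized by its inner products. The form at \<open>c\<close> then
    becomes the square norm of \<open>X\<close>.\<close>
  have "\<exists>X\<in>hom C \<beta> Y. \<forall>y\<in>hom C \<beta> Y. ipm \<beta> y X = (\<Sum>j\<in>J. ipm \<beta> y (x j) * c j)"
    using J x
  proof (induction J)
    case empty
    show ?case using \<beta> Y by (intro bexI[of _ "zer C \<beta> Y"]) auto
  next
    case (insert j J)
    then obtain X where X: "X \<in> hom C \<beta> Y" "\<forall>y\<in>hom C \<beta> Y. ipm \<beta> y X = (\<Sum>j\<in>J. ipm \<beta> y (x j) * c j)"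
      by auto
    have xj: "x j \<in> hom C \<beta> Y" "c j \<odot> x j \<in> hom C \<beta> Y" using insert.prems \<beta> Y scl_in by auto
    show ?case
      using X xj insert.hyps \<beta> Y pls_in[of \<beta> Y "c j \<odot> x j" X]
      by (intro bexI[of _ "(c j \<odot> x j) \<oplus> X"]) (auto simp: ipm_pls ipm_scl)
  qed
  then obtain X where X: "X \<in> hom C \<beta> Y" "\<And>y. y \<in> hom C \<beta> Y \<Longrightarrow> ipm \<beta> y X = (\<Sum>j\<in>J. ipm \<beta> y (x j) * c j)"
    by blast
  have "qform J (\<lambda>i j. ipm \<beta> (x i) (x j)) c = (\<Sum>i\<in>J. cnj (c i) * ipm \<beta> (x i) X)"
    using x by (simp add: qform_def X(2) sum_distrib_left mult.assoc cong: sum.cong)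
  also have "\<dots> = (\<Sum>i\<in>J. cnj (ipm \<beta> X (x i) * c i))"
  proof (rule sum.cong[OF refl])
    fix i assume i: "i \<in> J"
    show "cnj (c i) * ipm \<beta> (x i) X = cnj (ipm \<beta> X (x i) * c i)"
      using ipm_cnj[OF X(1) x[OF i]] by simp
  qed
  also have "\<dots> = cnj (ipm \<beta> X X)" using X by (simp add: cnj_sum)
  finally show "0 \<le> Re (qform J (\<lambda>i j. ipm \<beta> (x i) (x j)) c)" using ipm_self(2)[OF X(1)] by simp
qed

end

section \<open>Conjugation of morphisms and positivity of dimensions\<close>

lemma r_in: "\<alpha> \<in> \<Lambda> \<Longrightarrow> r \<alpha> \<in> hom C (unt C) (label_obj (bar_label \<alpha>) \<box> label_obj \<alpha>)"
  using conj
  by (auto simp: \<Lambda>_def standard_conjugates_def standard_solution_def conjugate_solution_def)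

lemma conjugate_equation:
  assumes "\<alpha> \<in> \<Lambda>"
  shows "((r (bar_label \<alpha>))\<^sup>\<dagger> \<otimes> I (label_obj \<alpha>)) \<cdot> (I (label_obj \<alpha>) \<otimes> r \<alpha>) = I (label_obj \<alpha>)"
proof (cases \<alpha>)
  case (Plain a)
  then have "a \<in> S" using assms by (auto simp: \<Lambda>_def)
  then show ?thesis using conj Plain
    by (auto simp: standard_conjugates_def standard_solution_def conjugate_solution_def)
next
  case (Bar a)
  then have a: "a \<in> S" using assms by (auto simp: \<Lambda>_def)
  then have o: "a \<in> obj C" "cj a \<in> obj C" using cj_obj by auto
  have e: "\<epsilon> a \<in> hom C (a \<box> cj a) (unt C)" "\<eta> a \<in> hom C (unt C) (cj a \<box> a)"
    and eq: "(I (cj a) \<otimes> ((\<epsilon> a)\<^sup>\<dagger>)\<^sup>\<dagger>) \<cdot> (\<eta> a \<otimes> I (cj a)) = I (cj a)"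
    using conj o by (auto simp: standard_conjugates_def standard_solution_def conjugate_solution_def)
  have aa: "((\<epsilon> a)\<^sup>\<dagger>)\<^sup>\<dagger> = \<epsilon> a" using e o adj_adj[of "a \<box> cj a" "unt C"] by simp
  have m1: "I (cj a) \<otimes> \<epsilon> a \<in> hom C (cj a \<box> a \<box> cj a) (cj a)"
    using tnm_in[of "cj a" "cj a" "a \<box> cj a" "unt C" "I (cj a)" "\<epsilon> a"] e o ten_unt by simp
  have m2: "\<eta> a \<otimes> I (cj a) \<in> hom C (cj a) (cj a \<box> a \<box> cj a)"
    using tnm_in[of "unt C" "cj a \<box> a" "cj a" "cj a" "\<eta> a" "I (cj a)"] e o ten_unt ten_assoc by simp
  \<comment> \<open>For a barred label the identity sought is the adjoint of the second conjugate
    equation of \<open>a\<close>.\<close>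
  have "((I (cj a) \<otimes> \<epsilon> a) \<cdot> (\<eta> a \<otimes> I (cj a)))\<^sup>\<dagger> = (\<eta> a \<otimes> I (cj a))\<^sup>\<dagger> \<cdot> (I (cj a) \<otimes> \<epsilon> a)\<^sup>\<dagger>"
    by (rule adj_cmp[OF _ _ _ m2 m1]) (use o in auto)
  also have "(\<eta> a \<otimes> I (cj a))\<^sup>\<dagger> = (\<eta> a)\<^sup>\<dagger> \<otimes> I (cj a)"
    using tnm_adj[of "unt C" "cj a \<box> a" "cj a" "cj a" "\<eta> a" "I (cj a)"] e o by simp
  also have "(I (cj a) \<otimes> \<epsilon> a)\<^sup>\<dagger> = I (cj a) \<otimes> (\<epsilon> a)\<^sup>\<dagger>"
    using tnm_adj[of "cj a" "cj a" "a \<box> cj a" "unt C" "I (cj a)" "\<epsilon> a"] e o by simp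
  finally show ?thesis using eq aa o Bar by simp
qed

lemma bar_in:
  assumes "\<beta>\<^sub>1 \<in> S" "\<beta>\<^sub>2 \<in> S" "\<alpha> \<in> \<Lambda>" and x: "x \<in> hom C \<beta>\<^sub>1 (\<beta>\<^sub>2 \<box> label_obj \<alpha>)"
  shows "bar \<beta>\<^sub>2 \<alpha> x \<in> hom C \<beta>\<^sub>2 (\<beta>\<^sub>1 \<box> label_obj (bar_label \<alpha>))"
    and "x\<^sup>\<dagger> \<otimes> I (label_obj (bar_label \<alpha>)) \<in>
      hom C (\<beta>\<^sub>2 \<box> label_obj \<alpha> \<box> label_obj (bar_label \<alpha>)) (\<beta>\<^sub>1 \<box> label_obj (bar_label \<alpha>))"
    and "I \<beta>\<^sub>2 \<otimes> r (bar_label \<alpha>) \<in> hom C \<beta>\<^sub>2 (\<beta>\<^sub>2 \<box> label_obj \<alpha> \<box> label_obj (bar_label \<alpha>))"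
proof -
  let ?A = "label_obj \<alpha>" and ?B = "label_obj (bar_label \<alpha>)"
  have o: "?A \<in> obj C" "?B \<in> obj C" "\<beta>\<^sub>1 \<in> obj C" "\<beta>\<^sub>2 \<in> obj C" using assms by auto
  show 1: "x\<^sup>\<dagger> \<otimes> I ?B \<in> hom C (\<beta>\<^sub>2 \<box> ?A \<box> ?B) (\<beta>\<^sub>1 \<box> ?B)"
    using tnm_in[of "\<beta>\<^sub>2 \<box> ?A" \<beta>\<^sub>1 ?B ?B "x\<^sup>\<dagger>" "I ?B"] adj_in[OF _ _ x] o ten_assoc by simp
  show 2: "I \<beta>\<^sub>2 \<otimes> r (bar_label \<alpha>) \<in> hom C \<beta>\<^sub>2 (\<beta>\<^sub>2 \<box> ?A \<box> ?B)"
    using tnm_in[of \<beta>\<^sub>2 \<beta>\<^sub>2 "unt C" "?A \<box> ?B" "I \<beta>\<^sub>2" "r (bar_label \<alpha>)"] r_in[of "bar_label \<alpha>"] assms o ten_unt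
    by simp
  show "bar \<beta>\<^sub>2 \<alpha> x \<in> hom C \<beta>\<^sub>2 (\<beta>\<^sub>1 \<box> ?B)"
    unfolding bar_def by (rule cmp_in[OF _ _ _ 2 1]) (use o in auto)
qed

text \<open>Frobenius reciprocity is an involution: by the interchange law \<open>x\<close> moves
  past \<open>r \<alpha>\<close>, and what remains beside it is the conjugate equation for
  \<open>\<alpha>\<close>. Both the involutivity of \<open>tomita_S\<close> and the bijection
  between the morphism spaces of conjugate edges rest on this.\<close>

lemma bar_bar:
  assumes \<beta>: "\<beta>\<^sub>1 \<in> S" "\<beta>\<^sub>2 \<in> S" and \<alpha>: "\<alpha> \<in> \<Lambda>" and x: "x \<in> hom C \<beta>\<^sub>1 (\<beta>\<^sub>2 \<box> label_obj \<alpha>)"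
  shows "bar \<beta>\<^sub>1 (bar_label \<alpha>) (bar \<beta>\<^sub>2 \<alpha> x) = x"
proof -
  let ?A = "label_obj \<alpha>" and ?B = "label_obj (bar_label \<alpha>)" and ?rb = "r (bar_label \<alpha>)" and ?r = "r \<alpha>"
  have o [simp]: "?A \<in> obj C" "?B \<in> obj C" "\<beta>\<^sub>1 \<in> obj C" "\<beta>\<^sub>2 \<in> obj C" using assms by auto
  have r: "?r \<in> hom C (unt C) (?B \<box> ?A)" "?rb \<in> hom C (unt C) (?A \<box> ?B)"
    using r_in[OF \<alpha>] r_in[of "bar_label \<alpha>"] \<alpha> by auto
  note b = bar_in[OF \<beta> \<alpha> x]
  have xd: "x\<^sup>\<dagger> \<in> hom C (\<beta>\<^sub>2 \<box> ?A) \<beta>\<^sub>1" using adj_in[OF _ _ x] by simp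
  have rbd: "?rb\<^sup>\<dagger> \<in> hom C (?A \<box> ?B) (unt C)" using adj_in[OF _ _ r(2)] by simp
  have xB: "x \<otimes> I ?B \<in> hom C (\<beta>\<^sub>1 \<box> ?B) (\<beta>\<^sub>2 \<box> ?A \<box> ?B)"
    using tnm_in[of \<beta>\<^sub>1 "\<beta>\<^sub>2 \<box> ?A" ?B ?B x "I ?B"] x ten_assoc by simp
  have Irb: "I \<beta>\<^sub>2 \<otimes> ?rb\<^sup>\<dagger> \<in> hom C (\<beta>\<^sub>2 \<box> ?A \<box> ?B) \<beta>\<^sub>2"
    using tnm_in[of \<beta>\<^sub>2 \<beta>\<^sub>2 "?A \<box> ?B" "unt C" "I \<beta>\<^sub>2" "?rb\<^sup>\<dagger>"] rbd ten_unt by simp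
  have bard: "(bar \<beta>\<^sub>2 \<alpha> x)\<^sup>\<dagger> = (I \<beta>\<^sub>2 \<otimes> ?rb\<^sup>\<dagger>) \<cdot> (x \<otimes> I ?B)"
  proof -
    have "(bar \<beta>\<^sub>2 \<alpha> x)\<^sup>\<dagger> = (I \<beta>\<^sub>2 \<otimes> ?rb)\<^sup>\<dagger> \<cdot> (x\<^sup>\<dagger> \<otimes> I ?B)\<^sup>\<dagger>"
      unfolding bar_def by (rule adj_cmp[OF _ _ _ b(3,2)]) auto
    also have "(I \<beta>\<^sub>2 \<otimes> ?rb)\<^sup>\<dagger> = I \<beta>\<^sub>2 \<otimes> ?rb\<^sup>\<dagger>"
      using tnm_adj[of \<beta>\<^sub>2 \<beta>\<^sub>2 "unt C" "?A \<box> ?B" "I \<beta>\<^sub>2" ?rb] r by simp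
    also have "(x\<^sup>\<dagger> \<otimes> I ?B)\<^sup>\<dagger> = x \<otimes> I ?B"
      using tnm_adj[of "\<beta>\<^sub>2 \<box> ?A" \<beta>\<^sub>1 ?B ?B "x\<^sup>\<dagger>" "I ?B"] xd adj_adj[OF _ _ x] by simp
    finally show ?thesis .
  qed
  have xBA: "(x \<otimes> I ?B) \<otimes> I ?A \<in> hom C (\<beta>\<^sub>1 \<box> ?B \<box> ?A) (\<beta>\<^sub>2 \<box> ?A \<box> ?B \<box> ?A)"
    using tnm_in[OF _ _ _ _ xB idt_in[of ?A]] ten_assoc by simp
  have IrbA: "(I \<beta>\<^sub>2 \<otimes> ?rb\<^sup>\<dagger>) \<otimes> I ?A \<in> hom C (\<beta>\<^sub>2 \<box> ?A \<box> ?B \<box> ?A) (\<beta>\<^sub>2 \<box> ?A)"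
    using tnm_in[OF _ _ _ _ Irb idt_in[of ?A]] ten_assoc by simp
  have Ir: "I \<beta>\<^sub>1 \<otimes> ?r \<in> hom C \<beta>\<^sub>1 (\<beta>\<^sub>1 \<box> ?B \<box> ?A)"
    using tnm_in[of \<beta>\<^sub>1 \<beta>\<^sub>1 "unt C" "?B \<box> ?A" "I \<beta>\<^sub>1" ?r] r ten_unt by simp
  have IAr: "I ?A \<otimes> ?r \<in> hom C ?A (?A \<box> ?B \<box> ?A)"
    using tnm_in[of ?A ?A "unt C" "?B \<box> ?A" "I ?A" ?r] r ten_unt by simp
  have I2Ar: "I \<beta>\<^sub>2 \<otimes> (I ?A \<otimes> ?r) \<in> hom C (\<beta>\<^sub>2 \<box> ?A) (\<beta>\<^sub>2 \<box> ?A \<box> ?B \<box> ?A)"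
    using tnm_in[OF _ _ _ _ idt_in[of \<beta>\<^sub>2] IAr] by simp
  have rbA: "?rb\<^sup>\<dagger> \<otimes> I ?A \<in> hom C (?A \<box> ?B \<box> ?A) ?A"
    using tnm_in[OF _ _ _ _ rbd idt_in[of ?A]] ten_unt ten_assoc by simp
  have "bar \<beta>\<^sub>1 (bar_label \<alpha>) (bar \<beta>\<^sub>2 \<alpha> x) = (((I \<beta>\<^sub>2 \<otimes> ?rb\<^sup>\<dagger>) \<cdot> (x \<otimes> I ?B)) \<otimes> I ?A) \<cdot> (I \<beta>\<^sub>1 \<otimes> ?r)"
    unfolding bar_def[of \<beta>\<^sub>1] bard by simp
  also have "((I \<beta>\<^sub>2 \<otimes> ?rb\<^sup>\<dagger>) \<cdot> (x \<otimes> I ?B)) \<otimes> I ?A = ((I \<beta>\<^sub>2 \<otimes> ?rb\<^sup>\<dagger>) \<otimes> I ?A) \<cdot> ((x \<otimes> I ?B) \<otimes> I ?A)"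
    using tnm_cmp[OF _ _ _ _ _ _ xB Irb idt_in[of ?A] idt_in[of ?A]] cmp_idt[OF _ _ idt_in[of ?A]] by simp
  also have "(((I \<beta>\<^sub>2 \<otimes> ?rb\<^sup>\<dagger>) \<otimes> I ?A) \<cdot> ((x \<otimes> I ?B) \<otimes> I ?A)) \<cdot> (I \<beta>\<^sub>1 \<otimes> ?r) =
      ((I \<beta>\<^sub>2 \<otimes> ?rb\<^sup>\<dagger>) \<otimes> I ?A) \<cdot> (((x \<otimes> I ?B) \<otimes> I ?A) \<cdot> (I \<beta>\<^sub>1 \<otimes> ?r))"
    by (rule cmp_assoc[OF _ _ _ _ Ir xBA IrbA]) auto
  \<comment> \<open>Interchange law: both sides equal \<open>x \<otimes> r \<alpha>\<close>.\<close>
  also have "((x \<otimes> I ?B) \<otimes> I ?A) \<cdot> (I \<beta>\<^sub>1 \<otimes> ?r) = (I \<beta>\<^sub>2 \<otimes> (I ?A \<otimes> ?r)) \<cdot> x"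
  proof -
    have "(x \<otimes> I ?B) \<otimes> I ?A = x \<otimes> I (?B \<box> ?A)"
      using tnm_assoc[OF _ _ _ _ _ _ x idt_in[of ?B] idt_in[of ?A]] tnm_idt[of ?B ?A] by simp
    then have "((x \<otimes> I ?B) \<otimes> I ?A) \<cdot> (I \<beta>\<^sub>1 \<otimes> ?r) = (x \<cdot> I \<beta>\<^sub>1) \<otimes> (I (?B \<box> ?A) \<cdot> ?r)"
      using tnm_cmp[of \<beta>\<^sub>1 \<beta>\<^sub>1 "\<beta>\<^sub>2 \<box> ?A" "unt C" "?B \<box> ?A" "?B \<box> ?A" "I \<beta>\<^sub>1" x ?r "I (?B \<box> ?A)"] x r by simp
    also have "\<dots> = x \<otimes> ?r" using cmp_idt[OF _ _ x] cmp_idt[OF _ _ r(1)] by simp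
    also have "\<dots> = (I (\<beta>\<^sub>2 \<box> ?A) \<cdot> x) \<otimes> (?r \<cdot> I (unt C))"
      using cmp_idt[OF _ _ x] cmp_idt[OF _ _ r(1)] by simp
    also have "\<dots> = (I (\<beta>\<^sub>2 \<box> ?A) \<otimes> ?r) \<cdot> (x \<otimes> I (unt C))"
      using tnm_cmp[of \<beta>\<^sub>1 "\<beta>\<^sub>2 \<box> ?A" "\<beta>\<^sub>2 \<box> ?A" "unt C" "unt C" "?B \<box> ?A" x "I (\<beta>\<^sub>2 \<box> ?A)" "I (unt C)" ?r] x r by simp
    also have "x \<otimes> I (unt C) = x" using tnm_unt[OF _ _ x] by simp
    also have "I (\<beta>\<^sub>2 \<box> ?A) \<otimes> ?r = I \<beta>\<^sub>2 \<otimes> (I ?A \<otimes> ?r)"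
      using tnm_assoc[OF _ _ _ _ _ _ idt_in[of \<beta>\<^sub>2] idt_in[of ?A] r(1)] tnm_idt[of \<beta>\<^sub>2 ?A] by simp
    finally show ?thesis .
  qed
  also have "((I \<beta>\<^sub>2 \<otimes> ?rb\<^sup>\<dagger>) \<otimes> I ?A) \<cdot> ((I \<beta>\<^sub>2 \<otimes> (I ?A \<otimes> ?r)) \<cdot> x) =
      (((I \<beta>\<^sub>2 \<otimes> ?rb\<^sup>\<dagger>) \<otimes> I ?A) \<cdot> (I \<beta>\<^sub>2 \<otimes> (I ?A \<otimes> ?r))) \<cdot> x"
    by (rule cmp_assoc[OF _ _ _ _ x I2Ar IrbA, symmetric]) auto
  also have "((I \<beta>\<^sub>2 \<otimes> ?rb\<^sup>\<dagger>) \<otimes> I ?A) \<cdot> (I \<beta>\<^sub>2 \<otimes> (I ?A \<otimes> ?r)) = I (\<beta>\<^sub>2 \<box> ?A)"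
  proof -
    have "(I \<beta>\<^sub>2 \<otimes> ?rb\<^sup>\<dagger>) \<otimes> I ?A = I \<beta>\<^sub>2 \<otimes> (?rb\<^sup>\<dagger> \<otimes> I ?A)"
      using tnm_assoc[OF _ _ _ _ _ _ idt_in[of \<beta>\<^sub>2] rbd idt_in[of ?A]] by simp
    then have "((I \<beta>\<^sub>2 \<otimes> ?rb\<^sup>\<dagger>) \<otimes> I ?A) \<cdot> (I \<beta>\<^sub>2 \<otimes> (I ?A \<otimes> ?r)) =
        (I \<beta>\<^sub>2 \<cdot> I \<beta>\<^sub>2) \<otimes> ((?rb\<^sup>\<dagger> \<otimes> I ?A) \<cdot> (I ?A \<otimes> ?r))"
      using tnm_cmp[OF _ _ _ _ _ _ idt_in[of \<beta>\<^sub>2] idt_in[of \<beta>\<^sub>2] IAr rbA] by simp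
    then show ?thesis
      using conjugate_equation[OF \<alpha>] cmp_idt[OF _ _ idt_in[of \<beta>\<^sub>2]] tnm_idt[of \<beta>\<^sub>2 ?A] by simp
  qed
  also have "I (\<beta>\<^sub>2 \<box> ?A) \<cdot> x = x" using cmp_idt[OF _ _ x] by simp
  finally show ?thesis .
qed

lemma bar_scl:
  assumes "\<beta>\<^sub>1 \<in> S" "\<beta>\<^sub>2 \<in> S" "\<alpha> \<in> \<Lambda>" and x: "x \<in> hom C \<beta>\<^sub>1 (\<beta>\<^sub>2 \<box> label_obj \<alpha>)"
  shows "bar \<beta>\<^sub>2 \<alpha> (c \<odot> x) = cnj c \<odot> bar \<beta>\<^sub>2 \<alpha> x"
proof -
  let ?A = "label_obj \<alpha>" and ?B = "label_obj (bar_label \<alpha>)"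
  have o [simp]: "?A \<in> obj C" "?B \<in> obj C" "\<beta>\<^sub>1 \<in> obj C" "\<beta>\<^sub>2 \<in> obj C" using assms by auto
  have "(c \<odot> x)\<^sup>\<dagger> = cnj c \<odot> x\<^sup>\<dagger>" using adj_scl[OF _ _ x] by simp
  moreover have "(cnj c \<odot> x\<^sup>\<dagger>) \<otimes> I ?B = cnj c \<odot> (x\<^sup>\<dagger> \<otimes> I ?B)"
    using tnm_scl[OF _ _ _ _ adj_in[OF _ _ x] idt_in[of ?B]] by simp
  moreover have "(cnj c \<odot> (x\<^sup>\<dagger> \<otimes> I ?B)) \<cdot> (I \<beta>\<^sub>2 \<otimes> r (bar_label \<alpha>)) = cnj c \<odot> bar \<beta>\<^sub>2 \<alpha> x"
    unfolding bar_def
    using cmp_scl[OF _ _ _ bar_in(3)[OF assms] bar_in(2)[OF assms], of "cnj c"] by simp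
  ultimately show ?thesis by (simp add: bar_def)
qed

lemma bar_zer [simp]:
  assumes "\<beta>\<^sub>1 \<in> S" "\<beta>\<^sub>2 \<in> S" "\<alpha> \<in> \<Lambda>"
  shows "bar \<beta>\<^sub>2 \<alpha> (zer C \<beta>\<^sub>1 (\<beta>\<^sub>2 \<box> label_obj \<alpha>)) = zer C \<beta>\<^sub>2 (\<beta>\<^sub>1 \<box> label_obj (bar_label \<alpha>))"
  using bar_scl[OF assms zer_in, of 0] scl_zero[OF bar_in(1)[OF assms zer_in]] assms by simp

text \<open>If \<open>\<eta> X\<close> were zero, the conjugate equation would make
  \<open>I X\<close> zero, against simplicity. The proof also exhibits the unique real scalar that
  the description in \<open>dim\<close> picks out.\<close>

lemma dim_pos:
  assumes "X \<in> S"
  shows "dim X > 0"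
proof -
  have o [simp]: "X \<in> obj C" "cj X \<in> obj C" using assms cj_obj by auto
  have e: "\<eta> X \<in> hom C (unt C) (cj X \<box> X)" "\<epsilon> X \<in> hom C (X \<box> cj X) (unt C)"
    and eq: "(((\<epsilon> X)\<^sup>\<dagger>)\<^sup>\<dagger> \<otimes> I X) \<cdot> (I X \<otimes> \<eta> X) = I X"
    using conj o by (auto simp: standard_conjugates_def standard_solution_def conjugate_solution_def)
  have nz: "\<eta> X \<noteq> zer C (unt C) (cj X \<box> X)"
  proof
    assume z: "\<eta> X = zer C (unt C) (cj X \<box> X)"
    have "I X \<otimes> \<eta> X = 0 \<odot> (I X \<otimes> \<eta> X)"
      using tnm_scl[OF _ _ _ _ idt_in[of X] e(1), of 0] z e(1) by simp
    moreover have 1: "I X \<otimes> \<eta> X \<in> hom C X (X \<box> cj X \<box> X)"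
      using tnm_in[OF _ _ _ _ idt_in[of X] e(1)] ten_unt by simp
    ultimately have z': "I X \<otimes> \<eta> X = zer C X (X \<box> cj X \<box> X)" using scl_zero[OF 1] by simp
    moreover have "((\<epsilon> X)\<^sup>\<dagger>)\<^sup>\<dagger> \<otimes> I X \<in> hom C (X \<box> cj X \<box> X) X"
      using tnm_in[OF _ _ _ _ e(2) idt_in[of X]] adj_adj[OF _ _ e(2)] ten_unt ten_assoc by simp
    ultimately have "I X = zer C X X" using eq z' cmp_zer_right[of "((\<epsilon> X)\<^sup>\<dagger>)\<^sup>\<dagger> \<otimes> I X" "X \<box> cj X \<box> X" X X] by simp
    then show False using S_simple[OF assms] by (simp add: simple_def)
  qed
  note p = ipm_self[OF unt_S _ e(1)]
  have "(\<eta> X)\<^sup>\<dagger> \<cdot> \<eta> X \<in> hom C (unt C) (unt C)"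
    by (rule cmp_in[OF _ _ _ e(1) adj_in[OF _ _ e(1)]]) auto
  then have eq: "(\<eta> X)\<^sup>\<dagger> \<cdot> \<eta> X = complex_of_real (Re (ipm (unt C) (\<eta> X) (\<eta> X))) \<odot> I (unt C)"
    using coef_eq[OF unt_S, of "(\<eta> X)\<^sup>\<dagger> \<cdot> \<eta> X"] p(1) by (simp add: ipm_def)
  have "dim X = Re (ipm (unt C) (\<eta> X) (\<eta> X))"
    unfolding dim_def
  proof (rule the_equality)
    show "(\<eta> X)\<^sup>\<dagger> \<cdot> \<eta> X = complex_of_real (Re (ipm (unt C) (\<eta> X) (\<eta> X))) \<odot> I (unt C)" by (rule eq)
  next
    fix d assume "(\<eta> X)\<^sup>\<dagger> \<cdot> \<eta> X = complex_of_real d \<odot> I (unt C)"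
    then show "d = Re (ipm (unt C) (\<eta> X) (\<eta> X))" by (simp add: ipm_def)
  qed
  then show ?thesis using p(3)[OF _ nz] by simp
qed

end

section \<open>The bimodule\<close>

context fock_category
begin

definition zT :: "'o \<times> 'o label \<times> 'o \<Rightarrow> 'm" where
  "zT = (\<lambda>(\<beta>\<^sub>2, \<alpha>, \<beta>\<^sub>1). zer C \<beta>\<^sub>1 (\<beta>\<^sub>2 \<box> label_obj \<alpha>))"

definition homT :: "'o \<times> 'o label \<times> 'o \<Rightarrow> 'm set" where
  "homT = (\<lambda>(\<beta>\<^sub>2, \<alpha>, \<beta>\<^sub>1). hom C \<beta>\<^sub>1 (\<beta>\<^sub>2 \<box> label_obj \<alpha>))"

definition suppT :: "('o, 'm) hvec \<Rightarrow> ('o \<times> 'o label \<times> 'o) set" where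
  "suppT \<xi> = {t \<in> triples. \<xi> t \<noteq> zT t}"

lemma tripleE:
  assumes "t \<in> triples"
  obtains \<beta>\<^sub>2 \<alpha> \<beta>\<^sub>1 where "t = (\<beta>\<^sub>2, \<alpha>, \<beta>\<^sub>1)" "\<beta>\<^sub>2 \<in> S" "\<alpha> \<in> \<Lambda>" "\<beta>\<^sub>1 \<in> S"
  using assms by (auto simp: triples_def)

lemma H_iff: "\<xi> \<in> H \<longleftrightarrow> \<xi> \<in> extensional triples \<and> (\<forall>t\<in>triples. \<xi> t \<in> homT t) \<and> finite (suppT \<xi>)"
proof -
  have "{(\<beta>\<^sub>2, \<alpha>, \<beta>\<^sub>1) \<in> triples. \<xi> (\<beta>\<^sub>2, \<alpha>, \<beta>\<^sub>1) \<noteq> zer C \<beta>\<^sub>1 (\<beta>\<^sub>2 \<box> label_obj \<alpha>)} = suppT \<xi>"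
    by (auto simp: suppT_def zT_def)
  then show ?thesis unfolding H_def homT_def[symmetric] by (auto simp: PiE_iff)
qed

lemma homT_simps: "x \<in> homT (\<beta>\<^sub>2, \<alpha>, \<beta>\<^sub>1) \<longleftrightarrow> x \<in> hom C \<beta>\<^sub>1 (\<beta>\<^sub>2 \<box> label_obj \<alpha>)"
  "zT (\<beta>\<^sub>2, \<alpha>, \<beta>\<^sub>1) = zer C \<beta>\<^sub>1 (\<beta>\<^sub>2 \<box> label_obj \<alpha>)"
  by (auto simp: homT_def zT_def)

lemma homT_ops [simp]:
  assumes "t \<in> triples"
  shows "zT t \<in> homT t" "x \<in> homT t \<Longrightarrow> c \<odot> x \<in> homT t" "x \<in> homT t \<Longrightarrow> y \<in> homT t \<Longrightarrow> x \<oplus> y \<in> homT t"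
    "c \<odot> zT t = zT t" "x \<in> homT t \<Longrightarrow> 0 \<odot> x = zT t" "x \<in> homT t \<Longrightarrow> x \<oplus> zT t = x"
    "x \<in> homT t \<Longrightarrow> 1 \<odot> x = x" "x \<in> homT t \<Longrightarrow> zT t \<oplus> x = x"
proof -
  obtain \<beta>\<^sub>2 \<alpha> \<beta>\<^sub>1 where t: "t = (\<beta>\<^sub>2, \<alpha>, \<beta>\<^sub>1)" "\<beta>\<^sub>2 \<in> S" "\<alpha> \<in> \<Lambda>" "\<beta>\<^sub>1 \<in> S"
    using assms by (rule tripleE)
  then have o: "\<beta>\<^sub>1 \<in> obj C" "\<beta>\<^sub>2 \<box> label_obj \<alpha> \<in> obj C" by auto
  note [simp] = zer_in[OF o] scl_in[OF o] pls_in[OF o] scl_zer[OF o] scl_zero[OF _ o] pls_zer[OF o] scl_one[OF o]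
  show "zT t \<in> homT t" "x \<in> homT t \<Longrightarrow> c \<odot> x \<in> homT t" "x \<in> homT t \<Longrightarrow> y \<in> homT t \<Longrightarrow> x \<oplus> y \<in> homT t"
    "c \<odot> zT t = zT t" "x \<in> homT t \<Longrightarrow> 0 \<odot> x = zT t" "x \<in> homT t \<Longrightarrow> x \<oplus> zT t = x"
    "x \<in> homT t \<Longrightarrow> 1 \<odot> x = x" "x \<in> homT t \<Longrightarrow> zT t \<oplus> x = x"
    using pls_commute[OF o _ zer_in[OF o], of x] by (auto simp: t homT_simps)
qed

lemma homT_scl_scl: "t \<in> triples \<Longrightarrow> x \<in> homT t \<Longrightarrow> c \<odot> (d \<odot> x) = (c * d) \<odot> x"
  and homT_scl_pls: "t \<in> triples \<Longrightarrow> x \<in> homT t \<Longrightarrow> y \<in> homT t \<Longrightarrow> c \<odot> (x \<oplus> y) = (c \<odot> x) \<oplus> (c \<odot> y)"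
  and homT_pls_scl: "t \<in> triples \<Longrightarrow> x \<in> homT t \<Longrightarrow> (c + d) \<odot> x = (c \<odot> x) \<oplus> (d \<odot> x)"
proof -
  assume "t \<in> triples"
  then obtain \<beta>\<^sub>2 \<alpha> \<beta>\<^sub>1 where t: "t = (\<beta>\<^sub>2, \<alpha>, \<beta>\<^sub>1)" "\<beta>\<^sub>2 \<in> S" "\<alpha> \<in> \<Lambda>" "\<beta>\<^sub>1 \<in> S"
    by (rule tripleE)
  then have o: "\<beta>\<^sub>1 \<in> obj C" "\<beta>\<^sub>2 \<box> label_obj \<alpha> \<in> obj C" "homT t = hom C \<beta>\<^sub>1 (\<beta>\<^sub>2 \<box> label_obj \<alpha>)"
    by (auto simp: homT_def)
  show "c \<odot> (d \<odot> x) = (c * d) \<odot> x" if "x \<in> homT t" using scl_mult[OF o(1,2)] that o(3) by simp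
  show "c \<odot> (x \<oplus> y) = (c \<odot> x) \<oplus> (c \<odot> y)" if "x \<in> homT t" "y \<in> homT t"
    using scl_pls_right[OF o(1,2)] that o(3) by simp
  show "(c + d) \<odot> x = (c \<odot> x) \<oplus> (d \<odot> x)" if "x \<in> homT t"
    using scl_pls_left[OF o(1,2)] that o(3) by simp
qed

lemma H_hom: "\<xi> \<in> H \<Longrightarrow> t \<in> triples \<Longrightarrow> \<xi> t \<in> homT t"
  by (simp add: H_iff)

lemma H_hom' [simp]: "\<xi> \<in> H \<Longrightarrow> \<omega> \<in> S \<Longrightarrow> \<alpha> \<in> \<Lambda> \<Longrightarrow> \<beta> \<in> S \<Longrightarrow> \<xi> (\<omega>, \<alpha>, \<beta>) \<in> hom C \<beta> (\<omega> \<box> label_obj \<alpha>)"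
  using H_hom[of \<xi> "(\<omega>, \<alpha>, \<beta>)"] by (simp add: homT_def)

lemma H_eqI: "\<xi> \<in> H \<Longrightarrow> \<zeta> \<in> H \<Longrightarrow> (\<And>t. t \<in> triples \<Longrightarrow> \<xi> t = \<zeta> t) \<Longrightarrow> \<xi> = \<zeta>"
  by (rule extensionalityI[of _ triples]) (auto simp: H_iff)

lemma hadd_in [simp]: "\<xi> \<in> H \<Longrightarrow> \<zeta> \<in> H \<Longrightarrow> hadd \<xi> \<zeta> \<in> H"
  unfolding H_iff
  by (intro conjI ballI; (rule finite_subset[of _ "suppT \<xi> \<union> suppT \<zeta>"])?) (auto simp: hadd_def suppT_def)

lemma hscale_in [simp]: "\<xi> \<in> H \<Longrightarrow> hscale c \<xi> \<in> H"
  unfolding H_iff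
  by (intro conjI ballI; (rule finite_subset[of _ "suppT \<xi>"])?) (auto simp: hscale_def suppT_def)

lemma lact_apply: "t \<in> triples \<Longrightarrow> lact a \<xi> t = a (fst t) \<odot> \<xi> t"
  by (auto simp: lact_def triples_def)

lemma ract_apply: "t \<in> triples \<Longrightarrow> ract \<xi> a t = a (snd (snd t)) \<odot> \<xi> t"
  by (auto simp: ract_def triples_def)

lemma lact_in [simp]: "\<xi> \<in> H \<Longrightarrow> lact a \<xi> \<in> H"
  unfolding H_iff
  by (intro conjI ballI; (rule finite_subset[of _ "suppT \<xi>"])?)
     (auto simp: lact_apply suppT_def, simp add: lact_def)

lemma ract_in [simp]: "\<xi> \<in> H \<Longrightarrow> ract \<xi> a \<in> H"
  unfolding H_iff
  by (intro conjI ballI; (rule finite_subset[of _ "suppT \<xi>"])?)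
     (auto simp: ract_apply suppT_def, simp add: ract_def)

lemma hadd_apply: "t \<in> triples \<Longrightarrow> hadd \<xi> \<zeta> t = \<xi> t \<oplus> \<zeta> t"
  by (simp add: hadd_def)

lemma hscale_apply: "t \<in> triples \<Longrightarrow> hscale c \<xi> t = c \<odot> \<xi> t"
  by (simp add: hscale_def)

definition hzero :: "('o, 'm) hvec" where
  "hzero = (\<lambda>t\<in>triples. zT t)"

definition hl :: "'o \<times> 'o label \<times> 'o \<Rightarrow> 'm \<Rightarrow> ('o, 'm) hvec" where
  "hl t x = (\<lambda>t'\<in>triples. if t' = t then x else zT t')"

lemma hl_in [simp]: "t \<in> triples \<Longrightarrow> x \<in> homT t \<Longrightarrow> hl t x \<in> H"
  unfolding H_iff
  by (intro conjI ballI; (rule finite_subset[of _ "{t}"])?) (auto simp: hl_def suppT_def)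

lemma hzero_in [simp]: "hzero \<in> H"
  unfolding H_iff
  by (intro conjI ballI; (rule finite_subset[of _ "{}"])?) (auto simp: hzero_def suppT_def)

lemma hzero_apply: "t \<in> triples \<Longrightarrow> hzero t = zT t"
  by (simp add: hzero_def)

lemma hl_apply: "t' \<in> triples \<Longrightarrow> hl t x t' = (if t' = t then x else zT t')"
  by (simp add: hl_def)

lemma hscale_zero: "\<xi> \<in> H \<Longrightarrow> hscale 0 \<xi> = hzero"
  by (rule H_eqI) (auto simp: hscale_apply hzero_apply H_hom)

lemma hscale_hl: "t \<in> triples \<Longrightarrow> x \<in> homT t \<Longrightarrow> hscale c (hl t x) = hl t (c \<odot> x)"
  by (rule H_eqI) (auto simp: hscale_apply hl_apply)

lemma lact_hl: "t \<in> triples \<Longrightarrow> x \<in> homT t \<Longrightarrow> lact a (hl t x) = hscale (a (fst t)) (hl t x)"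
  by (rule H_eqI) (auto simp: hscale_apply hl_apply lact_apply)

lemma ract_hl: "t \<in> triples \<Longrightarrow> x \<in> homT t \<Longrightarrow> ract (hl t x) a = hscale (a (snd (snd t))) (hl t x)"
  by (rule H_eqI) (auto simp: hscale_apply hl_apply ract_apply)

lemma hscale_one [simp]: "\<xi> \<in> H \<Longrightarrow> hscale 1 \<xi> = \<xi>"
  by (rule H_eqI) (auto simp: hscale_apply H_hom)

lemma lact_lact: "\<xi> \<in> H \<Longrightarrow> lact a (lact b \<xi>) = lact (\<lambda>\<beta>. a \<beta> * b \<beta>) \<xi>"
  by (rule H_eqI) (auto simp: lact_apply H_hom homT_scl_scl)

lemma lact_ract: "\<xi> \<in> H \<Longrightarrow> lact a (ract \<xi> b) = ract (lact a \<xi>) b"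
  by (rule H_eqI) (auto simp: lact_apply ract_apply H_hom homT_scl_scl mult.commute)

lemma lact_hadd: "\<xi> \<in> H \<Longrightarrow> \<zeta> \<in> H \<Longrightarrow> lact a (hadd \<xi> \<zeta>) = hadd (lact a \<xi>) (lact a \<zeta>)"
  by (rule H_eqI) (auto simp: lact_apply hadd_apply H_hom homT_scl_pls)

lemma lact_hscale: "\<xi> \<in> H \<Longrightarrow> lact a (hscale c \<xi>) = hscale c (lact a \<xi>)"
  by (rule H_eqI) (auto simp: lact_apply hscale_apply H_hom homT_scl_scl mult.commute)

lemma lact_unitA [simp]: "\<xi> \<in> H \<Longrightarrow> lact unitA \<xi> = \<xi>"
  by (rule H_eqI) (auto simp: lact_apply unitA_def H_hom elim!: tripleE)

lemma H_induct [consumes 1, case_names zero add]: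
  assumes "\<xi> \<in> H" "P hzero"
    and step: "\<And>t x \<xi>. t \<in> triples \<Longrightarrow> x \<in> homT t \<Longrightarrow> \<xi> \<in> H \<Longrightarrow> P \<xi> \<Longrightarrow> P (hadd (hl t x) \<xi>)"
  shows "P \<xi>"
  using assms(1)
proof (induction "card (suppT \<xi>)" arbitrary: \<xi>)
  case 0
  then have "suppT \<xi> = {}" by (simp add: H_iff)
  then have "\<xi> = hzero" using 0(2) by (intro H_eqI) (auto simp: suppT_def hzero_apply)
  then show ?case using assms(2) by simp
next
  case (Suc n)
  then obtain t where t: "t \<in> suppT \<xi>" by (metis card.empty ex_in_conv nat.distinct(1))
  then have tt: "t \<in> triples" by (simp add: suppT_def)
  define \<zeta> where "\<zeta> = (\<lambda>t'\<in>triples. if t' = t then zT t else \<xi> t')"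
  have s: "suppT \<zeta> = suppT \<xi> - {t}" by (auto simp: suppT_def \<zeta>_def)
  have fin: "finite (suppT \<xi>)" using Suc.prems by (simp add: H_iff)
  have \<zeta>: "\<zeta> \<in> H" using Suc.prems tt fin s by (auto simp: H_iff \<zeta>_def)
  have "card (suppT \<zeta>) = n" using Suc.hyps(2) s t fin by simp
  then have "P \<zeta>" using Suc.hyps(1) \<zeta> by simp
  moreover have "\<xi> = hadd (hl t (\<xi> t)) \<zeta>"
    using Suc.prems tt \<zeta> by (intro H_eqI) (auto simp: hadd_apply hl_apply \<zeta>_def H_hom)
  ultimately show ?case using step[OF tt _ \<zeta>, of "\<xi> t"] Suc.prems tt by (simp add: H_hom)
qed

section \<open>The algebra-valued inner product on the bimodule\<close>

definition supp :: "('o, 'm) hvec \<Rightarrow> 'o \<Rightarrow> ('o \<times> 'o label) set" where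
  "supp \<xi> \<beta> = {p \<in> S \<times> \<Lambda>. \<xi> (fst p, snd p, \<beta>) \<noteq> zer C \<beta> (fst p \<box> label_obj (snd p))}"

lemma finite_supp:
  assumes "\<xi> \<in> H" "\<beta> \<in> S"
  shows "finite (supp \<xi> \<beta>)"
proof (rule finite_subset)
  show "supp \<xi> \<beta> \<subseteq> (\<lambda>(\<omega>, \<alpha>, \<beta>). (\<omega>, \<alpha>)) ` suppT \<xi>"
  proof
    fix p assume "p \<in> supp \<xi> \<beta>"
    then have "(fst p, snd p, \<beta>) \<in> suppT \<xi>" using assms(2) by (auto simp: supp_def suppT_def zT_def)
    then show "p \<in> (\<lambda>(\<omega>, \<alpha>, \<beta>). (\<omega>, \<alpha>)) ` suppT \<xi>" by (force simp: image_iff)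
  qed
  show "finite ((\<lambda>(\<omega>, \<alpha>, \<beta>). (\<omega>, \<alpha>)) ` suppT \<xi>)" using assms(1) by (simp add: H_iff)
qed

text \<open>\<open>hip\<close> sums over the common support, which varies with the arguments. A zero
  component contributes nothing, so any finite index set covering one of the supports gives the same
  value; over a fixed index set linearity is termwise.\<close>

lemma hip_sum:
  assumes "\<xi> \<in> H" "\<zeta> \<in> H" "\<beta> \<in> S" "finite F" "F \<subseteq> S \<times> \<Lambda>" "supp \<xi> \<beta> \<subseteq> F \<or> supp \<zeta> \<beta> \<subseteq> F"
  shows "hip \<xi> \<zeta> \<beta> = (\<Sum>p\<in>F. ipm \<beta> (\<xi> (fst p, snd p, \<beta>)) (\<zeta> (fst p, snd p, \<beta>)))"
proof -
  have "{p \<in> S \<times> \<Lambda>. case p of (\<omega>, \<alpha>) \<Rightarrow> \<xi> (\<omega>, \<alpha>, \<beta>) \<noteq> zer C \<beta> (\<omega> \<box> label_obj \<alpha>) \<and>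
      \<zeta> (\<omega>, \<alpha>, \<beta>) \<noteq> zer C \<beta> (\<omega> \<box> label_obj \<alpha>)} = supp \<xi> \<beta> \<inter> supp \<zeta> \<beta>"
    by (auto simp: supp_def)
  moreover have "hip \<xi> \<zeta> \<beta> = (\<Sum>p\<in>{p \<in> S \<times> \<Lambda>. case p of (\<omega>, \<alpha>) \<Rightarrow> \<xi> (\<omega>, \<alpha>, \<beta>) \<noteq> zer C \<beta> (\<omega> \<box> label_obj \<alpha>) \<and>
      \<zeta> (\<omega>, \<alpha>, \<beta>) \<noteq> zer C \<beta> (\<omega> \<box> label_obj \<alpha>)}. ipm \<beta> (\<xi> (fst p, snd p, \<beta>)) (\<zeta> (fst p, snd p, \<beta>)))"
    using assms(3) by (simp only: hip_def ipm_def if_True) (auto intro!: sum.cong)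
  ultimately have "hip \<xi> \<zeta> \<beta> = (\<Sum>p\<in>supp \<xi> \<beta> \<inter> supp \<zeta> \<beta>. ipm \<beta> (\<xi> (fst p, snd p, \<beta>)) (\<zeta> (fst p, snd p, \<beta>)))"
    by simp
  also have "\<dots> = (\<Sum>p\<in>F. ipm \<beta> (\<xi> (fst p, snd p, \<beta>)) (\<zeta> (fst p, snd p, \<beta>)))"
  proof (rule sum.mono_neutral_left)
    show "\<forall>p\<in>F - supp \<xi> \<beta> \<inter> supp \<zeta> \<beta>. ipm \<beta> (\<xi> (fst p, snd p, \<beta>)) (\<zeta> (fst p, snd p, \<beta>)) = 0"
    proof
      fix p assume p: "p \<in> F - supp \<xi> \<beta> \<inter> supp \<zeta> \<beta>"
      then have o: "fst p \<in> S" "snd p \<in> \<Lambda>" using assms(5) by auto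
      have "\<xi> (fst p, snd p, \<beta>) = zer C \<beta> (fst p \<box> label_obj (snd p)) \<or>
          \<zeta> (fst p, snd p, \<beta>) = zer C \<beta> (fst p \<box> label_obj (snd p))"
        using p o by (auto simp: supp_def mem_Times_iff)
      then show "ipm \<beta> (\<xi> (fst p, snd p, \<beta>)) (\<zeta> (fst p, snd p, \<beta>)) = 0"
        using o assms(1-3) ipm_zer[OF assms(3), of "fst p \<box> label_obj (snd p)"]
          ipm_zer_left[OF assms(3), of "fst p \<box> label_obj (snd p)"] by auto
    qed
  qed (use assms in auto)
  finally show ?thesis .
qed

lemma supp_subset: "supp \<xi> \<beta> \<subseteq> S \<times> \<Lambda>"
  by (auto simp: supp_def)

lemmas hip_supp = hip_sum[OF _ _ _ finite_supp supp_subset disjI1[OF subset_refl]]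

lemma hip_outside: "\<beta> \<notin> S \<Longrightarrow> hip \<xi> \<zeta> \<beta> = 0"
  by (simp add: hip_def)

lemma ipm_H:
  assumes "\<xi> \<in> H" "\<zeta> \<in> H" "\<omega> \<in> S" "\<alpha> \<in> \<Lambda>" "\<beta> \<in> S"
  shows "ipm \<beta> (\<xi> (\<omega>, \<alpha>, \<beta>)) (c \<odot> \<zeta> (\<omega>, \<alpha>, \<beta>)) = c * ipm \<beta> (\<xi> (\<omega>, \<alpha>, \<beta>)) (\<zeta> (\<omega>, \<alpha>, \<beta>))"
    and "\<zeta>' \<in> H \<Longrightarrow> ipm \<beta> (\<xi> (\<omega>, \<alpha>, \<beta>)) (\<zeta> (\<omega>, \<alpha>, \<beta>) \<oplus> \<zeta>' (\<omega>, \<alpha>, \<beta>)) =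
      ipm \<beta> (\<xi> (\<omega>, \<alpha>, \<beta>)) (\<zeta> (\<omega>, \<alpha>, \<beta>)) + ipm \<beta> (\<xi> (\<omega>, \<alpha>, \<beta>)) (\<zeta>' (\<omega>, \<alpha>, \<beta>))"
    and "0 \<le> Re (ipm \<beta> (\<xi> (\<omega>, \<alpha>, \<beta>)) (\<xi> (\<omega>, \<alpha>, \<beta>)))"
  using assms ipm_scl[of \<beta> "\<omega> \<box> label_obj \<alpha>"] ipm_pls[of \<beta> "\<omega> \<box> label_obj \<alpha>"]
    ipm_self(2)[of \<beta> "\<omega> \<box> label_obj \<alpha>"] by auto

lemma hip_lact_sum:
  assumes "\<xi> \<in> H" "\<zeta> \<in> H" "\<beta> \<in> S" "finite F" "F \<subseteq> S \<times> \<Lambda>" "supp \<xi> \<beta> \<subseteq> F"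
  shows "hip \<xi> (lact a \<zeta>) \<beta> = (\<Sum>p\<in>F. a (fst p) * ipm \<beta> (\<xi> (fst p, snd p, \<beta>)) (\<zeta> (fst p, snd p, \<beta>)))"
  using assms
  by (subst hip_sum[of _ _ _ F]) (auto simp: lact_apply ipm_H intro!: sum.cong)

lemma hip_add: "\<xi> \<in> H \<Longrightarrow> \<zeta> \<in> H \<Longrightarrow> \<zeta>' \<in> H \<Longrightarrow> hip \<xi> (hadd \<zeta> \<zeta>') \<beta> = hip \<xi> \<zeta> \<beta> + hip \<xi> \<zeta>' \<beta>"
  by (cases "\<beta> \<in> S")
     (auto simp: hip_outside hip_supp hadd_apply ipm_H sum.distrib[symmetric] supp_def intro!: sum.cong)

lemma hip_scale: "\<xi> \<in> H \<Longrightarrow> \<zeta> \<in> H \<Longrightarrow> hip \<xi> (hscale c \<zeta>) \<beta> = c * hip \<xi> \<zeta> \<beta>"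
  by (cases "\<beta> \<in> S")
     (auto simp: hip_outside hip_supp hscale_apply ipm_H sum_distrib_left supp_def intro!: sum.cong)

lemma hip_ract: "\<xi> \<in> H \<Longrightarrow> \<zeta> \<in> H \<Longrightarrow> hip \<xi> (ract \<zeta> a) \<beta> = a \<beta> * hip \<xi> \<zeta> \<beta>"
  by (cases "\<beta> \<in> S")
     (auto simp: hip_outside hip_supp ract_apply ipm_H sum_distrib_left supp_def intro!: sum.cong)

lemma hip_cnj:
  assumes "\<xi> \<in> H" "\<zeta> \<in> H"
  shows "hip \<zeta> \<xi> \<beta> = cnj (hip \<xi> \<zeta> \<beta>)"
proof (cases "\<beta> \<in> S")
  case True
  have "hip \<zeta> \<xi> \<beta> = (\<Sum>p\<in>supp \<zeta> \<beta>. cnj (ipm \<beta> (\<xi> (fst p, snd p, \<beta>)) (\<zeta> (fst p, snd p, \<beta>))))"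
    unfolding hip_supp[OF assms(2,1) True assms(2) True]
  proof (rule sum.cong[OF refl])
    fix p assume "p \<in> supp \<zeta> \<beta>"
    then have "fst p \<in> S" "snd p \<in> \<Lambda>" by (auto simp: supp_def)
    then show "ipm \<beta> (\<zeta> (fst p, snd p, \<beta>)) (\<xi> (fst p, snd p, \<beta>)) =
        cnj (ipm \<beta> (\<xi> (fst p, snd p, \<beta>)) (\<zeta> (fst p, snd p, \<beta>)))"
      using assms True by (intro ipm_cnj[where Y = "fst p \<box> label_obj (snd p)"]) auto
  qed
  also have "\<dots> = cnj (hip \<xi> \<zeta> \<beta>)"
    by (simp add: hip_sum[OF assms True finite_supp[OF assms(2) True] supp_subset] cnj_sum)
  finally show ?thesis .
qed (simp add: hip_outside)

lemma hip_lact_left: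
  assumes "\<xi> \<in> H" "\<zeta> \<in> H"
  shows "hip (lact a \<xi>) \<zeta> \<beta> = hip \<xi> (lact (\<lambda>\<beta>. cnj (a \<beta>)) \<zeta>) \<beta>"
proof (cases "\<beta> \<in> S")
  case True
  have "hip (lact a \<xi>) \<zeta> \<beta> = cnj (hip \<zeta> (lact a \<xi>) \<beta>)" using assms by (simp add: hip_cnj[of \<zeta>])
  also have "hip \<zeta> (lact a \<xi>) \<beta> = (\<Sum>p\<in>supp \<zeta> \<beta>. a (fst p) * ipm \<beta> (\<zeta> (fst p, snd p, \<beta>)) (\<xi> (fst p, snd p, \<beta>)))"
    using assms True by (intro hip_lact_sum finite_supp supp_subset) auto
  also have "cnj \<dots> = (\<Sum>p\<in>supp \<zeta> \<beta>. ipm \<beta> (\<xi> (fst p, snd p, \<beta>)) (lact (\<lambda>\<beta>. cnj (a \<beta>)) \<zeta> (fst p, snd p, \<beta>)))"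
    unfolding cnj_sum
  proof (rule sum.cong[OF refl])
    fix p assume "p \<in> supp \<zeta> \<beta>"
    then have "fst p \<in> S" "snd p \<in> \<Lambda>" by (auto simp: supp_def)
    then show "cnj (a (fst p) * ipm \<beta> (\<zeta> (fst p, snd p, \<beta>)) (\<xi> (fst p, snd p, \<beta>))) =
      ipm \<beta> (\<xi> (fst p, snd p, \<beta>)) (lact (\<lambda>\<beta>. cnj (a \<beta>)) \<zeta> (fst p, snd p, \<beta>))"
      using assms True ipm_cnj[of \<beta> "fst p \<box> label_obj (snd p)" "\<zeta> (fst p, snd p, \<beta>)" "\<xi> (fst p, snd p, \<beta>)"]
      by (simp add: lact_apply ipm_H)
  qed
  also have "\<dots> = hip \<xi> (lact (\<lambda>\<beta>. cnj (a \<beta>)) \<zeta>) \<beta>"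
    using assms True
    by (intro hip_sum[symmetric] finite_supp supp_subset disjI2)
       (auto simp: supp_def lact_apply)
  finally show ?thesis .
qed (simp add: hip_outside)

text \<open>Only finitely many third indices occur in \<open>\<xi>\<close>. For this reason inner
  products in positive degree lie in the algebra and have finite trace.\<close>

lemma finite_hip_support:
  assumes "\<xi> \<in> H" "\<zeta> \<in> H"
  shows "finite {\<beta>. hip \<xi> \<zeta> \<beta> \<noteq> 0}"
proof (rule finite_subset)
  show "{\<beta>. hip \<xi> \<zeta> \<beta> \<noteq> 0} \<subseteq> (\<lambda>t. snd (snd t)) ` suppT \<xi>"
  proof
    fix \<beta> assume "\<beta> \<in> {\<beta>. hip \<xi> \<zeta> \<beta> \<noteq> 0}"
    then have b: "hip \<xi> \<zeta> \<beta> \<noteq> 0" by simp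
    then have \<beta>: "\<beta> \<in> S" using hip_outside by blast
    then have "supp \<xi> \<beta> \<noteq> {}" using b hip_supp[OF assms \<beta> assms(1) \<beta>] by auto
    then obtain p where "p \<in> supp \<xi> \<beta>" by auto
    then have "(fst p, snd p, \<beta>) \<in> suppT \<xi>" using \<beta> by (auto simp: supp_def suppT_def zT_def)
    then show "\<beta> \<in> (\<lambda>t. snd (snd t)) ` suppT \<xi>" by force
  qed
  show "finite ((\<lambda>t. snd (snd t)) ` suppT \<xi>)" using assms(1) by (simp add: H_iff)
qed

lemma finite_support_AA: "finite {\<beta>. a \<beta> \<noteq> 0} \<Longrightarrow> (\<And>\<beta>. a \<beta> \<noteq> 0 \<Longrightarrow> \<beta> \<in> S) \<Longrightarrow> a \<in> \<AA>"
proof -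
  assume f: "finite {\<beta>. a \<beta> \<noteq> 0}" and s: "\<And>\<beta>. a \<beta> \<noteq> 0 \<Longrightarrow> \<beta> \<in> S"
  have "range a \<subseteq> insert 0 (a ` {\<beta>. a \<beta> \<noteq> 0})" by auto
  then have "bounded (range a)" using f finite_imp_bounded finite_subset by blast
  then show ?thesis using s by (auto simp: \<AA>_def)
qed

lemma hip_AA: "\<xi> \<in> H \<Longrightarrow> \<zeta> \<in> H \<Longrightarrow> hip \<xi> \<zeta> \<in> \<AA>"
  by (rule finite_support_AA) (use finite_hip_support hip_outside in blast)+

lemma hip_bounded:
  assumes "\<xi> \<in> H"
  shows "\<exists>B\<ge>0. \<forall>\<beta>. Re (hip \<xi> \<xi> \<beta>) \<le> B"
proof -
  have "bounded (range (hip \<xi> \<xi>))" using hip_AA[OF assms assms] by (simp add: \<AA>_def)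
  then obtain B where B: "\<And>\<beta>. cmod (hip \<xi> \<xi> \<beta>) \<le> B" by (auto simp: bounded_iff)
  have "Re (hip \<xi> \<xi> \<beta>) \<le> \<bar>B\<bar>" for \<beta>
    using B[of \<beta>] complex_Re_le_cmod[of "hip \<xi> \<xi> \<beta>"] by linarith
  then show ?thesis by (intro exI[of _ "\<bar>B\<bar>"]) auto
qed

lemma hip_self:
  assumes "\<xi> \<in> H"
  shows "hip \<xi> \<xi> \<beta> = complex_of_real (Re (hip \<xi> \<xi> \<beta>))" "0 \<le> Re (hip \<xi> \<xi> \<beta>)"
proof -
  show "hip \<xi> \<xi> \<beta> = complex_of_real (Re (hip \<xi> \<xi> \<beta>))"
    using arg_cong[OF hip_cnj[OF assms assms, of \<beta>], of Im] by (simp add: complex_eq_iff)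
  show "0 \<le> Re (hip \<xi> \<xi> \<beta>)"
  proof (cases "\<beta> \<in> S")
    case True
    show ?thesis unfolding hip_supp[OF assms assms True assms True] Re_sum
      using assms True
      by (intro sum_nonneg) (auto simp: supp_def ipm_H)
  qed (simp add: hip_outside)
qed

lemma hip_hl:
  assumes "(\<omega>, \<alpha>, \<beta>) \<in> triples" "x \<in> homT (\<omega>, \<alpha>, \<beta>)" "\<zeta> \<in> H"
  shows "hip (hl (\<omega>, \<alpha>, \<beta>) x) \<zeta> \<gamma> = (if \<gamma> = \<beta> then ipm \<beta> x (\<zeta> (\<omega>, \<alpha>, \<beta>)) else 0)"
proof (cases "\<gamma> \<in> S")
  case True
  have s: "supp (hl (\<omega>, \<alpha>, \<beta>) x) \<gamma> \<subseteq> (if \<gamma> = \<beta> then {(\<omega>, \<alpha>)} else {})"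
    using True by (auto simp: supp_def hl_def zT_def split: if_splits)
  show ?thesis
    using assms True s hip_sum[OF hl_in[OF assms(1,2)] assms(3) True, of "if \<gamma> = \<beta> then {(\<omega>, \<alpha>)} else {}"]
    by (auto simp: hl_apply)
qed (use assms in \<open>auto simp: hip_outside\<close>)

section \<open>The Tomita conjugation\<close>

lemma tomita_S_apply:
  assumes "(\<beta>\<^sub>1, \<alpha>', \<beta>\<^sub>2) \<in> triples"
  shows "tomita_S \<xi> (\<beta>\<^sub>1, \<alpha>', \<beta>\<^sub>2) = complex_of_real (sqrt (label_lam (bar_label \<alpha>'))) \<odot>
    bar \<beta>\<^sub>2 (bar_label \<alpha>') (\<xi> (\<beta>\<^sub>2, bar_label \<alpha>', \<beta>\<^sub>1))"
  using assms by (simp add: tomita_S_def Let_def)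

lemma bar_homT: "(\<beta>\<^sub>2, \<alpha>, \<beta>\<^sub>1) \<in> triples \<Longrightarrow> x \<in> homT (\<beta>\<^sub>2, \<alpha>, \<beta>\<^sub>1) \<Longrightarrow>
    bar \<beta>\<^sub>2 \<alpha> x \<in> homT (\<beta>\<^sub>1, bar_label \<alpha>, \<beta>\<^sub>2)"
  using bar_in(1) by (simp add: homT_def)

lemma tomita_S_in [simp]:
  assumes \<xi>: "\<xi> \<in> H"
  shows "tomita_S \<xi> \<in> H"
  unfolding H_iff
proof (intro conjI ballI)
  show "tomita_S \<xi> \<in> extensional triples" by (simp add: tomita_S_def)
  show "tomita_S \<xi> t \<in> homT t" if "t \<in> triples" for t
    using that \<xi> bar_homT[of _ "bar_label _"]
    by (elim tripleE) (auto simp: tomita_S_apply H_hom)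
  show "finite (suppT (tomita_S \<xi>))"
  proof (rule finite_subset)
    show "suppT (tomita_S \<xi>) \<subseteq> (\<lambda>(\<beta>\<^sub>2, \<alpha>, \<beta>\<^sub>1). (\<beta>\<^sub>1, bar_label \<alpha>, \<beta>\<^sub>2)) ` suppT \<xi>"
    proof
      fix t assume t: "t \<in> suppT (tomita_S \<xi>)"
      then obtain \<beta>\<^sub>1 \<alpha> \<beta>\<^sub>2 where t': "t = (\<beta>\<^sub>1, \<alpha>, \<beta>\<^sub>2)" "\<beta>\<^sub>1 \<in> S" "\<alpha> \<in> \<Lambda>" "\<beta>\<^sub>2 \<in> S"
        by (auto simp: suppT_def elim: tripleE)
      have "(\<beta>\<^sub>2, bar_label \<alpha>, \<beta>\<^sub>1) \<in> suppT \<xi>"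
      proof (rule ccontr)
        assume "(\<beta>\<^sub>2, bar_label \<alpha>, \<beta>\<^sub>1) \<notin> suppT \<xi>"
        then have "\<xi> (\<beta>\<^sub>2, bar_label \<alpha>, \<beta>\<^sub>1) = zer C \<beta>\<^sub>1 (\<beta>\<^sub>2 \<box> label_obj (bar_label \<alpha>))"
          using t' by (simp add: suppT_def zT_def)
        then have "tomita_S \<xi> t = zT t" using t' by (simp add: tomita_S_apply zT_def)
        then show False using t by (simp add: suppT_def)
      qed
      then show "t \<in> (\<lambda>(\<beta>\<^sub>2, \<alpha>, \<beta>\<^sub>1). (\<beta>\<^sub>1, bar_label \<alpha>, \<beta>\<^sub>2)) ` suppT \<xi>" using t'(1) by force
    qed
    show "finite ((\<lambda>(\<beta>\<^sub>2, \<alpha>, \<beta>\<^sub>1). (\<beta>\<^sub>1, bar_label \<alpha>, \<beta>\<^sub>2)) ` suppT \<xi>)" using \<xi> by (simp add: H_iff)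
  qed
qed

lemma label_lam_pos: "\<alpha> \<in> \<Lambda> \<Longrightarrow> label_lam \<alpha> > 0"
  using lam_pos by (auto simp: \<Lambda>_def)

lemma label_lam_bar: "\<alpha> \<in> \<Lambda> \<Longrightarrow> label_lam (bar_label \<alpha>) = 1 / label_lam \<alpha>"
  by (cases \<alpha>) auto

lemma sqrt_label_lam_bar: "\<alpha> \<in> \<Lambda> \<Longrightarrow> sqrt (label_lam \<alpha>) * sqrt (label_lam (bar_label \<alpha>)) = 1"
  using label_lam_pos[of \<alpha>] by (simp add: label_lam_bar flip: real_sqrt_mult)

text \<open>\<open>bar\<close> is involutive, the weights \<open>sqrt (label_lam \<alpha>)\<close>
  are real and so pass through it unchanged, and the weights of a label and its conjugate multiply
  to 1.\<close>

lemma tomita_S_tomita_S [simp]: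
  assumes \<xi>: "\<xi> \<in> H"
  shows "tomita_S (tomita_S \<xi>) = \<xi>"
proof (rule H_eqI)
  fix t assume "t \<in> triples"
  then obtain \<beta>\<^sub>2 \<alpha> \<beta>\<^sub>1 where t: "t = (\<beta>\<^sub>2, \<alpha>, \<beta>\<^sub>1)" "\<beta>\<^sub>2 \<in> S" "\<alpha> \<in> \<Lambda>" "\<beta>\<^sub>1 \<in> S" by (rule tripleE)
  let ?x = "\<xi> (\<beta>\<^sub>2, \<alpha>, \<beta>\<^sub>1)"
  have x: "?x \<in> hom C \<beta>\<^sub>1 (\<beta>\<^sub>2 \<box> label_obj \<alpha>)" using t \<xi> by simp
  note b = bar_in(1)[OF t(4,2,3) x]
  have "tomita_S (tomita_S \<xi>) t = complex_of_real (sqrt (label_lam (bar_label \<alpha>))) \<odot>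
    bar \<beta>\<^sub>1 (bar_label \<alpha>) (complex_of_real (sqrt (label_lam \<alpha>)) \<odot> bar \<beta>\<^sub>2 \<alpha> ?x)"
    using t by (simp add: tomita_S_apply)
  also have "bar \<beta>\<^sub>1 (bar_label \<alpha>) (complex_of_real (sqrt (label_lam \<alpha>)) \<odot> bar \<beta>\<^sub>2 \<alpha> ?x) =
      complex_of_real (sqrt (label_lam \<alpha>)) \<odot> ?x"
    using bar_scl[OF t(2,4) _ b] bar_bar[OF t(4,2,3) x] t(3) by simp
  also have "complex_of_real (sqrt (label_lam (bar_label \<alpha>))) \<odot> (complex_of_real (sqrt (label_lam \<alpha>)) \<odot> ?x) =
      complex_of_real (sqrt (label_lam \<alpha>) * sqrt (label_lam (bar_label \<alpha>))) \<odot> ?x"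
    using scl_mult[OF _ _ x] t
    by (metis (no_types) S_obj label_obj_in mult.commute of_real_mult ten_obj)
  finally show "tomita_S (tomita_S \<xi>) t = \<xi> t"
    using t scl_one[OF _ _ x] by (simp only: sqrt_label_lam_bar) simp
qed (use \<xi> in auto)

lemma tomita_S_hl:
  assumes "(\<beta>\<^sub>2, \<alpha>, \<beta>\<^sub>1) \<in> triples" "x \<in> homT (\<beta>\<^sub>2, \<alpha>, \<beta>\<^sub>1)"
  shows "tomita_S (hl (\<beta>\<^sub>2, \<alpha>, \<beta>\<^sub>1) x) =
    hl (\<beta>\<^sub>1, bar_label \<alpha>, \<beta>\<^sub>2) (complex_of_real (sqrt (label_lam \<alpha>)) \<odot> bar \<beta>\<^sub>2 \<alpha> x)"
proof (rule H_eqI)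
  have b: "(\<beta>\<^sub>1, bar_label \<alpha>, \<beta>\<^sub>2) \<in> triples" using assms(1) by simp
  then show "hl (\<beta>\<^sub>1, bar_label \<alpha>, \<beta>\<^sub>2) (complex_of_real (sqrt (label_lam \<alpha>)) \<odot> bar \<beta>\<^sub>2 \<alpha> x) \<in> H"
    using bar_homT[OF assms] by simp
  fix t assume "t \<in> triples"
  then obtain \<gamma>\<^sub>1 \<alpha>' \<gamma>\<^sub>2 where t: "t = (\<gamma>\<^sub>1, \<alpha>', \<gamma>\<^sub>2)" "\<gamma>\<^sub>1 \<in> S" "\<alpha>' \<in> \<Lambda>" "\<gamma>\<^sub>2 \<in> S" by (rule tripleE)
  have iff: "(\<gamma>\<^sub>2, bar_label \<alpha>', \<gamma>\<^sub>1) = (\<beta>\<^sub>2, \<alpha>, \<beta>\<^sub>1) \<longleftrightarrow> t = (\<beta>\<^sub>1, bar_label \<alpha>, \<beta>\<^sub>2)"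
    using t(1) bar_label_bar by auto
  show "tomita_S (hl (\<beta>\<^sub>2, \<alpha>, \<beta>\<^sub>1) x) t =
      hl (\<beta>\<^sub>1, bar_label \<alpha>, \<beta>\<^sub>2) (complex_of_real (sqrt (label_lam \<alpha>)) \<odot> bar \<beta>\<^sub>2 \<alpha> x) t"
  proof (cases "t = (\<beta>\<^sub>1, bar_label \<alpha>, \<beta>\<^sub>2)")
    case True
    then show ?thesis using t by (simp add: tomita_S_apply hl_apply)
  next
    case False
    then have "hl (\<beta>\<^sub>2, \<alpha>, \<beta>\<^sub>1) x (\<gamma>\<^sub>2, bar_label \<alpha>', \<gamma>\<^sub>1) = zT (\<gamma>\<^sub>2, bar_label \<alpha>', \<gamma>\<^sub>1)"
      using iff t by (auto simp: hl_apply)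
    then show ?thesis using False t(2-4) unfolding t(1)
      by (auto simp: tomita_S_apply hl_apply homT_simps)
  qed
qed (use assms in auto)

section \<open>Inner products of words\<close>

lemma word_ip_length: "length u \<noteq> length w \<Longrightarrow> word_ip a u w = (\<lambda>_. 0)"
  by (induction a u w rule: word_ip.induct) auto

lemma word_ip_nonzero: "word_ip a u w \<beta> \<noteq> 0 \<Longrightarrow> length u = length w"
  using word_ip_length by metis

lemma lact_add: "\<zeta> \<in> H \<Longrightarrow> lact (\<lambda>\<beta>. a \<beta> + b \<beta>) \<zeta> = hadd (lact a \<zeta>) (lact b \<zeta>)"
  by (rule H_eqI) (auto simp: lact_apply hadd_apply H_hom homT_pls_scl)

lemma lact_mult: "\<zeta> \<in> H \<Longrightarrow> lact (\<lambda>\<beta>. c * a \<beta>) \<zeta> = hscale c (lact a \<zeta>)"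
  by (rule H_eqI) (auto simp: lact_apply hscale_apply H_hom homT_scl_scl)

lemma word_ip_add: "set u \<subseteq> H \<Longrightarrow> set w \<subseteq> H \<Longrightarrow>
    word_ip (\<lambda>\<beta>. a \<beta> + b \<beta>) u w = (\<lambda>\<beta>. word_ip a u w \<beta> + word_ip b u w \<beta>)"
proof (induction u arbitrary: w a b)
  case Nil
  then show ?case by (cases w) auto
next
  case (Cons \<xi> u)
  show ?case
  proof (cases w)
    case (Cons \<zeta> w')
    then have "hip \<xi> (lact (\<lambda>\<beta>. a \<beta> + b \<beta>) \<zeta>) = (\<lambda>\<beta>. hip \<xi> (lact a \<zeta>) \<beta> + hip \<xi> (lact b \<zeta>) \<beta>)"
      using Cons.prems by (auto simp: lact_add hip_add)
    then show ?thesis using Cons Cons.prems Cons.IH by simp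
  qed simp
qed

lemma word_ip_mult: "set u \<subseteq> H \<Longrightarrow> set w \<subseteq> H \<Longrightarrow>
    word_ip (\<lambda>\<beta>. c * a \<beta>) u w = (\<lambda>\<beta>. c * word_ip a u w \<beta>)"
proof (induction u arbitrary: w a)
  case Nil
  then show ?case by (cases w) auto
next
  case (Cons \<xi> u)
  show ?case
  proof (cases w)
    case (Cons \<zeta> w')
    then have "hip \<xi> (lact (\<lambda>\<beta>. c * a \<beta>) \<zeta>) = (\<lambda>\<beta>. c * hip \<xi> (lact a \<zeta>) \<beta>)"
      using Cons.prems by (auto simp: lact_mult hip_scale)
    then show ?thesis using Cons Cons.prems Cons.IH by simp
  qed simp
qed

lemma word_ip_hadd:
  "set u \<subseteq> H \<Longrightarrow> set w \<subseteq> H \<Longrightarrow> set w' \<subseteq> H \<Longrightarrow> \<xi> \<in> H \<Longrightarrow> \<zeta> \<in> H \<Longrightarrow>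
    word_ip a u (w @ hadd \<xi> \<zeta> # w') \<beta> = word_ip a u (w @ \<xi> # w') \<beta> + word_ip a u (w @ \<zeta> # w') \<beta>"
proof (induction w arbitrary: u a)
  case Nil
  show ?case
  proof (cases u)
    case (Cons \<mu> u')
    have "hip \<mu> (lact a (hadd \<xi> \<zeta>)) = (\<lambda>\<beta>. hip \<mu> (lact a \<xi>) \<beta> + hip \<mu> (lact a \<zeta>) \<beta>)"
      using Nil Cons by (auto simp: lact_hadd hip_add)
    then show ?thesis using Cons Nil by (simp add: word_ip_add)
  qed simp
next
  case (Cons \<nu> w)
  then show ?case by (cases u) auto
qed

lemma word_ip_hscale:
  "set u \<subseteq> H \<Longrightarrow> set w \<subseteq> H \<Longrightarrow> set w' \<subseteq> H \<Longrightarrow> \<xi> \<in> H \<Longrightarrow>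
    word_ip a u (w @ hscale c \<xi> # w') \<beta> = c * word_ip a u (w @ \<xi> # w') \<beta>"
proof (induction w arbitrary: u a)
  case Nil
  show ?case
  proof (cases u)
    case (Cons \<mu> u')
    have "hip \<mu> (lact a (hscale c \<xi>)) = (\<lambda>\<beta>. c * hip \<mu> (lact a \<xi>) \<beta>)"
      using Nil Cons by (auto simp: lact_hscale hip_scale)
    then show ?thesis using Cons Nil by (simp add: word_ip_mult)
  qed simp
next
  case (Cons \<nu> w)
  then show ?case by (cases u) auto
qed

lemma word_ip_balanced:
  "set u \<subseteq> H \<Longrightarrow> set w \<subseteq> H \<Longrightarrow> set w' \<subseteq> H \<Longrightarrow> \<xi> \<in> H \<Longrightarrow> \<zeta> \<in> H \<Longrightarrow>
    word_ip a u (w @ ract \<xi> b # \<zeta> # w') \<beta> = word_ip a u (w @ \<xi> # lact b \<zeta> # w') \<beta>"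
proof (induction w arbitrary: u a)
  case Nil
  show ?case
  proof (cases u)
    case (Cons \<mu> u')
    have h: "hip \<mu> (lact a (ract \<xi> b)) = (\<lambda>\<beta>. b \<beta> * hip \<mu> (lact a \<xi>) \<beta>)"
      using Nil Cons by (auto simp: lact_ract hip_ract)
    show ?thesis
    proof (cases u')
      case (Cons \<nu> u'')
      then show ?thesis using \<open>u = \<mu> # u'\<close> Nil h by (simp add: lact_lact mult.commute)
    qed (use \<open>u = \<mu> # u'\<close> in simp)
  qed simp
next
  case (Cons \<nu> w)
  then show ?case by (cases u) auto
qed

lemma word_ip_cnj: "set u \<subseteq> H \<Longrightarrow> set w \<subseteq> H \<Longrightarrow>
    word_ip (\<lambda>\<beta>. cnj (a \<beta>)) w u \<beta> = cnj (word_ip a u w \<beta>)"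
proof (induction u arbitrary: w a)
  case Nil
  then show ?case by (cases w) auto
next
  case (Cons \<xi> u)
  show ?case
  proof (cases w)
    case (Cons \<zeta> w')
    have "hip \<zeta> (lact (\<lambda>\<beta>. cnj (a \<beta>)) \<xi>) = (\<lambda>\<beta>. cnj (hip \<xi> (lact a \<zeta>) \<beta>))"
      using Cons Cons.prems hip_cnj[of \<xi> "lact a \<zeta>"] hip_lact_left[of \<zeta> \<xi> a] by (auto simp: hip_lact_left)
    then show ?thesis using Cons Cons.prems Cons.IH by simp
  qed simp
qed

lemma unitA_cnj [simp]: "(\<lambda>\<beta>. cnj (unitA \<beta>)) = unitA"
  by (auto simp: unitA_def)

lemma word_ip_unitA_cnj: "set u \<subseteq> H \<Longrightarrow> set w \<subseteq> H \<Longrightarrow> word_ip unitA w u \<beta> = cnj (word_ip unitA u w \<beta>)"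
  using word_ip_cnj[of u w unitA] by simp

text \<open>The recursion consumes words from the left. Seen from the right end, the inner product
  of the prefixes acts as a left multiplier on the last letter; this form suits operators acting on
  the right.\<close>

lemma word_ip_snoc: "length u = length w \<Longrightarrow>
    word_ip a (u @ [\<xi>]) (w @ [\<zeta>]) = hip \<xi> (lact (word_ip a u w) \<zeta>)"
  by (induction u w arbitrary: a rule: list_induct2) auto

lemma finite_word_ip_support:
  assumes "u \<noteq> []" "set u \<subseteq> H" "set w \<subseteq> H"
  shows "finite {\<beta>. word_ip a u w \<beta> \<noteq> 0}"
proof (cases "length u = length w")
  case True
  then obtain u' \<xi> w' \<zeta> where "u = u' @ [\<xi>]" "w = w' @ [\<zeta>]"
    using assms(1) by (metis length_0_conv rev_exhaust)
  then show ?thesis using True assms by (simp add: word_ip_snoc finite_hip_support)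
qed (simp add: word_ip_length)

text \<open>Induction on the length, with an arbitrary positive matrix of starting elements, since
  the first letters turn even a constant start into such a matrix. The new matrix is a sum, over the
  components of these letters, of Schur products of the old one with Gram matrices.\<close>

lemma word_ip_psd:
  assumes "finite J" "\<And>i. i \<in> J \<Longrightarrow> set (u i) \<subseteq> H \<and> length (u i) = n"
    and "\<And>\<beta>. \<beta> \<in> S \<Longrightarrow> psd J (\<lambda>i j. a i j \<beta>)" "\<beta> \<in> S"
  shows "psd J (\<lambda>i j. word_ip (a i j) (u i) (u j) \<beta>)"
  using assms(2-)
proof (induction n arbitrary: u a \<beta>)
  case 0
  then show ?case using psd_cong[of J "\<lambda>i j. word_ip (a i j) (u i) (u j) \<beta>" "\<lambda>i j. a i j \<beta>"] by auto
next
  case (Suc n)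
  have u: "u i = hd (u i) # tl (u i)" "hd (u i) \<in> H" "set (tl (u i)) \<subseteq> H" "length (tl (u i)) = n"
    if "i \<in> J" for i using Suc.prems(1)[OF that] by (cases "u i"; auto)+
  let ?a = "\<lambda>i j. hip (hd (u i)) (lact (a i j) (hd (u j)))"
  have "psd J (\<lambda>i j. ?a i j \<gamma>)" if \<gamma>: "\<gamma> \<in> S" for \<gamma>
  proof -
    define F where "F = (\<Union>i\<in>J. supp (hd (u i)) \<gamma>)"
    have F: "finite F" "F \<subseteq> S \<times> \<Lambda>" using assms(1) u \<gamma> finite_supp supp_subset unfolding F_def by blast+
    have A: "psd J (\<lambda>i j. \<Sum>p\<in>F. a i j (fst p) *
        ipm \<gamma> (hd (u i) (fst p, snd p, \<gamma>)) (hd (u j) (fst p, snd p, \<gamma>)))"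
    proof (rule psd_sum[OF F(1)], rule schur_product[OF assms(1)])
      fix p assume "p \<in> F"
      then have p: "fst p \<in> S" "snd p \<in> \<Lambda>" using F(2) by auto
      then show "psd J (\<lambda>i j. a i j (fst p))" using Suc.prems by auto
      show "psd J (\<lambda>i j. ipm \<gamma> (hd (u i) (fst p, snd p, \<gamma>)) (hd (u j) (fst p, snd p, \<gamma>)))"
        by (rule psd_ipm[where Y = "fst p \<box> label_obj (snd p)"]) (use assms(1) p \<gamma> u in auto)
    qed
    have B: "?a i j \<gamma> = (\<Sum>p\<in>F. a i j (fst p) *
        ipm \<gamma> (hd (u i) (fst p, snd p, \<gamma>)) (hd (u j) (fst p, snd p, \<gamma>)))" if "i \<in> J" "j \<in> J" for i j
      by (rule hip_lact_sum) (use F u that \<gamma> in \<open>auto simp: F_def\<close>)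
    show ?thesis by (rule iffD2[OF psd_cong[OF B] A])
  qed
  then have A: "psd J (\<lambda>i j. word_ip (?a i j) (tl (u i)) (tl (u j)) \<beta>)"
    by (intro Suc.IH) (use u Suc.prems in auto)
  have B: "word_ip (a i j) (u i) (u j) \<beta> = word_ip (?a i j) (tl (u i)) (tl (u j)) \<beta>"
    if "i \<in> J" "j \<in> J" for i j
    using u(1)[OF that(1)] u(1)[OF that(2)] by (metis word_ip.simps(2))
  show ?case by (rule iffD2[OF psd_cong[OF B] A])
qed

text \<open>Words of different length are orthogonal, so the form splits into blocks of constant
  length. In each block the start is a constant matrix with a nonnegative entry.\<close>

lemma word_ip_psd_words:
  assumes X: "finite X" "\<And>u. u \<in> X \<Longrightarrow> set u \<subseteq> H" and a: "\<And>\<beta>. \<beta> \<in> S \<Longrightarrow> a \<beta> = complex_of_real (b \<beta>) \<and> 0 \<le> b \<beta>"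
    and \<beta>: "\<beta> \<in> S"
  shows "0 \<le> Re (qform X (\<lambda>u w. word_ip a u w \<beta>) c)"
proof -
  have const: "psd J (\<lambda>i j. a \<gamma>)" if "\<gamma> \<in> S" for \<gamma> and J :: "('o, 'm) hvec list set"
    unfolding psd_def
  proof (intro conjI ballI allI)
    fix c :: "('o, 'm) hvec list \<Rightarrow> complex"
    have "qform J (\<lambda>i j. a \<gamma>) c = a \<gamma> * (cnj (\<Sum>i\<in>J. c i) * (\<Sum>i\<in>J. c i))"
      by (simp add: qform_def cnj_sum sum_product sum_distrib_left mult_ac)
    also have "\<dots> = complex_of_real (b \<gamma> * (cmod (\<Sum>i\<in>J. c i))\<^sup>2)"
      using a[OF that] by (simp only: complex_norm_square mult.commute of_real_mult)
    finally show "0 \<le> Re (qform J (\<lambda>i j. a \<gamma>) c)" using a[OF that] by simp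
    show "a \<gamma> = cnj (a \<gamma>)" by (simp add: a[OF that])
  qed
  let ?f = "\<lambda>u w. cnj (c u) * word_ip a u w \<beta> * c w"
  have "qform X (\<lambda>u w. word_ip a u w \<beta>) c = (\<Sum>n\<in>length ` X. \<Sum>u\<in>{u \<in> X. length u = n}. \<Sum>w\<in>X. ?f u w)"
    unfolding qform_def by (rule sum.group[symmetric]) (use X in auto)
  also have "\<dots> = (\<Sum>n\<in>length ` X. qform {u \<in> X. length u = n} (\<lambda>u w. word_ip a u w \<beta>) c)"
    unfolding qform_def
    by (rule sum.cong[OF refl], rule sum.cong[OF refl], rule sum.mono_neutral_right)
       (use X in \<open>auto dest: word_ip_nonzero\<close>)
  also have "0 \<le> Re \<dots>"
    unfolding Re_sum
    by (intro sum_nonneg psdD(2) word_ip_psd) (use X const \<beta> in auto)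
  finally show ?thesis .
qed

end

section \<open>Linear combinations of words\<close>

lemma lookup_pm_scale [simp]: "Poly_Mapping.lookup (pm_scale c x) k = c * Poly_Mapping.lookup x k"
  by (simp add: pm_scale_def map.rep_eq when_def)

interpretation pm: module "pm_scale :: complex \<Rightarrow> ('k \<Rightarrow>\<^sub>0 complex) \<Rightarrow> ('k \<Rightarrow>\<^sub>0 complex)"
  by unfold_locales (auto intro!: poly_mapping_eqI simp: lookup_add algebra_simps)

definition pm_sum :: "('k \<Rightarrow> complex) \<Rightarrow> ('k \<Rightarrow>\<^sub>0 complex) \<Rightarrow> complex" where
  "pm_sum g y = (\<Sum>w\<in>Poly_Mapping.keys y. Poly_Mapping.lookup y w * g w)"

lemma pm_sum_superset:
  assumes "finite A" "Poly_Mapping.keys y \<subseteq> A"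
  shows "pm_sum g y = (\<Sum>w\<in>A. Poly_Mapping.lookup y w * g w)"
  unfolding pm_sum_def by (rule sum.mono_neutral_left) (use assms in \<open>auto simp: in_keys_iff\<close>)

lemma pm_sum_add: "pm_sum g (x + y) = pm_sum g x + pm_sum g y"
proof -
  let ?A = "Poly_Mapping.keys x \<union> Poly_Mapping.keys y"
  have "Poly_Mapping.keys (x + y) \<subseteq> ?A" by (rule keys_add)
  then show ?thesis
    by (simp add: pm_sum_superset[of ?A] lookup_add algebra_simps sum.distrib)
qed

lemma pm_sum_scale: "pm_sum g (pm_scale c x) = c * pm_sum g x"
proof -
  have "Poly_Mapping.keys (pm_scale c x) \<subseteq> Poly_Mapping.keys x" by (auto simp: in_keys_iff)
  then show ?thesis
    by (simp add: pm_sum_superset[of "Poly_Mapping.keys x"] sum_distrib_left mult.assoc)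
qed

lemma pm_sum_zero [simp]: "pm_sum g 0 = 0"
  by (simp add: pm_sum_def)

lemma pm_sum_diff: "pm_sum g (x - y) = pm_sum g x - pm_sum g y"
  using pm_sum_add[of g "x - y" y] by simp

lemma pm_sum_word [simp]: "pm_sum g (word u) = g u"
  by (simp add: pm_sum_def)

lemma pm_sum_sum: "pm_sum g (\<Sum>i\<in>A. f i) = (\<Sum>i\<in>A. pm_sum g (f i))"
  by (induction A rule: infinite_finite_induct) (auto simp: pm_sum_add)

lemma pm_sum_linear: "pm_sum g (pm_linear f x) = pm_sum (\<lambda>u. pm_sum g (f u)) x"
  by (simp add: pm_linear_def pm_sum_sum pm_sum_scale pm_sum_def[of "\<lambda>u. pm_sum g (f u)"])

lemma lookup_pm_linear: "Poly_Mapping.lookup (pm_linear f x) k = pm_sum (\<lambda>u. Poly_Mapping.lookup (f u) k) x"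
  by (simp add: pm_linear_def lookup_sum pm_sum_def)

lemma pm_linear_add: "pm_linear f (x + y) = pm_linear f x + pm_linear f y"
  by (rule poly_mapping_eqI) (simp add: lookup_pm_linear lookup_add pm_sum_add)

lemma pm_linear_scale: "pm_linear f (pm_scale c x) = pm_scale c (pm_linear f x)"
  by (rule poly_mapping_eqI) (simp add: lookup_pm_linear pm_sum_scale)

lemma pm_linear_word [simp]: "pm_linear f (word u) = f u"
  by (rule poly_mapping_eqI) (simp add: lookup_pm_linear)

lemma pm_linear_zero [simp]: "pm_linear f 0 = 0"
  by (rule poly_mapping_eqI) (simp add: lookup_pm_linear)

lemma keys_pm_linear: "Poly_Mapping.keys (pm_linear f x) \<subseteq> (\<Union>u\<in>Poly_Mapping.keys x. Poly_Mapping.keys (f u))"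
proof
  fix k assume "k \<in> Poly_Mapping.keys (pm_linear f x)"
  then have "(\<Sum>u\<in>Poly_Mapping.keys x. Poly_Mapping.lookup x u * Poly_Mapping.lookup (f u) k) \<noteq> 0"
    by (simp add: in_keys_iff lookup_pm_linear pm_sum_def)
  then obtain u where "u \<in> Poly_Mapping.keys x" "Poly_Mapping.lookup x u * Poly_Mapping.lookup (f u) k \<noteq> 0"
    by (rule sum.not_neutral_contains_not_neutral)
  then show "k \<in> (\<Union>u\<in>Poly_Mapping.keys x. Poly_Mapping.keys (f u))" by (force simp: in_keys_iff)
qed

lemma pm_sum_cong: "(\<And>u. u \<in> Poly_Mapping.keys x \<Longrightarrow> f u = g u) \<Longrightarrow> pm_sum f x = pm_sum g x"
  by (simp add: pm_sum_def)

lemma pm_sum_mult: "pm_sum (\<lambda>u. c * f u) x = c * pm_sum f x"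
  by (simp add: pm_sum_def sum_distrib_left mult_ac)

lemma pm_sum_plus: "pm_sum (\<lambda>u. f u + g u) x = pm_sum f x + pm_sum g x"
  by (simp add: pm_sum_def sum.distrib algebra_simps)

lemma pm_sum_0 [simp]: "pm_sum (\<lambda>u. 0) x = 0"
  by (simp add: pm_sum_def)

context fock_category
begin

section \<open>The algebra-valued form on combinations of words\<close>

lemma free_words_0 [simp]: "0 \<in> free_words"
  by (simp add: free_words_def)

lemma free_words_add [simp]: "x \<in> free_words \<Longrightarrow> y \<in> free_words \<Longrightarrow> x + y \<in> free_words"
  using keys_add[of x y] by (auto simp: free_words_def)

lemma free_words_scale [simp]: "x \<in> free_words \<Longrightarrow> pm_scale c x \<in> free_words"
  by (auto simp: free_words_def in_keys_iff)

lemma free_words_word [simp]: "word u \<in> free_words \<longleftrightarrow> u \<noteq> [] \<and> set u \<subseteq> H"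
  by (simp add: free_words_def)

lemma free_words_keys: "x \<in> free_words \<Longrightarrow> u \<in> Poly_Mapping.keys x \<Longrightarrow> u \<noteq> [] \<and> set u \<subseteq> H"
  by (simp add: free_words_def)

lemma free_words_linear [simp]:
  assumes "x \<in> free_words" "\<And>u. u \<noteq> [] \<Longrightarrow> set u \<subseteq> H \<Longrightarrow> f u \<in> free_words"
  shows "pm_linear f x \<in> free_words"
  unfolding free_words_def
proof (intro CollectI ballI)
  fix v assume "v \<in> Poly_Mapping.keys (pm_linear f x)"
  then obtain u where "u \<in> Poly_Mapping.keys x" "v \<in> Poly_Mapping.keys (f u)"
    using keys_pm_linear[of f x] by blast
  then show "v \<noteq> [] \<and> set v \<subseteq> H" using free_words_keys assms by blast
qed

text \<open>The two conjugations make it conjugate-linear in \<open>x\<close>, although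
  \<open>pm_sum\<close> is linear.\<close>

definition Wl :: "('o, 'm) words \<Rightarrow> ('o, 'm) hvec list \<Rightarrow> 'o \<Rightarrow> complex" where
  "Wl x w \<beta> = cnj (pm_sum (\<lambda>u. cnj (word_ip unitA u w \<beta>)) x)"

definition Wf :: "('o, 'm) words \<Rightarrow> ('o, 'm) words \<Rightarrow> 'o \<Rightarrow> complex" where
  "Wf x y \<beta> = pm_sum (\<lambda>w. Wl x w \<beta>) y"

lemma Wf_double_sum: "Wf x y \<beta> = (\<Sum>u\<in>Poly_Mapping.keys x. \<Sum>w\<in>Poly_Mapping.keys y.
    cnj (Poly_Mapping.lookup x u) * Poly_Mapping.lookup y w * word_ip unitA u w \<beta>)"
  unfolding Wf_def Wl_def pm_sum_def
  by (subst sum.swap) (simp add: cnj_sum sum_distrib_left mult_ac)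

lemma Wf_add: "Wf x (y + z) \<beta> = Wf x y \<beta> + Wf x z \<beta>"
  and Wf_diff: "Wf x (y - z) \<beta> = Wf x y \<beta> - Wf x z \<beta>"
  and Wf_scale: "Wf x (pm_scale c y) \<beta> = c * Wf x y \<beta>"
  and Wf_word: "Wf x (word w) \<beta> = Wl x w \<beta>"
  and Wf_zero: "Wf x 0 \<beta> = 0"
  and Wf_linear: "Wf x (pm_linear f y) \<beta> = pm_sum (\<lambda>w. Wf x (f w) \<beta>) y"
  by (simp_all add: Wf_def pm_sum_add pm_sum_diff pm_sum_scale pm_sum_linear)

lemma Wf_left: "Wf x y \<beta> = cnj (pm_sum (\<lambda>u. cnj (Wf (word u) y \<beta>)) x)"
proof -
  have "Wf (word u) y \<beta> = (\<Sum>w\<in>Poly_Mapping.keys y. Poly_Mapping.lookup y w * word_ip unitA u w \<beta>)" for u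
    by (simp add: Wf_def Wl_def pm_sum_def[of _ y])
  then show ?thesis
    unfolding Wf_double_sum[of x y] pm_sum_def[of _ x]
    by (simp add: cnj_sum sum_distrib_left mult.assoc)
qed

lemma Wf_add_left: "Wf (y + z) x \<beta> = Wf y x \<beta> + Wf z x \<beta>"
  and Wf_scale_left: "Wf (pm_scale c y) x \<beta> = cnj c * Wf y x \<beta>"
  and Wf_zero_left: "Wf 0 x \<beta> = 0"
  and Wf_linear_left: "Wf (pm_linear f y) x \<beta> = cnj (pm_sum (\<lambda>u. cnj (Wf (f u) x \<beta>)) y)"
proof -
  define g where "g u = cnj (Wf (word u) x \<beta>)" for u
  have e: "Wf v x \<beta> = cnj (pm_sum g v)" for v unfolding g_def by (rule Wf_left)
  show "Wf (y + z) x \<beta> = Wf y x \<beta> + Wf z x \<beta>" "Wf (pm_scale c y) x \<beta> = cnj c * Wf y x \<beta>"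
    "Wf 0 x \<beta> = 0" "Wf (pm_linear f y) x \<beta> = cnj (pm_sum (\<lambda>u. cnj (Wf (f u) x \<beta>)) y)"
    by (simp_all add: e pm_sum_add pm_sum_scale pm_sum_linear)
qed

lemma Wf_word_word: "Wf (word u) (word w) \<beta> = word_ip unitA u w \<beta>"
  by (simp add: Wf_word Wl_def)

lemma Wf_cnj:
  assumes "x \<in> free_words" "y \<in> free_words"
  shows "Wf y x \<beta> = cnj (Wf x y \<beta>)"
proof -
  have "Wf y x \<beta> = (\<Sum>w\<in>Poly_Mapping.keys x. \<Sum>u\<in>Poly_Mapping.keys y.
      cnj (Poly_Mapping.lookup y u) * Poly_Mapping.lookup x w * cnj (word_ip unitA w u \<beta>))"
    unfolding Wf_double_sum
    by (subst sum.swap, intro sum.cong refl) (use assms free_words_keys word_ip_unitA_cnj in metis)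
  then show ?thesis by (simp add: Wf_double_sum cnj_sum mult_ac)
qed

lemma Wf_adjoint:
  assumes "\<And>u w. u \<in> Poly_Mapping.keys x \<Longrightarrow> w \<in> Poly_Mapping.keys y \<Longrightarrow>
    Wf (word u) (f w) \<beta> = Wf (g u) (word w) \<beta>"
  shows "Wf x (pm_linear f y) \<beta> = Wf (pm_linear g x) y \<beta>"
proof -
  have "Wf x (pm_linear f y) \<beta> = pm_sum (\<lambda>w. cnj (pm_sum (\<lambda>u. cnj (Wf (word u) (f w) \<beta>)) x)) y"
    unfolding Wf_linear by (subst Wf_left) simp
  also have "\<dots> = pm_sum (\<lambda>w. cnj (pm_sum (\<lambda>u. cnj (Wf (g u) (word w) \<beta>)) x)) y"
    using assms by (intro pm_sum_cong arg_cong[of _ _ cnj]) auto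
  also have "\<dots> = cnj (pm_sum (\<lambda>u. cnj (pm_sum (\<lambda>w. Wf (g u) (word w) \<beta>) y)) x)"
    unfolding pm_sum_def
    by (simp add: cnj_sum sum_distrib_left) (subst sum.swap, simp add: mult_ac)
  also have "\<dots> = Wf (pm_linear g x) y \<beta>"
    unfolding Wf_linear_left by (simp add: Wf_word) (simp add: Wf_def)
  finally show ?thesis .
qed

lemma Wl_relations:
  assumes x: "x \<in> free_words" and s: "set w \<subseteq> H" "set w' \<subseteq> H" "\<xi> \<in> H" "\<zeta> \<in> H"
  shows "Wl x (w @ hadd \<xi> \<zeta> # w') \<beta> = Wl x (w @ \<xi> # w') \<beta> + Wl x (w @ \<zeta> # w') \<beta>"
    and "Wl x (w @ hscale c \<xi> # w') \<beta> = c * Wl x (w @ \<xi> # w') \<beta>"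
    and "Wl x (w @ ract \<xi> b # \<zeta> # w') \<beta> = Wl x (w @ \<xi> # lact b \<zeta> # w') \<beta>"
proof -
  note k = free_words_keys[OF x]
  show "Wl x (w @ hadd \<xi> \<zeta> # w') \<beta> = Wl x (w @ \<xi> # w') \<beta> + Wl x (w @ \<zeta> # w') \<beta>"
  proof -
    have "pm_sum (\<lambda>u. cnj (word_ip unitA u (w @ hadd \<xi> \<zeta> # w') \<beta>)) x =
      pm_sum (\<lambda>u. cnj (word_ip unitA u (w @ \<xi> # w') \<beta>) + cnj (word_ip unitA u (w @ \<zeta> # w') \<beta>)) x"
      using k s by (intro pm_sum_cong) (simp add: word_ip_hadd)
    then show ?thesis by (simp add: Wl_def pm_sum_plus)
  qed
  have "pm_sum (\<lambda>u. cnj (word_ip unitA u (w @ hscale c \<xi> # w') \<beta>)) x =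
      pm_sum (\<lambda>u. cnj c * cnj (word_ip unitA u (w @ \<xi> # w') \<beta>)) x"
    using k s by (intro pm_sum_cong) (simp add: word_ip_hscale)
  then show "Wl x (w @ hscale c \<xi> # w') \<beta> = c * Wl x (w @ \<xi> # w') \<beta>"
    by (simp add: Wl_def pm_sum_mult)
  show "Wl x (w @ ract \<xi> b # \<zeta> # w') \<beta> = Wl x (w @ \<xi> # lact b \<zeta> # w') \<beta>"
    unfolding Wl_def by (intro arg_cong[of _ _ cnj] pm_sum_cong) (use k s in \<open>simp add: word_ip_balanced\<close>)
qed

text \<open>The form vanishes on each kind of relator, so it descends to the tensor product over the
  algebra and does not depend on the representatives taken by \<open>rep\<close>.\<close>

lemma Wf_span:
  assumes x: "x \<in> free_words" and y: "y \<in> pm.span relators"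
  shows "Wf x y \<beta> = 0"
  using y
proof (induction rule: pm.span_induct)
  case base
  show ?case by (auto simp: pm.subspace_def Wf_zero Wf_add Wf_scale)
next
  case (step y)
  then show ?case
    by (auto simp: relators_def Wf_diff Wf_scale Wf_word Wl_relations[OF x])
qed

lemma rep_tensor_class:
  assumes x: "x \<in> free_words"
  shows "rep (tensor_class x) \<in> free_words" "rep (tensor_class x) - x \<in> pm.span relators"
proof -
  have "x \<in> tensor_class x" using x by (simp add: tensor_class_def pm.span_zero)
  then have "rep (tensor_class x) \<in> tensor_class x" unfolding rep_def by (metis someI)
  then show "rep (tensor_class x) \<in> free_words" "rep (tensor_class x) - x \<in> pm.span relators"
    by (auto simp: tensor_class_def)
qed

lemma Wf_rep:
  assumes "x \<in> free_words" "y \<in> free_words"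
  shows "Wf x (rep (tensor_class y)) \<beta> = Wf x y \<beta>" "Wf (rep (tensor_class y)) x \<beta> = Wf y x \<beta>"
proof -
  show 1: "Wf x (rep (tensor_class y)) \<beta> = Wf x y \<beta>"
    using Wf_span[OF assms(1) rep_tensor_class(2)[OF assms(2)], of \<beta>] by (simp add: Wf_diff)
  show "Wf (rep (tensor_class y)) x \<beta> = Wf y x \<beta>"
    using 1 Wf_cnj[OF assms(1) assms(2), of \<beta>] Wf_cnj[OF assms(1) rep_tensor_class(1)[OF assms(2)], of \<beta>]
    by simp
qed

lemma tensor_class_eqI:
  assumes "y - x \<in> pm.span relators"
  shows "tensor_class x = tensor_class y"
proof -
  have "z - x \<in> pm.span relators \<longleftrightarrow> z - y \<in> pm.span relators" for z
    using pm.span_add[OF assms, of "z - y"] pm.span_diff[OF _ assms, of "z - x"] by (auto simp: algebra_simps)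
  then show ?thesis by (simp add: tensor_class_def)
qed

lemma finite_Wf_support:
  assumes "x \<in> free_words" "y \<in> free_words"
  shows "finite {\<beta>. Wf x y \<beta> \<noteq> 0}"
proof (rule finite_subset)
  show "{\<beta>. Wf x y \<beta> \<noteq> 0} \<subseteq>
      (\<Union>u\<in>Poly_Mapping.keys x. \<Union>w\<in>Poly_Mapping.keys y. {\<beta>. word_ip unitA u w \<beta> \<noteq> 0})"
  proof
    fix \<beta> assume "\<beta> \<in> {\<beta>. Wf x y \<beta> \<noteq> 0}"
    then have "Wf x y \<beta> \<noteq> 0" by simp
    then obtain u where u: "u \<in> Poly_Mapping.keys x" "(\<Sum>w\<in>Poly_Mapping.keys y.
      cnj (Poly_Mapping.lookup x u) * Poly_Mapping.lookup y w * word_ip unitA u w \<beta>) \<noteq> 0"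
      unfolding Wf_double_sum by (rule sum.not_neutral_contains_not_neutral)
    from u(2) obtain w where "w \<in> Poly_Mapping.keys y"
      "cnj (Poly_Mapping.lookup x u) * Poly_Mapping.lookup y w * word_ip unitA u w \<beta> \<noteq> 0"
      by (rule sum.not_neutral_contains_not_neutral)
    then show "\<beta> \<in> (\<Union>u\<in>Poly_Mapping.keys x. \<Union>w\<in>Poly_Mapping.keys y. {\<beta>. word_ip unitA u w \<beta> \<noteq> 0})"
      using u(1) by auto
  qed
  show "finite (\<Union>u\<in>Poly_Mapping.keys x. \<Union>w\<in>Poly_Mapping.keys y. {\<beta>. word_ip unitA u w \<beta> \<noteq> 0})"
    using assms free_words_keys finite_word_ip_support by (intro finite_UN_I finite_keys) blast+
qed

lemma qform_scale: "qform J (\<lambda>i j. d * M i j) c = d * qform J M c"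
  by (simp add: qform_def sum_distrib_left mult_ac)

text \<open>The coefficient at \<open>\<beta>\<close> of the inner product of \<open>x\<close> with
  \<open>a x\<close>, where \<open>a\<close> acts from the left. Norms of left operators are
  estimated through it.\<close>

definition Wa :: "('o \<Rightarrow> complex) \<Rightarrow> ('o, 'm) words \<Rightarrow> 'o \<Rightarrow> complex" where
  "Wa a x \<beta> = qform (Poly_Mapping.keys x) (\<lambda>u w. word_ip a u w \<beta>) (Poly_Mapping.lookup x)"

lemma Wa_unitA: "Wa unitA x \<beta> = Wf x x \<beta>"
  by (simp add: Wa_def Wf_double_sum qform_def mult_ac)

lemma Wa_nonneg:
  assumes "x \<in> free_words" "\<beta> \<in> S" "\<And>\<beta>. \<beta> \<in> S \<Longrightarrow> a \<beta> = complex_of_real (b \<beta>) \<and> 0 \<le> b \<beta>"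
  shows "0 \<le> Re (Wa a x \<beta>)"
  unfolding Wa_def by (rule word_ip_psd_words) (use assms free_words_keys in auto)

lemma Wf_nonneg: "x \<in> free_words \<Longrightarrow> \<beta> \<in> S \<Longrightarrow> 0 \<le> Re (Wf x x \<beta>)"
  using Wa_nonneg[of x \<beta> unitA "\<lambda>_. 1"] by (simp add: Wa_unitA unitA_def)

text \<open>The form depends linearly on the starting element, and that of \<open>B - a\<close> is
  nonnegative because this element is.\<close>

lemma Wa_bound:
  assumes x: "x \<in> free_words" and \<beta>: "\<beta> \<in> S"
    and a: "\<And>\<beta>. \<beta> \<in> S \<Longrightarrow> a \<beta> = complex_of_real (b \<beta>) \<and> b \<beta> \<le> B"
  shows "Re (Wa a x \<beta>) \<le> B * Re (Wf x x \<beta>)"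
proof -
  let ?a = "\<lambda>\<beta>. complex_of_real B * unitA \<beta> + (-1) * a \<beta>"
  have "Wa ?a x \<beta> = complex_of_real B * Wa unitA x \<beta> + (-1) * Wa a x \<beta>"
  proof -
    have "Wa ?a x \<beta> = qform (Poly_Mapping.keys x)
        (\<lambda>u w. complex_of_real B * word_ip unitA u w \<beta> + (-1) * word_ip a u w \<beta>) (Poly_Mapping.lookup x)"
      unfolding Wa_def
    proof (rule qform_cong[OF _ refl])
      fix u w assume "u \<in> Poly_Mapping.keys x" "w \<in> Poly_Mapping.keys x"
      then have s: "set u \<subseteq> H" "set w \<subseteq> H" using free_words_keys[OF x] by auto
      show "word_ip ?a u w \<beta> = complex_of_real B * word_ip unitA u w \<beta> + (-1) * word_ip a u w \<beta>"
        unfolding word_ip_add[OF s] word_ip_mult[OF s] ..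
    qed
    then show ?thesis unfolding qform_add qform_scale Wa_def .
  qed
  moreover have "0 \<le> Re (Wa ?a x \<beta>)"
    by (rule Wa_nonneg[OF x \<beta>, of _ "\<lambda>\<beta>. B - b \<beta>"]) (use a in \<open>auto simp: unitA_def\<close>)
  ultimately show ?thesis by (simp add: Wa_unitA)
qed

section \<open>Representatives of Fock space vectors\<close>

type_synonym ('p, 'n) raw = "('p \<Rightarrow> complex) \<times> ('p, 'n) words"

definition cl :: "('o, 'm) raw \<Rightarrow> ('o, 'm) fvec" where
  "cl q = (fst q, tensor_class (snd q))"

definition rw :: "('o, 'm) fvec \<Rightarrow> ('o, 'm) raw" where
  "rw \<zeta> = (fst \<zeta>, rep (snd \<zeta>))"

definition rip :: "('o, 'm) raw \<Rightarrow> ('o, 'm) raw \<Rightarrow> 'o \<Rightarrow> complex" where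
  "rip p q \<beta> = cnj (fst p \<beta>) * fst q \<beta> + Wf (snd p) (snd q) \<beta>"

definition rvip :: "('o, 'm) raw \<Rightarrow> ('o, 'm) raw \<Rightarrow> complex" where
  "rvip p q = \<tau> (rip p q)"

definition l2 :: "('o \<Rightarrow> complex) \<Rightarrow> bool" where
  "l2 a \<longleftrightarrow> (\<lambda>\<beta>. dim \<beta> * (cmod (a \<beta>))\<^sup>2) summable_on S"

text \<open>Finiteness of the trace is a condition on degree 0 only: the inner product in positive
  degree has finite support.\<close>

definition rawc :: "('o, 'm) raw set" where
  "rawc = {q. fst q \<in> \<AA> \<and> l2 (fst q) \<and> snd q \<in> free_words}"

lemma fip_rip: "fip \<zeta> \<zeta>' \<beta> = rip (rw \<zeta>) (rw \<zeta>') \<beta>"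
  by (simp add: fip_def rip_def rw_def Wf_double_sum split: prod.splits)

lemma rip_rw_cl:
  assumes "snd p \<in> free_words" "snd q \<in> free_words"
  shows "rip p (rw (cl q)) \<beta> = rip p q \<beta>" "rip (rw (cl q)) p \<beta> = rip q p \<beta>"
  using Wf_rep[OF assms] by (simp_all add: rip_def rw_def cl_def)

lemma summable_finite_support:
  "finite {\<beta>. (f \<beta> :: complex) \<noteq> 0} \<Longrightarrow> (\<lambda>\<beta>. complex_of_real (dim \<beta>) * f \<beta>) summable_on S"
  by (rule finite_nonzero_values_imp_summable_on) (auto elim: rev_finite_subset)

lemma l2_cross:
  assumes "l2 a" "l2 b"
  shows "(\<lambda>\<beta>. complex_of_real (dim \<beta>) * (cnj (a \<beta>) * b \<beta>)) summable_on S"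
proof -
  have "(\<lambda>\<beta>. dim \<beta> * (cmod (a \<beta>))\<^sup>2 + dim \<beta> * (cmod (b \<beta>))\<^sup>2) summable_on S"
    using assms unfolding l2_def by (rule summable_on_add)
  then have "(\<lambda>\<beta>. norm (complex_of_real (dim \<beta>) * (cnj (a \<beta>) * b \<beta>))) summable_on S"
  proof (rule Infinite_Sum.abs_summable_on_comparison_test')
    fix \<beta> assume "\<beta> \<in> S"
    then have d: "dim \<beta> > 0" by (rule dim_pos)
    have "cmod (a \<beta>) * cmod (b \<beta>) \<le> (cmod (a \<beta>))\<^sup>2 + (cmod (b \<beta>))\<^sup>2"
      using sum_squares_bound[of "cmod (a \<beta>)" "cmod (b \<beta>)"]
        mult_nonneg_nonneg[OF norm_ge_zero[of "a \<beta>"] norm_ge_zero[of "b \<beta>"]] by linarith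
    then show "norm (complex_of_real (dim \<beta>) * (cnj (a \<beta>) * b \<beta>)) \<le>
        dim \<beta> * (cmod (a \<beta>))\<^sup>2 + dim \<beta> * (cmod (b \<beta>))\<^sup>2"
      using d by (simp add: norm_mult flip: distrib_left)
  qed
  then show ?thesis by (rule summable_on_iff_abs_summable_on_complex[THEN iffD2])
qed

lemma l2_iff: "l2 a \<longleftrightarrow> (\<lambda>\<beta>. complex_of_real (dim \<beta>) * (cnj (a \<beta>) * a \<beta>)) summable_on S"
proof
  assume "(\<lambda>\<beta>. complex_of_real (dim \<beta>) * (cnj (a \<beta>) * a \<beta>)) summable_on S"
  then have "(\<lambda>\<beta>. Re (complex_of_real (dim \<beta>) * (cnj (a \<beta>) * a \<beta>))) summable_on S" by (rule summable_on_Re)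
  then show "l2 a" unfolding l2_def by (simp add: cmod_power2 flip: power2_eq_square)
qed (use l2_cross in blast)

lemma l2_add:
  assumes "l2 a" "l2 b"
  shows "l2 (\<lambda>\<beta>. a \<beta> + b \<beta>)"
proof -
  have "(\<lambda>\<beta>. (complex_of_real (dim \<beta>) * (cnj (a \<beta>) * a \<beta>) + complex_of_real (dim \<beta>) * (cnj (a \<beta>) * b \<beta>)) +
      (complex_of_real (dim \<beta>) * (cnj (b \<beta>) * a \<beta>) + complex_of_real (dim \<beta>) * (cnj (b \<beta>) * b \<beta>))) summable_on S"
    by (intro summable_on_add l2_cross assms)
  then show ?thesis by (simp add: l2_iff algebra_simps)
qed

lemma l2_mult:
  assumes "l2 a" "c \<in> \<AA>"
  shows "l2 (\<lambda>\<beta>. c \<beta> * a \<beta>)"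
proof -
  obtain B where B: "\<And>\<beta>. cmod (c \<beta>) \<le> B" using assms(2) by (auto simp: \<AA>_def bounded_iff)
  have "(\<lambda>\<beta>. B\<^sup>2 * (dim \<beta> * (cmod (a \<beta>))\<^sup>2)) summable_on S"
    using assms(1) unfolding l2_def by (rule summable_on_cmult_right)
  then have "(\<lambda>\<beta>. norm (dim \<beta> * (cmod (c \<beta> * a \<beta>))\<^sup>2)) summable_on S"
  proof (rule Infinite_Sum.abs_summable_on_comparison_test')
    fix \<beta> assume "\<beta> \<in> S"
    then have d: "dim \<beta> > 0" by (rule dim_pos)
    have "(cmod (c \<beta>))\<^sup>2 * (dim \<beta> * (cmod (a \<beta>))\<^sup>2) \<le> B\<^sup>2 * (dim \<beta> * (cmod (a \<beta>))\<^sup>2)"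
      using d B[of \<beta>] by (intro mult_right_mono power_mono) auto
    then show "norm (dim \<beta> * (cmod (c \<beta> * a \<beta>))\<^sup>2) \<le> B\<^sup>2 * (dim \<beta> * (cmod (a \<beta>))\<^sup>2)"
      using d by (simp add: norm_mult power_mult_distrib mult_ac)
  qed
  then show ?thesis unfolding l2_def by (rule summable_on_iff_abs_summable_on_real[THEN iffD2])
qed

lemma l2_finite: "finite {\<beta>. a \<beta> \<noteq> 0} \<Longrightarrow> l2 a"
  unfolding l2_iff by (rule summable_finite_support) (auto elim: rev_finite_subset)

lemma AA_0 [simp]: "(\<lambda>_. 0) \<in> \<AA>" and l2_0 [simp]: "l2 (\<lambda>_. 0)"
  by (auto intro: finite_support_AA l2_finite)

lemma AA_iff: "a \<in> \<AA> \<longleftrightarrow> (\<exists>B. \<forall>\<beta>. cmod (a \<beta>) \<le> B) \<and> (\<forall>\<beta>. \<beta> \<notin> S \<longrightarrow> a \<beta> = 0)"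
  by (auto simp: \<AA>_def bounded_iff)

lemma AA_add:
  assumes "a \<in> \<AA>" "b \<in> \<AA>"
  shows "(\<lambda>\<beta>. a \<beta> + b \<beta>) \<in> \<AA>"
proof -
  obtain B D where "\<And>\<beta>. cmod (a \<beta>) \<le> B" "\<And>\<beta>. cmod (b \<beta>) \<le> D" using assms by (auto simp: AA_iff)
  then have "cmod (a \<beta> + b \<beta>) \<le> B + D" for \<beta> by (meson add_mono norm_triangle_le)
  then show ?thesis using assms by (auto simp: AA_iff)
qed

lemma AA_mult:
  assumes "a \<in> \<AA>" "b \<in> \<AA>"
  shows "(\<lambda>\<beta>. a \<beta> * b \<beta>) \<in> \<AA>"
proof -
  obtain B D where BD: "\<And>\<beta>. cmod (a \<beta>) \<le> B" "\<And>\<beta>. cmod (b \<beta>) \<le> D" using assms by (auto simp: AA_iff)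
  have "cmod (a \<beta> * b \<beta>) \<le> B * D" for \<beta>
    unfolding norm_mult by (rule mult_mono[OF BD]) (use BD(1)[of \<beta>] norm_ge_zero[of "a \<beta>"] in linarith, simp)
  then show ?thesis using assms by (auto simp: AA_iff)
qed

lemma AA_scale:
  assumes "a \<in> \<AA>"
  shows "(\<lambda>\<beta>. c * a \<beta>) \<in> \<AA>"
proof -
  obtain B where "\<And>\<beta>. cmod (a \<beta>) \<le> B" using assms by (auto simp: AA_iff)
  then have "cmod (c * a \<beta>) \<le> cmod c * B" for \<beta> unfolding norm_mult by (intro mult_left_mono) auto
  then show ?thesis using assms by (auto simp: AA_iff)
qed

lemma AA_cnj: "a \<in> \<AA> \<Longrightarrow> (\<lambda>\<beta>. cnj (a \<beta>)) \<in> \<AA>"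
  by (auto simp: \<AA>_def bounded_iff)

lemma l2_scale: "l2 a \<Longrightarrow> l2 (\<lambda>\<beta>. c * a \<beta>)"
  unfolding l2_def
  using summable_on_cmult_right[of "\<lambda>\<beta>. dim \<beta> * (cmod (a \<beta>))\<^sup>2" S "(cmod c)\<^sup>2"]
  by (simp add: norm_mult power_mult_distrib mult_ac)

lemma rip_summable:
  assumes "p \<in> rawc" "q \<in> rawc"
  shows "(\<lambda>\<beta>. complex_of_real (dim \<beta>) * rip p q \<beta>) summable_on S"
proof -
  have "(\<lambda>\<beta>. complex_of_real (dim \<beta>) * (cnj (fst p \<beta>) * fst q \<beta>) + complex_of_real (dim \<beta>) * Wf (snd p) (snd q) \<beta>) summable_on S"
    by (intro summable_on_add l2_cross summable_finite_support finite_Wf_support)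
       (use assms in \<open>auto simp: rawc_def\<close>)
  then show ?thesis by (simp add: rip_def algebra_simps)
qed

definition radd :: "('o, 'm) raw \<Rightarrow> ('o, 'm) raw \<Rightarrow> ('o, 'm) raw" where
  "radd p q = (\<lambda>\<beta>. fst p \<beta> + fst q \<beta>, snd p + snd q)"

definition rscale :: "complex \<Rightarrow> ('o, 'm) raw \<Rightarrow> ('o, 'm) raw" where
  "rscale c q = (\<lambda>\<beta>. c * fst q \<beta>, pm_scale c (snd q))"

lemma rawc_ops [simp]:
  "p \<in> rawc \<Longrightarrow> q \<in> rawc \<Longrightarrow> radd p q \<in> rawc"
  "q \<in> rawc \<Longrightarrow> rscale c q \<in> rawc" "(\<lambda>_. 0, 0) \<in> rawc"
  by (auto simp: rawc_def radd_def rscale_def AA_add AA_scale l2_add l2_scale)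

lemma rip_radd: "rip p (radd q q') \<beta> = rip p q \<beta> + rip p q' \<beta>"
  and rip_rscale: "rip p (rscale c q) \<beta> = c * rip p q \<beta>"
  by (simp_all add: rip_def radd_def rscale_def Wf_add Wf_scale algebra_simps)

lemma rip_cnj: "p \<in> rawc \<Longrightarrow> q \<in> rawc \<Longrightarrow> rip q p \<beta> = cnj (rip p q \<beta>)"
  using Wf_cnj[of "snd p" "snd q" \<beta>] by (simp add: rip_def rawc_def mult.commute)

lemma rip_nonneg: "p \<in> rawc \<Longrightarrow> \<beta> \<in> S \<Longrightarrow> 0 \<le> Re (rip p p \<beta>)"
  using Wf_nonneg[of "snd p" \<beta>] by (simp add: rip_def rawc_def)

lemma rvip_radd: "p \<in> rawc \<Longrightarrow> q \<in> rawc \<Longrightarrow> q' \<in> rawc \<Longrightarrow> rvip p (radd q q') = rvip p q + rvip p q'"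
  unfolding rvip_def \<tau>_def rip_radd distrib_left by (intro infsum_add rip_summable)

lemma rvip_rscale: "p \<in> rawc \<Longrightarrow> q \<in> rawc \<Longrightarrow> rvip p (rscale c q) = c * rvip p q"
  unfolding rvip_def \<tau>_def rip_rscale
  using infsum_cmult_right'[of c "\<lambda>\<beta>. complex_of_real (dim \<beta>) * rip p q \<beta>" S] by (simp add: mult_ac)

lemma rvip_cnj: "p \<in> rawc \<Longrightarrow> q \<in> rawc \<Longrightarrow> rvip p q = cnj (rvip q p)"
  unfolding rvip_def \<tau>_def infsum_cnj[symmetric] by (intro infsum_cong) (simp add: rip_cnj[of q p])

lemma Re_rvip: "p \<in> rawc \<Longrightarrow> Re (rvip p p) = (\<Sum>\<^sub>\<infinity>\<beta>\<in>S. dim \<beta> * Re (rip p p \<beta>))"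
  unfolding rvip_def \<tau>_def by (subst infsum_Re[symmetric]) (auto intro: rip_summable)

lemma Re_rip_summable: "p \<in> rawc \<Longrightarrow> (\<lambda>\<beta>. dim \<beta> * Re (rip p p \<beta>)) summable_on S"
  using summable_on_Re[OF rip_summable[of p p]] by simp

lemma rvip_nonneg: "p \<in> rawc \<Longrightarrow> 0 \<le> Re (rvip p p)"
  unfolding Re_rvip by (intro infsum_nonneg mult_nonneg_nonneg rip_nonneg) (auto simp: dim_pos less_imp_le)

text \<open>The part of the inner product coming from words has finite support. Subtracting it
  leaves the square summability of the component in degree 0.\<close>

lemma fock_car_rw:
  assumes "\<zeta> \<in> car fock_pre"
  shows "rw \<zeta> \<in> rawc" "cl (rw \<zeta>) = \<zeta>"
proof -
  obtain a x where \<zeta>: "\<zeta> = (a, tensor_class x)" "a \<in> \<AA>" "x \<in> free_words"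
    and f: "\<tau>_finite (fip \<zeta> \<zeta>)" using assms by (auto simp: fock_pre_def fock_car_def)
  note r = rep_tensor_class[OF \<zeta>(3)]
  have f': "(\<lambda>\<beta>. complex_of_real (dim \<beta>) * rip (rw \<zeta>) (rw \<zeta>) \<beta>) summable_on S"
    using f unfolding \<tau>_finite_def fip_rip .
  have "(\<lambda>\<beta>. complex_of_real (dim \<beta>) * rip (rw \<zeta>) (rw \<zeta>) \<beta> -
      complex_of_real (dim \<beta>) * Wf (rep (tensor_class x)) (rep (tensor_class x)) \<beta>) summable_on S"
  proof -
    have "(\<lambda>\<beta>. complex_of_real (dim \<beta>) * rip (rw \<zeta>) (rw \<zeta>) \<beta> +
      complex_of_real (dim \<beta>) * (- Wf (rep (tensor_class x)) (rep (tensor_class x)) \<beta>)) summable_on S"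
      by (intro summable_on_add summable_finite_support f') (simp add: finite_Wf_support r)
    then show ?thesis by simp
  qed
  then have "l2 a" by (simp add: l2_iff rip_def rw_def \<zeta>(1) algebra_simps)
  then show "rw \<zeta> \<in> rawc" using \<zeta> r by (simp add: rw_def rawc_def)
  show "cl (rw \<zeta>) = \<zeta>"
    using tensor_class_eqI[OF r(2)] by (simp add: cl_def rw_def \<zeta>(1))
qed

lemma cl_in [simp]:
  assumes "q \<in> rawc"
  shows "cl q \<in> car fock_pre"
proof -
  have q: "fst q \<in> \<AA>" "l2 (fst q)" "snd q \<in> free_words" using assms by (auto simp: rawc_def)
  have "rw (cl q) \<in> rawc" using q rep_tensor_class by (simp add: rawc_def rw_def cl_def)
  then have "\<tau>_finite (fip (cl q) (cl q))" unfolding \<tau>_finite_def fip_rip by (intro rip_summable)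
  then show ?thesis using q by (auto simp: fock_pre_def fock_car_def cl_def)
qed

lemma vip_rvip: "vip fock_pre \<zeta> \<zeta>' = rvip (rw \<zeta>) (rw \<zeta>')"
  by (simp add: fock_pre_def rvip_def fip_rip[abs_def])

lemma rvip_rw_cl:
  assumes "p \<in> rawc" "q \<in> rawc"
  shows "rvip p (rw (cl q)) = rvip p q" "rvip (rw (cl q)) p = rvip q p"
  unfolding rvip_def \<tau>_def by (intro infsum_cong; use assms in \<open>simp add: rip_rw_cl rawc_def\<close>)+

lemma vip_cl: "p \<in> rawc \<Longrightarrow> q \<in> rawc \<Longrightarrow> vip fock_pre (cl p) (cl q) = rvip p q"
  by (simp add: vip_rvip rvip_rw_cl fock_car_rw(1))

lemma fock_ops:
  "vadd fock_pre \<zeta> \<zeta>' = cl (radd (rw \<zeta>) (rw \<zeta>'))" "vscale fock_pre c \<zeta> = cl (rscale c (rw \<zeta>))"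
  "vzero fock_pre = cl (\<lambda>_. 0, 0)"
  by (auto simp: fock_pre_def fadd_def fscale_def fzero_def cl_def rw_def radd_def rscale_def split: prod.splits)

lemma fock_pre_inner: "pre_inner fock_pre"
  by unfold_locales
     (auto simp: fock_ops vip_rvip rvip_rw_cl fock_car_rw rvip_radd rvip_rscale rvip_nonneg
       intro: rvip_cnj, simp add: rvip_def \<tau>_def rip_def Wf_zero)

sublocale K: pre_inner fock_pre
  by (rule fock_pre_inner)

sublocale F: hilbert "hilbert_completion fock_pre"
  by (rule K.Hc_hilbert)

definition em :: "('o, 'm) raw \<Rightarrow> (nat \<Rightarrow> ('o, 'm) fvec) set" where
  "em q = K.emb (cl q)"

lemma em_in [simp]: "q \<in> rawc \<Longrightarrow> em q \<in> car K.Hc"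
  by (simp add: em_def)

lemma em_vip: "p \<in> rawc \<Longrightarrow> q \<in> rawc \<Longrightarrow> vip K.Hc (em p) (em q) = rvip p q"
  by (simp add: em_def K.emb_vip vip_cl)

lemma emb_em: "\<zeta> \<in> car fock_pre \<Longrightarrow> K.emb \<zeta> = em (rw \<zeta>)"
  by (simp add: em_def fock_car_rw)

lemma F_ext:
  assumes "X \<in> car K.Hc" "Y \<in> car K.Hc" "\<And>p. p \<in> rawc \<Longrightarrow> vip K.Hc (em p) X = vip K.Hc (em p) Y"
  shows "X = Y"
  by (rule K.Hc_ext_emb[OF assms(1,2)]) (simp add: emb_em assms(3) fock_car_rw)

text \<open>The completion separates vectors by inner products, so equal pairings with all words
  suffice. This replaces the search for an explicit combination of relators each time two
  representatives have to be compared.\<close>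

lemma em_eqI:
  assumes "p \<in> rawc" "q \<in> rawc" "\<And>\<beta>. \<beta> \<in> S \<Longrightarrow> fst p \<beta> = fst q \<beta>"
    and "\<And>x \<beta>. x \<in> free_words \<Longrightarrow> \<beta> \<in> S \<Longrightarrow> Wf x (snd p) \<beta> = Wf x (snd q) \<beta>"
  shows "em p = em q"
proof (rule F_ext)
  fix z assume z: "z \<in> rawc"
  have "rvip z p = rvip z q"
    unfolding rvip_def \<tau>_def rip_def by (intro infsum_cong) (use assms z in \<open>simp add: rawc_def\<close>)
  then show "vip K.Hc (em z) (em p) = vip K.Hc (em z) (em q)" using assms z by (simp add: em_vip)
qed (use assms in auto)

lemma em_radd: "p \<in> rawc \<Longrightarrow> q \<in> rawc \<Longrightarrow> vadd K.Hc (em p) (em q) = em (radd p q)"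
  by (rule F_ext) (auto simp: F.ip_simps em_vip rvip_radd)

lemma em_rscale: "q \<in> rawc \<Longrightarrow> vscale K.Hc c (em q) = em (rscale c q)"
  by (rule F_ext) (auto simp: F.ip_simps em_vip rvip_rscale)

definition lift :: "(('o, 'm) raw \<Rightarrow> ('o, 'm) raw) \<Rightarrow> ('o, 'm) fvec \<Rightarrow> ('o, 'm) fvec" where
  "lift t \<zeta> = cl (t (rw \<zeta>))"

text \<open>A raw operator with a raw adjoint need not respect the equivalence of representatives
  exactly, but it does so modulo null vectors.\<close>

lemma lift_pair:
  assumes t: "\<And>q. q \<in> rawc \<Longrightarrow> t q \<in> rawc" and t': "\<And>q. q \<in> rawc \<Longrightarrow> t' q \<in> rawc"
    and adj: "\<And>p q. p \<in> rawc \<Longrightarrow> q \<in> rawc \<Longrightarrow> rvip p (t q) = rvip (t' p) q"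
  shows "B \<ge> 0 \<Longrightarrow> (\<And>q. q \<in> rawc \<Longrightarrow> Re (rvip (t q) (t q)) \<le> B * Re (rvip q q)) \<Longrightarrow>
      K.adjoint_pair (lift t) (lift t')"
    and "q \<in> rawc \<Longrightarrow> K.emb (lift t (cl q)) = em (t q)"
proof -
  {
    assume B: "B \<ge> 0" "\<And>q. q \<in> rawc \<Longrightarrow> Re (rvip (t q) (t q)) \<le> B * Re (rvip q q)"
    show "K.adjoint_pair (lift t) (lift t')"
    proof (rule K.adjoint_pairI[where B = "sqrt B"])
      fix \<zeta> \<zeta>' assume z: "\<zeta> \<in> car fock_pre" "\<zeta>' \<in> car fock_pre"
      note r = fock_car_rw(1)[OF z(1)] fock_car_rw(1)[OF z(2)]
      show "vip fock_pre \<zeta> (lift t \<zeta>') = vip fock_pre (lift t' \<zeta>) \<zeta>'"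
        using r by (simp add: vip_rvip lift_def rvip_rw_cl t t' adj)
      show "lift t \<zeta> \<in> car fock_pre" "lift t' \<zeta> \<in> car fock_pre" using r t t' by (simp_all add: lift_def)
      have "Re (vip fock_pre (lift t \<zeta>) (lift t \<zeta>)) \<le> B * Re (vip fock_pre \<zeta> \<zeta>)"
        using B(2)[OF r(1)] r t by (simp add: lift_def vip_cl vip_rvip[of \<zeta>])
      then show "vnorm fock_pre (lift t \<zeta>) \<le> sqrt B * vnorm fock_pre \<zeta>"
        by (simp add: vnorm_def flip: real_sqrt_mult)
    qed (use B in auto)
  }
  assume q: "q \<in> rawc"
  show "K.emb (lift t (cl q)) = em (t q)"
  proof (rule F_ext)
    fix p assume p: "p \<in> rawc"
    have c: "rw (cl q) \<in> rawc" using fock_car_rw(1)[OF cl_in[OF q]] .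
    have "vip K.Hc (em p) (K.emb (lift t (cl q))) = rvip p (t (rw (cl q)))"
      using p c t by (simp add: em_def K.emb_vip lift_def vip_cl)
    also have "\<dots> = rvip (t' p) q" using p q c t' by (simp add: adj rvip_rw_cl)
    also have "\<dots> = vip K.Hc (em p) (em (t q))" using p q t by (simp add: em_vip adj)
    finally show "vip K.Hc (em p) (K.emb (lift t (cl q))) = vip K.Hc (em p) (em (t q))" .
  qed (use q t fock_car_rw(1)[OF cl_in[OF q]] in \<open>auto simp: lift_def\<close>)
qed

abbreviation E :: "(('o, 'm) fvec \<Rightarrow> ('o, 'm) fvec) \<Rightarrow>
    (nat \<Rightarrow> ('o, 'm) fvec) set \<Rightarrow> (nat \<Rightarrow> ('o, 'm) fvec) set" where
  "E \<equiv> extend_op fock_pre"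

text \<open>An operator computed on representatives, together with its adjoint. Boundedness sits in
  the last conjunct. The consequence used throughout is that \<open>E (lift t)\<close> sends
  \<open>em q\<close> to \<open>em (t q)\<close>.\<close>

definition raw_pair :: "(('o, 'm) raw \<Rightarrow> ('o, 'm) raw) \<Rightarrow> (('o, 'm) raw \<Rightarrow> ('o, 'm) raw) \<Rightarrow> bool" where
  "raw_pair t t' \<longleftrightarrow> (\<forall>q\<in>rawc. t q \<in> rawc \<and> t' q \<in> rawc) \<and>
     (\<forall>p\<in>rawc. \<forall>q\<in>rawc. rvip p (t q) = rvip (t' p) q) \<and> K.adjoint_pair (lift t) (lift t')"

lemma raw_pairI:
  assumes "\<And>q. q \<in> rawc \<Longrightarrow> t q \<in> rawc" "\<And>q. q \<in> rawc \<Longrightarrow> t' q \<in> rawc"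
    and "\<And>p q. p \<in> rawc \<Longrightarrow> q \<in> rawc \<Longrightarrow> rvip p (t q) = rvip (t' p) q"
    and "B \<ge> 0" "\<And>q. q \<in> rawc \<Longrightarrow> Re (rvip (t q) (t q)) \<le> B * Re (rvip q q)"
  shows "raw_pair t t'"
  using assms(1-3) lift_pair(1)[OF assms] by (auto simp: raw_pair_def)

lemma raw_pairD:
  assumes "raw_pair t t'"
  shows "q \<in> rawc \<Longrightarrow> t q \<in> rawc" "q \<in> rawc \<Longrightarrow> t' q \<in> rawc"
    "p \<in> rawc \<Longrightarrow> q \<in> rawc \<Longrightarrow> rvip p (t q) = rvip (t' p) q"
    "K.adjoint_pair (lift t) (lift t')"
    "q \<in> rawc \<Longrightarrow> E (lift t) (em q) = em (t q)"
proof -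
  show *: "q \<in> rawc \<Longrightarrow> t q \<in> rawc" "q \<in> rawc \<Longrightarrow> t' q \<in> rawc"
    "p \<in> rawc \<Longrightarrow> q \<in> rawc \<Longrightarrow> rvip p (t q) = rvip (t' p) q" "K.adjoint_pair (lift t) (lift t')" for p q
    using assms by (auto simp: raw_pair_def)
  show "E (lift t) (em q) = em (t q)" if "q \<in> rawc"
    using K.extend_op(2)[OF *(4) cl_in[OF that]] lift_pair(2)[of t t', OF *(1-3) that] by (simp add: em_def)
qed

lemma raw_pair_sym:
  assumes "raw_pair t t'"
  shows "raw_pair t' t"
proof -
  note d = raw_pairD[OF assms]
  have "rvip p (t' q) = rvip (t p) q" if "p \<in> rawc" "q \<in> rawc" for p q
    using d(3)[OF that(2,1)] rvip_cnj[of p "t' q"] rvip_cnj[of "t p" q] d(1,2) that by simp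
  then show ?thesis using d K.adjoint_pair_sym[OF d(4)] by (auto simp: raw_pair_def)
qed

end

section \<open>Left operators\<close>

context pre_inner
begin

text \<open>The extension evaluates its operator only on terms of Cauchy sequences, which lie in the
  carrier. There, and not on arbitrary pairs, \<open>\<Gamma> \<xi>\<close> is identified with its
  lifted form.\<close>

lemma extend_op_cong:
  assumes "\<And>x. x \<in> car K \<Longrightarrow> T x = T' x"
  shows "extend_op K T = extend_op K T'"
proof -
  have "T (rep X n) = T' (rep X n)" if "X \<in> car Hc" for X n
    using that assms cauchy_seqsD(1)[OF rep_limit_class(1)] by (auto elim!: Hc_cases)
  then show ?thesis by (simp add: extend_op_def cong: restrict_cong)
qed

lemma adjoint_pair_cong:
  assumes "\<And>x. x \<in> car K \<Longrightarrow> T x = T2 x" "\<And>x. x \<in> car K \<Longrightarrow> T' x = T2' x"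
  shows "adjoint_pair T T' = adjoint_pair T2 T2'"
  using assms by (auto simp: adjoint_pair_def)

end

context fock_category
begin

lemma fadd_cl:
  assumes "snd p \<in> free_words" "snd q \<in> free_words"
  shows "fadd (cl p) (cl q) = cl (radd p q)"
proof -
  let ?x = "snd p" and ?y = "snd q"
  have "(rep (tensor_class ?x) + rep (tensor_class ?y)) - (?x + ?y) =
      (rep (tensor_class ?x) - ?x) + (rep (tensor_class ?y) - ?y)" by simp
  also have "\<dots> \<in> pm.span relators" by (intro pm.span_add rep_tensor_class assms)
  finally show ?thesis
    using tensor_class_eqI by (auto simp: fadd_def cl_def radd_def)
qed

lemma fscale_cl:
  assumes "snd q \<in> free_words"
  shows "vscale fock_pre c (cl q) = cl (rscale c q)"
proof -
  let ?x = "snd q"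
  have "pm_scale c (rep (tensor_class ?x)) - pm_scale c ?x = pm_scale c (rep (tensor_class ?x) - ?x)"
    by (rule pm.scale_right_diff_distrib[symmetric])
  also have "\<dots> \<in> pm.span relators" by (intro pm.span_scale rep_tensor_class assms)
  finally show ?thesis
    using tensor_class_eqI by (auto simp: fock_ops cl_def rscale_def rw_def)
qed

lemma rawc_free: "q \<in> rawc \<Longrightarrow> snd q \<in> free_words"
  by (simp add: rawc_def)

lemma raw_pair_add:
  assumes "raw_pair t t'" "raw_pair s s'"
  shows "raw_pair (\<lambda>q. radd (t q) (s q)) (\<lambda>q. radd (t' q) (s' q))"
proof -
  note d = raw_pairD[OF assms(1)] and d' = raw_pairD[OF assms(2)]
  have e: "lift (\<lambda>q. radd (t q) (s q)) \<zeta> = vadd fock_pre (lift t \<zeta>) (lift s \<zeta>)"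
    if "\<zeta> \<in> car fock_pre" "\<And>q. q \<in> rawc \<Longrightarrow> t q \<in> rawc" "\<And>q. q \<in> rawc \<Longrightarrow> s q \<in> rawc" for \<zeta> t s
    using that fock_car_rw(1)[OF that(1)] by (simp add: lift_def fock_pre_def fadd_cl rawc_free)
  have "K.adjoint_pair (\<lambda>\<zeta>. vadd fock_pre (lift t \<zeta>) (lift s \<zeta>)) (\<lambda>\<zeta>. vadd fock_pre (lift t' \<zeta>) (lift s' \<zeta>))"
    by (rule K.adjoint_pair_add[OF d(4) d'(4)])
  then have "K.adjoint_pair (lift (\<lambda>q. radd (t q) (s q))) (lift (\<lambda>q. radd (t' q) (s' q)))"
    using e[of _ t s] e[of _ t' s'] d(1,2) d'(1,2)
      K.adjoint_pair_cong[of "lift (\<lambda>q. radd (t q) (s q))" _ "lift (\<lambda>q. radd (t' q) (s' q))"] by simp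
  moreover have "rvip (radd (t' p) (s' p)) q = rvip (t' p) q + rvip (s' p) q" if "p \<in> rawc" "q \<in> rawc" for p q
    using that d(2) d'(2) rvip_cnj[of "radd (t' p) (s' p)" q] rvip_cnj[of "t' p" q] rvip_cnj[of "s' p" q]
    by (simp add: rvip_radd)
  ultimately show ?thesis using d d' unfolding raw_pair_def by (auto simp: rvip_radd)
qed

lemma raw_pair_scale:
  assumes "raw_pair t t'"
  shows "raw_pair (\<lambda>q. rscale c (t q)) (\<lambda>q. rscale (cnj c) (t' q))"
proof -
  note d = raw_pairD[OF assms(1)]
  have e: "lift (\<lambda>q. rscale c (t q)) \<zeta> = vscale fock_pre c (lift t \<zeta>)"
    if "\<zeta> \<in> car fock_pre" "\<And>q. q \<in> rawc \<Longrightarrow> t q \<in> rawc" for \<zeta> t c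
    using that fock_car_rw(1)[OF that(1)] by (simp add: lift_def fscale_cl rawc_free)
  have "K.adjoint_pair (\<lambda>\<zeta>. vscale fock_pre c (lift t \<zeta>)) (\<lambda>\<zeta>. vscale fock_pre (cnj c) (lift t' \<zeta>))"
    by (rule K.adjoint_pair_scale[OF d(4)])
  then have "K.adjoint_pair (lift (\<lambda>q. rscale c (t q))) (lift (\<lambda>q. rscale (cnj c) (t' q)))"
    using e[of _ t c] e[of _ t' "cnj c"] d(1,2)
      K.adjoint_pair_cong[of "lift (\<lambda>q. rscale c (t q))" _ "lift (\<lambda>q. rscale (cnj c) (t' q))"] by simp
  moreover have "rvip (rscale (cnj c) (t' p)) q = c * rvip (t' p) q" if "p \<in> rawc" "q \<in> rawc" for p q
    using that d(2) rvip_cnj[of "rscale (cnj c) (t' p)" q] rvip_cnj[of "t' p" q]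
    by (simp add: rvip_rscale)
  ultimately show ?thesis using d unfolding raw_pair_def by (auto simp: rvip_rscale)
qed

lemma rvip_bound:
  assumes "p \<in> rawc" "q \<in> rawc" "\<And>\<beta>. \<beta> \<in> S \<Longrightarrow> Re (rip p p \<beta>) \<le> B * Re (rip q q \<beta>)"
  shows "Re (rvip p p) \<le> B * Re (rvip q q)"
proof -
  have "Re (rvip p p) \<le> (\<Sum>\<^sub>\<infinity>\<beta>\<in>S. B * (dim \<beta> * Re (rip q q \<beta>)))"
    unfolding Re_rvip[OF assms(1)]
  proof (rule infsum_mono)
    fix \<beta> assume \<beta>: "\<beta> \<in> S"
    show "dim \<beta> * Re (rip p p \<beta>) \<le> B * (dim \<beta> * Re (rip q q \<beta>))"
      using mult_left_mono[OF assms(3)[OF \<beta>], of "dim \<beta>"] dim_pos[OF \<beta>] by (simp add: mult_ac)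
  qed (intro Re_rip_summable summable_on_cmult_right assms)+
  also have "\<dots> = B * Re (rvip q q)" unfolding Re_rvip[OF assms(2)] by (rule infsum_cmult_right')
  finally show ?thesis .
qed

lemma Wf_linear_qform:
  fixes x :: "('o, 'm) words"
  shows "Wf (pm_linear f x) (pm_linear f x) \<beta> =
    qform (Poly_Mapping.keys x) (\<lambda>u w. Wf (f u) (f w) \<beta>) (Poly_Mapping.lookup x)"
proof -
  have "Wf (pm_linear f x) (pm_linear f x) \<beta> = pm_sum (\<lambda>w. cnj (pm_sum (\<lambda>u. cnj (Wf (f u) (f w) \<beta>)) x)) x"
    unfolding Wf_linear by (simp only: Wf_linear_left)
  also have "\<dots> = (\<Sum>w\<in>Poly_Mapping.keys x. \<Sum>u\<in>Poly_Mapping.keys x.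
      cnj (Poly_Mapping.lookup x u) * Wf (f u) (f w) \<beta> * Poly_Mapping.lookup x w)"
    by (simp add: pm_sum_def cnj_sum sum_distrib_left mult_ac)
  also have "\<dots> = qform (Poly_Mapping.keys x) (\<lambda>u w. Wf (f u) (f w) \<beta>) (Poly_Mapping.lookup x)"
    unfolding qform_def by (rule sum.swap)
  finally show ?thesis .
qed

lemma Wf_linear_Wa:
  assumes "\<And>u w. u \<in> Poly_Mapping.keys x \<Longrightarrow> w \<in> Poly_Mapping.keys x \<Longrightarrow> Wf (f u) (f w) \<beta> = word_ip a u w \<beta>"
  shows "Wf (pm_linear f x) (pm_linear f x) \<beta> = Wa a x \<beta>"
  unfolding Wf_linear_qform Wa_def by (rule qform_cong) (use assms in auto)

definition rleft :: "('o \<Rightarrow> complex) \<Rightarrow> ('o, 'm) raw \<Rightarrow> ('o, 'm) raw" where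
  "rleft c q = (\<lambda>\<beta>. c \<beta> * fst q \<beta>, pm_linear (\<lambda>u. word (lact c (hd u) # tl u)) (snd q))"

lemma left_action_lift: "left_action c = lift (rleft c)"
  by (auto simp: left_action_def lift_def rleft_def cl_def rw_def)

lemma rleft_in: "c \<in> \<AA> \<Longrightarrow> q \<in> rawc \<Longrightarrow> rleft c q \<in> rawc"
proof -
  assume c: "c \<in> \<AA>" and q: "q \<in> rawc"
  have "pm_linear (\<lambda>u. word (lact c (hd u) # tl u)) (snd q) \<in> free_words"
  proof (rule free_words_linear)
    show "word (lact c (hd u) # tl u) \<in> free_words" if "u \<noteq> []" "set u \<subseteq> H" for u
      using that by (cases u) auto
  qed (use q in \<open>simp add: rawc_def\<close>)
  then show ?thesis using c q by (simp add: rawc_def rleft_def AA_mult l2_mult)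
qed

lemma hip_lact_right: "\<xi> \<in> H \<Longrightarrow> \<zeta> \<in> H \<Longrightarrow> hip \<xi> (lact a \<zeta>) \<beta> = hip (lact (\<lambda>\<beta>. cnj (a \<beta>)) \<xi>) \<zeta> \<beta>"
  by (simp add: hip_lact_left)

lemma hip_ract_left: "\<xi> \<in> H \<Longrightarrow> \<zeta> \<in> H \<Longrightarrow> hip (ract \<xi> a) \<zeta> \<beta> = cnj (a \<beta>) * hip \<xi> \<zeta> \<beta>"
  using hip_cnj[of \<zeta> "ract \<xi> a" \<beta>] hip_cnj[of \<zeta> \<xi> \<beta>] by (simp add: hip_ract)

lemma free_words_cases:
  assumes "x \<in> free_words" "u \<in> Poly_Mapping.keys x"
  obtains \<xi> u' where "u = \<xi> # u'" "\<xi> \<in> H" "set u' \<subseteq> H"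
  using free_words_keys[OF assms] that by (cases u) auto

text \<open>The inner product of \<open>c x\<close> with itself is that of \<open>x\<close> with
  \<open>cnj c * c\<close> applied to \<open>x\<close>. This is a \<open>Wa\<close>, so
  \<open>Wa_bound\<close> applies with the square of a bound of \<open>c\<close>.\<close>

lemma raw_pair_rleft:
  assumes c: "c \<in> \<AA>"
  shows "raw_pair (rleft c) (rleft (\<lambda>\<beta>. cnj (c \<beta>)))"
proof -
  obtain B where B: "\<And>\<beta>. cmod (c \<beta>) \<le> B" using c by (auto simp: AA_iff)
  show ?thesis
  proof (rule raw_pairI[where B = "B\<^sup>2"])
    fix p q assume p: "p \<in> rawc" and q: "q \<in> rawc"
    show "rvip p (rleft c q) = rvip (rleft (\<lambda>\<beta>. cnj (c \<beta>)) p) q"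
      unfolding rvip_def \<tau>_def
    proof (intro infsum_cong arg_cong2[of _ _ _ _ "(*)"] refl)
      fix \<beta>
      have "Wf (snd p) (pm_linear (\<lambda>u. word (lact c (hd u) # tl u)) (snd q)) \<beta> =
          Wf (pm_linear (\<lambda>u. word (lact (\<lambda>\<beta>. cnj (c \<beta>)) (hd u) # tl u)) (snd p)) (snd q) \<beta>"
      proof (rule Wf_adjoint)
        fix u w assume u: "u \<in> Poly_Mapping.keys (snd p)" and w: "w \<in> Poly_Mapping.keys (snd q)"
        obtain \<xi> u' where "u = \<xi> # u'" "\<xi> \<in> H" by (rule free_words_cases[OF rawc_free[OF p] u])
        moreover obtain \<zeta> w' where "w = \<zeta> # w'" "\<zeta> \<in> H" by (rule free_words_cases[OF rawc_free[OF q] w])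
        ultimately have uw: "u = \<xi> # u'" "w = \<zeta> # w'" "\<xi> \<in> H" "\<zeta> \<in> H" by auto
        have "hip \<xi> (lact c \<zeta>) = hip (lact (\<lambda>\<beta>. cnj (c \<beta>)) \<xi>) \<zeta>"
          using uw by (auto simp: hip_lact_right)
        then show "Wf (word u) (word (lact c (hd w) # tl w)) \<beta> =
            Wf (word (lact (\<lambda>\<beta>. cnj (c \<beta>)) (hd u) # tl u)) (word w) \<beta>"
          using uw by (simp add: Wf_word_word)
      qed
      then show "rip p (rleft c q) \<beta> = rip (rleft (\<lambda>\<beta>. cnj (c \<beta>)) p) q \<beta>"
        by (simp add: rip_def rleft_def)
    qed
  next
    fix q assume q: "q \<in> rawc"
    show "Re (rvip (rleft c q) (rleft c q)) \<le> B\<^sup>2 * Re (rvip q q)"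
    proof (rule rvip_bound[OF rleft_in[OF c q] q])
      fix \<beta> assume \<beta>: "\<beta> \<in> S"
      have c2: "(cmod (c \<beta>))\<^sup>2 \<le> B\<^sup>2" for \<beta> using B[of \<beta>] by (intro power_mono) auto
      have "Wf (snd (rleft c q)) (snd (rleft c q)) \<beta> = Wa (\<lambda>\<beta>. cnj (c \<beta>) * c \<beta>) (snd q) \<beta>"
        unfolding rleft_def snd_conv
      proof (rule Wf_linear_Wa)
        fix u w assume u: "u \<in> Poly_Mapping.keys (snd q)" and w: "w \<in> Poly_Mapping.keys (snd q)"
        obtain \<xi> u' where "u = \<xi> # u'" "\<xi> \<in> H" by (rule free_words_cases[OF rawc_free[OF q] u])
        moreover obtain \<zeta> w' where "w = \<zeta> # w'" "\<zeta> \<in> H" by (rule free_words_cases[OF rawc_free[OF q] w])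
        ultimately have uw: "u = \<xi> # u'" "w = \<zeta> # w'" "\<xi> \<in> H" "\<zeta> \<in> H" by auto
        have "hip (lact c \<xi>) (lact c \<zeta>) = hip \<xi> (lact (\<lambda>\<beta>. cnj (c \<beta>) * c \<beta>) \<zeta>)"
          using uw by (auto simp: hip_lact_left lact_lact)
        then show "Wf (word (lact c (hd u) # tl u)) (word (lact c (hd w) # tl w)) \<beta> =
            word_ip (\<lambda>\<beta>. cnj (c \<beta>) * c \<beta>) u w \<beta>"
          using uw by (simp add: Wf_word_word)
      qed
      moreover have "Re (Wa (\<lambda>\<beta>. cnj (c \<beta>) * c \<beta>) (snd q) \<beta>) \<le> B\<^sup>2 * Re (Wf (snd q) (snd q) \<beta>)"
        by (rule Wa_bound[OF rawc_free[OF q] \<beta>, where b = "\<lambda>\<beta>. (cmod (c \<beta>))\<^sup>2"])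
           (use c2 in \<open>simp add: mult.commute[of "cnj _"] flip: complex_norm_square\<close>)
      moreover have "Re (cnj (fst (rleft c q) \<beta>) * fst (rleft c q) \<beta>) \<le> B\<^sup>2 * Re (cnj (fst q \<beta>) * fst q \<beta>)"
      proof -
        have sq: "Re (cnj z * z) = (cmod z)\<^sup>2" for z by (simp add: cmod_power2 flip: power2_eq_square)
        show ?thesis
          unfolding sq using mult_right_mono[OF c2[of \<beta>], of "(cmod (fst q \<beta>))\<^sup>2"]
          by (simp add: rleft_def norm_mult power_mult_distrib)
      qed
      ultimately show "Re (rip (rleft c q) (rleft c q) \<beta>) \<le> B\<^sup>2 * Re (rip q q \<beta>)"
        unfolding rip_def plus_complex.sel distrib_left by (intro add_mono) auto
    qed
  qed (use rleft_in c AA_cnj in auto)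
qed

definition rcreate :: "('o, 'm) hvec \<Rightarrow> ('o, 'm) raw \<Rightarrow> ('o, 'm) raw" where
  "rcreate \<xi> q = (\<lambda>\<beta>. 0, word [ract \<xi> (fst q)] + pm_linear (\<lambda>u. word (\<xi> # u)) (snd q))"

text \<open>Annihilation sends words of length 1 into the algebra and longer words to words;
  \<open>an1\<close> and \<open>an2\<close> are these two parts.\<close>

definition an1 :: "('o, 'm) hvec \<Rightarrow> 'o \<Rightarrow> ('o, 'm) hvec list \<Rightarrow> complex" where
  "an1 \<xi> \<beta> u = (if length u = 1 then hip \<xi> (hd u) \<beta> else 0)"

definition an2 :: "('o, 'm) hvec \<Rightarrow> ('o, 'm) hvec list \<Rightarrow> ('o, 'm) words" where
  "an2 \<xi> u = (case u of \<zeta>\<^sub>1 # \<zeta>\<^sub>2 # w \<Rightarrow> word (lact (hip \<xi> \<zeta>\<^sub>1) \<zeta>\<^sub>2 # w) | _ \<Rightarrow> 0)"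

definition rannih :: "('o, 'm) hvec \<Rightarrow> ('o, 'm) raw \<Rightarrow> ('o, 'm) raw" where
  "rannih \<xi> q = (\<lambda>\<beta>. pm_sum (an1 \<xi> \<beta>) (snd q), pm_linear (an2 \<xi>) (snd q))"

lemma creation_lift: "creation \<xi> = lift (rcreate \<xi>)"
  by (auto simp: creation_def lift_def rcreate_def cl_def rw_def)

lemma annihilation_lift: "annihilation \<xi> = lift (rannih \<xi>)"
proof (rule ext, clarify)
  fix a X
  have "(\<Sum>u\<in>{u \<in> Poly_Mapping.keys (rep X). length u = 1}. Poly_Mapping.lookup (rep X) u * hip \<xi> (hd u) \<beta>) =
      pm_sum (an1 \<xi> \<beta>) (rep X)" for \<beta>
    unfolding pm_sum_def an1_def by (rule sum.mono_neutral_cong_left) auto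
  then show "annihilation \<xi> (a, X) = lift (rannih \<xi>) (a, X)"
    by (simp add: annihilation_def lift_def rannih_def cl_def rw_def an2_def[abs_def])
qed

lemma rcreate_in: "\<xi> \<in> H \<Longrightarrow> q \<in> rawc \<Longrightarrow> rcreate \<xi> q \<in> rawc"
  by (auto simp: rawc_def rcreate_def)

lemma pm_sum_support:
  assumes "\<And>u. u \<in> Poly_Mapping.keys x \<Longrightarrow> finite {\<beta>. f \<beta> u \<noteq> 0}"
  shows "finite {\<beta>. pm_sum (f \<beta>) x \<noteq> 0}"
proof (rule finite_subset)
  show "{\<beta>. pm_sum (f \<beta>) x \<noteq> 0} \<subseteq> (\<Union>u\<in>Poly_Mapping.keys x. {\<beta>. f \<beta> u \<noteq> 0})"
    by (auto simp: pm_sum_def elim!: sum.not_neutral_contains_not_neutral)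
qed (use assms in auto)

lemma rannih_in:
  assumes "\<xi> \<in> H" "q \<in> rawc"
  shows "rannih \<xi> q \<in> rawc"
proof -
  have f: "finite {\<beta>. pm_sum (an1 \<xi> \<beta>) (snd q) \<noteq> 0}"
  proof (rule pm_sum_support)
    fix u assume u: "u \<in> Poly_Mapping.keys (snd q)"
    have "hd u \<in> H" by (rule free_words_cases[OF rawc_free[OF assms(2)] u]) simp
    then show "finite {\<beta>. an1 \<xi> \<beta> u \<noteq> 0}"
      using assms(1) finite_hip_support[of \<xi> "hd u"] by (cases "length u = 1") (auto simp: an1_def)
  qed
  moreover have "\<beta> \<in> S" if "pm_sum (an1 \<xi> \<beta>) (snd q) \<noteq> 0" for \<beta>
  proof (rule ccontr)
    assume "\<beta> \<notin> S"
    then have "an1 \<xi> \<beta> = (\<lambda>_. 0)" by (auto simp: an1_def hip_outside)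
    then show False using that by simp
  qed
  ultimately have "(\<lambda>\<beta>. pm_sum (an1 \<xi> \<beta>) (snd q)) \<in> \<AA>" "l2 (\<lambda>\<beta>. pm_sum (an1 \<xi> \<beta>) (snd q))"
    by (intro finite_support_AA l2_finite; blast)+
  moreover have "pm_linear (an2 \<xi>) (snd q) \<in> free_words"
    using assms by (intro free_words_linear rawc_free) (auto simp: an2_def split: list.splits)
  ultimately show ?thesis by (simp add: rawc_def rannih_def)
qed

text \<open>Creation followed by annihilation with the same \<open>\<xi>\<close> is left
  multiplication by \<open>hip \<xi> \<xi>\<close>, and a bound of this element bounds the
  operator.\<close>

lemma raw_pair_rcreate:
  assumes \<xi>: "\<xi> \<in> H"
  shows "raw_pair (rcreate \<xi>) (rannih \<xi>)"
proof -
  obtain B where B: "B \<ge> 0" "\<And>\<beta>. Re (hip \<xi> \<xi> \<beta>) \<le> B" using hip_bounded[OF \<xi>] by blast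
  show ?thesis
  proof (rule raw_pairI[where B = B])
    fix p q assume p: "p \<in> rawc" and q: "q \<in> rawc"
    note kp = free_words_keys[OF rawc_free[OF p]] and kq = free_words_keys[OF rawc_free[OF q]]
    show "rvip p (rcreate \<xi> q) = rvip (rannih \<xi> p) q"
      unfolding rvip_def \<tau>_def
    proof (intro infsum_cong arg_cong2[of _ _ _ _ "(*)"] refl)
      fix \<beta>
      have "cnj (word_ip unitA u [ract \<xi> (fst q)] \<beta>) = cnj (fst q \<beta>) * an1 \<xi> \<beta> u"
        if ku: "u \<in> Poly_Mapping.keys (snd p)" for u
      proof (cases "length u = 1")
        case True
        then obtain \<zeta> where u: "u = [\<zeta>]" "\<zeta> \<in> H" using kp[OF ku] by (cases u) auto
        then show ?thesis using \<xi> hip_cnj[OF u(2) \<xi>, of \<beta>] by (simp add: an1_def hip_ract)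
      qed (simp add: an1_def word_ip_length)
      then have "pm_sum (\<lambda>u. cnj (word_ip unitA u [ract \<xi> (fst q)] \<beta>)) (snd p) =
          cnj (fst q \<beta>) * pm_sum (an1 \<xi> \<beta>) (snd p)"
        by (simp add: pm_sum_mult[symmetric] cong: pm_sum_cong)
      then have 1: "Wf (snd p) (word [ract \<xi> (fst q)]) \<beta> = cnj (pm_sum (an1 \<xi> \<beta>) (snd p)) * fst q \<beta>"
        by (simp add: Wf_word Wl_def)
      have 2: "Wf (snd p) (pm_linear (\<lambda>u. word (\<xi> # u)) (snd q)) \<beta> = Wf (pm_linear (an2 \<xi>) (snd p)) (snd q) \<beta>"
      proof (rule Wf_adjoint)
        fix u w assume "u \<in> Poly_Mapping.keys (snd p)" "w \<in> Poly_Mapping.keys (snd q)"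
        note u = kp[OF this(1)] and w = kq[OF this(2)]
        obtain \<omega> w' where w': "w = \<omega> # w'" "\<omega> \<in> H" using w by (cases w) auto
        obtain \<zeta>\<^sub>1 u' where u': "u = \<zeta>\<^sub>1 # u'" "\<zeta>\<^sub>1 \<in> H" using u by (cases u) auto
        show "Wf (word u) (word (\<xi> # w)) \<beta> = Wf (an2 \<xi> u) (word w) \<beta>"
        proof (cases u')
          case Nil
          then show ?thesis using u' w' by (simp add: an2_def Wf_word_word Wf_zero_left)
        next
          case (Cons \<zeta>\<^sub>2 u'')
          then have z: "\<zeta>\<^sub>2 \<in> H" using u u' by simp
          have "hip \<zeta>\<^sub>1 \<xi> = (\<lambda>\<beta>. cnj (hip \<xi> \<zeta>\<^sub>1 \<beta>))" using \<xi> u' hip_cnj by blast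
          then have "hip \<zeta>\<^sub>2 (lact (hip \<zeta>\<^sub>1 \<xi>) \<omega>) = hip (lact (hip \<xi> \<zeta>\<^sub>1) \<zeta>\<^sub>2) \<omega>"
            using z w' by (auto simp: hip_lact_left)
          then show ?thesis using u' w' Cons \<xi> by (simp add: an2_def Wf_word_word)
        qed
      qed
      show "rip p (rcreate \<xi> q) \<beta> = rip (rannih \<xi> p) q \<beta>"
        using 1 2 by (simp add: rip_def rcreate_def rannih_def Wf_add)
    qed
  next
    fix q assume q: "q \<in> rawc"
    note kq = free_words_keys[OF rawc_free[OF q]]
    show "Re (rvip (rcreate \<xi> q) (rcreate \<xi> q)) \<le> B * Re (rvip q q)"
    proof (rule rvip_bound[OF rcreate_in[OF \<xi> q] q])
      fix \<beta> assume \<beta>: "\<beta> \<in> S"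
      let ?w = "word [ract \<xi> (fst q)]" and ?P = "pm_linear (\<lambda>u. word (\<xi> # u)) (snd q)"
      have wP: "?w \<in> free_words" "?P \<in> free_words"
        using \<xi> rawc_free[OF q] by auto
      \<comment> \<open>The image of degree 0 has length 1 and that of positive degree has length at
        least 2, so there are no mixed terms.\<close>
      have "Wf ?w ?P \<beta> = pm_sum (\<lambda>u. 0) (snd q)"
        unfolding Wf_linear
        by (rule pm_sum_cong) (use kq in \<open>auto simp: Wf_word_word word_ip_length\<close>)
      then have cross: "Wf ?w ?P \<beta> = 0" "Wf ?P ?w \<beta> = 0" using Wf_cnj[OF wP, of \<beta>] by auto
      have PP: "Wf ?P ?P \<beta> = Wa (hip \<xi> \<xi>) (snd q) \<beta>"
        by (rule Wf_linear_Wa) (use \<xi> in \<open>simp add: Wf_word_word\<close>)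
      have "Wf ?w ?w \<beta> = cnj (fst q \<beta>) * fst q \<beta> * hip \<xi> \<xi> \<beta>"
        using \<xi> by (simp add: Wf_word_word hip_ract hip_ract_left)
      also have "\<dots> = complex_of_real ((cmod (fst q \<beta>))\<^sup>2 * Re (hip \<xi> \<xi> \<beta>))"
        using hip_self(1)[OF \<xi>, of \<beta>] by (simp add: mult.commute[of "cnj _"] flip: complex_norm_square)
      finally have "Re (Wf ?w ?w \<beta>) \<le> B * (cmod (fst q \<beta>))\<^sup>2"
        using mult_left_mono[OF B(2)[of \<beta>], of "(cmod (fst q \<beta>))\<^sup>2"] by (simp add: mult.commute)
      moreover have "Re (Wa (hip \<xi> \<xi>) (snd q) \<beta>) \<le> B * Re (Wf (snd q) (snd q) \<beta>)"
        by (rule Wa_bound[OF rawc_free[OF q] \<beta>, where b = "\<lambda>\<beta>. Re (hip \<xi> \<xi> \<beta>)"])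
           (use B hip_self(1)[OF \<xi>] in auto)
      moreover have "Re (cnj (fst q \<beta>) * fst q \<beta>) = (cmod (fst q \<beta>))\<^sup>2"
        by (simp add: cmod_power2 flip: power2_eq_square)
      ultimately show "Re (rip (rcreate \<xi> q) (rcreate \<xi> q) \<beta>) \<le> B * Re (rip q q \<beta>)"
        unfolding rip_def rcreate_def fst_conv snd_conv Wf_add Wf_add_left cross PP
        by (simp add: algebra_simps)
    qed
  qed (use B \<xi> rcreate_in rannih_in in auto)
qed

definition rgam :: "('o, 'm) hvec \<Rightarrow> ('o, 'm) raw \<Rightarrow> ('o, 'm) raw" where
  "rgam \<xi> q = radd (rcreate \<xi> q) (rannih (tomita_S \<xi>) q)"

lemma \<Gamma>_lift:
  assumes "\<xi> \<in> H" "\<zeta> \<in> car fock_pre"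
  shows "\<Gamma> \<xi> \<zeta> = lift (rgam \<xi>) \<zeta>"
  using fock_car_rw(1)[OF assms(2)] assms(1)
  by (simp add: \<Gamma>_def creation_lift annihilation_lift lift_def rgam_def fadd_cl rawc_free rcreate_in rannih_in)

lemma radd_commute: "radd p q = radd q p"
  by (simp add: radd_def add.commute)

text \<open>Under adjoints creation and annihilation change places, and applying
  \<open>tomita_S\<close> twice restores \<open>\<xi>\<close>. Hence the set of generators is
  self-adjoint.\<close>

lemma raw_pair_rgam:
  assumes \<xi>: "\<xi> \<in> H"
  shows "raw_pair (rgam \<xi>) (rgam (tomita_S \<xi>))"
  using raw_pair_add[OF raw_pair_rcreate[OF \<xi>] raw_pair_sym[OF raw_pair_rcreate[OF tomita_S_in[OF \<xi>]]]] \<xi>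
  by (simp add: rgam_def[abs_def] radd_commute[of "rannih _ _"])

section \<open>Right operators\<close>

definition unit_at :: "'o \<Rightarrow> 'o \<Rightarrow> complex" where
  "unit_at \<omega> \<beta> = (if \<beta> = \<omega> then 1 else 0)"

definition right_create :: "'o \<times> 'o label \<times> 'o \<Rightarrow> 'm \<Rightarrow> ('o, 'm) raw \<Rightarrow> ('o, 'm) raw" where
  "right_create t x q = (\<lambda>\<beta>. 0, word [lact (fst q) (hl t x)] + pm_linear (\<lambda>u. word (u @ [hl t x])) (snd q))"

text \<open>The inner product of \<open>hl t x\<close> with \<open>\<zeta>\<close> is this number
  times the projection at the third index of \<open>t\<close>.\<close>

definition right_coef :: "'o \<times> 'o label \<times> 'o \<Rightarrow> 'm \<Rightarrow> ('o, 'm) hvec \<Rightarrow> complex" where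
  "right_coef t x \<zeta> = ipm (snd (snd t)) x (\<zeta> t)"

definition ra1 :: "'o \<times> 'o label \<times> 'o \<Rightarrow> 'm \<Rightarrow> ('o, 'm) hvec list \<Rightarrow> complex" where
  "ra1 t x u = (if length u = 1 then right_coef t x (hd u) else 0)"

text \<open>Removing the last letter leaves a scalar, and the rest of the word is cut down to what
  ends at the first index of \<open>t\<close>. The cut appears because \<open>hl t x\<close> is
  fixed by the left action of that projection.\<close>

definition ra2 :: "'o \<times> 'o label \<times> 'o \<Rightarrow> 'm \<Rightarrow> ('o, 'm) hvec list \<Rightarrow> ('o, 'm) words" where
  "ra2 t x u = (if length u \<ge> 2 then
     pm_scale (right_coef t x (last u)) (word (butlast (butlast u) @ [ract (last (butlast u)) (unit_at (fst t))])) else 0)"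

definition right_annih :: "'o \<times> 'o label \<times> 'o \<Rightarrow> 'm \<Rightarrow> ('o, 'm) raw \<Rightarrow> ('o, 'm) raw" where
  "right_annih t x q = (\<lambda>\<beta>. unit_at (fst t) \<beta> * pm_sum (ra1 t x) (snd q), pm_linear (ra2 t x) (snd q))"

lemma ra2_snoc: "ra2 t x (u @ [\<mu>, \<zeta>]) = pm_scale (right_coef t x \<zeta>) (word (u @ [ract \<mu> (unit_at (fst t))]))"
  by (simp add: ra2_def butlast_append)

lemma unit_at_AA: "\<omega> \<in> S \<Longrightarrow> (\<lambda>\<beta>. unit_at \<omega> \<beta> * c) \<in> \<AA>" and l2_unit_at: "l2 (\<lambda>\<beta>. unit_at \<omega> \<beta> * c)"
proof -
  have f: "finite {\<beta>. unit_at \<omega> \<beta> * c \<noteq> 0}" by (rule finite_subset[of _ "{\<omega>}"]) (auto simp: unit_at_def)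
  then show "l2 (\<lambda>\<beta>. unit_at \<omega> \<beta> * c)" by (rule l2_finite)
  show "(\<lambda>\<beta>. unit_at \<omega> \<beta> * c) \<in> \<AA>" if "\<omega> \<in> S"
    by (rule finite_support_AA[OF f]) (use that in \<open>auto simp: unit_at_def split: if_splits\<close>)
qed

lemma list_length_ge2:
  assumes "length u \<ge> 2"
  obtains v \<mu> \<zeta> where "u = v @ [\<mu>, \<zeta>]"
proof -
  obtain u' \<zeta> where u: "u = u' @ [\<zeta>]" using assms by (cases u rule: rev_cases) auto
  obtain v \<mu> where "u' = v @ [\<mu>]" using assms u by (cases u' rule: rev_cases) auto
  then show ?thesis using that u by simp
qed

lemma ra2_free:
  assumes "set u \<subseteq> H"
  shows "ra2 t x u \<in> free_words"
proof (cases "length u \<ge> 2")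
  case True
  then show ?thesis using assms by (elim list_length_ge2) (simp add: ra2_snoc)
qed (simp add: ra2_def)

lemma \<tau>_dl: "\<omega>' \<in> S \<Longrightarrow> \<tau> (\<lambda>\<beta>. unit_at \<omega>' \<beta> * e) = complex_of_real (dim \<omega>') * e"
proof -
  assume "\<omega>' \<in> S"
  then have "\<tau> (\<lambda>\<beta>. unit_at \<omega>' \<beta> * e) = (\<Sum>\<^sub>\<infinity>\<beta>\<in>{\<omega>'}. complex_of_real (dim \<beta>) * (unit_at \<omega>' \<beta> * e))"
    unfolding \<tau>_def by (intro infsum_cong_neutral) (auto simp: unit_at_def)
  then show ?thesis by (simp add: unit_at_def)
qed

context
  fixes \<omega> \<alpha> \<gamma> x t
  assumes t: "t = (\<omega>, \<alpha>, \<gamma>)" and o: "\<omega> \<in> S" "\<alpha> \<in> \<Lambda>" "\<gamma> \<in> S" and x: "x \<in> homT t"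
begin

lemma tt: "t \<in> triples"
  using t o by simp

lemma fst_t: "fst t = \<omega>"
  using t by simp

lemma f_in [simp]: "hl t x \<in> H"
  using tt x by simp

lemma right_coef_ops:
  assumes "\<zeta> \<in> H"
  shows "right_coef t x (lact a \<zeta>) = a \<omega> * right_coef t x \<zeta>" "right_coef t x (ract \<zeta> a) = a \<gamma> * right_coef t x \<zeta>"
    "right_coef t x (hscale c \<zeta>) = c * right_coef t x \<zeta>"
proof -
  have "ipm \<gamma> x (c \<odot> \<zeta> t) = c * ipm \<gamma> x (\<zeta> t)" for c
    using o x assms by (simp add: t homT_simps ipm_scl[of _ "\<omega> \<box> label_obj \<alpha>"])
  then show "right_coef t x (lact a \<zeta>) = a \<omega> * right_coef t x \<zeta>" "right_coef t x (ract \<zeta> a) = a \<gamma> * right_coef t x \<zeta>"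
    "right_coef t x (hscale c \<zeta>) = c * right_coef t x \<zeta>"
    using lact_apply[OF tt, of a \<zeta>] ract_apply[OF tt, of \<zeta> a] hscale_apply[OF tt, of c \<zeta>]
    by (simp_all add: right_coef_def t)
qed

lemma hip_hl_right:
  assumes "\<zeta> \<in> H"
  shows "hip \<zeta> (lact a (hl t x)) \<beta> = unit_at \<gamma> \<beta> * (a \<omega> * cnj (right_coef t x \<zeta>))"
proof -
  have "hip \<zeta> (lact a (hl t x)) \<beta> = cnj (hip (lact a (hl t x)) \<zeta> \<beta>)"
    using assms hip_cnj[of "lact a (hl t x)" \<zeta> \<beta>] by simp
  also have "hip (lact a (hl t x)) \<zeta> \<beta> = hip (hl t x) (lact (\<lambda>\<beta>. cnj (a \<beta>)) \<zeta>) \<beta>"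
    using assms by (simp add: hip_lact_left)
  also have "\<dots> = (if \<beta> = \<gamma> then right_coef t x (lact (\<lambda>\<beta>. cnj (a \<beta>)) \<zeta>) else 0)"
    using hip_hl[of \<omega> \<alpha> \<gamma> x] tt x assms by (simp add: t right_coef_def)
  finally show ?thesis using assms by (simp add: right_coef_ops unit_at_def)
qed

lemma right_create_in: "q \<in> rawc \<Longrightarrow> right_create t x q \<in> rawc"
  by (auto simp: rawc_def right_create_def)

lemma right_annih_in: "q \<in> rawc \<Longrightarrow> right_annih t x q \<in> rawc"
  using unit_at_AA[OF o(1)] l2_unit_at by (auto simp: rawc_def right_annih_def t intro!: free_words_linear ra2_free)

lemma word_ip_ract_last:
  assumes "set (u @ [\<mu>]) \<subseteq> H" "set w \<subseteq> H"
  shows "word_ip unitA (u @ [ract \<mu> (unit_at \<omega>)]) w \<beta> = unit_at \<omega> \<beta> * word_ip unitA (u @ [\<mu>]) w \<beta>"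
proof (cases "length w = Suc (length u)")
  case True
  then obtain w' \<nu> where w: "w = w' @ [\<nu>]" by (cases w rule: rev_cases) auto
  then show ?thesis using True assms by (simp add: word_ip_snoc hip_ract_left unit_at_def)
qed (simp add: word_ip_length)

text \<open>The inner product with an appended homogeneous letter is supported at the third index of
  the letter. Its value depends on the preceding words only through their coefficient at the first
  index.\<close>

lemma ra2_adjoint:
  assumes u: "u \<noteq> []" "set u \<subseteq> H" and w: "w \<noteq> []" "set w \<subseteq> H"
  shows "word_ip unitA u (w @ [hl t x]) \<beta> = unit_at \<gamma> \<beta> * Wf (ra2 t x u) (word w) \<omega>"
    and "\<beta> \<noteq> \<omega> \<Longrightarrow> Wf (ra2 t x u) (word w) \<beta> = 0"
proof -
  have "word_ip unitA u (w @ [hl t x]) \<beta> = unit_at \<gamma> \<beta> * Wf (ra2 t x u) (word w) \<omega> \<and>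
      (\<beta> \<noteq> \<omega> \<longrightarrow> Wf (ra2 t x u) (word w) \<beta> = 0)"
  proof (cases "length u \<ge> 2")
    case True
    then obtain v \<mu> \<zeta> where u': "u = v @ [\<mu>, \<zeta>]" by (rule list_length_ge2)
    then have s: "set v \<subseteq> H" "\<mu> \<in> H" "\<zeta> \<in> H" using u by auto
    have W: "Wf (ra2 t x u) (word w) \<beta> = cnj (right_coef t x \<zeta>) * (unit_at \<omega> \<beta> * word_ip unitA (v @ [\<mu>]) w \<beta>)" for \<beta>
      using s w word_ip_ract_last[of v \<mu> w \<beta>] by (simp add: u' ra2_snoc Wf_scale_left Wf_word_word t)
    show ?thesis
    proof (cases "length w = Suc (length v)")
      case True
      have "word_ip unitA u (w @ [hl t x]) = hip \<zeta> (lact (word_ip unitA (v @ [\<mu>]) w) (hl t x))"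
        using True word_ip_snoc[of "v @ [\<mu>]" w unitA \<zeta> "hl t x"] by (simp add: u')
      then show ?thesis using s by (simp add: W hip_hl_right) (simp add: unit_at_def)
    next
      case False
      then show ?thesis using False by (simp add: W[unfolded u'] word_ip_length u')
    qed
  next
    case False
    then have "length u \<noteq> length (w @ [hl t x])" using w by (cases w) auto
    then show ?thesis using False by (simp add: word_ip_length ra2_def Wf_zero_left)
  qed
  then show "word_ip unitA u (w @ [hl t x]) \<beta> = unit_at \<gamma> \<beta> * Wf (ra2 t x u) (word w) \<omega>"
    "\<beta> \<noteq> \<omega> \<Longrightarrow> Wf (ra2 t x u) (word w) \<beta> = 0" by auto
qed

text \<open>The one number behind both sides of the adjoint relation: pairing with the right
  creation places it at \<open>\<gamma>\<close>, pairing with the right annihilation places it at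
  \<open>\<omega>\<close>.\<close>

definition right_form :: "('o, 'm) raw \<Rightarrow> ('o, 'm) raw \<Rightarrow> complex" where
  "right_form p q = cnj (pm_sum (ra1 t x) (snd p)) * fst q \<omega> + Wf (pm_linear (ra2 t x) (snd p)) (snd q) \<omega>"

lemma rip_right_create:
  assumes p: "p \<in> rawc" and q: "q \<in> rawc"
  shows "rip p (right_create t x q) \<beta> = unit_at \<gamma> \<beta> * right_form p q"
proof -
  note kp = free_words_keys[OF rawc_free[OF p]] and kq = free_words_keys[OF rawc_free[OF q]]
  have "cnj (word_ip unitA u [lact (fst q) (hl t x)] \<beta>) = (unit_at \<gamma> \<beta> * cnj (fst q \<omega>)) * ra1 t x u"
    if ku: "u \<in> Poly_Mapping.keys (snd p)" for u
  proof (cases "length u = 1")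
    case True
    then obtain \<zeta> where u: "u = [\<zeta>]" "\<zeta> \<in> H" using kp[OF ku] by (cases u) auto
    then show ?thesis by (simp add: ra1_def hip_hl_right) (simp add: unit_at_def)
  qed (simp add: ra1_def word_ip_length)
  then have "pm_sum (\<lambda>u. cnj (word_ip unitA u [lact (fst q) (hl t x)] \<beta>)) (snd p) =
      (unit_at \<gamma> \<beta> * cnj (fst q \<omega>)) * pm_sum (ra1 t x) (snd p)"
    by (simp add: pm_sum_mult[symmetric] cong: pm_sum_cong)
  then have 1: "Wf (snd p) (word [lact (fst q) (hl t x)]) \<beta> = unit_at \<gamma> \<beta> * (cnj (pm_sum (ra1 t x) (snd p)) * fst q \<omega>)"
    by (simp add: Wf_word Wl_def unit_at_def)
  have 2: "Wf (snd p) (pm_linear (\<lambda>u. word (u @ [hl t x])) (snd q)) \<beta> =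
      unit_at \<gamma> \<beta> * Wf (pm_linear (ra2 t x) (snd p)) (snd q) \<omega>"
  proof (cases "\<beta> = \<gamma>")
    case True
    have "Wf (snd p) (pm_linear (\<lambda>u. word (u @ [hl t x])) (snd q)) \<gamma> =
      cnj (pm_sum (\<lambda>u. cnj (pm_sum (\<lambda>w. word_ip unitA u (w @ [hl t x]) \<gamma>) (snd q))) (snd p))"
      by (subst Wf_left) (simp add: Wf_linear Wf_word_word)
    also have "\<dots> = cnj (pm_sum (\<lambda>u. cnj (pm_sum (\<lambda>w. Wf (ra2 t x u) (word w) \<omega>) (snd q))) (snd p))"
      using kp kq ra2_adjoint(1)[of _ _ \<gamma>]
      by (intro arg_cong[of _ _ cnj] pm_sum_cong) (simp add: unit_at_def)
    also have "\<dots> = Wf (pm_linear (ra2 t x) (snd p)) (snd q) \<omega>"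
      unfolding Wf_linear_left by (simp add: Wf_word) (simp add: Wf_def)
    finally show ?thesis using True by (simp add: unit_at_def)
  next
    case False
    have "Wf (snd p) (pm_linear (\<lambda>u. word (u @ [hl t x])) (snd q)) \<beta> =
      cnj (pm_sum (\<lambda>u. cnj (pm_sum (\<lambda>w. word_ip unitA u (w @ [hl t x]) \<beta>) (snd q))) (snd p))"
      by (subst Wf_left) (simp add: Wf_linear Wf_word_word)
    also have "\<dots> = cnj (pm_sum (\<lambda>u. cnj (pm_sum (\<lambda>w. 0) (snd q))) (snd p))"
      using kp kq ra2_adjoint(1)[of _ _ \<beta>] False
      by (intro arg_cong[of _ _ cnj] pm_sum_cong) (simp add: unit_at_def)
    finally show ?thesis using False by (simp add: unit_at_def)
  qed
  show ?thesis using 1 2 by (simp add: rip_def right_create_def Wf_add right_form_def algebra_simps)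
qed

lemma rip_right_annih:
  assumes p: "p \<in> rawc" and q: "q \<in> rawc"
  shows "rip (right_annih t x p) q \<beta> = unit_at \<omega> \<beta> * right_form p q"
proof (cases "\<beta> = \<omega>")
  case False
  note kp = free_words_keys[OF rawc_free[OF p]] and kq = free_words_keys[OF rawc_free[OF q]]
  have "Wf (pm_linear (ra2 t x) (snd p)) (snd q) \<beta> =
      cnj (pm_sum (\<lambda>u. cnj (pm_sum (\<lambda>w. Wf (ra2 t x u) (word w) \<beta>) (snd q))) (snd p))"
    unfolding Wf_linear_left by (simp add: Wf_word) (simp add: Wf_def)
  also have "\<dots> = cnj (pm_sum (\<lambda>u. cnj (pm_sum (\<lambda>w. 0) (snd q))) (snd p))"
    using kp kq ra2_adjoint(2)[of _ _ \<beta>] False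
    by (intro arg_cong[of _ _ cnj] pm_sum_cong) simp
  finally show ?thesis using False by (simp add: rip_def right_annih_def unit_at_def t)
qed (use fst_t in \<open>simp add: rip_def right_annih_def right_form_def unit_at_def\<close>)

lemma rip_le_rvip:
  assumes "q \<in> rawc"
  shows "dim \<omega> * Re (rip q q \<omega>) \<le> Re (rvip q q)"
proof -
  have "(\<Sum>\<beta>\<in>{\<omega>}. dim \<beta> * Re (rip q q \<beta>)) \<le> (\<Sum>\<^sub>\<infinity>\<beta>\<in>S. dim \<beta> * Re (rip q q \<beta>))"
    by (rule finite_sum_le_infsum[OF Re_rip_summable[OF assms]])
       (use o assms dim_pos[THEN less_imp_le] in \<open>auto intro!: mult_nonneg_nonneg rip_nonneg\<close>)
  then show ?thesis using Re_rvip[OF assms] by simp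
qed

text \<open>Creation followed by annihilation at the right end cuts down to what ends at
  \<open>\<omega>\<close> and multiplies by the square norm of \<open>x\<close>. The bound for right
  creation comes from here.\<close>

lemma right_form_right_create:
  assumes q: "q \<in> rawc"
  shows "right_form (right_create t x q) q = ipm \<gamma> x x * rip q q \<omega>"
proof -
  let ?k = "ipm \<gamma> x x"
  note kq = free_words_keys[OF rawc_free[OF q]]
  have xh: "x \<in> hom C \<gamma> (\<omega> \<box> label_obj \<alpha>)" using x by (simp add: t homT_simps)
  have rcf: "right_coef t x (hl t x) = ?k" using tt by (simp add: right_coef_def hl_apply t)
  have k: "cnj ?k = ?k" using ipm_self(1)[of \<gamma> "\<omega> \<box> label_obj \<alpha>", OF _ _ xh] o by (metis complex_cnj_complex_of_real S_obj label_obj_in ten_obj)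
  have "pm_sum (\<lambda>u. ra1 t x (u @ [hl t x])) (snd q) = pm_sum (\<lambda>u. 0) (snd q)"
    by (rule pm_sum_cong) (use kq in \<open>auto simp: ra1_def\<close>)
  then have 1: "pm_sum (ra1 t x) (snd (right_create t x q)) = fst q \<omega> * ?k"
    by (simp add: right_create_def pm_sum_add pm_sum_linear) (simp add: ra1_def right_coef_ops rcf)
  have "Wf (pm_linear (ra2 t x) (snd (right_create t x q))) (snd q) \<omega> =
      cnj (pm_sum (\<lambda>u. cnj (Wf (ra2 t x (u @ [hl t x])) (snd q) \<omega>)) (snd q))"
    by (simp add: right_create_def Wf_linear_left pm_sum_add pm_sum_linear) (simp add: ra2_def Wf_zero_left)
  also have "\<dots> = cnj (pm_sum (\<lambda>u. ?k * cnj (Wf (word u) (snd q) \<omega>)) (snd q))"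
  proof (intro arg_cong[of _ _ cnj] pm_sum_cong)
    fix u assume "u \<in> Poly_Mapping.keys (snd q)"
    then have u: "u \<noteq> []" "set u \<subseteq> H" using kq by auto
    then obtain v \<mu> where v: "u = v @ [\<mu>]" by (cases u rule: rev_cases) auto
    have "Wf (ra2 t x (u @ [hl t x])) (snd q) \<omega> = cnj ?k * pm_sum (\<lambda>w. word_ip unitA (v @ [ract \<mu> (unit_at \<omega>)]) w \<omega>) (snd q)"
      using v by (simp add: ra2_snoc Wf_scale_left rcf) (simp add: Wf_def Wl_def t)
    also have "pm_sum (\<lambda>w. word_ip unitA (v @ [ract \<mu> (unit_at \<omega>)]) w \<omega>) (snd q) = pm_sum (\<lambda>w. word_ip unitA u w \<omega>) (snd q)"
      by (rule pm_sum_cong, subst word_ip_ract_last) (use u v kq in \<open>auto simp: unit_at_def\<close>)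
    finally show "cnj (Wf (ra2 t x (u @ [hl t x])) (snd q) \<omega>) = ?k * cnj (Wf (word u) (snd q) \<omega>)"
      by (simp add: Wf_def Wl_def k)
  qed
  also have "\<dots> = ?k * Wf (snd q) (snd q) \<omega>" by (subst Wf_left[of "snd q" "snd q"]) (simp add: pm_sum_mult k)
  finally show ?thesis unfolding right_form_def 1 by (simp add: rip_def k algebra_simps)
qed

text \<open>The trace weighs \<open>right_form\<close> by \<open>dim \<gamma>\<close> on one side of
  the adjoint relation and by \<open>dim \<omega>\<close> on the other; their ratio corrects the
  adjoint.\<close>

lemma raw_pair_right_create:
  "raw_pair (right_create t x) (\<lambda>q. rscale (complex_of_real (dim \<gamma> / dim \<omega>)) (right_annih t x q))"
proof -
  let ?k = "Re (ipm \<gamma> x x)"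
  have xh: "x \<in> hom C \<gamma> (\<omega> \<box> label_obj \<alpha>)" using x by (simp add: t homT_simps)
  have k: "ipm \<gamma> x x = complex_of_real ?k" "0 \<le> ?k"
    using ipm_self(1,2)[of \<gamma> "\<omega> \<box> label_obj \<alpha>", OF _ _ xh] o by auto
  have d: "dim \<gamma> > 0" "dim \<omega> > 0" using o dim_pos by auto
  show ?thesis
  proof (rule raw_pairI[where B = "dim \<gamma> / dim \<omega> * ?k"])
    fix p q assume p: "p \<in> rawc" and q: "q \<in> rawc"
    have "rvip (rscale (complex_of_real (dim \<gamma> / dim \<omega>)) (right_annih t x p)) q =
        complex_of_real (dim \<gamma> / dim \<omega>) * rvip (right_annih t x p) q"
      using rvip_cnj[OF _ q, of "rscale _ (right_annih t x p)"] rvip_cnj[OF _ q, of "right_annih t x p"] p q right_annih_in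
      by (simp add: rvip_rscale)
    then show "rvip p (right_create t x q) = rvip (rscale (complex_of_real (dim \<gamma> / dim \<omega>)) (right_annih t x p)) q"
      unfolding rvip_def[of p] rvip_def[of "right_annih t x p"]
      using rip_right_create[OF p q, abs_def] rip_right_annih[OF p q, abs_def] d o \<tau>_dl by simp
  next
    fix q assume q: "q \<in> rawc"
    have "rvip (right_create t x q) (right_create t x q) = complex_of_real (dim \<gamma>) * (ipm \<gamma> x x * rip q q \<omega>)"
      unfolding rvip_def using rip_right_create[OF right_create_in[OF q] q, abs_def] o \<tau>_dl by (simp add: right_form_right_create[OF q])
    then have "Re (rvip (right_create t x q) (right_create t x q)) = dim \<gamma> * (?k * Re (rip q q \<omega>))"
      by (subst (asm) k(1)) (simp add: mult.assoc)
    also have "\<dots> = dim \<gamma> / dim \<omega> * ?k * (dim \<omega> * Re (rip q q \<omega>))" using d by simp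
    also have "\<dots> \<le> dim \<gamma> / dim \<omega> * ?k * Re (rvip q q)"
      using d k(2) rip_le_rvip[OF q] by (intro mult_left_mono) auto
    finally show "Re (rvip (right_create t x q) (right_create t x q)) \<le> dim \<gamma> / dim \<omega> * ?k * Re (rvip q q)" .
  qed (use d k right_create_in right_annih_in in auto)
qed

text \<open>The previous pair reversed and rescaled: the factor
  \<open>dim \<omega> / dim \<gamma>\<close> cancels the ratio of dimensions, so that right
  annihilation can carry any prescribed coefficient.\<close>

lemma raw_pair_right_annih:
  "raw_pair (\<lambda>q. rscale c (right_annih t x q)) (\<lambda>q. rscale (cnj c * complex_of_real (dim \<omega> / dim \<gamma>)) (right_create t x q))"
proof -
  have d: "dim \<gamma> > 0" "dim \<omega> > 0" using o dim_pos by auto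
  have rr: "rscale a (rscale b q) = rscale (a * b) q" for a b q by (simp add: rscale_def mult.assoc)
  have e: "complex_of_real (dim \<omega> / dim \<gamma>) * complex_of_real (dim \<gamma> / dim \<omega>) = 1"
    using d by (simp flip: of_real_mult)
  show ?thesis
    using raw_pair_scale[OF raw_pair_sym[OF raw_pair_right_create], of "c * complex_of_real (dim \<omega> / dim \<gamma>)"] e
    by (simp only: rr mult.assoc complex_cnj_mult complex_cnj_complex_of_real mult_1_right)
qed

end

end

section \<open>A total set\<close>

context fock_category
begin

definition vacuum :: "'o \<Rightarrow> (nat \<Rightarrow> ('o, 'm) fvec) set" where
  "vacuum v = em (unit_at v, 0)"

definition word_vec :: "('o, 'm) hvec list \<Rightarrow> (nat \<Rightarrow> ('o, 'm) fvec) set" where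
  "word_vec u = em (\<lambda>_. 0, word u)"

lemma raw_vacuum [simp]: "v \<in> S \<Longrightarrow> (unit_at v, 0) \<in> rawc"
  using unit_at_AA[of v 1] l2_unit_at[of v 1] by (simp add: rawc_def)

lemma raw_word_vec [simp]: "u \<noteq> [] \<Longrightarrow> set u \<subseteq> H \<Longrightarrow> (\<lambda>_. 0, word u) \<in> rawc"
  by (simp add: rawc_def)

lemma vacuum_in [simp]: "v \<in> S \<Longrightarrow> vacuum v \<in> car K.Hc"
  by (simp add: vacuum_def)

lemma word_vec_in [simp]: "u \<noteq> [] \<Longrightarrow> set u \<subseteq> H \<Longrightarrow> word_vec u \<in> car K.Hc"
  by (simp add: word_vec_def)

lemma pm_linear_word_id: "pm_linear word x = x"
proof (rule poly_mapping_eqI)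
  fix k
  have "(\<Sum>u\<in>Poly_Mapping.keys x. Poly_Mapping.lookup x u * (1 when u = k)) =
      (\<Sum>u\<in>Poly_Mapping.keys x. if u = k then Poly_Mapping.lookup x k else 0)"
    by (intro sum.cong) (auto simp: when_def)
  then show "Poly_Mapping.lookup (pm_linear word x) k = Poly_Mapping.lookup x k"
    by (simp add: lookup_pm_linear pm_sum_def lookup_single in_keys_iff)
qed

lemma vip_em_add:
  assumes "p \<in> rawc" "q \<in> rawc" "X \<in> car K.Hc"
  shows "vip K.Hc (em (radd p q)) X = vip K.Hc (em p) X + vip K.Hc (em q) X"
  using assms by (simp add: em_radd[symmetric] F.ip_simps)

lemma vip_em_scale:
  assumes "q \<in> rawc" "X \<in> car K.Hc"
  shows "vip K.Hc (em (rscale c q)) X = cnj c * vip K.Hc (em q) X"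
  using assms by (simp add: em_rscale[symmetric] F.ip_simps)

lemma infsum_remove_finite:
  fixes f :: "'o \<Rightarrow> real"
  assumes "f summable_on S" "finite D" "D \<subseteq> S"
  shows "(\<Sum>\<^sub>\<infinity>\<beta>\<in>S. if \<beta> \<in> D then 0 else f \<beta>) = infsum f S - sum f D"
proof -
  have "infsum f S = infsum f D + infsum f (S - D)"
    using infsum_Un_disjoint[of f D "S - D"] assms summable_on_subset_banach[OF assms(1), of "S - D"]
    by (simp add: Un_absorb1 Un_Diff_cancel summable_on_finite)
  moreover have "(\<Sum>\<^sub>\<infinity>\<beta>\<in>S. if \<beta> \<in> D then 0 else f \<beta>) = infsum f (S - D)"
    by (intro infsum_cong_neutral) auto
  ultimately show ?thesis using assms(2) by simp
qed

text \<open>In positive degree there are only finite combinations of words. In degree 0 there are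
  infinite square summable families; these are cut to finite parts, and Cauchy-Schwarz disposes of
  the small tail.\<close>

lemma F_total:
  assumes X: "X \<in> car K.Hc" and 1: "\<And>v. v \<in> S \<Longrightarrow> vip K.Hc (vacuum v) X = 0"
    and 2: "\<And>u. u \<noteq> [] \<Longrightarrow> set u \<subseteq> H \<Longrightarrow> vip K.Hc (word_vec u) X = 0"
  shows "X = vzero K.Hc"
proof (rule F_ext[OF X])
  have words: "vip K.Hc (em (\<lambda>_. 0, x)) X = 0" if x: "x \<in> free_words" for x
  proof -
    have "vip K.Hc (em (\<lambda>_. 0, \<Sum>u\<in>A. pm_scale (Poly_Mapping.lookup x u) (word u))) X = 0 \<and>
        (\<Sum>u\<in>A. pm_scale (Poly_Mapping.lookup x u) (word u)) \<in> free_words"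
      if "finite A" "A \<subseteq> Poly_Mapping.keys x" for A
      using that
    proof (induction A)
      case empty
      have "vip K.Hc (em (rscale 0 (\<lambda>_. 0, 0))) X = 0" by (subst vip_em_scale) (use X in auto)
      then show ?case by (simp add: rscale_def)
    next
      case (insert u A)
      let ?y = "\<Sum>u\<in>A. pm_scale (Poly_Mapping.lookup x u) (word u)"
      have u: "u \<noteq> []" "set u \<subseteq> H" using insert.prems free_words_keys[OF x, of u] by auto
      have y: "vip K.Hc (em (\<lambda>_. 0, ?y)) X = 0" "?y \<in> free_words" using insert by auto
      have "(\<lambda>_. 0, ?y) \<in> rawc" using y by (simp add: rawc_def)
      then have "vip K.Hc (em (radd (rscale (Poly_Mapping.lookup x u) (\<lambda>_. 0, word u)) (\<lambda>_. 0, ?y))) X = 0"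
        using u X y 2[OF u] by (simp add: vip_em_add vip_em_scale word_vec_def)
      then show ?case using insert.hyps y u by (simp add: radd_def rscale_def)
    qed
    from this[of "Poly_Mapping.keys x"] show ?thesis
      using pm_linear_word_id[of x] by (simp add: pm_linear_def)
  qed
  have fin: "vip K.Hc (em (\<lambda>\<beta>. if \<beta> \<in> D then a \<beta> else 0, 0)) X = 0 \<and> (\<lambda>\<beta>. if \<beta> \<in> D then a \<beta> else 0, 0) \<in> rawc"
    if "finite D" "D \<subseteq> S" for D a
    using that
  proof (induction D)
    case empty
    show ?case using words[of 0] by simp
  next
    case (insert v D)
    have e: "(\<lambda>\<beta>. if \<beta> \<in> insert v D then a \<beta> else 0, 0) =
        radd (rscale (a v) (unit_at v, 0)) (\<lambda>\<beta>. if \<beta> \<in> D then a \<beta> else 0, 0)"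
      using insert.hyps by (auto simp: radd_def rscale_def unit_at_def)
    have "v \<in> S" "(\<lambda>\<beta>. if \<beta> \<in> D then a \<beta> else 0, 0) \<in> rawc"
      "vip K.Hc (em (\<lambda>\<beta>. if \<beta> \<in> D then a \<beta> else 0, 0)) X = 0" using insert by auto
    then show ?case unfolding e using X 1[of v] by (simp add: vip_em_add vip_em_scale vacuum_def)
  qed
  have zero: "vip K.Hc (em (a, 0)) X = 0" if a: "(a, 0) \<in> rawc" for a
  proof (rule ccontr)
    assume ne: "vip K.Hc (em (a, 0)) X \<noteq> 0"
    \<comment> \<open>A tail of norm below \<open>e\<close> has an inner product with
      \<open>X\<close> strictly smaller than the assumed one; the \<open>+ 1\<close> keeps the
      denominator positive.\<close>
    define e where "e = cmod (vip K.Hc (em (a, 0)) X) / (vnorm K.Hc X + 1)"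
    have nX: "vnorm K.Hc X \<ge> 0" using X by simp
    have e: "e > 0" using ne nX by (simp add: e_def)
    let ?f = "\<lambda>\<beta>. dim \<beta> * (cmod (a \<beta>))\<^sup>2"
    have f: "?f summable_on S" using a by (simp add: rawc_def l2_def)
    obtain D where D: "finite D" "D \<subseteq> S" "dist (sum ?f D) (infsum ?f S) \<le> e\<^sup>2 / 2"
      using has_sum_finite_approximation[OF has_sum_infsum[OF f], of "e\<^sup>2 / 2"] e by auto
    let ?aD = "\<lambda>\<beta>. if \<beta> \<in> D then a \<beta> else 0" and ?b = "\<lambda>\<beta>. if \<beta> \<in> D then 0 else a \<beta>"
    note fD = fin[OF D(1,2), of a]
    have ab: "(a, 0) = radd (?aD, 0) (?b, 0)" by (auto simp: radd_def)
    have b: "(?b, 0) \<in> rawc"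
    proof -
      have "(?b, 0) = radd (a, 0) (rscale (-1) (?aD, 0))" by (auto simp: radd_def rscale_def)
      then show ?thesis using a fD by simp
    qed
    have "(vnorm K.Hc (em (?b, 0)))\<^sup>2 = Re (rvip (?b, 0) (?b, 0))"
      using b by (simp add: F.vnorm_sq em_vip)
    also have "\<dots> = (\<Sum>\<^sub>\<infinity>\<beta>\<in>S. if \<beta> \<in> D then 0 else ?f \<beta>)"
      unfolding Re_rvip[OF b]
      by (intro infsum_cong) (simp add: rip_def Wf_zero cmod_power2 flip: power2_eq_square)
    also have "\<dots> = infsum ?f S - sum ?f D" by (rule infsum_remove_finite[OF f D(1,2)])
    also have "\<dots> < e\<^sup>2" using D(3) zero_less_power[OF e, of 2] unfolding dist_real_def by linarith
    finally have nb: "vnorm K.Hc (em (?b, 0)) < e" using e by (simp add: power_less_imp_less_base)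
    have "vip K.Hc (em (a, 0)) X = vip K.Hc (em (?b, 0)) X"
      unfolding ab using fD b X by (simp add: vip_em_add)
    then have "cmod (vip K.Hc (em (a, 0)) X) \<le> vnorm K.Hc (em (?b, 0)) * vnorm K.Hc X"
      using F.cauchy_schwarz[OF em_in[OF b] X] by simp
    also have "\<dots> \<le> e * vnorm K.Hc X" using nb nX by (intro mult_right_mono) auto
    also have "\<dots> < e * (vnorm K.Hc X + 1)" using e by simp
    also have "\<dots> = cmod (vip K.Hc (em (a, 0)) X)" using nX by (simp add: e_def)
    finally show False by simp
  qed
  fix p assume p: "p \<in> rawc"
  have "p = radd (fst p, 0) (\<lambda>_. 0, snd p)" by (simp add: radd_def)
  moreover have "(fst p, 0) \<in> rawc" "(\<lambda>_. 0, snd p) \<in> rawc" using p by (auto simp: rawc_def)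
  ultimately have "vip K.Hc (em p) X = vip K.Hc (em (fst p, 0)) X + vip K.Hc (em (\<lambda>_. 0, snd p)) X"
    using X vip_em_add by metis
  then show "vip K.Hc (em p) X = vip K.Hc (em p) (vzero K.Hc)"
    using zero \<open>(fst p, 0) \<in> rawc\<close> words rawc_free[OF p] p by (simp add: F.ip_zero)
qed (rule F.zero_closed)

lemma word_vec_relations:
  assumes s: "set w \<subseteq> H" "set w' \<subseteq> H" "\<xi> \<in> H" "\<zeta> \<in> H"
  shows "word_vec (w @ hadd \<xi> \<zeta> # w') = vadd K.Hc (word_vec (w @ \<xi> # w')) (word_vec (w @ \<zeta> # w'))"
    and "word_vec (w @ hscale c \<xi> # w') = vscale K.Hc c (word_vec (w @ \<xi> # w'))"
    and "word_vec (w @ ract \<xi> b # \<zeta> # w') = word_vec (w @ \<xi> # lact b \<zeta> # w')"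
proof -
  have r: "(\<lambda>_. 0, word (w @ \<mu> # w')) \<in> rawc" if "\<mu> \<in> H" for \<mu> using that s by simp
  show "word_vec (w @ hadd \<xi> \<zeta> # w') = vadd K.Hc (word_vec (w @ \<xi> # w')) (word_vec (w @ \<zeta> # w'))"
    unfolding word_vec_def em_radd[OF r[OF s(3)] r[OF s(4)]]
    by (rule em_eqI[OF r rawc_ops(1)[OF r r]]) (use s in \<open>simp_all add: radd_def Wf_word Wf_add Wl_relations\<close>)
  show "word_vec (w @ hscale c \<xi> # w') = vscale K.Hc c (word_vec (w @ \<xi> # w'))"
    unfolding word_vec_def em_rscale[OF r[OF s(3)]]
    by (rule em_eqI[OF r rawc_ops(2)[OF r]])
       (use s in \<open>simp_all add: rscale_def Wf_word Wf_scale Wl_relations(2)[where \<zeta> = \<xi>]\<close>)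
  show "word_vec (w @ ract \<xi> b # \<zeta> # w') = word_vec (w @ \<xi> # lact b \<zeta> # w')"
    unfolding word_vec_def
    by (rule em_eqI) (use s in \<open>simp_all add: Wf_word Wl_relations\<close>)
qed

text \<open>Letters are replaced one at a time from the right: the suffix already lies in
  \<open>L\<close>, and the letter before it is decomposed, by additivity, into multiples of
  elements of \<open>L\<close>.\<close>

lemma F_total_letters:
  assumes X: "X \<in> car K.Hc" and L: "L \<subseteq> H"
    and span: "\<And>t x. t \<in> triples \<Longrightarrow> x \<in> homT t \<Longrightarrow> \<exists>k. \<exists>e\<in>L. hl t x = hscale k e"
    and 1: "\<And>v. v \<in> S \<Longrightarrow> vip K.Hc (vacuum v) X = 0"
    and 2: "\<And>u. u \<noteq> [] \<Longrightarrow> set u \<subseteq> L \<Longrightarrow> vip K.Hc (word_vec u) X = 0"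
  shows "X = vzero K.Hc"
proof (rule F_total[OF X 1])
  have *: "vip K.Hc (word_vec (u @ w)) X = 0" if "set u \<subseteq> H" "set w \<subseteq> L" "u @ w \<noteq> []" for u w
    using that
  proof (induction u arbitrary: w rule: rev_induct)
    case Nil
    then show ?case using 2 by simp
  next
    case (snoc \<xi> u)
    have \<xi>: "\<xi> \<in> H" and u: "set u \<subseteq> H" and w: "set w \<subseteq> H" using snoc.prems L by auto
    from \<xi> have "vip K.Hc (word_vec (u @ \<xi> # w)) X = 0"
    proof (induction rule: H_induct)
      case zero
      have "word_vec (u @ hzero # w) = vscale K.Hc 0 (word_vec (u @ hzero # w))"
        using word_vec_relations(2)[OF u w hzero_in hzero_in, of 0] hscale_zero[OF hzero_in] by simp
      moreover have "word_vec (u @ hzero # w) \<in> car K.Hc" using u w by simp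
      ultimately show ?case using X F.ip_scale_left[of X "word_vec (u @ hzero # w)" 0] by simp
    next
      case (add t x \<xi>)
      obtain k e where e: "e \<in> L" "hl t x = hscale k e" using span[OF add.hyps(1,2)] by blast
      have eH: "e \<in> H" using e L by auto
      have "vip K.Hc (word_vec (u @ hl t x # w)) X = cnj k * vip K.Hc (word_vec (u @ e # w)) X"
        unfolding e(2) using word_vec_relations(2)[OF u w eH eH, of k] u w eH X by (simp add: F.ip_simps)
      also have "\<dots> = 0" using snoc.IH[of "e # w"] u snoc.prems(2) e by simp
      finally show ?case
        using word_vec_relations(1)[OF u w hl_in[OF add.hyps(1,2)] add.hyps(3)] add u w X by (simp add: F.ip_simps)
    qed
    then show ?case by simp
  qed
  show "vip K.Hc (word_vec u) X = 0" if "u \<noteq> []" "set u \<subseteq> H" for u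
    using *[of u "[]"] that by simp
qed

section \<open>The generators and their commutant\<close>

definition gens :: "((nat \<Rightarrow> ('o, 'm) fvec) set \<Rightarrow> (nat \<Rightarrow> ('o, 'm) fvec) set) set" where
  "gens = {E (left_action a) | a. a \<in> \<AA>} \<union> {E (\<Gamma> \<xi>) | \<xi>. \<xi> \<in> H}"

lemma E_\<Gamma>: "\<xi> \<in> H \<Longrightarrow> E (\<Gamma> \<xi>) = E (lift (rgam \<xi>))"
  by (rule K.extend_op_cong) (simp add: \<Gamma>_lift)

lemma gensE:
  assumes "A \<in> gens"
  obtains t t' where "raw_pair t t'" "A = E (lift t)" "E (lift t') \<in> gens"
    "(\<exists>a\<in>\<AA>. t = rleft a) \<or> (\<exists>\<xi>\<in>H. t = rgam \<xi>)"
proof -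
  from assms consider a where "a \<in> \<AA>" "A = E (left_action a)" | \<xi> where "\<xi> \<in> H" "A = E (\<Gamma> \<xi>)"
    unfolding gens_def by blast
  then show thesis
  proof cases
    case (1 a)
    have "E (lift (rleft (\<lambda>\<beta>. cnj (a \<beta>)))) \<in> gens"
      using AA_cnj[OF 1(1)] left_action_lift unfolding gens_def by force
    then show ?thesis using that[OF raw_pair_rleft[OF 1(1)]] 1 left_action_lift by auto
  next
    case (2 \<xi>)
    have "E (lift (rgam (tomita_S \<xi>))) \<in> gens"
      using E_\<Gamma>[of "tomita_S \<xi>"] tomita_S_in[OF 2(1)] unfolding gens_def
      by (metis (mono_tags, lifting) UnI2 mem_Collect_eq)
    then show ?thesis using that[OF raw_pair_rgam[OF 2(1)]] 2 E_\<Gamma> by auto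
  qed
qed

lemma gens_bounded: "gens \<subseteq> bounded_ops K.Hc"
proof
  fix A assume "A \<in> gens"
  then obtain t t' where "raw_pair t t'" "A = E (lift t)" by (rule gensE)
  then show "A \<in> bounded_ops K.Hc" using K.extend_op(1)[OF raw_pairD(4)] by simp
qed

lemma gens_adjoint: "A \<in> gens \<Longrightarrow> adjoint_op K.Hc A \<in> gens"
proof -
  assume "A \<in> gens"
  then obtain t t' where t: "raw_pair t t'" "A = E (lift t)" "E (lift t') \<in> gens" by (rule gensE)
  show ?thesis unfolding t(2) K.extend_op(4)[OF raw_pairD(4)[OF t(1)]] by (rule t(3))
qed

lemma gens_\<Gamma>: "\<xi> \<in> H \<Longrightarrow> E (lift (rgam \<xi>)) \<in> gens"
  using E_\<Gamma> unfolding gens_def by (metis (mono_tags, lifting) UnI2 mem_Collect_eq)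

lemma gens_left: "a \<in> \<AA> \<Longrightarrow> E (lift (rleft a)) \<in> gens"
  using left_action_lift by (auto simp: gens_def)

lemma hscale_hscale: "\<xi> \<in> H \<Longrightarrow> hscale c (hscale d \<xi>) = hscale (c * d) \<xi>"
  by (rule H_eqI) (auto simp: hscale_apply H_hom homT_scl_scl)

lemma ract_mult: "\<xi> \<in> H \<Longrightarrow> ract \<xi> (\<lambda>\<beta>. c * a \<beta>) = hscale c (ract \<xi> a)"
  by (rule H_eqI) (auto simp: hscale_apply ract_apply H_hom homT_scl_scl)

lemma ract_hscale: "\<xi> \<in> H \<Longrightarrow> ract (hscale c \<xi>) a = hscale c (ract \<xi> a)"
  by (rule H_eqI) (auto simp: hscale_apply ract_apply H_hom homT_scl_scl mult.commute)

lemma hip_zero_right: "\<xi> \<in> H \<Longrightarrow> \<zeta> \<in> H \<Longrightarrow> hip \<xi> (lact (\<lambda>_. 0) \<zeta>) \<beta> = 0"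
  using lact_mult[of \<zeta> 0 "\<lambda>_. 1"] hip_scale[of \<xi> "lact (\<lambda>_. 1) \<zeta>" 0 \<beta>] by simp

lemma Wl_zero:
  assumes x: "x \<in> free_words" and s: "set w \<subseteq> H" "set w' \<subseteq> H" "\<xi> \<in> H"
  shows "Wl x (w @ lact (\<lambda>_. 0) \<xi> # w') \<beta> = 0" "Wl x (w @ ract \<xi> (\<lambda>_. 0) # w') \<beta> = 0"
    "Wl x (w @ ract \<xi> (\<lambda>\<beta>. k * b \<beta>) # w') \<beta> = k * Wl x (w @ ract \<xi> b # w') \<beta>"
    "Wl x (w @ lact (\<lambda>\<beta>. k * b \<beta>) \<xi> # w') \<beta> = k * Wl x (w @ lact b \<xi> # w') \<beta>"
proof -
  show 1: "Wl x (w @ ract \<xi> (\<lambda>\<beta>. k * b \<beta>) # w') \<beta> = k * Wl x (w @ ract \<xi> b # w') \<beta>" for k b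
    using s x by (simp add: ract_mult Wl_relations(2)[where \<zeta> = \<xi>])
  show 2: "Wl x (w @ lact (\<lambda>\<beta>. k * b \<beta>) \<xi> # w') \<beta> = k * Wl x (w @ lact b \<xi> # w') \<beta>" for k b
    using s x by (simp add: lact_mult Wl_relations(2)[where \<zeta> = \<xi>])
  show "Wl x (w @ ract \<xi> (\<lambda>_. 0) # w') \<beta> = 0" using 1[of 0 "\<lambda>_. 0"] by simp
  show "Wl x (w @ lact (\<lambda>_. 0) \<xi> # w') \<beta> = 0" using 2[of 0 "\<lambda>_. 0"] by simp
qed

lemmas Wl_zero_nil = Wl_zero[of _ "[]", simplified] Wl_zero[of _ "[\<mu>]" for \<mu>, simplified]

text \<open>The mirror image of \<open>rgam\<close>: creation along an edge and annihilation along
  another, both at the right end. For the conjugate edge and a suitable \<open>c\<close> it commutes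
  with all generators.\<close>

definition right_gam :: "'o \<times> 'o label \<times> 'o \<Rightarrow> 'm \<Rightarrow> 'o \<times> 'o label \<times> 'o \<Rightarrow> 'm \<Rightarrow> complex \<Rightarrow>
    ('o, 'm) raw \<Rightarrow> ('o, 'm) raw" where
  "right_gam t x t' x' c q = radd (right_create t x q) (rscale c (right_annih t' x' q))"

context
  fixes \<omega> \<alpha> \<gamma> x x' t t' and c :: complex
  assumes t: "t = (\<omega>, \<alpha>, \<gamma>)" and t': "t' = (\<gamma>, bar_label \<alpha>, \<omega>)"
    and o: "\<omega> \<in> S" "\<alpha> \<in> \<Lambda>" "\<gamma> \<in> S" and x: "x \<in> homT t" and x': "x' \<in> homT t'"
begin

lemma o': "bar_label \<alpha> \<in> \<Lambda>"
  using o by simp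

lemma raw_pair_right_gam:
  "raw_pair (right_gam t x t' x' c) (\<lambda>q. radd (rscale (complex_of_real (dim \<gamma> / dim \<omega>)) (right_annih t x q))
     (rscale (cnj c * complex_of_real (dim \<gamma> / dim \<omega>)) (right_create t' x' q)))"
  unfolding right_gam_def[abs_def]
  by (rule raw_pair_add[OF raw_pair_right_create[OF t o x] raw_pair_right_annih[OF t' o(3) o' o(1) x']])

context
  assumes star: "\<And>\<xi>. \<xi> \<in> H \<Longrightarrow> c * right_coef t' x' \<xi> = cnj (right_coef t x (tomita_S \<xi>))"
begin

text \<open>Operators at different ends of a word can interfere only on short ones. In degree 0 the
  creation of each side meets the annihilation of the other, and \<open>star\<close> is exactly the
  condition that the two results agree.\<close>

lemma right_gam_rgam_commute:
  assumes \<xi>: "\<xi> \<in> H" and q: "q \<in> rawc" and shape: "snd q = 0 \<or> (\<exists>u. snd q = word u \<and> fst q = (\<lambda>_. 0))"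
  shows "em (right_gam t x t' x' c (rgam \<xi> q)) = em (rgam \<xi> (right_gam t x t' x' c q))"
proof -
  let ?f = "hl t x" and ?\<eta> = "tomita_S \<xi>"
  note f = f_in[OF t o x] and R = right_coef_ops[OF t' o(3) o' o(1) x'] and hr = hip_hl_right[OF t o x]
  have ft': "fst t' = \<gamma>" by (simp add: t')
  have \<eta>: "?\<eta> \<in> H" using \<xi> by simp
  have raws: "right_gam t x t' x' c (rgam \<xi> q) \<in> rawc" "rgam \<xi> (right_gam t x t' x' c q) \<in> rawc"
    using q raw_pairD(1)[OF raw_pair_right_gam] raw_pairD(1)[OF raw_pair_rgam[OF \<xi>]] by auto
  note expand = right_gam_def rgam_def right_create_def right_annih_def rcreate_def rannih_def radd_def rscale_def ft'
    pm_linear_add pm_linear_scale pm_sum_add pm_sum_scale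
    Wf_add Wf_scale Wf_word Wf_zero
  \<comment> \<open>Lengths 0 to 3 are treated separately because the two ends share letters there;
    from length 4 on, each annihilation has two letters of its own.\<close>
  from shape consider "snd q = 0" | \<zeta> where "snd q = word [\<zeta>]" "fst q = (\<lambda>_. 0)" "\<zeta> \<in> H"
    | \<zeta>\<^sub>1 \<zeta>\<^sub>2 u where "snd q = word (\<zeta>\<^sub>1 # \<zeta>\<^sub>2 # u)" "fst q = (\<lambda>_. 0)" "\<zeta>\<^sub>1 \<in> H" "\<zeta>\<^sub>2 \<in> H" "set u \<subseteq> H"
  proof (elim disjE exE conjE)
    fix u assume u: "snd q = word u" "fst q = (\<lambda>_. 0)"
    then have "u \<noteq> []" "set u \<subseteq> H" using rawc_free[OF q] by auto
    then show thesis using that(2,3) u by (cases u rule: remdups_adj.cases) auto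
  qed
  then show ?thesis
  proof cases
    case 1
    show ?thesis
    proof (rule em_eqI[OF raws])
      show "fst (right_gam t x t' x' c (rgam \<xi> q)) \<beta> = fst (rgam \<xi> (right_gam t x t' x' c q)) \<beta>" for \<beta>
        using 1 \<xi> \<eta> hr[OF \<eta>] star[OF \<xi>]
        by (simp add: expand ra1_def an1_def R mult_ac)
      show "Wf y (snd (right_gam t x t' x' c (rgam \<xi> q))) \<beta> = Wf y (snd (rgam \<xi> (right_gam t x t' x' c q))) \<beta>"
        if y: "y \<in> free_words" for y \<beta>
        using 1 \<xi> f y Wl_relations(3)[OF y, of "[]" "[]" \<xi> ?f "fst q"]
        by (simp add: expand ra2_def an2_def Wl_zero_nil)
    qed
  next
    case (2 \<zeta>)
    show ?thesis
    proof (rule em_eqI[OF raws])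
      show "fst (right_gam t x t' x' c (rgam \<xi> q)) \<beta> = fst (rgam \<xi> (right_gam t x t' x' c q)) \<beta>" for \<beta>
        using 2 \<xi> \<eta> f by (simp add: expand ra1_def ra2_def an1_def an2_def R hip_zero_right)
      show "Wf y (snd (right_gam t x t' x' c (rgam \<xi> q))) \<beta> = Wf y (snd (rgam \<xi> (right_gam t x t' x' c q))) \<beta>"
        if y: "y \<in> free_words" for y \<beta>
      proof -
        have m: "(\<lambda>\<beta>. c * (unit_at \<gamma> \<beta> * right_coef t' x' \<zeta>)) = (\<lambda>\<beta>. (c * right_coef t' x' \<zeta>) * unit_at \<gamma> \<beta>)"
          by (simp add: mult_ac)
        show ?thesis
          using 2 \<xi> \<eta> f y by (simp add: expand ra1_def ra2_def an1_def an2_def Wl_zero_nil m)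
      qed
    qed
  next
    case (3 \<zeta>\<^sub>1 \<zeta>\<^sub>2 u)
    have hsimp: "hip ?\<eta> (ract \<zeta>\<^sub>1 (unit_at \<gamma>)) = (\<lambda>\<beta>. unit_at \<gamma> \<beta> * hip ?\<eta> \<zeta>\<^sub>1 \<beta>)" using 3 \<eta> by (auto simp: hip_ract)
    consider "u = []" | \<mu> where "u = [\<mu>]" "\<mu> \<in> H" | v \<nu> \<mu> where "u = v @ [\<nu>, \<mu>]" "set v \<subseteq> H" "\<nu> \<in> H" "\<mu> \<in> H"
    proof (cases "length u \<ge> 2")
      case True
      then obtain v \<nu> \<mu> where "u = v @ [\<nu>, \<mu>]" by (rule list_length_ge2)
      then show thesis using 3 that(3)[of v \<nu> \<mu>] by simp
    next
      case False
      then show thesis using 3 that(1,2) by (cases u rule: remdups_adj.cases) auto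
    qed
    then show ?thesis
    proof cases
      case u: 1
      show ?thesis
      proof (rule em_eqI[OF raws])
        show "fst (right_gam t x t' x' c (rgam \<xi> q)) \<beta> = fst (rgam \<xi> (right_gam t x t' x' c q)) \<beta>" for \<beta>
          using 3 u \<xi> \<eta> f by (simp add: expand ra1_def ra2_def an1_def an2_def R hip_zero_right hsimp) (simp add: unit_at_def)
        show "Wf y (snd (right_gam t x t' x' c (rgam \<xi> q))) \<beta> = Wf y (snd (rgam \<xi> (right_gam t x t' x' c q))) \<beta>"
          if y: "y \<in> free_words" for y \<beta>
          using 3 u \<xi> \<eta> f y by (simp add: expand ra1_def ra2_def an1_def an2_def Wl_zero_nil)
      qed
    next
      case u: (2 \<mu>)
      show ?thesis
      proof (rule em_eqI[OF raws])
        show "fst (right_gam t x t' x' c (rgam \<xi> q)) \<beta> = fst (rgam \<xi> (right_gam t x t' x' c q)) \<beta>" for \<beta>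
          using 3 u \<xi> \<eta> f by (simp add: expand ra1_def ra2_def an1_def an2_def R hip_zero_right)
        show "Wf y (snd (right_gam t x t' x' c (rgam \<xi> q))) \<beta> = Wf y (snd (rgam \<xi> (right_gam t x t' x' c q))) \<beta>"
          if y: "y \<in> free_words" for y \<beta>
          using 3 u \<xi> \<eta> f y by (simp add: expand ra1_def ra2_def an1_def an2_def Wl_zero_nil lact_ract algebra_simps)
      qed
    next
      case u: (3 v \<nu> \<mu>)
      have r2: "ra2 t' x' (\<zeta> # v @ [\<nu>, \<mu>]) = pm_scale (right_coef t' x' \<mu>) (word (\<zeta> # v @ [ract \<nu> (unit_at \<gamma>)]))"
        "ra2 t' x' (\<zeta> # \<zeta>' # v @ [\<nu>, \<mu>]) = pm_scale (right_coef t' x' \<mu>) (word (\<zeta> # \<zeta>' # v @ [ract \<nu> (unit_at \<gamma>)]))"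
        "ra2 t' x' (\<zeta> # \<zeta>' # \<zeta>'' # v @ [\<nu>, \<mu>]) = pm_scale (right_coef t' x' \<mu>) (word (\<zeta> # \<zeta>' # \<zeta>'' # v @ [ract \<nu> (unit_at \<gamma>)]))"
        for \<zeta> \<zeta>' \<zeta>''
        using ra2_snoc[of t' x' "\<zeta> # v" \<nu> \<mu>] ra2_snoc[of t' x' "\<zeta> # \<zeta>' # v" \<nu> \<mu>]
          ra2_snoc[of t' x' "\<zeta> # \<zeta>' # \<zeta>'' # v" \<nu> \<mu>] ft' by simp_all
      have r0: "ra2 t' x' [\<zeta>] = 0" for \<zeta> by (simp add: ra2_def)
      show ?thesis
      proof (rule em_eqI[OF raws])
        show "fst (right_gam t x t' x' c (rgam \<xi> q)) \<beta> = fst (rgam \<xi> (right_gam t x t' x' c q)) \<beta>" for \<beta>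
          using 3 u \<xi> \<eta> f by (simp add: expand ra1_def r2 an1_def an2_def R hip_zero_right)
        show "Wf y (snd (right_gam t x t' x' c (rgam \<xi> q))) \<beta> = Wf y (snd (rgam \<xi> (right_gam t x t' x' c q))) \<beta>"
          if y: "y \<in> free_words" for y \<beta>
          using 3 u \<xi> \<eta> f y by (simp add: expand ra1_def r2 r0 an1_def an2_def Wl_zero_nil algebra_simps)
      qed
    qed
  qed
qed

lemma right_gam_rleft_commute:
  assumes a: "a \<in> \<AA>" and q: "q \<in> rawc" and shape: "snd q = 0 \<or> (\<exists>u. snd q = word u \<and> fst q = (\<lambda>_. 0))"
  shows "em (right_gam t x t' x' c (rleft a q)) = em (rleft a (right_gam t x t' x' c q))"
proof -
  let ?f = "hl t x"
  note f = f_in[OF t o x] and R = right_coef_ops[OF t' o(3) o' o(1) x']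
  have ft': "fst t' = \<gamma>" by (simp add: t')
  have raws: "right_gam t x t' x' c (rleft a q) \<in> rawc" "rleft a (right_gam t x t' x' c q) \<in> rawc"
    using q raw_pairD(1)[OF raw_pair_right_gam] rleft_in[OF a] by auto
  note expand = right_gam_def rleft_def right_create_def right_annih_def radd_def rscale_def ft'
    pm_linear_add pm_linear_scale pm_sum_add pm_sum_scale
    Wf_add Wf_scale Wf_word Wf_zero
  from shape consider "snd q = 0" | \<zeta> where "snd q = word [\<zeta>]" "fst q = (\<lambda>_. 0)" "\<zeta> \<in> H"
    | v \<nu> \<mu> where "snd q = word (v @ [\<nu>, \<mu>])" "fst q = (\<lambda>_. 0)" "set v \<subseteq> H" "\<nu> \<in> H" "\<mu> \<in> H"
  proof (elim disjE exE conjE)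
    fix u assume u: "snd q = word u" "fst q = (\<lambda>_. 0)"
    then have u': "u \<noteq> []" "set u \<subseteq> H" using rawc_free[OF q] by auto
    show thesis
    proof (cases "length u \<ge> 2")
      case True
      then obtain v \<nu> \<mu> where "u = v @ [\<nu>, \<mu>]" by (rule list_length_ge2)
      then show thesis using u u' that(3)[of v \<nu> \<mu>] by simp
    next
      case False
      then show thesis using u u' that(2) by (cases u rule: remdups_adj.cases) auto
    qed
  qed
  then show ?thesis
  proof cases
    case 1
    show ?thesis
    proof (rule em_eqI[OF raws])
      show "Wf y (snd (right_gam t x t' x' c (rleft a q))) \<beta> = Wf y (snd (rleft a (right_gam t x t' x' c q))) \<beta>"
        if y: "y \<in> free_words" for y \<beta>
        using 1 f by (simp add: expand lact_lact)
    qed (use 1 in \<open>simp add: expand\<close>)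
  next
    case (2 \<zeta>)
    show ?thesis
    proof (rule em_eqI[OF raws])
      show "fst (right_gam t x t' x' c (rleft a q)) \<beta> = fst (rleft a (right_gam t x t' x' c q)) \<beta>" for \<beta>
        using 2 by (simp add: expand ra1_def R) (simp add: unit_at_def)
      show "Wf y (snd (right_gam t x t' x' c (rleft a q))) \<beta> = Wf y (snd (rleft a (right_gam t x t' x' c q))) \<beta>"
        if y: "y \<in> free_words" for y \<beta>
        using 2 f y by (simp add: expand lact_lact ra2_def Wl_zero_nil)
    qed
  next
    case (3 v \<nu> \<mu>)
    show ?thesis
    proof (rule em_eqI[OF raws])
      show "fst (right_gam t x t' x' c (rleft a q)) \<beta> = fst (rleft a (right_gam t x t' x' c q)) \<beta>" for \<beta>
        using 3 by (cases v) (simp_all add: expand ra1_def)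
      show "Wf y (snd (right_gam t x t' x' c (rleft a q))) \<beta> = Wf y (snd (rleft a (right_gam t x t' x' c q))) \<beta>"
        if y: "y \<in> free_words" for y \<beta>
      proof (cases v)
        case Nil
        then show ?thesis using 3 f y by (simp add: expand lact_lact ra2_def Wl_zero_nil lact_ract)
      next
        case (Cons \<zeta> v')
        then show ?thesis
          using 3 f y ra2_snoc[of t' x' "lact a \<zeta> # v'" \<nu> \<mu>] ra2_snoc[of t' x' "\<zeta> # v'" \<nu> \<mu>] ft'
          by (simp add: expand lact_lact Wl_zero_nil)
      qed
    qed
  qed
qed

text \<open>Commutation has been checked on vacuum vectors and single words. These are total, so the
  two bounded compositions agree everywhere.\<close>

lemma right_gam_commutant: "E (lift (right_gam t x t' x' c)) \<in> commutant K.Hc gens"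
proof (rule F.commutantI)
  let ?Y = "E (lift (right_gam t x t' x' c))"
  note Yp = raw_pair_right_gam
  show Yb: "?Y \<in> bounded_ops K.Hc" by (rule K.extend_op(1)[OF raw_pairD(4)[OF Yp]])
  fix A X assume A: "A \<in> gens" and X: "X \<in> car K.Hc"
  obtain s s' where s: "raw_pair s s'" "A = E (lift s)"
    "(\<exists>a\<in>\<AA>. s = rleft a) \<or> (\<exists>\<xi>\<in>H. s = rgam \<xi>)" using gensE[OF A] by metis
  have Ab: "A \<in> bounded_ops K.Hc" using A gens_bounded by auto
  define W where "W = vacuum ` S \<union> word_vec ` {u. u \<noteq> [] \<and> set u \<subseteq> H}"
  have "compose (car K.Hc) ?Y A X = compose (car K.Hc) A ?Y X"
  proof (rule F.eq_on_total[where W = W and P = "compose (car K.Hc) ?Y A" and Q = "compose (car K.Hc) A ?Y"])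
    show "w \<in> car K.Hc" if "w \<in> W" for w using that by (auto simp: W_def)
    show "Z = vzero K.Hc" if "Z \<in> car K.Hc" "\<And>w. w \<in> W \<Longrightarrow> vip K.Hc w Z = 0" for Z
      by (rule F_total[OF that(1)]) (use that(2) in \<open>auto simp: W_def\<close>)
    show "compose (car K.Hc) ?Y A \<in> bounded_ops K.Hc" "compose (car K.Hc) A ?Y \<in> bounded_ops K.Hc"
      using F.bounded_ops_compose Ab Yb by auto
    fix w assume "w \<in> W"
    then consider v where "v \<in> S" "w = vacuum v" | u where "u \<noteq> []" "set u \<subseteq> H" "w = word_vec u" by (auto simp: W_def)
    then obtain q where q: "q \<in> rawc" "w = em q" "snd q = 0 \<or> (\<exists>u. snd q = word u \<and> fst q = (\<lambda>_. 0))"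
    proof cases
      case (1 v)
      then show thesis using that[of "(unit_at v, 0)"] by (simp add: vacuum_def)
    next
      case (2 u)
      then show thesis using that[of "(\<lambda>_. 0, word u)"] by (auto simp: word_vec_def)
    qed
    have "em (right_gam t x t' x' c (s q)) = em (s (right_gam t x t' x' c q))"
      using s(3) right_gam_rleft_commute[OF _ q(1,3)] right_gam_rgam_commute[OF _ q(1,3)] by blast
    then have "?Y (A w) = A (?Y w)"
      using q s(2) raw_pairD(1,5)[OF Yp] raw_pairD(1,5)[OF s(1)] by simp
    then show "compose (car K.Hc) ?Y A w = compose (car K.Hc) A ?Y w"
      using q by (simp add: compose_def)
  qed (rule X)
  then show "?Y (A X) = A (?Y X)" using X by (simp add: compose_def)
qed

end

end

text \<open>The hypothesis relating left and right operators holds whenever the two morphism spaces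
  are one-dimensional.\<close>

lemma star_one_dimensional:
  assumes t: "t = (\<omega>, \<alpha>, \<gamma>)" "t' = (\<gamma>, bar_label \<alpha>, \<omega>)" and o: "\<omega> \<in> S" "\<alpha> \<in> \<Lambda>" "\<gamma> \<in> S"
    and x: "x \<in> homT t" and x': "x' \<in> homT t'" "x' \<noteq> zT t'"
    and dim1: "\<And>y. y \<in> homT t' \<Longrightarrow> \<exists>k. y = k \<odot> x'"
    and S: "tomita_S (hl t' x') = hl t (complex_of_real \<kappa> \<odot> x)"
    and c: "c = complex_of_real \<kappa> * ipm \<gamma> x x / ipm \<omega> x' x'"
    and \<xi>: "\<xi> \<in> H"
  shows "c * right_coef t' x' \<xi> = cnj (right_coef t x (tomita_S \<xi>))"
proof -
  have tt: "t \<in> triples" "t' \<in> triples" using t o by auto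
  \<comment> \<open>Both sides depend on \<open>\<xi>\<close> only through this scalar.\<close>
  obtain k where k: "\<xi> t' = k \<odot> x'" using dim1 H_hom[OF \<xi> tt(2)] by blast
  have xh: "x \<in> hom C \<gamma> (\<omega> \<box> label_obj \<alpha>)" "x' \<in> hom C \<omega> (\<gamma> \<box> label_obj (bar_label \<alpha>))"
    using x x' by (simp_all add: t homT_simps)
  have b: "bar \<gamma> (bar_label \<alpha>) x' \<in> hom C \<gamma> (\<omega> \<box> label_obj \<alpha>)"
    using bar_in(1)[OF o(1,3) _ xh(2)] o by simp
  let ?l = "complex_of_real (sqrt (label_lam (bar_label \<alpha>)))"
  have "tomita_S (hl t' x') t = ?l \<odot> bar \<gamma> (bar_label \<alpha>) x'"
    using tomita_S_hl[of \<gamma> "bar_label \<alpha>" \<omega> x'] tt x'(1) by (simp add: t hl_apply)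
  then have lb: "?l \<odot> bar \<gamma> (bar_label \<alpha>) x' = complex_of_real \<kappa> \<odot> x"
    using S tt by (simp add: hl_apply)
  have "tomita_S \<xi> t = ?l \<odot> bar \<gamma> (bar_label \<alpha>) (\<xi> t')"
    using tt(1) by (simp add: t tomita_S_apply)
  also have "\<dots> = ?l \<odot> (cnj k \<odot> bar \<gamma> (bar_label \<alpha>) x')"
    using bar_scl[OF o(1,3) _ xh(2)] o k by simp
  also have "\<dots> = cnj k \<odot> (?l \<odot> bar \<gamma> (bar_label \<alpha>) x')"
    using scl_mult[OF _ _ b] o by (metis S_obj label_obj_in mult.commute ten_obj)
  also have "\<dots> = (cnj k * complex_of_real \<kappa>) \<odot> x"
    unfolding lb using scl_mult[OF _ _ xh(1)] o by simp
  finally have 1: "right_coef t x (tomita_S \<xi>) = cnj k * complex_of_real \<kappa> * ipm \<gamma> x x"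
    using ipm_scl[of \<gamma> "\<omega> \<box> label_obj \<alpha>" x x] xh o by (simp add: right_coef_def t)
  have 2: "right_coef t' x' \<xi> = k * ipm \<omega> x' x'"
    using ipm_scl[of \<omega> "\<gamma> \<box> label_obj (bar_label \<alpha>)" x' x'] xh o k by (simp add: right_coef_def t)
  have "ipm \<omega> x' x' \<noteq> 0"
    using ipm_self(3)[of \<omega> "\<gamma> \<box> label_obj (bar_label \<alpha>)" x'] xh o x'(2) by (auto simp: t homT_simps)
  moreover have "cnj (ipm \<gamma> x x) = ipm \<gamma> x x"
    using ipm_cnj[of \<gamma> "\<omega> \<box> label_obj \<alpha>" x x] xh o by simp
  ultimately show ?thesis unfolding 1 2 c by simp
qed

section \<open>Coefficients of words\<close>

lemma rvip_word_length:
  assumes "q \<in> rawc" "\<And>w. w \<in> Poly_Mapping.keys (snd q) \<Longrightarrow> length w < length u"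
  shows "rvip (\<lambda>_. 0, word u) q = 0"
proof -
  have "Wf (word u) (snd q) \<beta> = 0" for \<beta>
  proof -
    have "Wf (word u) (snd q) \<beta> = pm_sum (\<lambda>w. 0) (snd q)"
      unfolding Wf_def
    proof (rule pm_sum_cong)
      fix w assume "w \<in> Poly_Mapping.keys (snd q)"
      then have "length u \<noteq> length w" using assms(2) by fastforce
      then show "Wl (word u) w \<beta> = 0" by (simp add: Wl_def word_ip_length)
    qed
    then show ?thesis by simp
  qed
  then show ?thesis by (simp add: rvip_def \<tau>_def rip_def)
qed

lemma vnorm_word_vec: "u \<noteq> [] \<Longrightarrow> set u \<subseteq> H \<Longrightarrow> vnorm K.Hc (word_vec u) = sqrt (Re (\<tau> (word_ip unitA u u)))"
proof -
  assume "u \<noteq> []" "set u \<subseteq> H"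
  moreover have "Wf (word u) (word u) = word_ip unitA u u" by (rule ext) (simp add: Wf_word_word)
  ultimately show ?thesis by (simp add: vnorm_def word_vec_def em_vip rvip_def rip_def[abs_def])
qed

text \<open>\<open>X\<close> is approximated by a vector of finite degree, which is orthogonal to
  all longer words; the constant norm of the words makes the error uniform in
  \<open>k\<close>.\<close>

lemma coefficient_decay:
  assumes X: "X \<in> car K.Hc" and u: "\<And>k. u k \<noteq> []" "\<And>k. set (u k) \<subseteq> H" "\<And>k. length (u k) \<ge> k"
    and norm: "\<And>k. word_ip unitA (u k) (u k) = g"
  shows "(\<lambda>k. vip K.Hc (word_vec (u k)) X) \<longlonglongrightarrow> 0"
proof (rule LIMSEQ_I)
  fix e :: real assume e: "e > 0"
  define D where "D = sqrt (Re (\<tau> g)) + 1"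
  have nu: "vnorm K.Hc (word_vec (u k)) = sqrt (Re (\<tau> g))" for k using u norm by (simp add: vnorm_word_vec)
  have D: "D > 0" using F.vnorm_nonneg[OF word_vec_in[OF u(1,2)], of 0] nu[of 0] by (simp add: D_def add_nonneg_pos)
  obtain \<zeta> where \<zeta>: "\<zeta> \<in> car fock_pre" "vdist K.Hc (K.emb \<zeta>) X < e / D"
    using K.emb_dense[OF X, of "e / D"] e D by auto
  define q where "q = rw \<zeta>"
  have q: "q \<in> rawc" "K.emb \<zeta> = em q" using \<zeta> fock_car_rw(1) emb_em by (auto simp: q_def)
  define N where "N = Suc (Max (insert 0 (length ` Poly_Mapping.keys (snd q))))"
  show "\<exists>n0. \<forall>k\<ge>n0. norm (vip K.Hc (word_vec (u k)) X - 0) < e"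
  proof (intro exI allI impI)
    fix k assume k: "N \<le> k"
    have "length w < length (u k)" if "w \<in> Poly_Mapping.keys (snd q)" for w
    proof -
      have "length w \<le> Max (insert 0 (length ` Poly_Mapping.keys (snd q)))" using that by (intro Max_ge) auto
      then show ?thesis using k u(3)[of k] by (simp add: N_def)
    qed
    then have 0: "vip K.Hc (word_vec (u k)) (em q) = 0"
      using q u by (simp add: word_vec_def em_vip rvip_word_length)
    have "cmod (vip K.Hc (word_vec (u k)) (em q) - vip K.Hc (word_vec (u k)) X) \<le> vnorm K.Hc (word_vec (u k)) * vdist K.Hc (em q) X"
      by (rule F.ip_diff_le) (use q X u in auto)
    also have "\<dots> \<le> D * vdist K.Hc (em q) X"
      using nu[of k] q X by (intro mult_right_mono) (auto simp: D_def)
    also have "\<dots> < D * (e / D)" using \<zeta>(2) D q by (intro mult_strict_left_mono) auto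
    finally show "norm (vip K.Hc (word_vec (u k)) X - 0) < e" using 0 D by simp
  qed
qed

end

section \<open>A discrete wave equation on the quarter plane\<close>

text \<open>The equation makes \<open>z (m + 1) n - z m (n + 1)\<close> constant along diagonals.\<close>

lemma quarter_plane_wave:
  fixes z :: "nat \<Rightarrow> nat \<Rightarrow> complex" and s :: real
  assumes eq: "\<And>m n. z (Suc m) n + (if m = 0 then (if p then s * z 0 n else 0) else z (m - 1) n + s * z m n) =
      z m (Suc n) + (if n = 0 then (if q then s * z m 0 else 0) else z m (n - 1) + s * z m n)"
    and lim: "\<And>m n. (\<lambda>k. z (m + k) (n + k)) \<longlonglongrightarrow> 0"
    and s: "s > 0"
  shows "z (Suc m) n = z m (Suc n)"
    and "p \<or> q \<or> s \<le> 1 \<Longrightarrow> z m n = 0"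
    and "z 1 0 = 0 \<Longrightarrow> z 0 0 = 0"
proof -
  define D where "D m n = z (Suc m) n - z m (Suc n)" for m n
  have D_Suc: "D (Suc m) (Suc n) = D m n" for m n
    using eq[of "Suc m" "Suc n"] by (simp add: D_def algebra_simps)
  have D_add: "D (m + k) (n + k) = D m n" for m n k
    by (induction k) (simp_all add: D_Suc)
  have "(\<lambda>k. D (m + k) (n + k)) \<longlonglongrightarrow> 0 - 0" for m n
    unfolding D_def using lim[of "Suc m" n] lim[of m "Suc n"] by (intro tendsto_diff) simp_all
  then have D0: "D m n = 0" for m n
    by (simp add: D_add LIMSEQ_const_iff)
  then have shift: "z (Suc m) n = z m (Suc n)" for m n by (simp add: D_def)
  then show "z (Suc m) n = z m (Suc n)" .
  \<comment> \<open>Hence \<open>z\<close> is a function of \<open>m + n\<close> alone, and the two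
    edges of the quarter plane give two recurrences for it.\<close>
  have G: "z m n = z 0 (m + n)" for m n
    by (induction m arbitrary: n) (simp_all add: shift)
  have left: "(if p then s * z 0 (Suc n) else 0) = z 0 n + s * z 0 (Suc n)" for n
    using eq[of 0 "Suc n"] shift[of 0 "Suc n"] by simp
  have right: "z 0 n + s * z 0 (Suc n) = (if q then s * z 0 (Suc n) else 0)" for n
    using eq[of "Suc n" 0] shift[of "Suc n" 0] G[of "Suc n" 0] G[of n 0] by simp
  \<comment> \<open>When a flag is set, the terms with \<open>s\<close> cancel in the corresponding
    recurrence and leave \<open>z 0 n = 0\<close>.\<close>
  have pq: "z 0 n = 0" if "p \<or> q" for n
    using left[of n] right[of n] that by (cases p; cases q) auto
  have step: "z 0 n = - (s * z 0 (Suc n))" if "\<not> (p \<or> q)" for n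
    using left[of n] that by (simp add: add_eq_0_iff2)
  show "z m n = 0" if "p \<or> q \<or> s \<le> 1"
  proof (cases "p \<or> q")
    case True
    then show ?thesis using pq G[of m n] by simp
  next
    case False
    then have s1: "s \<le> 1" using that by simp
    \<comment> \<open>For \<open>s \<le> 1\<close> the recurrence makes absolute values
      nondecreasing along the edge. As \<open>z\<close> depends on \<open>m + n\<close> only, they
      do not decrease along diagonals either, where they must tend to 0.\<close>
    have "cmod (z 0 N) \<le> cmod (z k (N + k))" for N k
    proof -
      have "cmod (z 0 N) \<le> cmod (z 0 (N + j))" for j
      proof (induction j)
        case (Suc j)
        have "cmod (z 0 (N + j)) = s * cmod (z 0 (Suc (N + j)))"
          using step[OF False, of "N + j"] s by (simp add: norm_mult)
        also have "\<dots> \<le> 1 * cmod (z 0 (Suc (N + j)))" using s1 by (intro mult_right_mono) auto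
        finally show ?case using Suc by simp
      qed simp
      from this[of "k + k"] show ?thesis using G[of k "N + k"] by (simp add: add_ac)
    qed
    moreover have "(\<lambda>k. cmod (z k (N + k))) \<longlonglongrightarrow> 0" for N
      using tendsto_norm_zero[OF lim[of 0 N]] by simp
    ultimately have "cmod (z 0 N) \<le> 0" for N by (meson LIMSEQ_le_const)
    then show ?thesis using G[of m n] by simp
  qed
  \<comment> \<open>Valid for every positive \<open>s\<close>: one step of the recurrence carries a
    zero back to the corner.\<close>
  show "z 0 0 = 0" if "z 1 0 = 0"
  proof (cases "p \<or> q")
    case False
    then show ?thesis using step[OF False, of 0] that shift[of 0 0] by simp
  qed (use pq in blast)
qed

section \<open>Loops\<close>

context fock_category
begin

lemma bar_label_neq [simp]: "bar_label \<alpha> \<noteq> \<alpha>"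
  by (cases \<alpha>) auto

text \<open>Two unit vectors spanning the morphism spaces of a loop at \<open>v\<close> and of its conjugate; the
  number \<open>s\<close> is the weight of the annihilation part of \<open>\<Gamma> a\<close>.\<close>

definition loop_pair :: "'o \<Rightarrow> ('o, 'm) hvec \<Rightarrow> ('o, 'm) hvec \<Rightarrow> real \<Rightarrow> bool" where
  "loop_pair v a b s \<longleftrightarrow> (\<exists>\<alpha> xa xb. v \<in> S \<and> \<alpha> \<in> \<Lambda> \<and> s > 0 \<and>
     xa \<in> homT (v, \<alpha>, v) \<and> xb \<in> homT (v, bar_label \<alpha>, v) \<and>
     ipm v xa xa = 1 \<and> ipm v xb xb = 1 \<and>
     (\<forall>y\<in>homT (v, \<alpha>, v). \<exists>k. y = k \<odot> xa) \<and> (\<forall>y\<in>homT (v, bar_label \<alpha>, v). \<exists>k. y = k \<odot> xb) \<and>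
     a = hl (v, \<alpha>, v) xa \<and> b = hl (v, bar_label \<alpha>, v) xb \<and>
     tomita_S a = hscale (complex_of_real s) b \<and> tomita_S b = hscale (complex_of_real (1 / s)) a)"

lemma loop_pair_sym: "loop_pair v a b s \<Longrightarrow> loop_pair v b a (1 / s)"
  unfolding loop_pair_def by (elim exE conjE, rule_tac x = "bar_label \<alpha>" in exI) auto

definition homog :: "('o, 'm) hvec \<Rightarrow> bool" where
  "homog e \<longleftrightarrow> (\<exists>t\<in>triples. \<exists>x\<in>homT t. e = hl t x)"

text \<open>Annihilation by \<open>a\<close> or \<open>b\<close> either recognizes such a letter by
  equality or gives 0. As the components at the two loops are one-dimensional, every homogeneous
  vector is still a multiple of a letter.\<close>

definition letters :: "('o, 'm) hvec \<Rightarrow> ('o, 'm) hvec \<Rightarrow> ('o, 'm) hvec set" where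
  "letters a b = {e. homog e \<and> (e = a \<or> hip a e = (\<lambda>_. 0)) \<and> (e = b \<or> hip b e = (\<lambda>_. 0))}"

lemma letters_sym: "letters b a = letters a b"
  by (auto simp: letters_def)

lemma homog_H: "homog e \<Longrightarrow> e \<in> H"
  by (auto simp: homog_def)

lemma letters_H: "letters a b \<subseteq> H"
  by (auto simp: letters_def homog_H)

lemma homog_lact: "homog e \<Longrightarrow> lact (unit_at v) e = e \<or> lact (unit_at v) e = hscale 0 e"
  and homog_ract: "homog e \<Longrightarrow> ract e (unit_at v) = e \<or> ract e (unit_at v) = hscale 0 e"
  unfolding homog_def using lact_hl[of _ _ "unit_at v"] ract_hl[of _ _ "unit_at v"] by (auto simp: unit_at_def)

lemma loop_pairD:
  assumes "loop_pair v a b s"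
  shows "v \<in> S" "s > 0" "homog a" "homog b" "a \<in> H" "b \<in> H" "a \<noteq> b"
    "hip a a = unit_at v" "hip b b = unit_at v" "hip a b = (\<lambda>_. 0)" "hip b a = (\<lambda>_. 0)"
    "lact (unit_at v) a = a" "ract a (unit_at v) = a" "lact (unit_at v) b = b" "ract b (unit_at v) = b"
    "tomita_S a = hscale (complex_of_real s) b" "tomita_S b = hscale (complex_of_real (1 / s)) a"
    "a \<in> letters a b" "b \<in> letters a b"
    "\<And>w. w \<noteq> v \<Longrightarrow> lact (unit_at w) a = hscale 0 a" "\<And>c. lact c a = hscale (c v) a"
    "\<And>t x. t \<in> triples \<Longrightarrow> x \<in> homT t \<Longrightarrow> \<exists>k. \<exists>e\<in>letters a b. hl t x = hscale k e"
proof -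
  obtain \<alpha> xa xb where l: "v \<in> S" "\<alpha> \<in> \<Lambda>" "s > 0"
    "xa \<in> homT (v, \<alpha>, v)" "xb \<in> homT (v, bar_label \<alpha>, v)" "ipm v xa xa = 1" "ipm v xb xb = 1"
    "\<forall>y\<in>homT (v, \<alpha>, v). \<exists>k. y = k \<odot> xa" "\<forall>y\<in>homT (v, bar_label \<alpha>, v). \<exists>k. y = k \<odot> xb"
    "a = hl (v, \<alpha>, v) xa" "b = hl (v, bar_label \<alpha>, v) xb"
    "tomita_S a = hscale (complex_of_real s) b" "tomita_S b = hscale (complex_of_real (1 / s)) a"
    using assms unfolding loop_pair_def by metis
  let ?ta = "(v, \<alpha>, v)" and ?tb = "(v, bar_label \<alpha>, v)"
  have t: "?ta \<in> triples" "?tb \<in> triples" using l by auto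
  show "v \<in> S" "s > 0" "tomita_S a = hscale (complex_of_real s) b"
    "tomita_S b = hscale (complex_of_real (1 / s)) a" using l by auto
  show H: "homog a" "homog b" using t l by (auto simp: homog_def)
  then show aH: "a \<in> H" "b \<in> H" by (auto simp: homog_H)
  have hip_a: "hip a \<zeta> = (\<lambda>\<gamma>. if \<gamma> = v then ipm v xa (\<zeta> ?ta) else 0)" if "\<zeta> \<in> H" for \<zeta>
    unfolding l(10) using hip_hl[OF t(1) l(4) that] by auto
  have hip_b: "hip b \<zeta> = (\<lambda>\<gamma>. if \<gamma> = v then ipm v xb (\<zeta> ?tb) else 0)" if "\<zeta> \<in> H" for \<zeta>
    unfolding l(11) using hip_hl[OF t(2) l(5) that] by auto
  have za: "ipm v xa (zT ?ta) = 0" "ipm v xb (zT ?tb) = 0"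
    using l by (simp_all add: homT_simps ipm_zer[of v "v \<box> label_obj _"])
  have aa: "a ?ta = xa" "a ?tb = zT ?tb" "b ?tb = xb" "b ?ta = zT ?ta"
    unfolding l(10,11) using t bar_label_neq[of \<alpha>] bar_label_neq[of \<alpha>, symmetric] by (simp_all add: hl_apply)
  show hh: "hip a a = unit_at v" "hip b b = unit_at v" "hip a b = (\<lambda>_. 0)" "hip b a = (\<lambda>_. 0)"
    using l(6,7) aa za by (simp_all add: hip_a[OF aH(1)] hip_a[OF aH(2)] hip_b[OF aH(1)] hip_b[OF aH(2)] unit_at_def fun_eq_iff)
  have "hip a a v \<noteq> hip a b v" using hh by (simp add: unit_at_def)
  then show "a \<noteq> b" by auto
  have eig: "lact c a = hscale (c v) a" "ract a c = hscale (c v) a" "lact c b = hscale (c v) b" "ract b c = hscale (c v) b" for c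
    unfolding l(10,11) using t l lact_hl ract_hl by auto
  show "lact (unit_at v) a = a" "ract a (unit_at v) = a" "lact (unit_at v) b = b" "ract b (unit_at v) = b"
    using aH by (simp_all add: eig) (simp_all add: unit_at_def)
  show "lact c a = hscale (c v) a" for c by (rule eig)
  show "lact (unit_at w) a = hscale 0 a" if "w \<noteq> v" for w using that by (simp add: eig) (simp add: unit_at_def)
  show "a \<in> letters a b" "b \<in> letters a b" using H hh by (auto simp: letters_def)
  show "\<exists>k. \<exists>e\<in>letters a b. hl t x = hscale k e" if tx: "t \<in> triples" "x \<in> homT t" for t x
  proof -
    consider "t = ?ta" | "t = ?tb" | "t \<noteq> ?ta" "t \<noteq> ?tb" by blast
    then show ?thesis
    proof cases
      case 1
      then obtain k where "x = k \<odot> xa" using l tx by blast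
      then have "hl t x = hscale k a" using hscale_hl[OF t(1) l(4)] 1 l by simp
      then show ?thesis using \<open>a \<in> letters a b\<close> by blast
    next
      case 2
      then obtain k where "x = k \<odot> xb" using l tx by blast
      then have "hl t x = hscale k b" using hscale_hl[OF t(2) l(5)] 2 l by simp
      then show ?thesis using \<open>b \<in> letters a b\<close> by blast
    next
      case 3
      have "hl t x \<in> H" using tx by simp
      then have "hl t x \<in> letters a b"
        using 3 tx t za by (auto simp: letters_def homog_def hip_a hip_b hl_apply)
      then show ?thesis using tx by (metis hl_in hscale_one)
    qed
  qed
qed

text \<open>The empty word carries no endpoints of its own, so the base point \<open>v\<close>
  decides which vacuum vector it denotes.\<close>

definition W :: "'o \<Rightarrow> ('o, 'm) hvec list \<Rightarrow> (nat \<Rightarrow> ('o, 'm) fvec) set" where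
  "W v u = (if u = [] then vacuum v else word_vec u)"

lemma W_in: "v \<in> S \<Longrightarrow> set u \<subseteq> H \<Longrightarrow> W v u \<in> car K.Hc"
  by (simp add: W_def)

definition starts_at :: "'o \<Rightarrow> ('o, 'm) hvec list \<Rightarrow> bool" where
  "starts_at v u \<longleftrightarrow> u = [] \<or> lact (unit_at v) (hd u) = hd u"

definition ends_at :: "'o \<Rightarrow> ('o, 'm) hvec list \<Rightarrow> bool" where
  "ends_at v u \<longleftrightarrow> u = [] \<or> ract (last u) (unit_at v) = last u"

lemma word_vec_zero_letter:
  assumes "set w \<subseteq> H" "set w' \<subseteq> H" "\<xi> \<in> H" "X \<in> car K.Hc"
  shows "vip K.Hc (word_vec (w @ hscale 0 \<xi> # w')) X = 0"
  using word_vec_relations(2)[OF assms(1,2,3,3), of 0] assms F.ip_scale_left[of X "word_vec (w @ \<xi> # w')" 0] by simp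

text \<open>By balancing, the projection at \<open>v\<close> may be moved across the tensor sign: it
  fixes the first letter and kills the second.\<close>

lemma word_vec_not_composable:
  assumes "set w \<subseteq> H" "set w' \<subseteq> H" "e \<in> H" "ract e (unit_at v) = e" "homog e'" "lact (unit_at v) e' \<noteq> e'" "X \<in> car K.Hc"
  shows "vip K.Hc (word_vec (w @ e # e' # w')) X = 0"
proof -
  have e': "e' \<in> H" "lact (unit_at v) e' = hscale 0 e'" using assms homog_lact homog_H by auto
  have "word_vec (w @ e # e' # w') = word_vec (w @ ract e (unit_at v) # e' # w')" using assms by simp
  also have "\<dots> = word_vec ((w @ [e]) @ hscale 0 e' # w')"
    using word_vec_relations(3)[OF assms(1,2,3) e'(1)] e'(2) by simp
  finally show ?thesis using word_vec_zero_letter[of "w @ [e]" w' e' X] assms e' by simp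
qed

lemma word_vec_not_composable':
  assumes "set w \<subseteq> H" "set w' \<subseteq> H" "e' \<in> H" "lact (unit_at v) e' = e'" "homog e" "ract e (unit_at v) \<noteq> e" "X \<in> car K.Hc"
  shows "vip K.Hc (word_vec (w @ e # e' # w')) X = 0"
proof -
  have e: "e \<in> H" "ract e (unit_at v) = hscale 0 e" using assms homog_ract homog_H by auto
  have "word_vec (w @ e # e' # w') = word_vec (w @ e # lact (unit_at v) e' # w')" using assms by simp
  also have "\<dots> = word_vec (w @ hscale 0 e # e' # w')"
    using word_vec_relations(3)[OF assms(1,2) e(1) assms(3)] e(2) by metis
  finally show ?thesis using word_vec_zero_letter[of w "e' # w'" e X] assms e by simp
qed

lemma vip_em_word_vec: "X \<in> car K.Hc \<Longrightarrow> p \<in> rawc \<Longrightarrow> u \<noteq> [] \<Longrightarrow> set u \<subseteq> H \<Longrightarrow>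
    (\<And>\<beta>. fst p \<beta> = 0) \<Longrightarrow> (\<And>x \<beta>. x \<in> free_words \<Longrightarrow> Wf x (snd p) \<beta> = k * Wl x u \<beta>) \<Longrightarrow>
    vip K.Hc (em p) X = cnj k * vip K.Hc (word_vec u) X"
proof -
  assume *: "X \<in> car K.Hc" "p \<in> rawc" "u \<noteq> []" "set u \<subseteq> H" "\<And>\<beta>. fst p \<beta> = 0"
    "\<And>x \<beta>. x \<in> free_words \<Longrightarrow> Wf x (snd p) \<beta> = k * Wl x u \<beta>"
  have "em p = em (rscale k (\<lambda>_. 0, word u))"
    by (rule em_eqI[OF *(2) rawc_ops(2)]) (use * in \<open>auto simp: rscale_def Wf_scale Wf_word\<close>)
  then show ?thesis using * by (simp add: vip_em_scale word_vec_def)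
qed

lemma vip_em_vacuum: "X \<in> car K.Hc \<Longrightarrow> p \<in> rawc \<Longrightarrow> v \<in> S \<Longrightarrow>
    (\<And>\<beta>. fst p \<beta> = k * unit_at v \<beta>) \<Longrightarrow> (\<And>x \<beta>. x \<in> free_words \<Longrightarrow> Wf x (snd p) \<beta> = 0) \<Longrightarrow>
    vip K.Hc (em p) X = cnj k * vip K.Hc (vacuum v) X"
proof -
  assume *: "X \<in> car K.Hc" "p \<in> rawc" "v \<in> S" "\<And>\<beta>. fst p \<beta> = k * unit_at v \<beta>"
    "\<And>x \<beta>. x \<in> free_words \<Longrightarrow> Wf x (snd p) \<beta> = 0"
  have "em p = em (rscale k (unit_at v, 0))"
    by (rule em_eqI[OF *(2) rawc_ops(2)]) (use * in \<open>auto simp: rscale_def Wf_scale Wf_zero\<close>)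
  then show ?thesis using * by (simp add: vip_em_scale vacuum_def)
qed

text \<open>The adjoint of \<open>\<Gamma> b\<close> is \<open>\<Gamma>\<close> of
  \<open>tomita_S b\<close>, that is, \<open>1 / s\<close> times the creation of \<open>a\<close>
  plus the annihilation of \<open>b\<close>. Moved onto the word, it yields the two terms.\<close>

lemma left_step:
  assumes l: "loop_pair v a b s" and u: "set u \<subseteq> letters a b" and X: "X \<in> car K.Hc"
  shows "vip K.Hc (W v u) (E (lift (rgam b)) X) = complex_of_real (1 / s) * vip K.Hc (W v (a # u)) X +
    (if u \<noteq> [] \<and> hd u = b \<and> starts_at v (tl u) then vip K.Hc (W v (tl u)) X else 0)"
proof -
  note d = loop_pairD[OF l]
  define q where "q = (if u = [] then (unit_at v, 0) else (\<lambda>_. 0, word u))"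
  have uH: "set u \<subseteq> H" using u letters_H by blast
  have q: "q \<in> rawc" "em q = W v u" using uH d(1) by (auto simp: q_def W_def vacuum_def word_vec_def)
  have Sb: "tomita_S b \<in> H" using d(6) by simp
  note bp = raw_pair_rgam[OF d(6)]
  have rq: "rcreate (tomita_S b) q \<in> rawc" "rannih b q \<in> rawc"
    using rcreate_in[OF Sb q(1)] rannih_in[OF d(6) q(1)] by auto
  have "vip K.Hc (W v u) (E (lift (rgam b)) X) = vip K.Hc (E (lift (rgam (tomita_S b))) (em q)) X"
    using K.extend_op(3)[OF raw_pairD(4)[OF bp], of "W v u" X] W_in[OF d(1) uH] X q by simp
  also have "E (lift (rgam (tomita_S b))) (em q) = em (rgam (tomita_S b) q)"
    by (rule raw_pairD(5)[OF raw_pair_sym[OF bp] q(1)])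
  also have "vip K.Hc \<dots> X = vip K.Hc (em (rcreate (tomita_S b) q)) X + vip K.Hc (em (rannih b q)) X"
    unfolding rgam_def using rq X d(6) by (simp add: vip_em_add)
  also have "vip K.Hc (em (rcreate (tomita_S b) q)) X = cnj (complex_of_real (1 / s)) * vip K.Hc (word_vec (a # u)) X"
  proof (rule vip_em_word_vec[OF X rq(1)])
    show "Wf x (snd (rcreate (tomita_S b) q)) \<beta> = complex_of_real (1 / s) * Wl x (a # u) \<beta>"
      if x: "x \<in> free_words" for x \<beta>
      using Wl_relations(2)[OF x, of "[]" u a a "complex_of_real (1 / s)"] d(5) uH
        Wl_zero[OF x, of "[]" "[]" "hscale (complex_of_real (1 / s)) a"] d(13)
        ract_hscale[of a "complex_of_real (1 / s)" "unit_at v"]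
      by (auto simp: q_def rcreate_def Wf_add Wf_word Wf_zero d(17))
  qed (use d(5) uH in \<open>auto simp: rcreate_def\<close>)
  also have "vip K.Hc (em (rannih b q)) X =
      (if u \<noteq> [] \<and> hd u = b \<and> starts_at v (tl u) then vip K.Hc (W v (tl u)) X else 0)"
  proof (cases u rule: remdups_adj.cases)
    case 1
    have "vip K.Hc (em (rannih b q)) X = cnj 0 * vip K.Hc (vacuum v) X"
      by (rule vip_em_vacuum[OF X rq(2) d(1)]) (simp_all add: q_def 1 rannih_def Wf_zero)
    then show ?thesis using 1 by simp
  next
    case (2 \<xi>)
    have \<xi>: "\<xi> = b \<or> hip b \<xi> = (\<lambda>_. 0)" using u 2 by (auto simp: letters_def)
    have "vip K.Hc (em (rannih b q)) X = cnj (if \<xi> = b then 1 else 0) * vip K.Hc (vacuum v) X"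
      by (rule vip_em_vacuum[OF X rq(2) d(1)]) (use \<xi> d(9) in \<open>auto simp: q_def 2 rannih_def an1_def an2_def Wf_zero\<close>)
    then show ?thesis using 2 by (simp add: starts_at_def W_def)
  next
    case (3 \<xi> \<xi>' u')
    have \<xi>: "\<xi> = b \<or> hip b \<xi> = (\<lambda>_. 0)" and \<xi>': "homog \<xi>'" "\<xi>' \<in> H" "set u' \<subseteq> H"
      using u 3 letters_H by (auto simp: letters_def homog_H)
    have "vip K.Hc (em (rannih b q)) X = cnj (if \<xi> = b \<and> starts_at v (\<xi>' # u') then 1 else 0) * vip K.Hc (word_vec (\<xi>' # u')) X"
    proof (rule vip_em_word_vec[OF X rq(2)])
      show "Wf x (snd (rannih b q)) \<beta> = (if \<xi> = b \<and> starts_at v (\<xi>' # u') then 1 else 0) * Wl x (\<xi>' # u') \<beta>"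
        if x: "x \<in> free_words" for x \<beta>
        using \<xi> \<xi>' d(9) homog_lact[OF \<xi>'(1), of v] Wl_zero(1)[OF x, of "[]" u' \<xi>'] Wl_relations(2)[OF x, of "[]" u' \<xi>' \<xi>' 0]
        by (auto simp: q_def 3 rannih_def an2_def Wf_word starts_at_def)
    qed (use \<xi>' in \<open>auto simp: q_def 3 rannih_def an1_def\<close>)
    then show ?thesis using 3 by (simp add: W_def)
  qed
  finally show ?thesis by (simp add: W_def)
qed

text \<open>The mirror image of \<open>\<Gamma> a\<close>, acting on the right ends of words.\<close>

definition right_op where
  "right_op v a b s T \<longleftrightarrow> T \<in> commutant K.Hc gens \<and>
    (\<forall>u X. set u \<subseteq> Collect homog \<longrightarrow> (u = [] \<or> last u \<in> letters a b) \<longrightarrow> X \<in> car K.Hc \<longrightarrow>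
      vip K.Hc (W v u) (T X) = complex_of_real (1 / s) * vip K.Hc (W v (u @ [b])) X +
      (if u \<noteq> [] \<and> last u = a \<and> ends_at v (butlast u) then vip K.Hc (W v (butlast u)) X else 0)) \<and>
    T (vacuum v) = word_vec [a] \<and> (\<forall>w\<in>S. w \<noteq> v \<longrightarrow> T (vacuum w) = vzero K.Hc) \<and>
    T (word_vec [b]) = vadd K.Hc (word_vec [b, a]) (vscale K.Hc (complex_of_real (1 / s)) (vacuum v))"

lemma right_opD:
  assumes "right_op v a b s T"
  shows "T \<in> commutant K.Hc gens"
    "\<And>u X. set u \<subseteq> Collect homog \<Longrightarrow> u = [] \<or> last u \<in> letters a b \<Longrightarrow> X \<in> car K.Hc \<Longrightarrow>
      vip K.Hc (W v u) (T X) = complex_of_real (1 / s) * vip K.Hc (W v (u @ [b])) X +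
      (if u \<noteq> [] \<and> last u = a \<and> ends_at v (butlast u) then vip K.Hc (W v (butlast u)) X else 0)"
    "T (vacuum v) = word_vec [a]" "\<And>w. w \<in> S \<Longrightarrow> w \<noteq> v \<Longrightarrow> T (vacuum w) = vzero K.Hc"
    "T (word_vec [b]) = vadd K.Hc (word_vec [b, a]) (vscale K.Hc (complex_of_real (1 / s)) (vacuum v))"
  using assms unfolding right_op_def by blast+

text \<open>This is \<open>right_gam\<close> at the loops: it creates \<open>a\<close> and
  annihilates \<open>b\<close> with the weight \<open>1 / s\<close> demanded by \<open>star\<close>.
  All endpoints are \<open>v\<close>, so the ratio of dimensions is 1, and the adjoint creates
  \<open>b\<close> with weight \<open>1 / s\<close> and annihilates \<open>a\<close>.\<close>

lemma right_operator:
  assumes l: "loop_pair v a b s"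
  shows "\<exists>T. right_op v a b s T"
proof -
  note d = loop_pairD[OF l]
  obtain \<alpha> xa xb where l: "v \<in> S" "\<alpha> \<in> \<Lambda>" "s > 0"
    "xa \<in> homT (v, \<alpha>, v)" "xb \<in> homT (v, bar_label \<alpha>, v)" "ipm v xa xa = 1" "ipm v xb xb = 1"
    "\<forall>y\<in>homT (v, \<alpha>, v). \<exists>k. y = k \<odot> xa" "\<forall>y\<in>homT (v, bar_label \<alpha>, v). \<exists>k. y = k \<odot> xb"
    "a = hl (v, \<alpha>, v) xa" "b = hl (v, bar_label \<alpha>, v) xb"
    "tomita_S b = hscale (complex_of_real (1 / s)) a"
    using l unfolding loop_pair_def by metis
  let ?ta = "(v, \<alpha>, v)" and ?tb = "(v, bar_label \<alpha>, v)" and ?c = "complex_of_real (1 / s)"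
  have t: "?ta \<in> triples" "?tb \<in> triples" using l by auto
  have ob: "bar_label \<alpha> \<in> \<Lambda>" using l by simp
  have xb0: "xb \<noteq> zT ?tb"
    using l by (auto simp: homT_simps ipm_zer[of v "v \<box> label_obj _"])
  have star: "?c * right_coef ?tb xb \<xi> = cnj (right_coef ?ta xa (tomita_S \<xi>))" if "\<xi> \<in> H" for \<xi>
  proof (rule star_one_dimensional[OF refl refl l(1,2,1,4,5) xb0 _ _ _ that, where \<kappa> = "1 / s"])
    show "tomita_S (hl ?tb xb) = hl ?ta (complex_of_real (1 / s) \<odot> xa)"
      using l(12) hscale_hl[OF t(1) l(4)] l(10,11) by simp
  qed (use l in auto)
  define T where "T = E (lift (right_gam ?ta xa ?tb xb ?c))"
  have dv: "dim v > 0" using dim_pos l(1) by simp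
  note Yp0 = raw_pair_right_gam[OF refl refl l(1,2,1,4,5), of ?c]
  have Yp: "raw_pair (right_gam ?ta xa ?tb xb ?c) (\<lambda>q. radd (rscale 1 (right_annih ?ta xa q)) (rscale ?c (right_create ?tb xb q)))"
    using Yp0 dv by simp
  note rin = right_create_in[OF refl l(1) ob l(1,5)] and rain = right_annih_in[OF refl l(1,2,1,4)]
  \<comment> \<open>On letters the right coefficient is only a test for equality with
    \<open>a\<close>.\<close>
  have rca: "right_coef ?ta xa e = (if e = a then 1 else 0)" if "e \<in> letters a b" for e
  proof -
    have "e \<in> H" using that letters_H by blast
    then have "right_coef ?ta xa e = hip a e v" using hip_hl[OF t(1) l(4), of e v] l(10) by (simp add: right_coef_def)
    then show ?thesis using that d(8) by (auto simp: letters_def unit_at_def)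
  qed
  have "right_op v a b s T" unfolding right_op_def
  proof (intro conjI allI ballI impI)
    show "T \<in> commutant K.Hc gens"
      unfolding T_def by (rule right_gam_commutant[OF refl refl l(1,2,1,4,5) star])
    have Tem: "T (em q) = em (right_gam ?ta xa ?tb xb ?c q)" if "q \<in> rawc" for q
      unfolding T_def by (rule raw_pairD(5)[OF Yp that])
    have ryin: "right_gam ?ta xa ?tb xb ?c q \<in> rawc" if "q \<in> rawc" for q
      by (rule raw_pairD(1)[OF Yp that])
    have "T (vacuum v) = em (right_gam ?ta xa ?tb xb ?c (unit_at v, 0))" unfolding vacuum_def by (rule Tem) (use l in simp)
    also have "\<dots> = word_vec [a]" unfolding word_vec_def
      by (rule em_eqI[OF ryin]) (use l(1) d(5,12) l(10) in \<open>simp_all add: right_gam_def right_create_def right_annih_def radd_def rscale_def\<close>)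
    finally show "T (vacuum v) = word_vec [a]" .
    show "T (vacuum w) = vzero K.Hc" if w: "w \<in> S" "w \<noteq> v" for w
    proof -
      have "T (vacuum w) = em (right_gam ?ta xa ?tb xb ?c (unit_at w, 0))" unfolding vacuum_def by (rule Tem) (use w in simp)
      also have "\<dots> = em (rscale 0 (unit_at v, 0))"
      proof (rule em_eqI[OF ryin])
        show "Wf x (snd (right_gam ?ta xa ?tb xb ?c (unit_at w, 0))) \<beta> = Wf x (snd (rscale 0 (unit_at v, 0))) \<beta>"
          if x: "x \<in> free_words" for x \<beta>
          using d(20)[OF w(2)] l(10) Wl_relations(2)[OF x, of "[]" "[]" a a 0] d(5)
          by (simp add: right_gam_def right_create_def right_annih_def radd_def rscale_def Wf_word Wf_zero)
      qed (use w l(1) in \<open>simp_all add: right_gam_def right_create_def right_annih_def radd_def rscale_def\<close>)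
      also have "\<dots> = vzero K.Hc"
        by (rule F_ext) (use l(1) in \<open>auto simp: em_rscale[symmetric] F.ip_simps\<close>)
      finally show ?thesis .
    qed
    have "T (word_vec [b]) = em (right_gam ?ta xa ?tb xb ?c (\<lambda>_. 0, word [b]))" unfolding word_vec_def by (rule Tem) (use d(6) in simp)
    also have "\<dots> = em (radd (\<lambda>_. 0, word [b, a]) (rscale ?c (unit_at v, 0)))"
    proof (rule em_eqI[OF ryin])
      have "right_coef ?tb xb b = 1" using l t by (simp add: right_coef_def hl_apply)
      then show "fst (right_gam ?ta xa ?tb xb ?c (\<lambda>_. 0, word [b])) \<beta> = fst (radd (\<lambda>_. 0, word [b, a]) (rscale ?c (unit_at v, 0))) \<beta>" for \<beta>
        by (simp add: right_gam_def right_create_def right_annih_def radd_def rscale_def ra1_def)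
      show "Wf x (snd (right_gam ?ta xa ?tb xb ?c (\<lambda>_. 0, word [b]))) \<beta> =
          Wf x (snd (radd (\<lambda>_. 0, word [b, a]) (rscale ?c (unit_at v, 0)))) \<beta>" if x: "x \<in> free_words" for x \<beta>
        using l(10) Wl_zero(1)[OF x, of "[]" "[]" a] d(5)
        by (simp add: right_gam_def right_create_def right_annih_def radd_def rscale_def ra2_def Wf_word Wf_zero Wf_add)
    qed (use l(1) d(5,6) in simp_all)
    finally show "T (word_vec [b]) = vadd K.Hc (word_vec [b, a]) (vscale K.Hc ?c (vacuum v))"
      using l(1) d(5,6) by (simp add: word_vec_def vacuum_def em_radd em_rscale)
    fix u X assume u: "set u \<subseteq> Collect homog" "u = [] \<or> last u \<in> letters a b" and X: "X \<in> car K.Hc"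
    define q where "q = (if u = [] then (unit_at v, 0) else (\<lambda>_. 0, word u))"
    have uH: "set u \<subseteq> H" using u(1) homog_H by blast
    have q: "q \<in> rawc" "em q = W v u" using uH l(1) by (auto simp: q_def W_def vacuum_def word_vec_def)
    have "vip K.Hc (W v u) (T X) =
        vip K.Hc (E (lift (\<lambda>q. radd (rscale 1 (right_annih ?ta xa q)) (rscale ?c (right_create ?tb xb q)))) (em q)) X"
      unfolding T_def using K.extend_op(3)[OF raw_pairD(4)[OF Yp], of "W v u" X] W_in[OF l(1) uH] X q by simp
    also have "\<dots> = vip K.Hc (em (radd (rscale 1 (right_annih ?ta xa q)) (rscale ?c (right_create ?tb xb q)))) X"
      using raw_pairD(5)[OF raw_pair_sym[OF Yp] q(1)] by simp
    also have "\<dots> = vip K.Hc (em (right_annih ?ta xa q)) X + cnj ?c * vip K.Hc (em (right_create ?tb xb q)) X"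
      using X rin[OF q(1)] rain[OF q(1)] vip_em_scale[OF rain[OF q(1)] X, of 1]
        vip_em_scale[OF rin[OF q(1)] X, of ?c] by (simp add: vip_em_add)
    also have "vip K.Hc (em (right_create ?tb xb q)) X = cnj 1 * vip K.Hc (word_vec (u @ [b])) X"
    proof (rule vip_em_word_vec[OF X rin[OF q(1)]])
      show "Wf x (snd (right_create ?tb xb q)) \<beta> = 1 * Wl x (u @ [b]) \<beta>" if x: "x \<in> free_words" for x \<beta>
        using l(11) d(6,14) Wl_zero(1)[OF x, of "[]" "[]" b]
        by (auto simp: q_def right_create_def Wf_add Wf_word Wf_zero)
    qed (use d(6) uH in \<open>auto simp: right_create_def\<close>)
    also have "vip K.Hc (em (right_annih ?ta xa q)) X =
        (if u \<noteq> [] \<and> last u = a \<and> ends_at v (butlast u) then vip K.Hc (W v (butlast u)) X else 0)"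
    proof (cases "length u \<ge> 2")
      case True
      then obtain w \<mu> \<zeta> where w: "u = w @ [\<mu>, \<zeta>]" by (rule list_length_ge2)
      then have m: "\<zeta> \<in> letters a b" "homog \<mu>" "\<mu> \<in> H" "set w \<subseteq> H"
        using u uH by (auto simp: letters_def)
      have "vip K.Hc (em (right_annih ?ta xa q)) X =
          cnj (if \<zeta> = a \<and> ends_at v (w @ [\<mu>]) then 1 else 0) * vip K.Hc (word_vec (w @ [\<mu>])) X"
      proof (rule vip_em_word_vec[OF X rain[OF q(1)]])
        show "Wf x (snd (right_annih ?ta xa q)) \<beta> = (if \<zeta> = a \<and> ends_at v (w @ [\<mu>]) then 1 else 0) * Wl x (w @ [\<mu>]) \<beta>"
          if x: "x \<in> free_words" for x \<beta>
          using rca[OF m(1)] homog_ract[OF m(2), of v] m(3,4) Wl_relations(2)[OF x, of w "[]" \<mu> \<mu> 0]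
          by (auto simp: q_def w right_annih_def ra2_snoc Wf_scale Wf_word ends_at_def)
      qed (use m in \<open>auto simp: q_def w right_annih_def ra1_def\<close>)
      then show ?thesis using w by (simp add: W_def butlast_append)
    next
      case False
      then consider "u = []" | \<zeta> where "u = [\<zeta>]" by (cases u rule: remdups_adj.cases) auto
      then show ?thesis
      proof cases
        case 1
        have "vip K.Hc (em (right_annih ?ta xa q)) X = cnj 0 * vip K.Hc (vacuum v) X"
          by (rule vip_em_vacuum[OF X rain[OF q(1)] l(1)]) (simp_all add: q_def 1 right_annih_def Wf_zero)
        then show ?thesis using 1 by simp
      next
        case (2 \<zeta>)
        have "vip K.Hc (em (right_annih ?ta xa q)) X = cnj (if \<zeta> = a then 1 else 0) * vip K.Hc (vacuum v) X"
          by (rule vip_em_vacuum[OF X rain[OF q(1)] l(1)])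
             (use rca[of \<zeta>] u 2 in \<open>auto simp: q_def right_annih_def ra1_def ra2_def Wf_zero\<close>)
        then show ?thesis using 2 by (simp add: W_def ends_at_def)
      qed
    qed
    finally show "vip K.Hc (W v u) (T X) = ?c * vip K.Hc (W v (u @ [b])) X +
      (if u \<noteq> [] \<and> last u = a \<and> ends_at v (butlast u) then vip K.Hc (W v (butlast u)) X else 0)"
      by (simp add: W_def)
  qed
  then show ?thesis by blast
qed

lemma word_ip_Cons_loop:
  assumes "e \<in> H" "hip e e = unit_at v" "starts_at v u" "u \<noteq> []" "set u \<subseteq> H"
  shows "word_ip unitA (e # u) (e # u) = word_ip unitA u u"
  using assms by (cases u) (simp_all add: starts_at_def)

text \<open>As \<open>u\<close> ends at \<open>v\<close>, its inner product with itself is a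
  multiple of the projection at \<open>v\<close>, and a loop of norm 1 at \<open>v\<close>
  reproduces this multiple. Appending loops therefore keeps norms constant, as
  \<open>coefficient_decay\<close> requires.\<close>

lemma word_ip_snoc_loop:
  assumes "e \<in> H" "hip e e = unit_at v" "lact (unit_at v) e = e" "ends_at v u" "u \<noteq> []" "set u \<subseteq> H"
    and "\<And>a. hip e (lact a e) = (\<lambda>\<beta>. unit_at v \<beta> * a v)"
  shows "word_ip unitA (u @ [e]) (u @ [e]) = word_ip unitA u u"
proof -
  obtain w \<mu> where w: "u = w @ [\<mu>]" using assms(5) by (cases u rule: rev_cases) auto
  have m: "ract \<mu> (unit_at v) = \<mu>" "\<mu> \<in> H" using assms(4,6) w by (auto simp: ends_at_def)
  have dd: "word_ip unitA u u \<beta> = unit_at v \<beta> * word_ip unitA u u \<beta>" for \<beta>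
  proof -
    have "word_ip unitA u u \<beta> = hip \<mu> (ract (lact (word_ip unitA w w) \<mu>) (unit_at v)) \<beta>"
      using m w by (simp add: word_ip_snoc lact_ract[symmetric])
    then show ?thesis using m w by (simp add: hip_ract word_ip_snoc)
  qed
  have "word_ip unitA u u \<beta> = unit_at v \<beta> * word_ip unitA u u v" for \<beta>
    using dd[of \<beta>] by (cases "\<beta> = v") (simp_all add: unit_at_def)
  then have "word_ip unitA u u = (\<lambda>\<beta>. unit_at v \<beta> * word_ip unitA u u v)" by (rule ext)
  then show ?thesis using assms(7) word_ip_snoc[of u u unitA e e] by simp
qed

end

section \<open>The vacuum vectors are eigenvectors of the center\<close>

primrec pair_power :: "'h \<Rightarrow> 'h \<Rightarrow> nat \<Rightarrow> 'h list" where
  "pair_power b a 0 = []"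
| "pair_power b a (Suc k) = b # a # pair_power b a k"

lemma pair_power_Suc_right: "pair_power b a (Suc k) = pair_power b a k @ [b, a]"
  by (induction k) auto

lemma append_pair_power_Suc: "w @ pair_power b a (Suc n) = (w @ pair_power b a n) @ [b, a]"
  by (simp only: pair_power_Suc_right append_assoc)

lemma length_pair_power: "length (pair_power b a k) = 2 * k"
  by (induction k) auto

lemma set_pair_power: "set (pair_power b a k) \<subseteq> {a, b}"
  by (induction k) auto

lemma pair_power_add: "pair_power b a m @ pair_power b a n = pair_power b a (m + n)"
  by (induction m) auto

text \<open>Pairs \<open>ba\<close> are stripped from either end as long as possible. The core
  \<open>u\<close> that remains is the corner of a quarter plane, with \<open>m\<close> and
  \<open>n\<close> as coordinates of \<open>w\<close>.\<close>

lemma pair_power_decomposition: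
  "\<exists>m u n. w = pair_power b a m @ u @ pair_power b a n \<and> (\<forall>u'. u \<noteq> b # a # u') \<and> (\<forall>u'. u \<noteq> u' @ [b, a])"
proof (induction "length w" arbitrary: w rule: less_induct)
  case less
  show ?case
  proof (cases "\<exists>u'. w = b # a # u'")
    case True
    then obtain u' where w: "w = b # a # u'" by blast
    then obtain m u n where "u' = pair_power b a m @ u @ pair_power b a n" "\<forall>u'. u \<noteq> b # a # u'" "\<forall>u'. u \<noteq> u' @ [b, a]"
      using less[of u'] by auto
    then show ?thesis using w by (intro exI[of _ "Suc m"] exI[of _ u] exI[of _ n]) simp
  next
    case no: False
    show ?thesis
    proof (cases "\<exists>u'. w = u' @ [b, a]")
      case True
      then obtain u' where w: "w = u' @ [b, a]" by blast
      then obtain m u n where u: "u' = pair_power b a m @ u @ pair_power b a n" "\<forall>u'. u \<noteq> b # a # u'" "\<forall>u'. u \<noteq> u' @ [b, a]"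
        using less[of u'] by auto
      then show ?thesis
        using w by (intro exI[of _ m] exI[of _ u] exI[of _ "Suc n"]) (simp add: pair_power_Suc_right del: pair_power.simps(2))
    next
      case False
      then show ?thesis using no by (intro exI[of _ 0] exI[of _ w]) auto
    qed
  qed
qed

context fock_category
begin

text \<open>For the label \<open>Plain (unt C)\<close> the morphism space at \<open>v\<close> is the
  endomorphism space of \<open>v\<close>, spanned by the identity. \<open>bar\<close> maps it
  bijectively and conjugate-linearly onto the space of the conjugate label, which is therefore
  one-dimensional too.\<close>

lemma loop_exists:
  assumes v: "v \<in> S"
  shows "\<exists>a b s. loop_pair v a b s"
proof -
  define \<alpha> :: "'o label" where "\<alpha> = Plain (unt C)"
  have \<alpha>: "\<alpha> \<in> \<Lambda>" "label_obj \<alpha> = unt C" by (auto simp: \<alpha>_def \<Lambda>_def)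
  have vv: "v \<box> label_obj \<alpha> = v" using v \<alpha> ten_unt by simp
  let ?t = "(v, \<alpha>, v)" and ?t' = "(v, bar_label \<alpha>, v)"
  have t: "?t \<in> triples" "?t' \<in> triples" using v \<alpha> by auto
  have Iv: "I v \<in> homT ?t" using v by (simp add: homT_simps vv)
  have I1: "ipm v (I v) (I v) = 1" using v cmp_idt[OF _ _ idt_in[of v]] by (simp add: ipm_def)
  have I_span: "\<exists>k. y = k \<odot> I v" if "y \<in> homT ?t" for y
    using coef_eq[OF v, of y] that by (auto simp: homT_simps vv)
  define b0 where "b0 = bar v \<alpha> (I v)"
  have b0: "b0 \<in> homT ?t'" unfolding b0_def by (rule bar_homT[OF t(1) Iv])
  have bb: "bar v (bar_label \<alpha>) b0 = I v"
    unfolding b0_def using Iv by (intro bar_bar[OF v v \<alpha>(1)]) (simp add: homT_simps)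
  have b0h: "b0 \<in> hom C v (v \<box> label_obj (bar_label \<alpha>))" using b0 by (simp add: homT_simps)
  have "b0 \<noteq> zer C v (v \<box> label_obj (bar_label \<alpha>))"
  proof
    assume "b0 = zer C v (v \<box> label_obj (bar_label \<alpha>))"
    then have "I v = zer C v v" using bb bar_zer[of v v "bar_label \<alpha>"] v \<alpha> vv by simp
    then show False using S_simple[OF v] by (simp add: simple_def)
  qed
  then have n2: "ipm v b0 b0 = complex_of_real (Re (ipm v b0 b0))" "Re (ipm v b0 b0) > 0"
    using ipm_self[OF _ _ b0h] v \<alpha> by auto
  \<comment> \<open>The norm of the conjugate of \<open>I v\<close>; together with the weight of the
    label it makes up \<open>s\<close>.\<close>
  define \<nu> where "\<nu> = sqrt (Re (ipm v b0 b0))"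
  have \<nu>: "\<nu> > 0" "ipm v b0 b0 = complex_of_real (\<nu>\<^sup>2)" using n2 by (auto simp: \<nu>_def)
  define xb where "xb = complex_of_real (1 / \<nu>) \<odot> b0"
  have xb: "xb \<in> homT ?t'" using t b0 by (simp add: xb_def)
  have b0xb: "b0 = complex_of_real \<nu> \<odot> xb"
    using homT_scl_scl[OF t(2) b0] hscale_one scl_one[of v "v \<box> label_obj (bar_label \<alpha>)" b0] b0h v \<alpha> \<nu> by (simp add: xb_def)
  have xb1: "ipm v xb xb = 1"
  proof -
    have "ipm v xb xb = complex_of_real (1 / \<nu>) * (complex_of_real (1 / \<nu>) * ipm v b0 b0)"
      unfolding xb_def using v \<alpha> b0h scl_in[of v "v \<box> label_obj (bar_label \<alpha>)" b0]
      by (simp add: ipm_scl[of v "v \<box> label_obj (bar_label \<alpha>)"] ipm_scl_left[of v "v \<box> label_obj (bar_label \<alpha>)"])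
    then show ?thesis using \<nu> by (simp add: power2_eq_square)
  qed
  have xb_span: "\<exists>k. y = k \<odot> xb" if y: "y \<in> homT ?t'" for y
  proof -
    have yh: "y \<in> hom C v (v \<box> label_obj (bar_label \<alpha>))" using y by (simp add: homT_simps)
    have "bar v (bar_label \<alpha>) y \<in> homT ?t" using bar_homT[OF t(2) y] by simp
    then obtain k where k: "bar v (bar_label \<alpha>) y = k \<odot> I v" using I_span by blast
    have "y = bar v \<alpha> (k \<odot> I v)" using bar_bar[OF v v _ yh] \<alpha> k by simp
    also have "\<dots> = cnj k \<odot> b0" unfolding b0_def using Iv by (intro bar_scl[OF v v \<alpha>(1)]) (simp add: homT_simps)
    also have "\<dots> = (cnj k * complex_of_real \<nu>) \<odot> xb" by (subst b0xb) (rule homT_scl_scl[OF t(2) xb])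
    finally show ?thesis by blast
  qed
  let ?a = "hl ?t (I v)" and ?b = "hl ?t' xb"
  define s where "s = sqrt (label_lam \<alpha>) * \<nu>"
  have s: "s > 0" using label_lam_pos[OF \<alpha>(1)] \<nu> by (simp add: s_def)
  have H: "?a \<in> H" "?b \<in> H" using t Iv xb by auto
  have Sa: "tomita_S ?a = hscale (complex_of_real s) ?b"
    using tomita_S_hl[OF t(1) Iv] hscale_hl[OF t(2) xb] homT_scl_scl[OF t(2) xb]
    by (simp add: b0_def[symmetric] b0xb s_def)
  have sxb: "complex_of_real s \<odot> xb \<in> homT ?t'" using t xb by simp
  \<comment> \<open>Obtained by applying \<open>tomita_S\<close> to the formula for
    \<open>?a\<close>, since it is an involution.\<close>
  have "tomita_S ?b = hscale (complex_of_real (1 / s)) ?a"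
  proof -
    have "?a = tomita_S (hl ?t' (complex_of_real s \<odot> xb))"
      using tomita_S_tomita_S[OF H(1)] Sa hscale_hl[OF t(2) xb] by simp
    also have "\<dots> = hl ?t (complex_of_real (sqrt (label_lam (bar_label \<alpha>))) \<odot> (complex_of_real s \<odot> bar v (bar_label \<alpha>) xb))"
      using tomita_S_hl[OF t(2) sxb] t xb bar_scl[OF v v, of "bar_label \<alpha>" xb] \<alpha>
      by (simp add: homT_simps)
    also have "\<dots> = hscale (complex_of_real s) (tomita_S ?b)"
    proof -
      have bxb: "bar v (bar_label \<alpha>) xb \<in> homT ?t" using bar_homT[OF t(2) xb] by simp
      show ?thesis using tomita_S_hl[OF t(2) xb] hscale_hl[OF t(1)] homT_scl_scl[OF t(1) bxb] t bxb
        by (simp add: mult.commute)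
    qed
    finally have "hscale (complex_of_real (1 / s)) ?a =
        hscale (complex_of_real (1 / s)) (hscale (complex_of_real s) (tomita_S ?b))" by (rule arg_cong)
    also have "\<dots> = hscale (complex_of_real (1 / s) * complex_of_real s) (tomita_S ?b)"
      by (rule hscale_hscale) (use H in simp)
    finally have "hscale (complex_of_real (1 / s)) ?a = hscale (complex_of_real (1 / s) * complex_of_real s) (tomita_S ?b)" .
    then show ?thesis using s H by simp
  qed
  then show ?thesis
    unfolding loop_pair_def using v \<alpha> s Iv xb I1 xb1 I_span xb_span Sa by blast
qed

lemma F_scale_0: "X \<in> car K.Hc \<Longrightarrow> vscale K.Hc 0 X = vzero K.Hc"
  by (rule F.ip_ext) (simp_all add: F.ip_simps)

lemma rgam_vacuum:
  assumes "\<xi> \<in> H" "v \<in> S"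
  shows "E (lift (rgam \<xi>)) (vacuum v) = word_vec [ract \<xi> (unit_at v)]"
proof -
  have "E (lift (rgam \<xi>)) (vacuum v) = em (rgam \<xi> (unit_at v, 0))"
    unfolding vacuum_def using raw_pairD(5)[OF raw_pair_rgam[OF assms(1)]] assms by simp
  also have "\<dots> = word_vec [ract \<xi> (unit_at v)]"
    by (simp add: rgam_def rcreate_def rannih_def radd_def word_vec_def)
  finally show ?thesis .
qed

text \<open>The right operator in \<open>right_op\<close> yields the same vector from
  \<open>[b]\<close>. This coincidence of a left and a right action is what drives the
  argument.\<close>

lemma rgam_loop:
  assumes l: "loop_pair v a b s"
  shows "E (lift (rgam b)) (word_vec [a]) = vadd K.Hc (word_vec [b, a]) (vscale K.Hc (complex_of_real (1 / s)) (vacuum v))"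
proof -
  note d = loop_pairD[OF l]
  have Sb: "hip (tomita_S b) a \<beta> = complex_of_real (1 / s) * unit_at v \<beta>" for \<beta>
    using d(5,8) hip_cnj[of a "hscale (complex_of_real (1 / s)) a" \<beta>] hip_scale[of a a "complex_of_real (1 / s)" \<beta>]
    by (simp add: d(17)) (simp add: unit_at_def)
  have r: "rgam b (\<lambda>_. 0, word [a]) \<in> rawc"
    using raw_pairD(1)[OF raw_pair_rgam[OF d(6)]] d(5) by simp
  have "E (lift (rgam b)) (word_vec [a]) = em (rgam b (\<lambda>_. 0, word [a]))"
    unfolding word_vec_def using raw_pairD(5)[OF raw_pair_rgam[OF d(6)]] d(5) by simp
  also have "\<dots> = em (radd (\<lambda>_. 0, word [b, a]) (rscale (complex_of_real (1 / s)) (unit_at v, 0)))"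
  proof (rule em_eqI[OF r])
    show "Wf x (snd (rgam b (\<lambda>_. 0, word [a]))) \<beta> =
        Wf x (snd (radd (\<lambda>_. 0, word [b, a]) (rscale (complex_of_real (1 / s)) (unit_at v, 0)))) \<beta>"
      if x: "x \<in> free_words" for x \<beta>
      using Wl_zero(2)[OF x, of "[]" "[]" b] d(6)
      by (simp add: rgam_def rcreate_def rannih_def radd_def rscale_def an2_def Wf_word Wf_zero Wf_add)
    show "radd (\<lambda>_. 0, word [b, a]) (rscale (complex_of_real (1 / s)) (unit_at v, 0)) \<in> rawc"
      using d(1,5,6) by (intro rawc_ops) simp_all
  qed (use d(1,5,6) Sb in \<open>simp add: rgam_def rcreate_def rannih_def radd_def rscale_def an1_def\<close>)
  also have "\<dots> = vadd K.Hc (word_vec [b, a]) (vscale K.Hc (complex_of_real (1 / s)) (vacuum v))"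
    using d(1,5,6) by (simp add: word_vec_def vacuum_def em_radd em_rscale)
  finally show ?thesis .
qed

lemma vip_vacuum_vacuum: "v \<in> S \<Longrightarrow> w \<in> S \<Longrightarrow> vip K.Hc (vacuum w) (vacuum v) = (if w = v then complex_of_real (dim v) else 0)"
proof -
  assume *: "v \<in> S" "w \<in> S"
  have "rip (unit_at w, 0) (unit_at v, 0) = (\<lambda>\<beta>. unit_at v \<beta> * (if w = v then 1 else 0))"
    by (auto simp: rip_def Wf_zero unit_at_def)
  then show ?thesis using * \<tau>_dl[OF * (1), of "if w = v then 1 else 0"] by (simp add: vacuum_def em_vip rvip_def)
qed

lemma vip_word_vec_vacuum: "v \<in> S \<Longrightarrow> u \<noteq> [] \<Longrightarrow> set u \<subseteq> H \<Longrightarrow> vip K.Hc (word_vec u) (vacuum v) = 0"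
  by (simp add: vacuum_def word_vec_def em_vip rvip_def rip_def[abs_def] Wf_zero \<tau>_def)

section \<open>A central operator and the support of its values on vacuum vectors\<close>

context
  fixes z
  assumes z1: "z \<in> commutant K.Hc gens" and z2: "z \<in> commutant K.Hc (commutant K.Hc gens)"
begin

lemma z_in [simp]: "X \<in> car K.Hc \<Longrightarrow> z X \<in> car K.Hc"
  using F.bounded_opsD(1)[OF F.commutantD(1)[OF z1]] .

lemma z_\<Gamma>: "\<xi> \<in> H \<Longrightarrow> X \<in> car K.Hc \<Longrightarrow> z (E (lift (rgam \<xi>)) X) = E (lift (rgam \<xi>)) (z X)"
  by (rule F.commutantD(2)[OF z1 gens_\<Gamma>])

lemma z_left: "a \<in> \<AA> \<Longrightarrow> X \<in> car K.Hc \<Longrightarrow> z (E (lift (rleft a)) X) = E (lift (rleft a)) (z X)"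
  by (rule F.commutantD(2)[OF z1 gens_left])

lemma z_right: "T \<in> commutant K.Hc gens \<Longrightarrow> X \<in> car K.Hc \<Longrightarrow> z (T X) = T (z X)"
  by (rule F.commutantD(2)[OF z2])

lemma unit_at_in_AA: "v \<in> S \<Longrightarrow> unit_at v \<in> \<AA>"
  using unit_at_AA[of v 1] by simp

lemma cnj_unit_at: "(\<lambda>\<beta>. cnj (unit_at v \<beta>)) = unit_at v"
  by (auto simp: unit_at_def)

text \<open>The projection at \<open>v\<close> is self-adjoint, fixes the vacuum vector at
  \<open>v\<close> and commutes with \<open>z\<close>. Consequently the coefficients of the image
  vanish at words that do not start at \<open>v\<close>.\<close>

lemma z_vacuum_left:
  assumes v: "v \<in> S" and q: "q \<in> rawc"
  shows "vip K.Hc (em q) (z (vacuum v)) = vip K.Hc (em (rleft (unit_at v) q)) (z (vacuum v))"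
proof -
  note p = raw_pair_rleft[OF unit_at_in_AA[OF v], unfolded cnj_unit_at]
  have "(rleft (unit_at v) (unit_at v, 0)) = (unit_at v, 0)" by (auto simp: rleft_def unit_at_def)
  then have "E (lift (rleft (unit_at v))) (vacuum v) = vacuum v" unfolding vacuum_def using raw_pairD(5)[OF p] v by simp
  then have "z (vacuum v) = E (lift (rleft (unit_at v))) (z (vacuum v))" using z_left[OF unit_at_in_AA[OF v] vacuum_in[OF v]] by simp
  then have "vip K.Hc (em q) (z (vacuum v)) = vip K.Hc (em q) (E (lift (rleft (unit_at v))) (z (vacuum v)))" by simp
  also have "\<dots> = vip K.Hc (E (lift (rleft (unit_at v))) (em q)) (z (vacuum v))"
    by (rule K.extend_op(3)[OF raw_pairD(4)[OF p]]) (use q v in auto)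
  also have "\<dots> = vip K.Hc (em (rleft (unit_at v) q)) (z (vacuum v))" using raw_pairD(5)[OF p q] by simp
  finally show ?thesis .
qed

lemma z_vacuum_other:
  assumes "v \<in> S" "w \<in> S" "w \<noteq> v"
  shows "vip K.Hc (vacuum w) (z (vacuum v)) = 0"
proof -
  have "rleft (unit_at v) (unit_at w, 0) = rscale 0 (unit_at w, 0)"
    using assms(3) by (auto simp: rleft_def rscale_def unit_at_def)
  then show ?thesis
    using z_vacuum_left[OF assms(1) raw_vacuum[OF assms(2)]] vip_em_scale[OF raw_vacuum[OF assms(2)], of "z (vacuum v)" 0] assms
    by (simp add: vacuum_def)
qed

lemma z_vacuum_source:
  assumes v: "v \<in> S" and u: "u \<noteq> []" "set u \<subseteq> H" "homog (hd u)" "\<not> starts_at v u"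
  shows "vip K.Hc (word_vec u) (z (vacuum v)) = 0"
proof -
  obtain \<xi> u' where u': "u = \<xi> # u'" using u by (cases u) auto
  have "lact (unit_at v) \<xi> = hscale 0 \<xi>" using homog_lact u u' by (auto simp: starts_at_def)
  then have e: "rleft (unit_at v) (\<lambda>_. 0, word u) = (\<lambda>_. 0, word ([] @ hscale 0 \<xi> # u'))"
    by (simp add: rleft_def u')
  have "vip K.Hc (word_vec u) (z (vacuum v)) = vip K.Hc (word_vec ([] @ hscale 0 \<xi> # u')) (z (vacuum v))"
    using z_vacuum_left[OF v raw_word_vec[OF u(1,2)]] e by (simp add: word_vec_def)
  also have "\<dots> = 0" by (rule word_vec_zero_letter) (use u u' v in auto)
  finally show ?thesis .
qed

text \<open>The right operator of loops at \<open>w\<close> kills the vacuum vector at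
  \<open>v\<close>, hence also its image under \<open>z\<close>. Pairing this with
  \<open>x @ [a]\<close> shows that each appended \<open>[a, b]\<close> multiplies the coefficient
  by \<open>- s\<close>, which for \<open>s \<ge> 1\<close> is compatible with decay only if the
  coefficient is 0.\<close>

lemma z_vacuum_target_aux:
  assumes v: "v \<in> S" and w: "w \<noteq> v" and l: "loop_pair w a b s" and s: "s \<ge> 1"
    and u: "u \<noteq> []" "set u \<subseteq> Collect homog" "ends_at w u"
  shows "vip K.Hc (word_vec u) (z (vacuum v)) = 0"
proof -
  note d = loop_pairD[OF l] and d' = loop_pairD[OF loop_pair_sym[OF l]]
  obtain T where "right_op w a b s T" using right_operator[OF l] by blast
  note T = right_opD[OF this]
  let ?X = "z (vacuum v)"
  have X: "?X \<in> car K.Hc" using v by simp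
  have "T ?X = z (vzero K.Hc)" using z_right[OF T(1) vacuum_in[OF v]] T(4)[OF v] w by simp
  also have "\<dots> = z (vscale K.Hc 0 (vacuum v))" using v by (simp add: F_scale_0)
  also have "\<dots> = vzero K.Hc"
    using F.bounded_opsD(3)[OF F.commutantD(1)[OF z1], of "vacuum v" 0] v by (simp add: F_scale_0)
  finally have TX: "T ?X = vzero K.Hc" .
  have closed_word: "u @ pair_power a b k \<noteq> []" "set (u @ pair_power a b k) \<subseteq> Collect homog" "ends_at w (u @ pair_power a b k)" for k
  proof -
    show "u @ pair_power a b k \<noteq> []" "set (u @ pair_power a b k) \<subseteq> Collect homog" using u d(3,4) set_pair_power[of a b k] by auto
    show "ends_at w (u @ pair_power a b k)"
      using u(3) d(15) by (cases k) (simp_all add: pair_power_Suc_right ends_at_def del: pair_power.simps(2))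
  qed
  have H: "set x \<subseteq> H" if "set x \<subseteq> Collect homog" for x using that homog_H by auto
  have step: "vip K.Hc (word_vec (x @ [a, b])) ?X = - complex_of_real s * vip K.Hc (word_vec x) ?X"
    if x: "x \<noteq> []" "set x \<subseteq> Collect homog" "ends_at w x" for x
  proof -
    have "vip K.Hc (W w (x @ [a])) (T ?X) = 0"
      unfolding TX using x H[OF x(2)] d(5) by (simp add: W_def F.ip_zero)
    moreover have "vip K.Hc (W w (x @ [a])) (T ?X) =
        complex_of_real (1 / s) * vip K.Hc (W w ((x @ [a]) @ [b])) ?X + vip K.Hc (W w x) ?X"
      by (subst T(2)) (use x d(3,18) X in auto)
    ultimately show ?thesis using d(2) x(1) by (simp add: W_def field_simps add_eq_0_iff2)
  qed
  have geo: "cmod (vip K.Hc (word_vec (u @ pair_power a b k)) ?X) = s ^ k * cmod (vip K.Hc (word_vec u) ?X)" for k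
  proof (induction k)
    case (Suc k)
    have "vip K.Hc (word_vec (u @ pair_power a b (Suc k))) ?X = - complex_of_real s * vip K.Hc (word_vec (u @ pair_power a b k)) ?X"
      using step[OF closed_word] by (simp add: pair_power_Suc_right del: pair_power.simps(2))
    then show ?case using Suc d(2) by (simp add: norm_mult)
  qed simp
  have "(\<lambda>k. vip K.Hc (word_vec (u @ pair_power a b k)) ?X) \<longlonglongrightarrow> 0"
  proof (rule coefficient_decay[OF X closed_word(1) H[OF closed_word(2)]])
    show "k \<le> length (u @ pair_power a b k)" for k using length_pair_power[of a b k] by simp
    have e: "word_ip unitA (x @ [a, b]) (x @ [a, b]) = word_ip unitA x x"
      if x: "x \<noteq> []" "set x \<subseteq> Collect homog" "ends_at w x" for x
    proof -
      have "word_ip unitA ((x @ [a]) @ [b]) ((x @ [a]) @ [b]) = word_ip unitA (x @ [a]) (x @ [a])"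
        by (rule word_ip_snoc_loop[where v = w])
           (use d(5,6,9,13,14) H[OF x(2)] in \<open>auto simp: ends_at_def hip_scale d'(21)\<close>)
      also have "\<dots> = word_ip unitA x x"
        by (rule word_ip_snoc_loop[where v = w])
           (use x d(5,8,12) H[OF x(2)] in \<open>auto simp: hip_scale d(21)\<close>)
      finally show ?thesis by simp
    qed
    show "word_ip unitA (u @ pair_power a b k) (u @ pair_power a b k) = word_ip unitA u u" for k
    proof (induction k)
      case (Suc k)
      then show ?case using e[OF closed_word] by (simp add: pair_power_Suc_right del: pair_power.simps(2))
    qed simp
  qed
  then have "(\<lambda>k. cmod (vip K.Hc (word_vec (u @ pair_power a b k)) ?X)) \<longlonglongrightarrow> 0" by (rule tendsto_norm_zero)
  moreover have "cmod (vip K.Hc (word_vec u) ?X) \<le> cmod (vip K.Hc (word_vec (u @ pair_power a b k)) ?X)" for k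
    unfolding geo using mult_right_mono[OF one_le_power[OF s, of k], of "cmod (vip K.Hc (word_vec u) ?X)"] by simp
  ultimately have "cmod (vip K.Hc (word_vec u) ?X) \<le> 0" by (meson LIMSEQ_le_const)
  then show ?thesis by simp
qed

text \<open>Swapping the loops at the end point \<open>w\<close> of the word inverts
  \<open>s\<close>, so one of the two orientations has \<open>s \<ge> 1\<close>.\<close>

lemma z_vacuum_target:
  assumes v: "v \<in> S" and u: "u \<noteq> []" "set u \<subseteq> Collect homog" "\<not> ends_at v u"
  shows "vip K.Hc (word_vec u) (z (vacuum v)) = 0"
proof -
  have "homog (last u)" using u last_in_set by blast
  then obtain t x where e: "t \<in> triples" "x \<in> homT t" "last u = hl t x" by (auto simp: homog_def)
  define w where "w = snd (snd t)"
  have w: "w \<in> S" using e(1) by (auto simp: w_def triples_def)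
  have tr: "ract (last u) (unit_at w) = last u" using e ract_hl[OF e(1,2), of "unit_at w"] by (simp add: w_def unit_at_def)
  then have tw: "ends_at w u" by (simp add: ends_at_def)
  then have word_vec: "w \<noteq> v" using u(3) by auto
  obtain a b s where l: "loop_pair w a b s" using loop_exists[OF w] by blast
  show ?thesis
  proof (cases "s \<ge> 1")
    case True
    then show ?thesis using z_vacuum_target_aux[OF v word_vec l True u(1,2) tw] by simp
  next
    case False
    then have "1 / s \<ge> 1" using loop_pairD(2)[OF l] by simp
    then show ?thesis using z_vacuum_target_aux[OF v word_vec loop_pair_sym[OF l] _ u(1,2) tw] by simp
  qed
qed

lemma E_rgam_in [simp]: "\<xi> \<in> H \<Longrightarrow> X \<in> car K.Hc \<Longrightarrow> E (lift (rgam \<xi>)) X \<in> car K.Hc"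
  using F.bounded_opsD(1)[OF subsetD[OF gens_bounded gens_\<Gamma>]] .

text \<open>On the vacuum vector both products give the word \<open>[b, a]\<close> plus
  \<open>1 / s\<close> times the vacuum vector. \<open>z\<close> passes the left operators because
  it lies in the commutant, and the right ones because it lies in the bicommutant.\<close>

lemma z_exchange:
  assumes l: "loop_pair v a b s" and Ta: "right_op v a b s Ta" and Tb: "right_op v b a (1 / s) Tb"
  shows "E (lift (rgam b)) (E (lift (rgam a)) (z (vacuum v))) = Ta (Tb (z (vacuum v)))"
proof -
  note d = loop_pairD[OF l] and ta = right_opD[OF Ta] and tb = right_opD[OF Tb]
  have vacuum: "vacuum v \<in> car K.Hc" and Tin: "Tb (vacuum v) \<in> car K.Hc"
    using d(1,6) tb(3) by simp_all
  have "E (lift (rgam b)) (E (lift (rgam a)) (z (vacuum v))) = z (E (lift (rgam b)) (E (lift (rgam a)) (vacuum v)))"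
    using z_\<Gamma> d(5,6) vacuum by simp
  also have "E (lift (rgam b)) (E (lift (rgam a)) (vacuum v)) = Ta (Tb (vacuum v))"
    by (simp only: rgam_vacuum[OF d(5,1)] d(13) rgam_loop[OF l] tb(3) ta(5))
  also have "z (Ta (Tb (vacuum v))) = Ta (Tb (z (vacuum v)))"
    using z_right[OF ta(1) Tin] z_right[OF tb(1) vacuum] by simp
  finally show ?thesis .
qed

definition closed_word :: "'o \<Rightarrow> ('o, 'm) hvec \<Rightarrow> ('o, 'm) hvec \<Rightarrow> ('o, 'm) hvec list \<Rightarrow> bool" where
  "closed_word v a b w \<longleftrightarrow> w \<noteq> [] \<and> set w \<subseteq> letters a b \<and> starts_at v w \<and> ends_at v w"

text \<open>This is \<open>z_exchange\<close> paired with \<open>u\<close>, all operators being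
  moved onto the word. The term \<open>1 / s * Z u\<close> occurs on both sides and cancels. The
  conditional terms come from annihilating an outer letter of \<open>u\<close>, after which a letter
  is either restored or annihilated as well.\<close>

lemma z_recurrence:
  assumes l: "loop_pair v a b s" and u: "closed_word v a b u"
  defines "Z w \<equiv> vip K.Hc (W v w) (z (vacuum v))"
  shows "Z (b # a # u) + (if hd u = b then complex_of_real s * Z u +
        (if tl u \<noteq> [] \<and> hd (tl u) = a \<and> starts_at v (tl (tl u)) then Z (tl (tl u)) else 0) else 0) =
      Z (u @ [b, a]) + (if last u = a then complex_of_real s * Z u +
        (if butlast u \<noteq> [] \<and> last (butlast u) = b \<and> ends_at v (butlast (butlast u)) then Z (butlast (butlast u)) else 0) else 0)"
    (is "_ + ?L = _ + ?R")
proof -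
  note d = loop_pairD[OF l]
  have u': "u \<noteq> []" "set u \<subseteq> letters a b" "starts_at v u" "ends_at v u" using u by (auto simp: closed_word_def)
  obtain Ta where Ta: "right_op v a b s Ta" using right_operator[OF l] by blast
  obtain Tb where Tb: "right_op v b a (1 / s) Tb" using right_operator[OF loop_pair_sym[OF l]] by blast
  note ta = right_opD[OF Ta] and tb = right_opD[OF Tb]
  let ?X = "z (vacuum v)"
  have X: "?X \<in> car K.Hc" using d(1) by simp
  have EX: "E (lift (rgam a)) ?X \<in> car K.Hc" using d(5) X by simp
  have TX: "Tb ?X \<in> car K.Hc" using F.bounded_opsD(1)[OF F.commutantD(1)[OF tb(1)] X] .
  have sc: "complex_of_real (1 / s) * (complex_of_real s * x) = x" for x using d(2) by simp
  have LHom: "x \<in> letters a b \<Longrightarrow> homog x" for x by (auto simp: letters_def)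
  have tlu: "set (tl u) \<subseteq> letters a b" "set (butlast u) \<subseteq> letters a b"
    using u'(2) list.set_sel(2)[OF u'(1)] by (auto dest: in_set_butlastD)
  have "vip K.Hc (W v u) (E (lift (rgam b)) (E (lift (rgam a)) ?X)) =
      complex_of_real (1 / s) * vip K.Hc (W v (a # u)) (E (lift (rgam a)) ?X) +
      (if hd u = b \<and> starts_at v (tl u) then vip K.Hc (W v (tl u)) (E (lift (rgam a)) ?X) else 0)"
    using left_step[OF l u'(2) EX] u'(1) by simp
  also have "vip K.Hc (W v (a # u)) (E (lift (rgam a)) ?X) = complex_of_real s * Z (b # a # u) + Z u"
    using left_step[OF loop_pair_sym[OF l], of "a # u" ?X] u'(2,3) X d(18) by (simp add: letters_sym Z_def)
  also have "vip K.Hc (W v (tl u)) (E (lift (rgam a)) ?X) = complex_of_real s * Z (b # tl u) +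
      (if tl u \<noteq> [] \<and> hd (tl u) = a \<and> starts_at v (tl (tl u)) then Z (tl (tl u)) else 0)"
    using left_step[OF loop_pair_sym[OF l], of "tl u" ?X] tlu X by (simp add: letters_sym Z_def)
  also have "(if hd u = b \<and> starts_at v (tl u) then complex_of_real s * Z (b # tl u) +
      (if tl u \<noteq> [] \<and> hd (tl u) = a \<and> starts_at v (tl (tl u)) then Z (tl (tl u)) else 0) else 0) = ?L"
  \<comment> \<open>If \<open>tl u\<close> does not start at \<open>v\<close>, then \<open>u\<close>
    contains a non-composable pair, so \<open>Z u = 0\<close>; the next letter is then not
    \<open>a\<close> either, and the condition may be left out of \<open>?L\<close>.\<close>
  proof (cases "hd u = b \<and> \<not> starts_at v (tl u)")
    case True
    then obtain e w where e: "u = b # e # w" "lact (unit_at v) e \<noteq> e"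
      using u'(1) by (cases u rule: remdups_adj.cases) (auto simp: starts_at_def)
    have "Z u = 0" unfolding Z_def W_def e(1)
      using word_vec_not_composable[of "[]" w b v e ?X] e u'(2) LHom[of e] letters_H d(6,15) X by auto
    then show ?thesis using e d(12) by auto
  next
    case False
    have "b # tl u = u" if "hd u = b" using u'(1) that by (cases u) auto
    then show ?thesis using False by auto
  qed
  finally have L: "vip K.Hc (W v u) (E (lift (rgam b)) (E (lift (rgam a)) ?X)) =
      Z (b # a # u) + complex_of_real (1 / s) * Z u + ?L" by (simp only: distrib_left sc)
  have hom: "set w \<subseteq> letters a b \<Longrightarrow> set w \<subseteq> Collect homog" for w using LHom by auto
  have lastL: "w = [] \<or> last w \<in> letters a b" if "set w \<subseteq> letters a b" for w
    using that last_in_set by blast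
  have "vip K.Hc (W v u) (Ta (Tb ?X)) =
      complex_of_real (1 / s) * vip K.Hc (W v (u @ [b])) (Tb ?X) +
      (if last u = a \<and> ends_at v (butlast u) then vip K.Hc (W v (butlast u)) (Tb ?X) else 0)"
    using ta(2)[OF hom[OF u'(2)] lastL[OF u'(2)] TX] u'(1) by simp
  also have "vip K.Hc (W v (u @ [b])) (Tb ?X) = complex_of_real s * Z (u @ [b, a]) + Z u"
    using tb(2)[of "u @ [b]" ?X] hom[OF u'(2)] u'(4) X d(4,19) by (simp add: letters_sym Z_def)
  also have "vip K.Hc (W v (butlast u)) (Tb ?X) = complex_of_real s * Z (butlast u @ [a]) +
      (if butlast u \<noteq> [] \<and> last (butlast u) = b \<and> ends_at v (butlast (butlast u)) then Z (butlast (butlast u)) else 0)"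
    using tb(2)[of "butlast u" ?X] hom[OF tlu(2)] lastL[OF tlu(2)] X by (simp add: letters_sym Z_def)
  also have "(if last u = a \<and> ends_at v (butlast u) then complex_of_real s * Z (butlast u @ [a]) +
      (if butlast u \<noteq> [] \<and> last (butlast u) = b \<and> ends_at v (butlast (butlast u)) then Z (butlast (butlast u)) else 0) else 0) = ?R"
  \<comment> \<open>The same argument at the right end, with the non-composable pair formed by the
    last two letters.\<close>
  proof (cases "last u = a \<and> \<not> ends_at v (butlast u)")
    case True
    then obtain w' where w': "u = w' @ [a]" using u'(1) by (cases u rule: rev_cases) auto
    then obtain w e where e: "u = w @ [e, a]" "ract e (unit_at v) \<noteq> e"
      using True by (cases w' rule: rev_cases) (auto simp: ends_at_def butlast_append)
    have "Z u = 0" unfolding Z_def W_def e(1)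
      using word_vec_not_composable'[of w "[]" a v e ?X] e u'(2) LHom[of e] letters_H d(5,12) X by auto
    then show ?thesis using e d(15) by (auto simp: butlast_append)
  next
    case False
    have "butlast u @ [a] = u" if "last u = a" using u'(1) that by (metis append_butlast_last_id)
    then show ?thesis using False by auto
  qed
  finally have R: "vip K.Hc (W v u) (Ta (Tb ?X)) =
      Z (u @ [b, a]) + complex_of_real (1 / s) * Z u + ?R" by (simp only: distrib_left sc)
  show ?thesis using L R z_exchange[OF l Ta Tb] by simp
qed

section \<open>Words as points of quarter planes\<close>

lemma closed_word_append:
  assumes l: "loop_pair v a b s" and u: "closed_word v a b u"
  shows "closed_word v a b (b # a # u)" "closed_word v a b (u @ [b, a])"
  using u loop_pairD(13,14,18,19)[OF l] by (auto simp: closed_word_def starts_at_def ends_at_def)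

lemma closed_word_pair_power:
  assumes l: "loop_pair v a b s" and u: "closed_word v a b u"
  shows "closed_word v a b (pair_power b a m @ u @ pair_power b a n)"
proof -
  have "closed_word v a b (u @ pair_power b a n)"
    by (induction n) (use u closed_word_append(2)[OF l] append_pair_power_Suc in \<open>simp_all add: append_pair_power_Suc del: pair_power.simps(2) append_assoc\<close>)
  then show ?thesis by (induction m) (use closed_word_append(1)[OF l] in simp_all)
qed

lemma word_ip_loop:
  assumes l: "loop_pair v a b s" and w: "closed_word v a b w"
  shows "word_ip unitA (b # a # w) (b # a # w) = word_ip unitA w w"
    "word_ip unitA (w @ [b, a]) (w @ [b, a]) = word_ip unitA w w"
proof -
  note d = loop_pairD[OF l] and d' = loop_pairD[OF loop_pair_sym[OF l]]
  have w': "w \<noteq> []" "set w \<subseteq> H" "starts_at v w" "ends_at v w" using w letters_H by (auto simp: closed_word_def)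
  show "word_ip unitA (b # a # w) (b # a # w) = word_ip unitA w w"
    using word_ip_Cons_loop[OF d(6,9), of "a # w"] word_ip_Cons_loop[OF d(5,8) w'(3,1,2)] w'(2) d(5,12)
    by (simp add: starts_at_def)
  have "word_ip unitA ((w @ [b]) @ [a]) ((w @ [b]) @ [a]) = word_ip unitA (w @ [b]) (w @ [b])"
    by (rule word_ip_snoc_loop[where v = v])
       (use d(5,6,8,12,15) w'(2) in \<open>auto simp: ends_at_def hip_scale d(21)\<close>)
  also have "\<dots> = word_ip unitA w w"
    by (rule word_ip_snoc_loop[where v = v]) (use w' d(6,9,14) in \<open>auto simp: hip_scale d'(21)\<close>)
  finally show "word_ip unitA (w @ [b, a]) (w @ [b, a]) = word_ip unitA w w" by simp
qed

lemma word_ip_pair_power: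
  assumes l: "loop_pair v a b s" and u: "closed_word v a b u"
  shows "word_ip unitA (pair_power b a m @ u @ pair_power b a n) (pair_power b a m @ u @ pair_power b a n) = word_ip unitA u u"
proof (induction m)
  case 0
  show ?case
  proof (induction n)
    case (Suc n)
    have "closed_word v a b (u @ pair_power b a n)" using closed_word_pair_power[OF l u, of 0 n] by simp
    then show ?case using Suc word_ip_loop(2)[OF l, of "u @ pair_power b a n"]
      by (simp only: append_Nil pair_power.simps(1) append_pair_power_Suc)
  qed simp
next
  case (Suc m)
  then show ?case using word_ip_loop(1)[OF l closed_word_pair_power[OF l u, of m n]] by simp
qed

text \<open>A word is a point of a quarter plane: its core, surrounded by \<open>m\<close> and \<open>n\<close> copies of \<open>[b, a]\<close>.\<close>

lemma z_core:
  assumes l: "loop_pair v a b s" and u: "closed_word v a b u" "\<And>u'. u \<noteq> b # a # u'" "\<And>u'. u \<noteq> u' @ [b, a]"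
  defines "Z w \<equiv> vip K.Hc (W v w) (z (vacuum v))"
  shows "s \<le> 1 \<Longrightarrow> Z (pair_power b a m @ u @ pair_power b a n) = 0" "Z (b # a # u) = 0 \<Longrightarrow> Z u = 0"
proof -
  note d = loop_pairD[OF l]
  define y where "y m n = Z (pair_power b a m @ u @ pair_power b a n)" for m n
  have g: "closed_word v a b (pair_power b a m @ u @ pair_power b a n)" for m n by (rule closed_word_pair_power[OF l u(1)])
  have u': "u \<noteq> []" "starts_at v u" "ends_at v u" using u(1) by (auto simp: closed_word_def)
  \<comment> \<open>The flags of the wave equation record whether the core begins with
    \<open>b\<close> and whether it ends with \<open>a\<close>.\<close>
  have eq: "y (Suc m) n + (if m = 0 then (if hd u = b then s * y 0 n else 0) else y (m - 1) n + s * y m n) =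
      y m (Suc n) + (if n = 0 then (if last u = a then s * y m 0 else 0) else y m (n - 1) + s * y m n)" for m n
  proof -
    let ?w = "pair_power b a m @ u @ pair_power b a n"
    have L: "(if hd ?w = b then complex_of_real s * Z ?w +
        (if tl ?w \<noteq> [] \<and> hd (tl ?w) = a \<and> starts_at v (tl (tl ?w)) then Z (tl (tl ?w)) else 0) else 0) =
      (if m = 0 then (if hd u = b then s * y 0 n else 0) else y (m - 1) n + s * y m n)"
    proof (cases m)
      case 0
      \<comment> \<open>A second annihilation would require \<open>a\<close> as the second letter.
        The core does not begin with \<open>ba\<close>, and if it is just \<open>[b]\<close>, the
        next letter, if any, is the \<open>b\<close> opening the right block.\<close>
      have "\<not> (tl ?w \<noteq> [] \<and> hd (tl ?w) = a)" if "hd u = b"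
        using u'(1) u(2) that 0 d(7) by (cases u rule: remdups_adj.cases; cases n) auto
      moreover have "hd ?w = hd u" using 0 u'(1) by simp
      ultimately show ?thesis using 0 by (cases "hd u = b") (auto simp: y_def)
    next
      case (Suc m')
      have "starts_at v (pair_power b a m' @ u @ pair_power b a n)" using g[of m' n] by (simp add: closed_word_def)
      then show ?thesis using Suc by (simp add: y_def)
    qed
    have R: "(if last ?w = a then complex_of_real s * Z ?w +
        (if butlast ?w \<noteq> [] \<and> last (butlast ?w) = b \<and> ends_at v (butlast (butlast ?w)) then Z (butlast (butlast ?w)) else 0) else 0) =
      (if n = 0 then (if last u = a then s * y m 0 else 0) else y m (n - 1) + s * y m n)"
    proof (cases n)
      case 0
      have "\<not> (butlast ?w \<noteq> [] \<and> last (butlast ?w) = b)" if "last u = a"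
      proof -
        obtain x where x: "u = x @ [a]" using u'(1) \<open>last u = a\<close> by (metis append_butlast_last_id)
        show ?thesis
        proof (cases x rule: rev_cases)
          \<comment> \<open>The core is \<open>[a]\<close>; the letter before it, if any, is the
            \<open>a\<close> closing the left block.\<close>
          case Nil
          have "last (pair_power b a m) \<noteq> b" if "pair_power b a m \<noteq> []"
          proof (cases m)
            case (Suc m')
            then show ?thesis using d(7) append_pair_power_Suc[of "[]" b a m']
              by (simp del: pair_power.simps(2))
          qed (use that in simp)
          then show ?thesis using 0 x Nil by (auto simp: butlast_append)
        next
          case (snoc x' e)
          then have "e \<noteq> b" using u(3) x by auto
          then show ?thesis using 0 x snoc by (simp add: butlast_append)
        qed
      qed
      moreover have "last ?w = last u" using 0 u'(1) by simp
      ultimately show ?thesis using 0 by (cases "last u = a") (auto simp: y_def)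
    next
      case (Suc n')
      have e: "?w = (pair_power b a m @ u @ pair_power b a n') @ [b, a]"
        using append_pair_power_Suc[of "pair_power b a m @ u" b a n'] Suc by (simp only: append_assoc)
      have "ends_at v (pair_power b a m @ u @ pair_power b a n')" using g[of m n'] by (simp add: closed_word_def)
      moreover have "y m n = Z ((pair_power b a m @ u @ pair_power b a n') @ [b, a])" unfolding y_def e ..
      moreover have "y m (n - 1) = Z (pair_power b a m @ u @ pair_power b a n')" using Suc by (simp add: y_def)
      ultimately show ?thesis unfolding e using Suc by (simp add: butlast_append)
    qed
    have e: "(pair_power b a m @ u @ pair_power b a n) @ [b, a] = pair_power b a m @ u @ pair_power b a (Suc n)"
      using append_pair_power_Suc[of "pair_power b a m @ u" b a n] by (simp only: append_assoc)
    have "b # a # ?w = pair_power b a (Suc m) @ u @ pair_power b a n" by simp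
    then show ?thesis
      using z_recurrence[OF l g[of m n]] e unfolding Z_def[symmetric] L R by (simp only: y_def)
  qed
  have X: "z (vacuum v) \<in> car K.Hc" using d(1) by simp
  have lim: "(\<lambda>k. y (m + k) (n + k)) \<longlonglongrightarrow> 0" for m n
  proof -
    have ne: "pair_power b a i @ u @ pair_power b a j \<noteq> []" "set (pair_power b a i @ u @ pair_power b a j) \<subseteq> H" for i j
      using g[of i j] subset_trans[OF _ letters_H[of a b], of "set (pair_power b a i @ u @ pair_power b a j)"]
      by (simp_all add: closed_word_def)
    have "(\<lambda>k. vip K.Hc (word_vec (pair_power b a (m + k) @ u @ pair_power b a (n + k))) (z (vacuum v))) \<longlonglongrightarrow> 0"
    proof (rule coefficient_decay[OF X ne])
      show "k \<le> length (pair_power b a (m + k) @ u @ pair_power b a (n + k))" for k by (simp add: length_pair_power)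
    qed (rule word_ip_pair_power[OF l u(1)])
    moreover have "W v (pair_power b a i @ u @ pair_power b a j) = word_vec (pair_power b a i @ u @ pair_power b a j)" for i j
      using ne(1)[of i j] unfolding W_def by (rule if_not_P)
    ultimately show ?thesis by (simp only: y_def Z_def)
  qed
  note wave = quarter_plane_wave[where z = y, OF eq lim d(2)]
  show "Z (pair_power b a m @ u @ pair_power b a n) = 0" if "s \<le> 1" using wave(2)[of m n] that by (simp add: y_def)
  show "Z u = 0" if "Z (b # a # u) = 0" using wave(3) that by (simp add: y_def)
qed

text \<open>The core is nonempty. If it starts and ends at \<open>v\<close>, \<open>z_core\<close>
  applies. Otherwise an offending end either meets a loop of a surrounding block, which gives a
  non-composable pair, or is an end of the whole word, where \<open>z_vacuum_source\<close> or
  \<open>z_vacuum_target\<close> applies.\<close>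

lemma z_letters_not_pair_power:
  assumes l: "loop_pair v a b s" and s: "s \<le> 1" and w: "w \<noteq> []" "set w \<subseteq> letters a b" "\<And>k. w \<noteq> pair_power b a k"
  shows "vip K.Hc (word_vec w) (z (vacuum v)) = 0"
proof -
  note d = loop_pairD[OF l]
  have X: "z (vacuum v) \<in> car K.Hc" using d(1) by simp
  obtain m u n where u: "w = pair_power b a m @ u @ pair_power b a n" "\<And>u'. u \<noteq> b # a # u'" "\<And>u'. u \<noteq> u' @ [b, a]"
    using pair_power_decomposition[of w b a] by blast
  have "u \<noteq> []"
  proof
    assume "u = []"
    then have "w = pair_power b a (m + n)" using u(1) by (simp add: pair_power_add)
    then show False using w(3) by blast
  qed
  have H: "set w \<subseteq> H" "set w \<subseteq> Collect homog" "set u \<subseteq> Collect homog" "set u \<subseteq> H" "set (pair_power b a m) \<subseteq> H" "set (pair_power b a n) \<subseteq> H"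
    using w(2) letters_H[of a b] u(1) set_pair_power[of b a m] set_pair_power[of b a n] d(5,6) by (auto simp: letters_def)
  show ?thesis
  proof (cases "starts_at v u")
    case src: True
    show ?thesis
    proof (cases "ends_at v u")
      case True
      then have "closed_word v a b u" using src \<open>u \<noteq> []\<close> w(2) u(1) by (simp add: closed_word_def)
      from z_core(1)[OF l this u(2,3) s, of m n] show ?thesis
        using u(1) \<open>u \<noteq> []\<close> by (simp add: W_def)
    next
      case False
      obtain x e where x: "u = x @ [e]" using \<open>u \<noteq> []\<close> by (cases u rule: rev_cases) auto
      have e: "homog e" "ract e (unit_at v) \<noteq> e" using False H x by (auto simp: ends_at_def)
      show ?thesis
      proof (cases n)
        case 0
        then have "\<not> ends_at v w" using False u(1) x by (auto simp: ends_at_def)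
        then show ?thesis using z_vacuum_target[OF d(1) w(1) H(2)] by simp
      next
        case (Suc n')
        then show ?thesis using word_vec_not_composable'[of "pair_power b a m @ x" "a # pair_power b a n'" b v e "z (vacuum v)"]
          u(1) x e H d(6,14) X by simp
      qed
    qed
  next
    case False
    obtain x e where x: "u = e # x" using \<open>u \<noteq> []\<close> by (cases u) auto
    have e: "homog e" "lact (unit_at v) e \<noteq> e" using False H x by (auto simp: starts_at_def)
    show ?thesis
    proof (cases m)
      case 0
      then have "\<not> starts_at v w" "homog (hd w)" using False u(1) x e by (auto simp: starts_at_def)
      then show ?thesis using z_vacuum_source[OF d(1) w(1) H(1)] by simp
    next
      case (Suc m')
      have "pair_power b a m = (pair_power b a m' @ [b]) @ [a]" unfolding Suc pair_power_Suc_right by simp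
      then have "w = (pair_power b a m' @ [b]) @ a # e # (x @ pair_power b a n)" using u(1) x by simp
      then show ?thesis using word_vec_not_composable[of "pair_power b a m' @ [b]" "x @ pair_power b a n" a v e "z (vacuum v)"]
          e H d(5,13) X by simp
    qed
  qed
qed

text \<open>What remains are the words \<open>(ba)^k\<close>. For the swapped pair such a word is
  its own core, but the parameter is then \<open>1 / s\<close>, so growth may fail. Instead
  \<open>a # b # w\<close>, one step further out, is no power of \<open>ba\<close> and has
  coefficient 0, which the recurrence at the corner carries back to \<open>w\<close>.\<close>

lemma z_letters_aux:
  assumes l: "loop_pair v a b s" and s: "s \<le> 1" and w: "w \<noteq> []" "set w \<subseteq> letters a b"
  shows "vip K.Hc (word_vec w) (z (vacuum v)) = 0"
proof (cases "\<exists>k. w = pair_power b a k")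
  case False
  then show ?thesis using z_letters_not_pair_power[OF l s w] by blast
next
  case True
  note d = loop_pairD[OF l]
  obtain k where k: "w = pair_power b a (Suc k)" using True w(1) by (metis pair_power.simps(1) not0_implies_Suc)
  have c: "w = b # a # pair_power b a k" "w = pair_power b a k @ [b, a]"
    using k pair_power_Suc_right[of b a k] by (simp, simp only:)
  have "starts_at v w" unfolding c(1) using d(14) by (simp add: starts_at_def)
  moreover have "ends_at v w" unfolding c(2) using d(13) by (simp add: ends_at_def)
  ultimately have g: "closed_word v b a w" using w by (simp add: closed_word_def letters_sym)
  have "a # b # w \<noteq> pair_power b a j" for j using d(7) by (cases j) auto
  then have "vip K.Hc (W v (a # b # w)) (z (vacuum v)) = 0"
    using z_letters_not_pair_power[OF l s, of "a # b # w"] w d(18,19) by (simp add: W_def)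
  \<comment> \<open>The roles of \<open>a\<close> and \<open>b\<close> are interchanged here:
    \<open>z_core\<close> is used for the swapped pair, in the part that holds for every
    parameter.\<close>
  then have "vip K.Hc (W v w) (z (vacuum v)) = 0"
  proof (rule z_core(2)[OF loop_pair_sym[OF l] g, rotated 2])
    show "w \<noteq> a # b # u'" for u' using c(1) d(7) by simp
    show "w \<noteq> u' @ [a, b]" for u' unfolding c(2) using d(7) by simp
  qed
  then show ?thesis using w(1) by (simp add: W_def)
qed

lemma z_letters:
  assumes l: "loop_pair v a b s" and w: "w \<noteq> []" "set w \<subseteq> letters a b"
  shows "vip K.Hc (word_vec w) (z (vacuum v)) = 0"
proof (cases "s \<le> 1")
  case False
  then show ?thesis using z_letters_aux[OF loop_pair_sym[OF l] _ w(1)] w(2) by (simp add: letters_sym)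
qed (rule z_letters_aux[OF l _ w])

section \<open>Eigenvalues at the vacuum vectors, and the conclusion\<close>

definition eigenval :: "'o \<Rightarrow> complex" where
  "eigenval v = vip K.Hc (vacuum v) (z (vacuum v)) / complex_of_real (dim v)"

lemma vdiff_zero_eq: "X \<in> car K.Hc \<Longrightarrow> Y \<in> car K.Hc \<Longrightarrow> F.vdiff X Y = vzero K.Hc \<Longrightarrow> X = Y"
  by (rule F.ip_ext) (use F.ip_vdiff[of _ X Y] in \<open>auto simp: F.ip_zero\<close>)

text \<open>The difference of the two sides is orthogonal to every vacuum vector and to every word
  in \<open>letters a b\<close>, and these vectors are total.\<close>

lemma z_vacuum:
  assumes v: "v \<in> S"
  shows "z (vacuum v) = vscale K.Hc (eigenval v) (vacuum v)"
proof -
  obtain a b s where l: "loop_pair v a b s" using loop_exists[OF v] by blast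
  have X: "z (vacuum v) \<in> car K.Hc" "vscale K.Hc (eigenval v) (vacuum v) \<in> car K.Hc" using v by (simp_all add: F.ip_simps)
  have ip: "vip K.Hc Y (F.vdiff (z (vacuum v)) (vscale K.Hc (eigenval v) (vacuum v))) = vip K.Hc Y (z (vacuum v)) - eigenval v * vip K.Hc Y (vacuum v)"
    if "Y \<in> car K.Hc" for Y
    using that X v by (simp add: F.ip_vdiff F.ip_scale)
  have "F.vdiff (z (vacuum v)) (vscale K.Hc (eigenval v) (vacuum v)) = vzero K.Hc"
  proof (rule F_total_letters[OF _ letters_H[of a b] loop_pairD(22)[OF l]])
    show "vip K.Hc (vacuum w) (F.vdiff (z (vacuum v)) (vscale K.Hc (eigenval v) (vacuum v))) = 0" if w: "w \<in> S" for w
      using ip[OF vacuum_in[OF w]] vip_vacuum_vacuum[OF v w] z_vacuum_other[OF v w] dim_pos[OF v] by (auto simp: eigenval_def)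
    show "vip K.Hc (word_vec u) (F.vdiff (z (vacuum v)) (vscale K.Hc (eigenval v) (vacuum v))) = 0"
      if u: "u \<noteq> []" "set u \<subseteq> letters a b" for u
      using ip[OF word_vec_in[OF u(1)]] vip_word_vec_vacuum[OF v u(1)] z_letters[OF l u] u(2) letters_H[of a b] by auto
  qed (use X in auto)
  then show ?thesis by (rule vdiff_zero_eq[OF X])
qed

text \<open>The edge from \<open>unt C\<close> to \<open>w\<close> given by the identity of \<open>w\<close> is reached both from the vacuum
  vector at \<open>unt C\<close> by an operator in the commutant and from that at \<open>w\<close> by a generator.\<close>

lemma eigenval_unt:
  assumes w: "w \<in> S"
  shows "eigenval w = eigenval (unt C)"
proof -
  let ?u = "unt C" and ?t = "(unt C, Plain w, w)" and ?t' = "(w, Bar w, unt C)"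
  have \<alpha>: "Plain w \<in> \<Lambda>" "Bar w \<in> \<Lambda>" using w by (auto simp: \<Lambda>_def)
  have t: "?t \<in> triples" "?t' \<in> triples" using w unt_S \<alpha> by auto
  have uw: "?u \<box> w = w" using ten_unt w by simp
  have x: "I w \<in> homT ?t" using w idt_in[of w] by (simp add: homT_simps uw)
  define x' where "x' = bar ?u (Plain w) (I w)"
  have x': "x' \<in> homT ?t'" using bar_homT[OF t(1) x] by (simp add: x'_def)
  have bb: "bar w (Bar w) x' = I w"
    using bar_bar[OF w unt_S \<alpha>(1), of "I w"] x by (simp add: x'_def homT_simps)
  have x0: "x' \<noteq> zT ?t'"
  proof
    assume "x' = zT ?t'"
    then have "I w = zer C w w" using bb bar_zer[of ?u w "Bar w"] w unt_S \<alpha> uw by (simp add: homT_simps)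
    then show False using S_simple[OF w] by (simp add: simple_def)
  qed
  have span: "\<exists>k. y = k \<odot> x'" if y: "y \<in> homT ?t'" for y
  proof -
    have yh: "y \<in> hom C ?u (w \<box> label_obj (Bar w))" using y by (simp only: homT_simps)
    have "bar w (Bar w) y \<in> homT ?t" using bar_homT[OF t(2) y] by simp
    then have "bar w (Bar w) y = coef w (bar w (Bar w) y) \<odot> I w"
      using coef_eq[OF w] by (simp add: homT_simps uw)
    then obtain k where k: "bar w (Bar w) y = k \<odot> I w" by blast
    have "y = bar ?u (Plain w) (k \<odot> I w)" using bar_bar[OF unt_S w \<alpha>(2) yh] k by simp
    also have "\<dots> = cnj k \<odot> x'"
      unfolding x'_def using x by (intro bar_scl[OF w unt_S \<alpha>(1)]) (simp add: homT_simps)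
    finally show ?thesis by blast
  qed
  let ?f = "hl ?t (I w)" and ?c = "complex_of_real (sqrt (label_lam (Bar w))) * ipm w (I w) (I w) / ipm ?u x' x'"
  have f: "?f \<in> H" using t x by simp
  have lf: "lact (unit_at ?u) ?f = ?f" and rf: "ract ?f (unit_at w) = ?f"
    using f lact_hl[OF t(1) x, of "unit_at ?u"] ract_hl[OF t(1) x, of "unit_at w"] by (simp_all add: unit_at_def)
  \<comment> \<open>The proportionality factor is just the weight of the conjugate label, since
    \<open>bar\<close> carries \<open>x'\<close> back to \<open>I w\<close> without a further
    scalar.\<close>
  have star: "?c * right_coef ?t' x' \<xi> = cnj (right_coef ?t (I w) (tomita_S \<xi>))" if "\<xi> \<in> H" for \<xi>
  proof (rule star_one_dimensional[OF refl _ unt_S \<alpha>(1) w x x' x0 span _ refl that])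
    show "tomita_S (hl ?t' x') = hl ?t (complex_of_real (sqrt (label_lam (Bar w))) \<odot> I w)"
      using tomita_S_hl[OF t(2) x'] bb by simp
  qed simp_all
  let ?Y = "E (lift (right_gam ?t (I w) ?t' x' ?c))"
  have t'2: "?t' = (w, bar_label (Plain w), ?u)" by simp
  note Yc = right_gam_commutant[OF refl t'2 unt_S \<alpha>(1) w x x' star]
    and Yp = raw_pair_right_gam[OF refl t'2 unt_S \<alpha>(1) w x x', of ?c]
  have "?Y (vacuum ?u) = em (right_gam ?t (I w) ?t' x' ?c (unit_at ?u, 0))"
    unfolding vacuum_def by (rule raw_pairD(5)[OF Yp]) (use unt_S in simp)
  also have "\<dots> = word_vec [?f]" unfolding word_vec_def
    by (rule em_eqI[OF raw_pairD(1)[OF Yp]])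
       (use unt_S f lf in \<open>simp_all add: right_gam_def right_create_def right_annih_def radd_def rscale_def\<close>)
  finally have Y: "?Y (vacuum ?u) = word_vec [?f]" .
  have Yb: "?Y \<in> bounded_ops K.Hc" by (rule F.commutantD(1)[OF Yc])
  have G: "E (lift (rgam ?f)) (vacuum w) = word_vec [?f]" using rgam_vacuum[OF f w] rf by simp
  have Gb: "E (lift (rgam ?f)) \<in> bounded_ops K.Hc" using gens_\<Gamma>[OF f] gens_bounded by blast
  have 1: "z (word_vec [?f]) = vscale K.Hc (eigenval ?u) (word_vec [?f])"
    using z_right[OF Yc vacuum_in[OF unt_S]] z_vacuum[OF unt_S] F.bounded_opsD(3)[OF Yb vacuum_in[OF unt_S]] Y by simp
  have 2: "z (word_vec [?f]) = vscale K.Hc (eigenval w) (word_vec [?f])"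
    using z_\<Gamma>[OF f vacuum_in[OF w]] z_vacuum[OF w] F.bounded_opsD(3)[OF Gb vacuum_in[OF w]] G by simp
  have "rip (\<lambda>_. 0, word [?f]) (\<lambda>_. 0, word [?f]) = (\<lambda>\<beta>. unit_at w \<beta> * 1)"
  proof
    fix \<beta>
    have "ipm w (I w) (I w) = 1" using w cmp_idt[OF _ _ idt_in[of w]] by (simp add: ipm_def)
    then show "rip (\<lambda>_. 0, word [?f]) (\<lambda>_. 0, word [?f]) \<beta> = unit_at w \<beta> * 1"
      using hip_hl[OF t(1) x f, of \<beta>] f t by (simp add: rip_def Wf_word_word hl_apply unit_at_def)
  qed
  then have "vip K.Hc (word_vec [?f]) (word_vec [?f]) = complex_of_real (dim w)"
    using \<tau>_dl[OF w, of 1] f by (simp add: word_vec_def em_vip rvip_def)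
  then have "vip K.Hc (word_vec [?f]) (word_vec [?f]) \<noteq> 0" using dim_pos[OF w] by simp
  moreover have "eigenval ?u * vip K.Hc (word_vec [?f]) (word_vec [?f]) = eigenval w * vip K.Hc (word_vec [?f]) (word_vec [?f])"
    using arg_cong[OF 1[symmetric, unfolded 2], of "vip K.Hc (word_vec [?f])"] f by (simp add: F.ip_scale)
  ultimately show ?thesis by simp
qed

definition scalar_at :: "(nat \<Rightarrow> ('o, 'm) fvec) set \<Rightarrow> bool" where
  "scalar_at X \<longleftrightarrow> X \<in> car K.Hc \<and> z X = vscale K.Hc (eigenval (unt C)) X"

lemma scalar_at_vacuum: "v \<in> S \<Longrightarrow> scalar_at (vacuum v)"
  using z_vacuum[of v] eigenval_unt[of v] by (simp add: scalar_at_def)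

lemma z_bounded: "z \<in> bounded_ops K.Hc"
  by (rule F.commutantD(1)[OF z1])

lemma scalar_at_bounded:
  assumes A: "A \<in> gens" and X: "scalar_at X"
  shows "scalar_at (A X)"
proof -
  have X': "X \<in> car K.Hc" "z X = vscale K.Hc (eigenval (unt C)) X" using X by (auto simp: scalar_at_def)
  have Ab: "A \<in> bounded_ops K.Hc" using A gens_bounded by blast
  have "z (A X) = A (z X)" by (rule F.commutantD(2)[OF z1 A X'(1)])
  then show ?thesis using F.bounded_opsD(1,3)[OF Ab X'(1)] X' by (simp add: scalar_at_def)
qed

lemma scalar_at_scale: "scalar_at X \<Longrightarrow> scalar_at (vscale K.Hc d X)"
proof -
  assume "scalar_at X"
  then have X: "X \<in> car K.Hc" "z X = vscale K.Hc (eigenval (unt C)) X" by (auto simp: scalar_at_def)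
  have "vscale K.Hc d (vscale K.Hc (eigenval (unt C)) X) = vscale K.Hc (eigenval (unt C)) (vscale K.Hc d X)"
    by (rule F.ip_ext) (use X in \<open>auto simp: F.ip_simps\<close>)
  then show ?thesis using F.bounded_opsD(3)[OF z_bounded X(1), of d] X by (simp add: scalar_at_def F.ip_simps)
qed

lemma scalar_at_add: "scalar_at X \<Longrightarrow> scalar_at Y \<Longrightarrow> scalar_at (vadd K.Hc X Y)"
proof -
  assume "scalar_at X" "scalar_at Y"
  then have X: "X \<in> car K.Hc" "z X = vscale K.Hc (eigenval (unt C)) X"
    and Y: "Y \<in> car K.Hc" "z Y = vscale K.Hc (eigenval (unt C)) Y" by (auto simp: scalar_at_def)
  have "vadd K.Hc (vscale K.Hc (eigenval (unt C)) X) (vscale K.Hc (eigenval (unt C)) Y) =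
      vscale K.Hc (eigenval (unt C)) (vadd K.Hc X Y)"
    by (rule F.ip_ext) (use X Y in \<open>auto simp: F.ip_simps algebra_simps\<close>)
  then show ?thesis using F.bounded_opsD(2)[OF z_bounded X(1) Y(1)] X Y by (simp add: scalar_at_def F.ip_simps)
qed

text \<open>\<open>\<Gamma> \<xi>\<close> applied to the word \<open>u'\<close> is
  \<open>\<xi> # u'\<close> plus an annihilation term, which is a multiple of a vacuum vector or of
  a word two letters shorter than \<open>u\<close>. By strong induction on the length, the
  generators reach all homogeneous words from vacuum vectors.\<close>

lemma scalar_at_word_vec:
  assumes "u \<noteq> []" "set u \<subseteq> Collect homog"
  shows "scalar_at (word_vec u)"
  using assms
proof (induction "length u" arbitrary: u rule: less_induct)
  case less
  then obtain \<xi> u' where u: "u = \<xi> # u'" by (cases u) auto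
  have \<xi>: "homog \<xi>" "\<xi> \<in> H" "set u' \<subseteq> Collect homog" "set u' \<subseteq> H"
    using less.prems u homog_H by auto
  show ?case
  proof (cases "u' = []")
    case True
    obtain t x where t: "t \<in> triples" "x \<in> homT t" "\<xi> = hl t x" using \<xi>(1) by (auto simp: homog_def)
    have v: "snd (snd t) \<in> S" using t(1) by (auto simp: triples_def)
    have "ract \<xi> (unit_at (snd (snd t))) = \<xi>" using ract_hl[OF t(1,2)] t(3) \<xi>(2) by (simp add: unit_at_def)
    then have "word_vec u = E (lift (rgam \<xi>)) (vacuum (snd (snd t)))" using rgam_vacuum[OF \<xi>(2) v] True u by simp
    then show ?thesis using scalar_at_bounded[OF gens_\<Gamma>[OF \<xi>(2)] scalar_at_vacuum[OF v]] by simp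
  next
    case False
    then obtain \<zeta> w where w: "u' = \<zeta> # w" by (cases u') auto
    obtain t x where t: "t \<in> triples" "x \<in> homT t" "\<zeta> = hl t x" using \<xi>(3) w by (auto simp: homog_def)
    define v where "v = snd (snd t)"
    have v: "v \<in> S" using t(1) by (auto simp: triples_def v_def)
    let ?q = "(\<lambda>_. 0, word u')" and ?S = "tomita_S \<xi>"
    have q: "?q \<in> rawc" using \<xi>(4) False by simp
    have S: "?S \<in> H" using \<xi>(2) by simp
    have rq: "rannih ?S ?q \<in> rawc" "rgam \<xi> ?q \<in> rawc"
      using rannih_in[OF S q] raw_pairD(1)[OF raw_pair_rgam[OF \<xi>(2)] q] by auto
    have "\<exists>k. hip \<zeta> ?S = (\<lambda>\<beta>. unit_at v \<beta> * k)"
      using hip_hl[of "fst t" "fst (snd t)" v x ?S] S t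
      by (intro exI[of _ "hip \<zeta> ?S v"]) (auto simp: v_def unit_at_def)
    then obtain k where k: "hip \<zeta> ?S = (\<lambda>\<beta>. unit_at v \<beta> * k)" by blast
    have hS: "hip ?S \<zeta> \<beta> = cnj k * unit_at v \<beta>" for \<beta>
      using hip_cnj[of \<zeta> ?S \<beta>] k S \<xi>(4) w by (simp add: unit_at_def)
    have "word_vec u = vadd K.Hc (E (lift (rgam \<xi>)) (word_vec u')) (vscale K.Hc (-1) (em (rannih ?S ?q)))"
    proof -
      have "word_vec u = em (radd (rgam \<xi> ?q) (rscale (-1) (rannih ?S ?q)))" unfolding word_vec_def
      proof (rule em_eqI)
        show "Wf y (snd (\<lambda>_. 0, word u)) \<beta> = Wf y (snd (radd (rgam \<xi> ?q) (rscale (-1) (rannih ?S ?q)))) \<beta>"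
          if y: "y \<in> free_words" for y \<beta>
          using Wl_zero(2)[OF y, of "[]" "[]" \<xi>] \<xi>(2)
          by (simp add: u rgam_def rcreate_def radd_def rscale_def Wf_add Wf_scale Wf_word)
        show "(\<lambda>_. 0, word u) \<in> rawc" using \<xi>(2,4) u by simp
        show "radd (rgam \<xi> ?q) (rscale (-1) (rannih ?S ?q)) \<in> rawc" by (intro rawc_ops rq)
      qed (simp add: rgam_def rcreate_def radd_def rscale_def)
      then show ?thesis
        using rq q raw_pairD(5)[OF raw_pair_rgam[OF \<xi>(2)] q] by (simp add: word_vec_def em_radd em_rscale)
    qed
    moreover have "scalar_at (word_vec u')"
      using less.hyps[of u'] u False \<xi>(3) by simp
    moreover have "scalar_at (em (rannih ?S ?q))"
    proof (cases w)
      case Nil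
      have "em (rannih ?S ?q) = em (rscale (cnj k) (unit_at v, 0))"
        by (rule em_eqI[OF rq(1) rawc_ops(2)[OF raw_vacuum[OF v]]])
           (use v in \<open>simp_all add: w Nil rannih_def an1_def an2_def rscale_def hS Wf_zero\<close>)
      then show ?thesis using scalar_at_scale[OF scalar_at_vacuum[OF v]] v by (simp add: vacuum_def em_rscale)
    next
      case (Cons \<mu> w')
      have \<mu>: "homog \<mu>" "\<mu> \<in> H" "set w' \<subseteq> H" using \<xi>(3,4) w Cons by auto
      obtain s y where s: "s \<in> triples" "y \<in> homT s" "\<mu> = hl s y" using \<mu>(1) by (auto simp: homog_def)
      let ?k = "hip ?S \<zeta> (fst s)"
      have \<mu>r: "(\<lambda>_. 0, word (\<mu> # w')) \<in> rawc" using \<mu> by simp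
      have "em (rannih ?S ?q) = em (rscale ?k (\<lambda>_. 0, word (\<mu> # w')))"
      proof (rule em_eqI[OF rq(1) rawc_ops(2)[OF \<mu>r]])
        show "Wf y (snd (rannih ?S ?q)) \<beta> = Wf y (snd (rscale ?k (\<lambda>_. 0, word (\<mu> # w')))) \<beta>"
          if y: "y \<in> free_words" for y \<beta>
          using Wl_relations(2)[OF y, of "[]" w' \<mu> \<mu> ?k] \<mu> lact_hl[OF s(1,2), of "hip ?S \<zeta>"] s(3)
          by (simp add: w Cons rannih_def an2_def rscale_def Wf_scale Wf_word)
      qed (simp add: w Cons rannih_def an1_def rscale_def)
      moreover have "scalar_at (word_vec (\<mu> # w'))"
        using less.hyps[of "\<mu> # w'"] u w Cons \<xi>(3) by simp
      ultimately show ?thesis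
        using scalar_at_scale[of "word_vec (\<mu> # w')" ?k] em_rscale[OF \<mu>r, of ?k] by (simp add: word_vec_def)
    qed
    ultimately show ?thesis
      using scalar_at_add scalar_at_scale scalar_at_bounded[OF gens_\<Gamma>[OF \<xi>(2)]] by simp
  qed
qed

lemma central_scalar: "\<exists>c. \<forall>X\<in>car K.Hc. z X = vscale K.Hc c X"
proof (intro exI ballI)
  let ?P = "\<lambda>X\<in>car K.Hc. vscale K.Hc (eigenval (unt C)) X"
  define B where "B = vacuum ` S \<union> word_vec ` {u. u \<noteq> [] \<and> set u \<subseteq> Collect homog}"
  have hH: "Collect homog \<subseteq> H" using homog_H by auto
  have B: "scalar_at Y" if "Y \<in> B" for Y using that scalar_at_vacuum scalar_at_word_vec by (auto simp: B_def)
  fix X assume X: "X \<in> car K.Hc"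
  have "z X = ?P X"
  proof (rule F.eq_on_total[where W = B, OF _ _ z_bounded F.scalar_bounded_op _ X])
    show "Y \<in> car K.Hc" "z Y = ?P Y" if "Y \<in> B" for Y using B[OF that] by (simp_all add: scalar_at_def)
    show "Y = vzero K.Hc" if Y: "Y \<in> car K.Hc" "\<And>w. w \<in> B \<Longrightarrow> vip K.Hc w Y = 0" for Y
    proof (rule F_total_letters[OF Y(1) hH])
      show "\<exists>k. \<exists>e\<in>Collect homog. hl t x = hscale k e" if "t \<in> triples" "x \<in> homT t" for t x
        using that by (intro exI[of _ 1] bexI[of _ "hl t x"]) (auto simp: homog_def)
    qed (use Y(2) in \<open>auto simp: B_def\<close>)
  qed
  then show "z X = vscale K.Hc (eigenval (unt C)) X" using X by simp
qed

end

lemma factor_Phi: "factor fock_space Phi"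
proof -
  have "factor K.Hc (vN_generated K.Hc gens)"
  proof (rule F.factor_generatedI[OF gens_bounded gens_adjoint])
    have "vacuum (unt C) \<noteq> vzero K.Hc"
      using vip_vacuum_vacuum[OF unt_S unt_S] dim_pos[OF unt_S] F.ip_zero[OF vacuum_in[OF unt_S]] by auto
    then show "\<exists>x\<in>car K.Hc. x \<noteq> vzero K.Hc" using unt_S vacuum_in by blast
  qed (auto intro: central_scalar)
  then show ?thesis by (simp add: fock_space_def Phi_def gens_def)
qed

end

theorem theorem3p1:
  fixes C :: "('o, 'm) tensor_cat"
    and cj :: "'o \<Rightarrow> 'o" and \<eta> \<epsilon> :: "'o \<Rightarrow> 'm"
    and S :: "'o set" and lam :: "'o \<Rightarrow> real"
  assumes "cstar_tensor_category C"
    and "tcat.has_direct_sums C"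
    and "tcat.has_subobjects C"
    and "tcat.simple C (unt C)"
    and "tcat.standard_conjugates C cj \<eta> \<epsilon>"
    and "tcat.simple_representatives C S"
    and "unt C \<in> S"
    and "\<And>\<alpha>. \<alpha> \<in> S \<Longrightarrow> lam \<alpha> > 0"
  shows "factor (fock.fock_space C cj \<eta> S) (fock.Phi C cj \<eta> \<epsilon> S lam)"
proof -
  have "fock_category C cj \<eta> \<epsilon> S lam"
    using assms by (intro fock_category.intro fock_category_axioms.intro) auto
  then show ?thesis by (rule fock_category.factor_Phi)
qed

end
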